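(* Let $d\ge 1$ be an integer. There exists $r=r(d)$ such that the following holds. Let $A\in GL_d(\mathbb Z)$ be an irreducible ergodic toral automorphism of $\mathbb T^d$, let $\lambda\in\mathbb R$ be an eigenvalue of $A$, let $v\in\mathbb R^d$ be a non-zero eigenvector of $A$ with eigenvalue $\lambda$, and let $\alpha$ be the affine $\mathbb Z\ltimes_\lambda\mathbb R$-action on $\mathbb T^d$ generated by the pair $(A,v)$. Then there exists $\delta=\delta(d,\alpha)>0$ such that, if $\beta$ is a $C^\infty$-smooth $\mathbb Z\ltimes_\lambda\mathbb R$-action on $\mathbb T^d$ satisfying $d_r(\alpha,\beta)<\delta$, then there is a vector $v^*$ proportional to $v$ such that $\beta$ is $C^\infty$-conjugate to the affine action $\alpha^*$ generated by $(A,v^* )$; that is, there is a $C^\infty$ diffeomorphism $H$ of $\mathbb T^d$ with $H\circ\beta(g)\circ H^{-1}=\alpha^*(g)$ for all $g\in\mathbb Z\ltimes_\lambda\mathbb R$. Moreover, one may choose $r=42(d+1)$.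
   Context: $\mathbb T^d=\mathbb R^d/\mathbb Z^d$. A toral automorphism $A\in GL_d(\mathbb Z)$ is irreducible if its characteristic polynomial is irreducible over $\mathbb Q$; it is ergodic if it has no eigenvalue that is a root of unity. The group $\mathbb Z\ltimes_\lambda\mathbb R$ is the set $\mathbb Z\times\mathbb R$ with the group law $(n_1,t_1)(n_2,t_2)=(n_1+n_2,\lambda^{-n_2}t_1+t_2)$. The affine action generated by $(A,v)$ (where $Av=\lambda v$) is the homomorphism $\alpha:\mathbb Z\ltimes_\lambda\mathbb R\to\mathrm{Diff}^\infty(\mathbb T^d)$ with $\alpha(n,0)x=A^nx$ and $\alpha(0,t)x=x+tv$. A $C^\infty$-smooth $\mathbb Z\ltimes_\lambda\mathbb R$-action $\beta$ is a homomorphism into $\mathrm{Diff}^\infty(\mathbb T^d)$ generated by a pair $(\tilde A,\tilde v)$: $\beta(1,0)=\tilde A$ is a $C^\infty$ diffeomorphism homotopic to $A$, and $\beta(0,t)$ is the flow at time $t$ of a $C^\infty$ vector field $\tilde v:\mathbb T^d\to\mathbb R^d$. Distance: $d_r(\beta,\alpha)=(\|\tilde A-A\|_r,\|\tilde v-v\|_r)$, where $\|\cdot\|_r$ is the $C^r$ norm and $\tilde A-A$ is regarded as a map $f:\mathbb T^d\to\mathbb R^d$ with $\tilde A=A+f$; $d_r(\alpha,\beta)<\delta$ means that both components are $<\delta$ (for some choice of such $f$). *)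

theory Defs
  imports "HOL-Analysis.Analysis" "HOL-Algebra.Group"
    "HOL-Computational_Algebra.Polynomial" "HOL-Computational_Algebra.Polynomial_Factorial"
begin

unbundle no m_inv_syntax

quotient_type 'd torus = "real ^ ('d::finite)" / "\<lambda>x y. \<forall>i. x $ i - y $ i \<in> \<int>"
  morphisms rep_torus to_torus
proof (rule equivpI)
  show "reflp (\<lambda>x y :: real ^ 'd. \<forall>i. x $ i - y $ i \<in> \<int>)"
    by (auto intro!: reflpI)
  show "symp (\<lambda>x y :: real ^ 'd. \<forall>i. x $ i - y $ i \<in> \<int>)"
  proof (rule sympI)
    fix x y :: "real ^ 'd"
    assume *: "\<forall>i. x $ i - y $ i \<in> \<int>"
    show "\<forall>i. y $ i - x $ i \<in> \<int>"
    proof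
      fix i
      from * have "- (x $ i - y $ i) \<in> \<int>" by (intro Ints_minus) auto
      then show "y $ i - x $ i \<in> \<int>" by simp
    qed
  qed
  show "transp (\<lambda>x y :: real ^ 'd. \<forall>i. x $ i - y $ i \<in> \<int>)"
  proof (rule transpI)
    fix x y z :: "real ^ 'd"
    assume "\<forall>i. x $ i - y $ i \<in> \<int>" "\<forall>i. y $ i - z $ i \<in> \<int>"
    then have "(x $ i - y $ i) + (y $ i - z $ i) \<in> \<int>" for i
      by (intro Ints_add) auto
    then show "\<forall>i. x $ i - z $ i \<in> \<int>" by simp
  qed
qed

instantiation torus :: (finite) topological_space
begin

definition open_torus :: "'a torus set \<Rightarrow> bool" where
  "open_torus U \<longleftrightarrow> open (to_torus -` U)"

instance
  by standard (auto simp: open_torus_def vimage_Union vimage_Int)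

end

instantiation torus :: (finite) ab_group_add
begin

lift_definition zero_torus :: "'a torus" is 0 .

lift_definition plus_torus :: "'a torus \<Rightarrow> 'a torus \<Rightarrow> 'a torus" is "(+)"
proof -
  fix x x' y y' :: "real ^ 'a" and i
  assume "\<And>i. x $ i - x' $ i \<in> \<int>" "\<And>i. y $ i - y' $ i \<in> \<int>"
  then have "(x $ i - x' $ i) + (y $ i - y' $ i) \<in> \<int>" by (intro Ints_add) auto
  then show "(x + y) $ i - (x' + y') $ i \<in> \<int>" by (simp add: algebra_simps)
qed

lift_definition uminus_torus :: "'a torus \<Rightarrow> 'a torus" is uminus
proof -
  fix x x' :: "real ^ 'a" and i
  assume "\<And>i. x $ i - x' $ i \<in> \<int>"
  then have "- (x $ i - x' $ i) \<in> \<int>" by (intro Ints_minus) auto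
  then show "(- x) $ i - (- x') $ i \<in> \<int>" by simp
qed

lift_definition minus_torus :: "'a torus \<Rightarrow> 'a torus \<Rightarrow> 'a torus" is "(-)"
proof -
  fix x x' y y' :: "real ^ 'a" and i
  assume "\<And>i. x $ i - x' $ i \<in> \<int>" "\<And>i. y $ i - y' $ i \<in> \<int>"
  then have "(x $ i - x' $ i) - (y $ i - y' $ i) \<in> \<int>" by (blast intro: Ints_diff)
  then show "(x - y) $ i - (x' - y') $ i \<in> \<int>" by (simp add: algebra_simps)
qed

instance
proof
  fix a b c :: "'a torus"
  show "a + b + c = a + (b + c)"
    by transfer (simp add: add.assoc)
  show "a + b = b + a"
    by transfer (simp add: add.commute)
  show "0 + a = a" "- a + a = 0" "a - b = a + - b"
    by (transfer; simp)+
qed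

end

primrec Ck_on :: "nat \<Rightarrow> 'a::real_normed_vector set \<Rightarrow> ('a \<Rightarrow> 'b::real_normed_vector) \<Rightarrow> bool" where
  "Ck_on 0 S f \<longleftrightarrow> continuous_on S f"
| "Ck_on (Suc k) S f \<longleftrightarrow> (\<forall>x\<in>S. f differentiable (at x)) \<and>
     (\<forall>u. Ck_on k S (\<lambda>x. frechet_derivative f (at x) u))"

text \<open>Meant for open sets \<open>S\<close> and finite-dimensional spaces.\<close>

definition smooth_on :: "'a::real_normed_vector set \<Rightarrow> ('a \<Rightarrow> 'b::real_normed_vector) \<Rightarrow> bool" where
  "smooth_on S f \<longleftrightarrow> (\<forall>k. Ck_on k S f)"

text \<open>The smooth structure on the torus is the one that makes the projection
  \<open>to_torus\<close> a local diffeomorphism. A function into a vector space is therefore smooth if its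
  pullback is, and a map between tori is smooth if it has smooth lifts locally.\<close>

definition smooth_fun :: "('d::finite torus \<Rightarrow> 'b::real_normed_vector) \<Rightarrow> bool" where
  "smooth_fun f \<longleftrightarrow> smooth_on UNIV (f \<circ> to_torus)"

definition smooth_map :: "('d::finite torus \<Rightarrow> 'd torus) \<Rightarrow> bool" where
  "smooth_map h \<longleftrightarrow> (\<forall>x. \<exists>U F. open U \<and> x \<in> U \<and> smooth_on U F \<and>
     (\<forall>y\<in>U. h (to_torus y) = to_torus (F y)))"

definition diffeo :: "('d::finite torus \<Rightarrow> 'd torus) \<Rightarrow> bool" where
  "diffeo h \<longleftrightarrow> bij h \<and> smooth_map h \<and> smooth_map (inv h)"

definition Diff_group :: "('d::finite torus \<Rightarrow> 'd torus) monoid" where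
  "Diff_group = \<lparr>carrier = {h. diffeo h}, mult = (\<circ>), one = id\<rparr>"

text \<open>\<open>iter_partial [i\<^sub>1, \<dots>, i\<^sub>k] f\<close> is the partial derivative
  \<open>\<partial>\<^sub>i\<^sub>1 \<dots> \<partial>\<^sub>i\<^sub>k f\<close>.\<close>

primrec iter_partial :: "'d list \<Rightarrow> (real ^ 'd::finite \<Rightarrow> 'b::real_normed_vector) \<Rightarrow> real ^ 'd \<Rightarrow> 'b"
where
  "iter_partial [] f = f"
| "iter_partial (i # is) f = (\<lambda>x. frechet_derivative (iter_partial is f) (at x) (axis i 1))"

text \<open>The supremum of all partial derivatives of order at most \<open>r\<close>. The set is bounded for smooth
  functions, the only ones to which the norm is applied.\<close>

definition Cr_norm :: "nat \<Rightarrow> ('d::finite torus \<Rightarrow> 'b::real_normed_vector) \<Rightarrow> real" where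
  "Cr_norm r f = (SUP (is, x) \<in> {is. length is \<le> r} \<times> UNIV. norm (iter_partial is (f \<circ> to_torus) x))"

text \<open>A curve in the torus has velocity \<open>w\<close> at time \<open>t\<close> if it has, near \<open>t\<close>, a lift with
  derivative \<open>w\<close> at \<open>t\<close>. Two such lifts differ by an integer vector that is constant near \<open>t\<close>, so
  the velocity is unique.\<close>

definition has_velocity :: "(real \<Rightarrow> 'd::finite torus) \<Rightarrow> real ^ 'd \<Rightarrow> real \<Rightarrow> bool" where
  "has_velocity \<gamma> w t \<longleftrightarrow> (\<exists>c. (c has_vector_derivative w) (at t) \<and>
     (\<forall>\<^sub>F s in nhds t. \<gamma> s = to_torus (c s)))"

text \<open>Membership in \<open>GL\<^sub>d(\<int>)\<close> is invertibility of an integer matrix over the ring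
  \<^typ>\<open>int\<close>.\<close>

definition charpoly :: "int ^ 'd ^ 'd \<Rightarrow> rat poly" where
  "charpoly A = det (mat [:0, 1:] - map_matrix (\<lambda>a. [:of_int a:]) A)"

definition irreducible_aut :: "int ^ 'd ^ 'd \<Rightarrow> bool" where
  "irreducible_aut A \<longleftrightarrow> irreducible (charpoly A)"

definition eigenvector :: "'a::field ^ 'd ^ 'd \<Rightarrow> 'a ^ 'd \<Rightarrow> 'a \<Rightarrow> bool" where
  "eigenvector M w \<mu> \<longleftrightarrow> w \<noteq> 0 \<and> M *v w = \<mu> *s w"

definition ergodic_aut :: "int ^ 'd ^ 'd \<Rightarrow> bool" where
  "ergodic_aut A \<longleftrightarrow> \<not> (\<exists>(\<mu>::complex) w. eigenvector (map_matrix of_int A) w \<mu> \<and>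
     (\<exists>n>0. \<mu> ^ n = 1))"

lift_definition toral_map :: "int ^ 'd ^ 'd \<Rightarrow> 'd::finite torus \<Rightarrow> 'd torus"
  is "\<lambda>A x. map_matrix of_int A *v x"
proof -
  fix A :: "int ^ 'd ^ 'd" and x y :: "real ^ 'd" and i
  assume "\<And>i. x $ i - y $ i \<in> \<int>"
  then have "(\<Sum>j\<in>UNIV. of_int (A $ i $ j) * (x $ j - y $ j)) \<in> \<int>"
    by (intro Ints_sum Ints_mult) auto
  then show "(map_matrix of_int A *v x) $ i - (map_matrix of_int A *v y) $ i \<in> \<int>"
    by (simp add: matrix_vector_mult_def sum_subtractf right_diff_distrib)
qed

definition int_funpow :: "('a \<Rightarrow> 'a) \<Rightarrow> int \<Rightarrow> 'a \<Rightarrow> 'a" where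
  "int_funpow f n = (if 0 \<le> n then f ^^ nat n else inv f ^^ nat (- n))"

definition ZR_group :: "real \<Rightarrow> (int \<times> real) monoid" where
  "ZR_group lam = \<lparr>carrier = UNIV,
     mult = (\<lambda>(n1, t1) (n2, t2). (n1 + n2, lam powi (- n2) * t1 + t2)), one = (0, 0)\<rparr>"

text \<open>In the group above, \<open>(n, t) = (n, 0)(0, t)\<close>. Hence the action with \<open>(n, 0) \<mapsto> A\<^sup>n\<close> and
  \<open>(0, t) \<mapsto> (x \<mapsto> x + t v)\<close> is the following map; that it is an action is
  \<open>affine_action_hom\<close> below.\<close>

definition affine_action :: "int ^ 'd ^ 'd \<Rightarrow> real ^ 'd \<Rightarrow> int \<times> real \<Rightarrow> 'd::finite torus \<Rightarrow> 'd torus"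
where
  "affine_action A v = (\<lambda>(n, t) x. int_funpow (toral_map A) n (x + to_torus (t *\<^sub>R v)))"

lemma ZR_group:
  assumes "lam \<noteq> 0"
  shows "group (ZR_group lam)"
proof (rule groupI)
  fix x assume "x \<in> carrier (ZR_group lam)"
  obtain n t where x: "x = (n, t)" by (cases x)
  show "\<exists>y\<in>carrier (ZR_group lam). y \<otimes>\<^bsub>ZR_group lam\<^esub> x = \<one>\<^bsub>ZR_group lam\<^esub>"
    using assms by (intro bexI[of _ "(- n, - (lam powi n) * t)"])
      (auto simp: x ZR_group_def power_int_minus)
qed (use assms power_int_add[of lam] in \<open>auto simp: ZR_group_def algebra_simps simp flip: power_int_add\<close>)

lemma int_funpow_add:
  assumes "bij f"
  shows "int_funpow f (m + n) = int_funpow f m \<circ> int_funpow f n"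
proof -
  have step: "int_funpow f (k + 1) = f \<circ> int_funpow f k" for k
  proof (cases "k \<ge> 0")
    case True
    then show ?thesis by (simp add: int_funpow_def nat_add_distrib)
  next
    case False
    define j where "j = nat (- k) - 1"
    have k: "k = - int (Suc j)" using False by (simp add: j_def)
    have "f \<circ> (inv f ^^ Suc j) = inv f ^^ j"
      using assms by (simp add: fun_eq_iff bij_is_surj surj_f_inv_f)
    moreover have "int_funpow f (k + 1) = inv f ^^ j"
      by (cases "j = 0") (simp_all add: int_funpow_def k)
    moreover have "int_funpow f k = inv f ^^ Suc j"
      unfolding int_funpow_def k by (simp add: nat_add_distrib)
    ultimately show ?thesis by simp
  qed
  show ?thesis
  proof (induction m rule: int_induct[where k = 0])
    case base
    show ?case by (simp add: int_funpow_def)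
  next
    case (step1 i)
    have "int_funpow f (i + 1 + n) = f \<circ> int_funpow f (i + n)"
      using step[of "i + n"] by (simp add: algebra_simps)
    then show ?case using step1 by (simp add: step comp_assoc)
  next
    case (step2 i)
    have *: "int_funpow f i = f \<circ> int_funpow f (i - 1)"
      "int_funpow f (i + n) = f \<circ> int_funpow f (i - 1 + n)"
      using step[of "i - 1"] step[of "i - 1 + n"] by simp_all
    show ?case
    proof
      fix x
      have "f (int_funpow f (i - 1 + n) x) = int_funpow f (i + n) x"
        by (simp only: * o_apply)
      also have "\<dots> = int_funpow f i (int_funpow f n x)"
        by (simp only: step2 o_apply)
      also have "\<dots> = f (int_funpow f (i - 1) (int_funpow f n x))"
        by (simp only: * o_apply)
      finally show "int_funpow f (i - 1 + n) x = (int_funpow f (i - 1) \<circ> int_funpow f n) x"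
        unfolding o_apply by (rule injD[OF bij_is_inj[OF assms]])
    qed
  qed
qed

lemma toral_map_add: "toral_map A (x + y) = toral_map A x + toral_map A y"
  by transfer (simp add: matrix_vector_right_distrib)

lemma toral_map_mult: "toral_map (A ** B) = toral_map A \<circ> toral_map B"
proof
  fix x
  have *: "map_matrix real_of_int (A ** B) = map_matrix of_int A ** map_matrix of_int B"
    by (simp add: vec_eq_iff matrix_matrix_mult_def)
  show "toral_map (A ** B) x = (toral_map A \<circ> toral_map B) x"
    by (induct x rule: torus.abs_induct) (simp add: toral_map.abs_eq * flip: matrix_vector_mul_assoc)
qed

lemma toral_map_one: "toral_map (mat 1) = id"
proof
  fix x :: "'d::finite torus"
  have *: "map_matrix real_of_int (mat 1 :: int ^ 'd ^ 'd) = mat 1"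
    by (simp add: vec_eq_iff mat_def)
  show "toral_map (mat 1) x = id x"
    by (induct x rule: torus.abs_induct) (simp add: toral_map.abs_eq *)
qed

lemma toral_map_bij:
  assumes "A ** B = mat 1" "B ** A = mat 1"
  shows "bij (toral_map A)" "inv (toral_map A) = toral_map B"
proof -
  have "toral_map A \<circ> toral_map B = id" "toral_map B \<circ> toral_map A = id"
    using assms by (simp_all add: toral_map_one flip: toral_map_mult)
  then show "bij (toral_map A)" "inv (toral_map A) = toral_map B"
    by (auto intro: o_bij inv_unique_comp)
qed

lemma toral_map_funpow: "\<exists>C. toral_map A ^^ n = toral_map C"
proof (induction n)
  case 0
  show ?case by (rule exI[of _ "mat 1"]) (simp add: toral_map_one)
next
  case (Suc n)
  then show ?case by (metis funpow.simps(2) toral_map_mult)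
qed

lemma int_funpow_toral_map:
  assumes "invertible A"
  shows "\<exists>C. int_funpow (toral_map A) n = toral_map C"
proof -
  obtain B where "A ** B = mat 1" "B ** A = mat 1" using assms by (auto simp: invertible_def)
  then show ?thesis by (simp add: int_funpow_def toral_map_bij toral_map_funpow)
qed

lemma Ck_on_const: "Ck_on k S (\<lambda>_. c)"
  by (induction k arbitrary: c) (simp_all add: frechet_derivative_const)

lemma smooth_on_affine: "smooth_on S (\<lambda>x :: real ^ 'd. M *v x + c)"
  unfolding smooth_on_def
proof
  fix k
  have D: "((\<lambda>x. M *v x + c) has_derivative (*v) M) (at x)" for x :: "real ^ 'd"
    using has_derivative_add[OF bounded_linear_imp_has_derivative[OF matrix_vector_mul_bounded_linear]
        has_derivative_const] by simp
  then have "frechet_derivative (\<lambda>x. M *v x + c) (at x) = (*v) M" for x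
    by (metis frechet_derivative_at)
  moreover have "(\<lambda>x. M *v x + c) differentiable (at x)" for x
    using D by (rule differentiableI)
  ultimately show "Ck_on k S (\<lambda>x. M *v x + c)"
    by (cases k) (auto simp: Ck_on_const intro!: continuous_intros)
qed

lemma affine_action_hom:
  fixes A :: "int ^ 'd ^ 'd" and v :: "real ^ 'd"
  assumes A: "invertible A" and lam: "lam \<noteq> 0" and v: "map_matrix of_int A *v v = lam *s v"
  shows "affine_action A v \<in> hom (ZR_group lam) Diff_group"
proof -
  let ?P = "int_funpow (toral_map A)"
  obtain B where "A ** B = mat 1" "B ** A = mat 1" using A by (auto simp: invertible_def)
  then have bij: "bij (toral_map A)" by (rule toral_map_bij)
  have P0: "?P 0 = id" by (simp add: int_funpow_def fun_eq_iff)
  have P1: "?P 1 = toral_map A" by (simp add: int_funpow_def)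
  have Padd: "?P n (x + y) = ?P n x + ?P n y" for n x y
    using int_funpow_toral_map[OF A, of n] by (auto simp: toral_map_add)
  have Av: "toral_map A (to_torus (t *\<^sub>R v)) = to_torus ((lam * t) *\<^sub>R v)" for t
    using v by (simp add: toral_map.abs_eq matrix_vector_mult_scaleR scalar_mult_eq_scaleR mult.commute)
  have Pv: "?P n (to_torus (t *\<^sub>R v)) = to_torus ((lam powi n * t) *\<^sub>R v)" for n t
  proof (induction n rule: int_induct[where k = 0])
    case base
    show ?case by (simp add: P0)
  next
    case (step1 i)
    have "?P (1 + i) (to_torus (t *\<^sub>R v)) = to_torus ((lam powi (1 + i) * t) *\<^sub>R v)"
      using lam unfolding int_funpow_add[OF bij] P1 by (simp add: step1 Av power_int_add mult.assoc)
    then show ?case by (simp add: add.commute)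
  next
    case (step2 i)
    have "?P (1 + (i - 1)) (to_torus (t *\<^sub>R v)) = toral_map A (?P (i - 1) (to_torus (t *\<^sub>R v)))"
      unfolding int_funpow_add[OF bij] P1 by simp
    moreover have "toral_map A (to_torus ((lam powi (i - 1) * t) *\<^sub>R v)) = to_torus ((lam powi i * t) *\<^sub>R v)"
      using lam power_int_add[of lam 1 "i - 1"] by (simp add: Av mult.assoc)
    ultimately have "toral_map A (?P (i - 1) (to_torus (t *\<^sub>R v)))
        = toral_map A (to_torus ((lam powi (i - 1) * t) *\<^sub>R v))"
      using step2 by simp
    then show ?case by (rule injD[OF bij_is_inj[OF bij]])
  qed
  have mult: "affine_action A v (g \<otimes>\<^bsub>ZR_group lam\<^esub> h) = affine_action A v g \<circ> affine_action A v h"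
    for g h
  proof -
    obtain n1 t1 n2 t2 where gh: "g = (n1, t1)" "h = (n2, t2)" by (metis prod.exhaust)
    show ?thesis
    proof
      fix x
      have "?P n2 (to_torus ((lam powi (- n2) * t1) *\<^sub>R v)) = to_torus (t1 *\<^sub>R v)"
        unfolding Pv using lam by (simp add: power_int_minus flip: mult.assoc)
      moreover have "to_torus ((lam powi (- n2) * t1 + t2) *\<^sub>R v)
          = to_torus ((lam powi (- n2) * t1) *\<^sub>R v) + to_torus (t2 *\<^sub>R v)"
        by (simp add: plus_torus.abs_eq scaleR_left_distrib)
      ultimately show "affine_action A v (g \<otimes>\<^bsub>ZR_group lam\<^esub> h) x
          = (affine_action A v g \<circ> affine_action A v h) x"
        by (simp add: gh affine_action_def ZR_group_def int_funpow_add[OF bij] Padd ac_simps)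
    qed
  qed
  have one: "affine_action A v (0, 0) = id"
    by (simp add: affine_action_def P0 fun_eq_iff flip: zero_torus.abs_eq)
  have smooth: "smooth_map (affine_action A v g)" for g
  proof -
    obtain n t where g: "g = (n, t)" by (cases g)
    obtain C where C: "?P n = toral_map C" using int_funpow_toral_map[OF A] by blast
    have "affine_action A v g (to_torus y)
        = to_torus (map_matrix of_int C *v y + map_matrix of_int C *v (t *\<^sub>R v))" for y
      by (simp add: g affine_action_def C plus_torus.abs_eq toral_map.abs_eq matrix_vector_right_distrib)
    then show ?thesis
      unfolding smooth_map_def
      by (intro allI exI[of _ UNIV] exI[of _ "\<lambda>y. map_matrix of_int C *v y + map_matrix of_int C *v (t *\<^sub>R v)"])
        (simp add: smooth_on_affine)
  qed
  have "diffeo (affine_action A v g)" for g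
  proof -
    interpret group "ZR_group lam" using lam by (rule ZR_group)
    have [simp]: "g \<in> carrier (ZR_group lam)" by (simp add: ZR_group_def)
    define h where "h = m_inv (ZR_group lam) g"
    have "g \<otimes>\<^bsub>ZR_group lam\<^esub> h = (0, 0)" "h \<otimes>\<^bsub>ZR_group lam\<^esub> g = (0, 0)"
      using r_inv[of g] l_inv[of g] by (simp_all add: h_def) (simp_all add: ZR_group_def)
    then have *: "affine_action A v g \<circ> affine_action A v h = id"
      "affine_action A v h \<circ> affine_action A v g = id"
      by (metis mult one)+
    then have "inv (affine_action A v g) = affine_action A v h" by (rule inv_unique_comp)
    with * show ?thesis by (auto simp: diffeo_def smooth intro: o_bij)
  qed
  then show ?thesis by (auto simp: hom_def Diff_group_def mult)
qed

definition smooth_action ::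
  "int ^ 'd ^ 'd \<Rightarrow> real \<Rightarrow> ('d::finite torus \<Rightarrow> 'd torus) \<Rightarrow> ('d torus \<Rightarrow> real ^ 'd)
    \<Rightarrow> (int \<times> real \<Rightarrow> 'd torus \<Rightarrow> 'd torus) \<Rightarrow> bool" where
  "smooth_action A lam A' v' \<beta> \<longleftrightarrow>
     \<beta> \<in> hom (ZR_group lam) Diff_group \<and>
     \<beta> (1, 0) = A' \<and> homotopic_with_canon (\<lambda>_. True) UNIV UNIV (toral_map A) A' \<and>
     smooth_fun v' \<and> (\<forall>x t. has_velocity (\<lambda>s. \<beta> (0, s) x) (v' (\<beta> (0, t) x)) t)"

text \<open>\<open>d\<^sub>r(\<alpha>, \<beta>) < \<delta>\<close> for the affine action generated by \<open>(A, v)\<close> and the smooth action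
  generated by \<open>(A', v')\<close>. As \<open>A'\<close> is smooth, the continuous choices of \<open>f\<close> are smooth and differ by
  integer vectors.\<close>

definition dist_less ::
  "nat \<Rightarrow> real \<Rightarrow> int ^ 'd ^ 'd \<Rightarrow> real ^ 'd \<Rightarrow> ('d::finite torus \<Rightarrow> 'd torus)
    \<Rightarrow> ('d torus \<Rightarrow> real ^ 'd) \<Rightarrow> bool" where
  "dist_less r \<delta> A v A' v' \<longleftrightarrow>
     (\<exists>f. smooth_fun f \<and> (\<forall>x. A' x = toral_map A x + to_torus (f x)) \<and> Cr_norm r f < \<delta>) \<and>
     Cr_norm r (\<lambda>x. v' x - v) < \<delta>"

end

theory Submission
  imports Defs "HOL-Computational_Algebra.Fundamental_Theorem_Algebra"
begin

text \<open>An eigenvector \<open>v\<close> of an irreducible integer matrix is Diophantine. A KAM iteration with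
  counterterm, which does not use the group relation, therefore yields a diffeomorphism \<open>H = id + h\<close>
  close to the identity, a number \<open>b\<close> close to \<open>1\<close> and a small constant \<open>w\<close> orthogonal to \<open>v\<close> with
  \<open>V(H x) = b DH(x) v + w\<close> for the perturbed vector field \<open>V\<close>.

  Let \<open>F\<close> be a lift of the perturbed diffeomorphism and \<open>G = H\<^sup>-\<^sup>1 F H\<close>, so that \<open>G - A\<close> is periodic.
  The relation \<open>DF(x) V(x) = \<lambda> V(F x)\<close> shows that the derivative of \<open>G - A\<close> along \<open>v\<close> is close to
  \<open>(\<lambda> - A) w / b\<close>. As \<open>G - A\<close> is bounded and the \<open>\<lambda>\<close>-eigenspace is spanned by \<open>v\<close>, this forces
  \<open>w = 0\<close>. Then the derivative of \<open>G - A\<close> along \<open>v\<close> vanishes, hence \<open>G - A\<close> is constant, and a translation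
  removes the constant because \<open>1\<close> is not an eigenvalue. The same conjugacy turns the flow
  of \<open>V\<close> into the translation flow along \<open>b v\<close>.\<close>

section \<open>Weighted Wiener algebras\<close>

text \<open>Small divisors cost derivatives at every step, and the perturbation is only smooth. The
  iteration therefore uses analytic truncations: Fourier series with exponential weights on strips
  of width \<open>s = 4^-n\<close>, where one Newton step loses a factor \<open>s^Q\<close> with
  \<open>Q = 2 * \<tau> + 2 * CARD('d)\<close>. Such decay takes
  \<open>2 * Q + 1 + 2 * CARD('d)\<close> derivatives; as \<tau> is \<open>CARD('d)\<close>, this is
  \<open>10 * CARD('d) + 1\<close>, well below \<open>42 * (CARD('d) + 1)\<close>.

  The mean of a vector field is an obstruction with as many components as the torus has dimensions,
  and rescaling \<open>v\<close> removes only one of them. The vector \<open>w\<close> takes up the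
  others. It is excluded afterwards by a first-order argument, for which a small derivative of the
  perturbation of \<open>A\<close> suffices.\<close>

definition knorm :: "int ^ 'd::finite \<Rightarrow> real" where
  "knorm k = (\<Sum>j\<in>UNIV. \<bar>of_int (k $ j)\<bar>)"

definition kdot :: "int ^ 'd::finite \<Rightarrow> complex ^ 'd \<Rightarrow> complex" where
  "kdot k z = (\<Sum>j\<in>UNIV. of_int (k $ j) * z $ j)"

definition em :: "int ^ 'd::finite \<Rightarrow> complex ^ 'd \<Rightarrow> complex" where
  "em k z = exp (2 * of_real pi * \<i> * kdot k z)"

definition cvec :: "real ^ 'd::finite \<Rightarrow> complex ^ 'd" where
  "cvec x = (\<chi> j. of_real (x $ j))"

text \<open>The factor \<open>2 * pi\<close> matches the exponent of \<open>em\<close>, so that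
  \<open>em k\<close> is at most \<open>exp (s * knorm k)\<close> on \<open>strip s\<close>.\<close>

definition strip :: "real \<Rightarrow> (complex ^ 'd::finite) set" where
  "strip s = {z. \<forall>j. 2 * pi * \<bar>Im (z $ j)\<bar> < s}"

lemma knorm_nonneg [simp]: "0 \<le> knorm k"
  by (simp add: knorm_def sum_nonneg)

lemma knorm_0 [simp]: "knorm 0 = 0"
  by (simp add: knorm_def)

lemma knorm_triangle: "knorm (k + l) \<le> knorm k + knorm l"
  unfolding knorm_def sum.distrib[symmetric] by (intro sum_mono) auto

lemma knorm_uminus [simp]: "knorm (- k) = knorm k"
  by (simp add: knorm_def)

lemma component_le_knorm: "\<bar>of_int (k $ j)\<bar> \<le> knorm k"
  unfolding knorm_def by (rule member_le_sum) auto

lemma knorm_ge_1: assumes "k \<noteq> 0" shows "1 \<le> knorm k"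
proof -
  obtain j where "k $ j \<noteq> 0" using assms by (auto simp: vec_eq_iff)
  then have "1 \<le> \<bar>of_int (k $ j) :: real\<bar>" by linarith
  then show ?thesis using component_le_knorm[of k j] by linarith
qed

lemma kdot_add: "kdot (k + l) z = kdot k z + kdot l z"
  by (simp add: kdot_def sum.distrib algebra_simps)

lemma kdot_add_right: "kdot k (z + w) = kdot k z + kdot k w"
  by (simp add: kdot_def sum.distrib algebra_simps)

lemma kdot_0 [simp]: "kdot 0 z = 0"
  by (simp add: kdot_def)

lemma em_0 [simp]: "em 0 z = 1"
  by (simp add: em_def)

lemma em_add: "em (k + l) z = em k z * em l z"
  by (simp add: em_def kdot_add exp_add[symmetric] algebra_simps)

lemma em_add_right: "em k (z + w) = em k z * em k w"
  by (simp add: em_def kdot_add_right exp_add[symmetric] algebra_simps)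

lemma Im_kdot: "Im (kdot k z) = (\<Sum>j\<in>UNIV. of_int (k $ j) * Im (z $ j))"
  by (simp add: kdot_def)

lemma norm_em: "norm (em k z) = exp (- (2 * pi * Im (kdot k z)))"
  by (simp add: em_def norm_exp_eq_Re)

lemma norm_em_le:
  assumes "\<And>j. 2 * pi * \<bar>Im (z $ j)\<bar> \<le> s"
  shows "norm (em k z) \<le> exp (s * knorm k)"
proof -
  have "- (2 * pi * Im (kdot k z)) = (\<Sum>j\<in>UNIV. - of_int (k $ j) * (2 * pi * Im (z $ j)))"
    unfolding Im_kdot sum_distrib_left sum_negf[symmetric] by (rule sum.cong) auto
  also have "\<dots> \<le> (\<Sum>j\<in>UNIV. \<bar>of_int (k $ j)\<bar> * s)"
  proof (rule sum_mono)
    fix j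
    have "- of_int (k $ j) * (2 * pi * Im (z $ j)) \<le> \<bar>of_int (k $ j)\<bar> * \<bar>2 * pi * Im (z $ j)\<bar>"
      by (rule order_trans[OF abs_ge_self]) (simp only: abs_mult abs_minus_cancel order_refl)
    also have "\<dots> \<le> \<bar>of_int (k $ j)\<bar> * s"
      using assms[of j] by (intro mult_left_mono) (simp_all add: abs_mult)
    finally show "- of_int (k $ j) * (2 * pi * Im (z $ j)) \<le> \<bar>of_int (k $ j)\<bar> * s" .
  qed
  also have "\<dots> = s * knorm k" by (simp add: knorm_def sum_distrib_left mult.commute)
  finally show ?thesis by (simp add: norm_em)
qed

lemma norm_em_strip: "z \<in> strip s \<Longrightarrow> norm (em k z) \<le> exp (s * knorm k)"
  by (rule norm_em_le) (auto simp: strip_def less_imp_le)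

lemma norm_em_cvec [simp]: "norm (em k (cvec x)) = 1"
  by (simp add: norm_em Im_kdot cvec_def)

lemma cvec_in_strip: "0 < s \<Longrightarrow> cvec x \<in> strip s"
  by (simp add: strip_def cvec_def)

lemma cnj_em_cvec: "cnj (em k (cvec x)) = em (- k) (cvec x)"
  by (simp add: em_def kdot_def cvec_def exp_cnj sum_negf)

text \<open>The set \<open>S\<close> is kept apart from the weight because two instances occur:
  exponential weights with a complex strip for the analytic iteration, and powers of
  \<open>1 + knorm k\<close> with the real points \<open>range cvec\<close>, from which
  differentiability is read off.\<close>

definition wien_rep :: "(int ^ 'd \<Rightarrow> real) \<Rightarrow> (complex ^ 'd) set \<Rightarrow> (int ^ 'd \<Rightarrow> complex) \<Rightarrow> real \<Rightarrow>
    (complex ^ 'd::finite \<Rightarrow> complex) \<Rightarrow> bool" where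
  "wien_rep \<omega> S c A u \<longleftrightarrow> ((\<lambda>k. norm (c k) * \<omega> k) has_sum A) UNIV \<and>
    (\<forall>z\<in>S. ((\<lambda>k. c k * em k z) has_sum u z) UNIV)"

text \<open>The coefficients are existentially quantified, so that their uniqueness is never needed.\<close>

definition wien :: "(int ^ 'd \<Rightarrow> real) \<Rightarrow> (complex ^ 'd) set \<Rightarrow> real \<Rightarrow> (complex ^ 'd::finite \<Rightarrow> complex) \<Rightarrow> bool"
  where "wien \<omega> S C u \<longleftrightarrow> (\<exists>c A. wien_rep \<omega> S c A u \<and> A \<le> C)"

lemma wienE:
  assumes "wien \<omega> S C u"
  obtains c A where "((\<lambda>k. norm (c k) * \<omega> k) has_sum A) UNIV" "A \<le> C"
    "\<And>z. z \<in> S \<Longrightarrow> ((\<lambda>k. c k * em k z) has_sum u z) UNIV"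
  using assms unfolding wien_def wien_rep_def by blast

lemma wienI:
  assumes "((\<lambda>k. norm (c k) * \<omega> k) has_sum A) UNIV" "A \<le> C"
    "\<And>z. z \<in> S \<Longrightarrow> ((\<lambda>k. c k * em k z) has_sum u z) UNIV"
  shows "wien \<omega> S C u"
  using assms unfolding wien_def wien_rep_def by blast

lemma norm_sum_le_weighted:
  fixes a :: "'i \<Rightarrow> complex"
  assumes "((\<lambda>i. w i) has_sum A) I" "\<And>i. i \<in> I \<Longrightarrow> norm (a i) \<le> w i"
  shows "(a has_sum infsum a I) I" "norm (infsum a I) \<le> A"
    "(\<lambda>i. norm (a i)) summable_on I" "(\<Sum>\<^sub>\<infinity>i\<in>I. norm (a i)) \<le> A"
proof -
  show s: "(\<lambda>i. norm (a i)) summable_on I"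
    by (rule summable_on_comparison_test[OF has_sum_imp_summable[OF assms(1)]]) (use assms(2) in auto)
  then show 1: "(a has_sum infsum a I) I"
    using abs_summable_summable by (intro has_sum_infsum) blast
  show "norm (infsum a I) \<le> A"
    by (rule norm_infsum_le[OF 1 assms(1)]) (use assms(2) in auto)
  show "(\<Sum>\<^sub>\<infinity>i\<in>I. norm (a i)) \<le> A"
    using has_sum_mono[OF has_sum_infsum[OF s] assms(1)] assms(2) by auto
qed

lemma has_sum_fibres:
  fixes f :: "'i \<Rightarrow> 'a::banach"
  assumes "(f has_sum a) UNIV" "\<And>k. (f has_sum g k) (\<kappa> -` {k})"
  shows "(g has_sum a) UNIV"
proof -
  have "bij_betw snd (Sigma UNIV (\<lambda>k. \<kappa> -` {k})) (UNIV :: 'i set)"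
    by (rule bij_betwI[where g = "\<lambda>i. (\<kappa> i, i)"]) auto
  then have "((\<lambda>x. f (snd x)) has_sum a) (Sigma UNIV (\<lambda>k. \<kappa> -` {k}))"
    using assms(1) by (simp add: has_sum_reindex_bij_betw)
  then show ?thesis
    by (rule has_sum_SigmaD) (use assms(2) in simp)
qed

text \<open>A Beurling weight. Submultiplicativity makes the weighted summable series closed under
  products, and the domination of the modes makes them converge absolutely on
  \<open>S\<close>.\<close>

locale fourier_weight =
  fixes \<omega> :: "int ^ 'd::finite \<Rightarrow> real" and S :: "(complex ^ 'd) set"
  assumes weight_pos: "\<omega> k > 0" and weight_0: "\<omega> 0 = 1"
    and weight_add: "\<omega> (k + l) \<le> \<omega> k * \<omega> l"
    and em_le_weight: "z \<in> S \<Longrightarrow> norm (em k z) \<le> \<omega> k"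
begin

text \<open>Sums and products of series produce the same frequency many times. By the triangle
  inequality, collecting the terms with equal frequency can only lower the weighted norm, so norms
  may be computed before collecting.\<close>

lemma wien_atoms:
  assumes "((\<lambda>i. norm (a i) * \<omega> (\<kappa> i)) has_sum A) UNIV" "A \<le> C"
    and "\<And>z. z \<in> S \<Longrightarrow> ((\<lambda>i. a i * em (\<kappa> i) z) has_sum u z) UNIV"
  shows "wien \<omega> S C u"
proof -
  define c where "c k = (\<Sum>\<^sub>\<infinity>i\<in>\<kappa> -` {k}. a i)" for k
  define w where "w k = (\<Sum>\<^sub>\<infinity>i\<in>\<kappa> -` {k}. norm (a i) * \<omega> (\<kappa> i))" for k
  have "(\<lambda>i. norm (a i) * \<omega> (\<kappa> i)) summable_on (\<kappa> -` {k})" for k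
    using has_sum_imp_summable[OF assms(1)] by (rule summable_on_subset_banach) auto
  then have w: "((\<lambda>i. norm (a i) * \<omega> (\<kappa> i)) has_sum w k) (\<kappa> -` {k})" for k
    unfolding w_def by (rule has_sum_infsum)
  have wk: "((\<lambda>i. (norm (a i) * \<omega> (\<kappa> i)) * inverse (\<omega> k)) has_sum w k * inverse (\<omega> k)) (\<kappa> -` {k})" for k
    by (rule has_sum_cmult_left[OF w])
  have "norm (a i) \<le> (norm (a i) * \<omega> (\<kappa> i)) * inverse (\<omega> k)" if "i \<in> \<kappa> -` {k}" for i k
    using weight_pos[of k] that by (auto simp: mult.assoc)
  then have ck: "(a has_sum c k) (\<kappa> -` {k}) \<and> norm (c k) \<le> w k * inverse (\<omega> k)" for k
    unfolding c_def using norm_sum_le_weighted(1,2)[OF wk] by blast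
  have c: "(a has_sum c k) (\<kappa> -` {k})" and nc: "norm (c k) * \<omega> k \<le> w k" for k
    using ck[of k] weight_pos[of k] by (simp_all add: pos_le_divide_eq flip: divide_inverse)
  have W: "(w has_sum A) UNIV"
    by (rule has_sum_fibres[OF assms(1) w])
  have s: "(\<lambda>k. norm (c k) * \<omega> k) summable_on UNIV"
    by (rule summable_on_comparison_test[OF has_sum_imp_summable[OF W]])
      (use nc weight_pos in \<open>auto simp: less_imp_le\<close>)
  have "(\<Sum>\<^sub>\<infinity>k. norm (c k) * \<omega> k) \<le> A"
    using has_sum_mono[OF has_sum_infsum[OF s] W] nc by auto
  moreover have "((\<lambda>k. c k * em k z) has_sum u z) UNIV" if "z \<in> S" for z
  proof (rule has_sum_fibres[OF assms(3)[OF that], where \<kappa> = \<kappa>])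
    fix k
    have "((\<lambda>i. a i * em k z) has_sum c k * em k z) (\<kappa> -` {k})"
      by (rule has_sum_cmult_left[OF c])
    then show "((\<lambda>i. a i * em (\<kappa> i) z) has_sum c k * em k z) (\<kappa> -` {k})"
      by (rule has_sum_cong[THEN iffD1, rotated]) auto
  qed
  ultimately show ?thesis
    using has_sum_infsum[OF s] assms(2) by (intro wienI[OF has_sum_infsum[OF s]]) auto
qed

lemma wien_bound:
  assumes "wien \<omega> S C u" "z \<in> S"
  shows "norm (u z) \<le> C"
proof -
  obtain c A where *: "((\<lambda>k. norm (c k) * \<omega> k) has_sum A) UNIV" "A \<le> C"
    "((\<lambda>k. c k * em k z) has_sum u z) UNIV"
    using wienE[OF assms(1)] assms(2) by metis
  have "norm (u z) \<le> A"
    by (rule norm_infsum_le[OF *(3,1)])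
      (use em_le_weight[OF assms(2)] in \<open>auto simp: norm_mult intro!: mult_left_mono\<close>)
  then show ?thesis using * by simp
qed

lemma wien_nonneg: assumes "wien \<omega> S C u" shows "0 \<le> C"
proof -
  obtain c :: "int ^ 'd \<Rightarrow> complex" and A
    where c: "((\<lambda>k. norm (c k) * \<omega> k) has_sum A) UNIV" "A \<le> C"
    using assms by (rule wienE)
  have "0 \<le> A" using c(1) by (rule has_sum_nonneg) (auto simp: weight_pos less_imp_le)
  then show ?thesis using c by simp
qed

text \<open>Completeness of the algebra: chosen representations of the summands form one absolutely
  summable double family, whose terms are collected by frequency.\<close>

lemma wien_series:
  fixes u :: "'i \<Rightarrow> _"
  assumes "\<And>i. wien \<omega> S (C i) (u i)" "(C has_sum C') UNIV"
    and "\<And>z. z \<in> S \<Longrightarrow> ((\<lambda>i. u i z) has_sum U z) UNIV"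
  shows "wien \<omega> S C' U"
proof -
  obtain c A where "\<And>i. wien_rep \<omega> S (c i) (A i) (u i) \<and> A i \<le> C i"
    using assms(1) unfolding wien_def by metis
  then have c: "\<And>i. ((\<lambda>k. norm (c i k) * \<omega> k) has_sum A i) UNIV" "\<And>i. A i \<le> C i"
    "\<And>i z. z \<in> S \<Longrightarrow> ((\<lambda>k. c i k * em k z) has_sum u i z) UNIV"
    unfolding wien_rep_def by auto
  have A0: "0 \<le> A i" for i
    using c(1)[of i] by (rule has_sum_nonneg) (auto simp: weight_pos less_imp_le)
  have As: "A summable_on UNIV"
    by (rule summable_on_comparison_test[OF has_sum_imp_summable[OF assms(2)]]) (use c A0 in auto)
  have s: "(\<lambda>(i, k). norm (c i k) * \<omega> k) summable_on UNIV \<times> UNIV"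
    by (rule summable_on_SigmaI[where g = A]) (use c As weight_pos in \<open>auto simp: less_imp_le\<close>)
  have h: "((\<lambda>(i, k). norm (c i k) * \<omega> k) has_sum infsum A UNIV) (UNIV \<times> UNIV)"
    by (rule has_sum_SigmaI[OF _ has_sum_infsum[OF As] s]) (use c in auto)
  show ?thesis
  proof (rule wien_atoms[where a = "\<lambda>(i, k). c i k" and \<kappa> = snd])
    show "((\<lambda>x. norm ((\<lambda>(i, k). c i k) x) * \<omega> (snd x)) has_sum infsum A UNIV) UNIV"
      using h by (simp add: case_prod_unfold)
    show "infsum A UNIV \<le> C'"
      using has_sum_mono[OF has_sum_infsum[OF As] assms(2)] c(2) by auto
    fix z assume z: "z \<in> S"
    have "(\<lambda>(i, k). c i k * em k z) summable_on UNIV \<times> UNIV"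
      by (rule abs_summable_summable, rule summable_on_comparison_test[OF s])
        (use em_le_weight[OF z] in \<open>auto simp: norm_mult intro!: mult_left_mono\<close>)
    then have "((\<lambda>(i, k). c i k * em k z) has_sum U z) (UNIV \<times> UNIV)"
      by (intro has_sum_SigmaI[OF _ assms(3)[OF z]]) (use c z in auto)
    then show "((\<lambda>x. (\<lambda>(i, k). c i k) x * em (snd x) z) has_sum U z) UNIV"
      by (simp add: case_prod_unfold)
  qed
qed

lemma wien_mono: "wien \<omega> S C u \<Longrightarrow> C \<le> C' \<Longrightarrow> wien \<omega> S C' u"
  unfolding wien_def using order_trans by fast

lemma wien_cong: "wien \<omega> S C u \<Longrightarrow> (\<And>z. z \<in> S \<Longrightarrow> u z = u' z) \<Longrightarrow> wien \<omega> S C u'"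
  unfolding wien_def wien_rep_def by auto

lemma wien_em: "wien \<omega> S (norm a * \<omega> k) (\<lambda>z. a * em k z)"
proof (rule wienI)
  let ?c = "\<lambda>l. if l = k then a else 0"
  show "((\<lambda>l. norm (?c l) * \<omega> l) has_sum norm a * \<omega> k) UNIV"
    by (rule has_sum_finite_neutralI[where B = "{k}"]) auto
  show "((\<lambda>l. ?c l * em l z) has_sum a * em k z) UNIV" for z
    by (rule has_sum_finite_neutralI[where B = "{k}"]) auto
qed auto

lemma wien_const: "norm a \<le> C \<Longrightarrow> wien \<omega> S C (\<lambda>_. a)"
  using wien_mono[OF wien_em[of a 0]] by (simp add: weight_0)

lemma wien_add:
  assumes "wien \<omega> S C u" "wien \<omega> S D v"
  shows "wien \<omega> S (C + D) (\<lambda>z. u z + v z)"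
\<comment> \<open>A sum of two functions is a series indexed by \<open>bool\<close>.\<close>
proof (rule wien_series[where u = "\<lambda>b. if b then u else v" and C = "\<lambda>b. if b then C else D"])
  show "((\<lambda>b. (if b then C else D)) has_sum C + D) UNIV"
    "((\<lambda>b. (if b then u else v) z) has_sum u z + v z) UNIV" for z
    by (auto intro!: has_sum_finiteI simp: UNIV_bool)
qed (use assms in auto)

lemma wien_sum:
  assumes "finite I" "\<And>i. i \<in> I \<Longrightarrow> wien \<omega> S (C i) (u i)"
  shows "wien \<omega> S (\<Sum>i\<in>I. C i) (\<lambda>z. \<Sum>i\<in>I. u i z)"
  using assms by (induction I) (auto intro!: wien_add wien_const)

text \<open>The product of the two series is indexed by pairs, with frequency \<open>k + l\<close>;
  the submultiplicative weight bounds its norm by the product of the norms.\<close>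

lemma wien_mult:
  assumes "wien \<omega> S C u" "wien \<omega> S D v"
  shows "wien \<omega> S (C * D) (\<lambda>z. u z * v z)"
proof -
  obtain c A where c: "((\<lambda>k. norm (c k) * \<omega> k) has_sum A) UNIV" "A \<le> C"
    "\<And>z. z \<in> S \<Longrightarrow> ((\<lambda>k. c k * em k z) has_sum u z) UNIV"
    using assms(1) by (rule wienE) blast
  obtain d B where d: "((\<lambda>k. norm (d k) * \<omega> k) has_sum B) UNIV" "B \<le> D"
    "\<And>z. z \<in> S \<Longrightarrow> ((\<lambda>k. d k * em k z) has_sum v z) UNIV"
    using assms(2) by (rule wienE) blast
  have A0: "0 \<le> A" using c(1) by (rule has_sum_nonneg) (auto simp: weight_pos less_imp_le)
  have B0: "0 \<le> B" using d(1) by (rule has_sum_nonneg) (auto simp: weight_pos less_imp_le)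
  have s: "(\<lambda>(k, l). (norm (c k) * \<omega> k) * (norm (d l) * \<omega> l)) summable_on UNIV \<times> UNIV"
    by (rule summable_on_SigmaI[where g = "\<lambda>k. norm (c k) * \<omega> k * B"])
     (use has_sum_imp_summable[OF c(1)] d weight_pos in \<open>auto simp: less_imp_le intro!: has_sum_cmult_right summable_on_cmult_left\<close>)
  have le: "norm (c k * d l) * \<omega> (k + l) \<le> (norm (c k) * \<omega> k) * (norm (d l) * \<omega> l)" for k l
    using mult_left_mono[OF weight_add[of k l], of "norm (c k * d l)"]
    by (simp add: norm_mult mult_ac)
  have s': "(\<lambda>(k, l). norm (c k * d l) * \<omega> (k + l)) summable_on UNIV \<times> UNIV"
    by (rule summable_on_comparison_test[OF s])
      (use le weight_pos in \<open>auto simp: less_imp_le\<close>)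
  have h: "((\<lambda>(k, l). (norm (c k) * \<omega> k) * (norm (d l) * \<omega> l)) has_sum A * B) (UNIV \<times> UNIV)"
    by (rule has_sum_SigmaI[OF _ _ s, where g = "\<lambda>k. norm (c k) * \<omega> k * B"])
     (use c d in \<open>auto intro!: has_sum_cmult_right has_sum_cmult_left\<close>)
  show ?thesis
  proof (rule wien_atoms[where a = "\<lambda>(k, l). c k * d l" and \<kappa> = "\<lambda>(k, l). k + l"])
    show "((\<lambda>x. norm ((\<lambda>(k, l). c k * d l) x) * \<omega> ((\<lambda>(k, l). k + l) x)) has_sum
      (\<Sum>\<^sub>\<infinity>(k, l). norm (c k * d l) * \<omega> (k + l))) UNIV"
      using has_sum_infsum[OF s'] by (simp add: case_prod_unfold)
    have "(\<Sum>\<^sub>\<infinity>(k, l). norm (c k * d l) * \<omega> (k + l)) \<le> A * B"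
      using has_sum_mono[OF has_sum_infsum[OF s'] h] le by auto
    also have "\<dots> \<le> C * D" using c d A0 B0 by (intro mult_mono) auto
    finally show "(\<Sum>\<^sub>\<infinity>(k, l). norm (c k * d l) * \<omega> (k + l)) \<le> C * D" .
    fix z assume z: "z \<in> S"
    have "(\<lambda>(k, l). (c k * em k z) * (d l * em l z)) summable_on UNIV \<times> UNIV"
      by (rule abs_summable_summable, rule summable_on_comparison_test[OF s])
        (use em_le_weight[OF z] weight_pos in \<open>auto simp: norm_mult less_imp_le intro!: mult_mono\<close>)
    then have "((\<lambda>(k, l). (c k * em k z) * (d l * em l z)) has_sum u z * v z) (UNIV \<times> UNIV)"
      by (intro has_sum_SigmaI[where g = "\<lambda>k. c k * em k z * v z"])
        (use c d z in \<open>auto intro!: has_sum_cmult_right has_sum_cmult_left\<close>)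
    then show "((\<lambda>x. (\<lambda>(k, l). c k * d l) x * em ((\<lambda>(k, l). k + l) x) z) has_sum u z * v z) UNIV"
      by (simp add: case_prod_unfold em_add algebra_simps)
  qed
qed

lemma wien_cmult: "wien \<omega> S C u \<Longrightarrow> wien \<omega> S (norm a * C) (\<lambda>z. a * u z)"
  by (rule wien_mult[OF wien_const]) auto

lemma wien_uminus: "wien \<omega> S C u \<Longrightarrow> wien \<omega> S C (\<lambda>z. - u z)"
  using wien_cmult[of C u "-1"] by simp

lemma wien_diff: "wien \<omega> S C u \<Longrightarrow> wien \<omega> S D v \<Longrightarrow> wien \<omega> S (C + D) (\<lambda>z. u z - v z)"
  using wien_add[OF _ wien_uminus] by force

lemma wien_power: "wien \<omega> S C u \<Longrightarrow> wien \<omega> S (C ^ n) (\<lambda>z. u z ^ n)"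
  by (induction n) (auto intro!: wien_mult wien_const)

text \<open>The power series converges in the algebra, the norm of each power being at most the
  power of the norm. This later makes the modes of a displaced point members of the algebra.\<close>

lemma wien_exp:
  assumes "wien \<omega> S C u"
  shows "wien \<omega> S (exp C) (\<lambda>z. exp (u z))"
proof (rule wien_series[where u = "\<lambda>n z. u z ^ n / fact n" and C = "\<lambda>n. C ^ n / fact n"])
  have "(\<lambda>n. x ^ n / fact n) sums exp x" for x :: "'a::{banach, real_normed_field}"
    using exp_converges[of x] by (simp add: scaleR_conv_of_real field_simps)
  moreover have "summable (\<lambda>n. norm (x ^ n / fact n))" for x :: "'a::{banach, real_normed_field}"
    using summable_norm_exp[of x] by (simp add: norm_divide norm_mult norm_inverse norm_power divide_inverse mult.commute)
  ultimately have "((\<lambda>n. x ^ n / fact n) has_sum exp x) UNIV" for x :: "'a::{banach, real_normed_field}"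
    by (intro norm_summable_imp_has_sum)
  then show "((\<lambda>n. C ^ n / fact n) has_sum exp C) UNIV"
    "((\<lambda>n. u z ^ n / fact n) has_sum exp (u z)) UNIV" for z by blast+
  show "wien \<omega> S (C ^ n / fact n) (\<lambda>z. u z ^ n / fact n)" for n
    using wien_cmult[OF wien_power[OF assms, of n], of "1 / fact n"]
    by (simp add: norm_divide)
qed

end

section \<open>Summability over the lattice and the two families of weights\<close>

lemma summable_inverse_square_int: "(\<lambda>i::int. 1 / (1 + \<bar>of_int i\<bar>)\<^sup>2 :: real) summable_on UNIV"
proof -
  have "summable (\<lambda>n::nat. 1 / (1 + real n)\<^sup>2)"
    using inverse_power_summable[of 2, where 'a = real] summable_Suc_iff[of "\<lambda>n. 1 / (real n)\<^sup>2"]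
    by (simp add: divide_inverse)
  then have n: "(\<lambda>n::nat. 1 / (1 + real n)\<^sup>2) summable_on UNIV"
    by (intro summable_nonneg_imp_summable_on) auto
  have b: "bij_betw int UNIV {0..}" "bij_betw (\<lambda>n. - int n) UNIV {..0}"
    by (rule bij_betwI[where g = nat], auto) (rule bij_betwI[where g = "\<lambda>i. nat (- i)"], auto)
  have "(\<lambda>i::int. 1 / (1 + \<bar>of_int i\<bar>)\<^sup>2 :: real) summable_on {0..}"
    using summable_on_reindex_bij_betw[OF b(1), of "\<lambda>i. 1 / (1 + \<bar>of_int i\<bar>)\<^sup>2 :: real"] n by simp
  moreover have "(\<lambda>i::int. 1 / (1 + \<bar>of_int i\<bar>)\<^sup>2 :: real) summable_on {..0}"
    using summable_on_reindex_bij_betw[OF b(2), of "\<lambda>i. 1 / (1 + \<bar>of_int i\<bar>)\<^sup>2 :: real"] n by simp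
  ultimately have "(\<lambda>i::int. 1 / (1 + \<bar>of_int i\<bar>)\<^sup>2 :: real) summable_on {0..} \<union> {..0}"
    by (rule summable_on_union)
  moreover have "{0..} \<union> {..0} = (UNIV :: int set)" by auto
  ultimately show ?thesis by simp
qed

text \<open>Every component is at most \<open>knorm k\<close>, so the term is dominated by a product
  of convergent one-dimensional series. This is the origin of the exponent
  \<open>2 * CARD('d)\<close> that reappears whenever a bound on single coefficients is turned into
  a bound on their sum.\<close>

lemma summable_knorm: "(\<lambda>k::int ^ 'd::finite. 1 / (1 + knorm k) ^ (2 * CARD('d))) summable_on UNIV"
proof (rule nonneg_bdd_above_summable_on)
  let ?a = "\<lambda>i::int. 1 / (1 + \<bar>of_int i\<bar>)\<^sup>2 :: real"
  let ?A = "infsum ?a UNIV"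
  show "bdd_above (sum (\<lambda>k::int ^ 'd. 1 / (1 + knorm k) ^ (2 * CARD('d))) ` {F. F \<subseteq> UNIV \<and> finite F})"
  proof (rule bdd_aboveI2)
    fix F :: "(int ^ 'd) set" assume "F \<in> {F. F \<subseteq> UNIV \<and> finite F}"
    then have F: "finite F" by simp
    have le: "1 / (1 + knorm k) ^ (2 * CARD('d)) \<le> (\<Prod>j\<in>UNIV. ?a (k $ j))" for k :: "int ^ 'd"
    proof -
      have "(\<Prod>j\<in>UNIV. (1 + \<bar>of_int (k $ j)\<bar> :: real)\<^sup>2) \<le> (\<Prod>j\<in>(UNIV::'d set). (1 + knorm k)\<^sup>2)"
        using component_le_knorm[of k] by (intro prod_mono) (auto intro!: power_mono)
      then have "(\<Prod>j\<in>UNIV. (1 + \<bar>of_int (k $ j)\<bar> :: real)\<^sup>2) \<le> (1 + knorm k) ^ (2 * CARD('d))"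
        by (simp add: power_mult)
      then have "1 / (1 + knorm k) ^ (2 * CARD('d)) \<le> 1 / (\<Prod>j\<in>UNIV. (1 + \<bar>of_int (k $ j)\<bar> :: real)\<^sup>2)"
        by (intro divide_left_mono mult_pos_pos prod_pos) (auto intro!: zero_less_power add_pos_nonneg)
      then show ?thesis by (simp add: prod_dividef)
    qed
    have "sum (\<lambda>k. 1 / (1 + knorm k) ^ (2 * CARD('d))) F \<le> (\<Sum>k\<in>F. \<Prod>j\<in>UNIV. ?a (k $ j))"
      by (rule sum_mono[OF le])
    also have "\<dots> = (\<Sum>g\<in>vec_nth ` F. \<Prod>j\<in>UNIV. ?a (g j))"
      by (subst sum.reindex) (auto simp: inj_on_def vec_eq_iff)
    also have "\<dots> \<le> (\<Sum>g\<in>PiE UNIV (\<lambda>j. (\<lambda>k. k $ j) ` F). \<Prod>j\<in>UNIV. ?a (g j))"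
      using F by (intro sum_mono2 finite_PiE) (auto intro!: prod_nonneg)
    also have "\<dots> = (\<Prod>j\<in>UNIV. \<Sum>i\<in>(\<lambda>k. k $ j) ` F. ?a i)"
      using F by (subst prod.distrib[symmetric] prod_sum_PiE) auto
    also have "\<dots> \<le> (\<Prod>j\<in>(UNIV :: 'd set). ?A)"
      using F by (intro prod_mono conjI sum_nonneg finite_sum_le_infsum[OF summable_inverse_square_int]) auto
    finally show "sum (\<lambda>k. 1 / (1 + knorm k) ^ (2 * CARD('d))) F \<le> (\<Prod>j\<in>(UNIV :: 'd set). ?A)" .
  qed
qed auto

abbreviation Bs :: "real \<Rightarrow> real \<Rightarrow> (complex ^ 'd::finite \<Rightarrow> complex) \<Rightarrow> bool" where
  "Bs s \<equiv> wien (\<lambda>k. exp (s * knorm k)) (strip s)"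

lemma fourier_weight_strip: "0 \<le> s \<Longrightarrow> fourier_weight (\<lambda>k :: int ^ 'd::finite. exp (s * knorm k)) (strip s)"
  by standard (auto simp: norm_em_strip knorm_triangle mult_left_mono exp_add[symmetric] distrib_left[symmetric])

text \<open>Modes have modulus one at real points, so a weight that is at least one dominates
  them.\<close>

lemma fourier_weight_power: "fourier_weight (\<lambda>k :: int ^ 'd::finite. (1 + knorm k) ^ m) (range cvec)"
proof
  show "(1 + knorm (k + l)) ^ m \<le> (1 + knorm k) ^ m * (1 + knorm l) ^ m" for k l :: "int ^ 'd"
    unfolding power_mult_distrib[symmetric]
    by (rule power_mono) (use knorm_triangle[of k l] in \<open>auto simp: algebra_simps intro: order_trans\<close>)
  show "norm (em k z) \<le> (1 + knorm k) ^ m" if "z \<in> range cvec" for z and k :: "int ^ 'd"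
    using that by (auto intro!: one_le_power)
qed (auto intro!: zero_less_power add_pos_nonneg)

lemmas Bs_bound = fourier_weight.wien_bound[OF fourier_weight_strip]
lemmas Bs_nonneg = fourier_weight.wien_nonneg[OF fourier_weight_strip]
lemmas Bs_series = fourier_weight.wien_series[OF fourier_weight_strip]
lemmas Bs_mono = fourier_weight.wien_mono[OF fourier_weight_strip]
lemmas Bs_cong = fourier_weight.wien_cong[OF fourier_weight_strip]
lemmas Bs_em = fourier_weight.wien_em[OF fourier_weight_strip]
lemmas Bs_const = fourier_weight.wien_const[OF fourier_weight_strip]
lemmas Bs_add = fourier_weight.wien_add[OF fourier_weight_strip]
lemmas Bs_diff = fourier_weight.wien_diff[OF fourier_weight_strip]
lemmas Bs_uminus = fourier_weight.wien_uminus[OF fourier_weight_strip]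
lemmas Bs_sum = fourier_weight.wien_sum[OF fourier_weight_strip]
lemmas Bs_mult = fourier_weight.wien_mult[OF fourier_weight_strip]
lemmas Bs_cmult = fourier_weight.wien_cmult[OF fourier_weight_strip]
lemmas Bs_exp = fourier_weight.wien_exp[OF fourier_weight_strip]

text \<open>Differentiation and division by small divisors both multiply the coefficients. Comparing
  the multiplier with the quotient of two weights bounds the operator between the two
  algebras.\<close>

lemma wien_multiplier:
  assumes c: "((\<lambda>k. norm (c k) * \<omega> k) has_sum A) UNIV"
    and S: "\<And>z k. z \<in> S \<Longrightarrow> norm (em k z) \<le> \<omega>' k"
    and m: "\<And>k. norm (m k) * \<omega>' k \<le> M * \<omega> k" "\<And>k. 0 \<le> \<omega>' k" and "M * A \<le> C"
  shows "wien \<omega>' S C (\<lambda>z. \<Sum>\<^sub>\<infinity>k. m k * c k * em k z)"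
    "z \<in> S \<Longrightarrow> ((\<lambda>k. m k * c k * em k z) has_sum (\<Sum>\<^sub>\<infinity>k. m k * c k * em k z)) UNIV"
    "(\<lambda>k. norm (m k * c k) * \<omega>' k) summable_on UNIV"
proof -
  have MA: "((\<lambda>k. M * (norm (c k) * \<omega> k)) has_sum M * A) UNIV"
    by (rule has_sum_cmult_right[OF c])
  have le: "norm (m k * c k) * \<omega>' k \<le> M * (norm (c k) * \<omega> k)" for k
    using mult_left_mono[OF m(1)[of k], of "norm (c k)"] by (simp add: norm_mult mult_ac)
  show s: "(\<lambda>k. norm (m k * c k) * \<omega>' k) summable_on UNIV"
    by (rule summable_on_comparison_test[OF has_sum_imp_summable[OF MA]]) (use le m in auto)
  show 2: "((\<lambda>k. m k * c k * em k z) has_sum (\<Sum>\<^sub>\<infinity>k. m k * c k * em k z)) UNIV" if "z \<in> S" for z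
    by (rule norm_sum_le_weighted(1)[OF has_sum_infsum[OF s]])
      (use S[OF that] in \<open>auto simp: norm_mult intro!: mult_left_mono\<close>)
  have "(\<Sum>\<^sub>\<infinity>k. norm (m k * c k) * \<omega>' k) \<le> M * A"
    using has_sum_mono[OF has_sum_infsum[OF s] MA] le by auto
  then show "wien \<omega>' S C (\<lambda>z. \<Sum>\<^sub>\<infinity>k. m k * c k * em k z)"
    using assms(5) by (intro wienI[OF has_sum_infsum[OF s]] 2) auto
qed

lemma wien_change:
  assumes "wien \<omega> S C u" "\<And>k. \<omega>' k \<le> M * \<omega> k" "\<And>k. 0 \<le> \<omega>' k" "S' \<subseteq> S" "0 \<le> M"
  shows "wien \<omega>' S' (M * C) u"
proof -
  obtain c A where c: "((\<lambda>k. norm (c k) * \<omega> k) has_sum A) UNIV" "A \<le> C"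
    "\<And>z. z \<in> S \<Longrightarrow> ((\<lambda>k. c k * em k z) has_sum u z) UNIV"
    using assms(1) by (rule wienE) blast
  have MA: "((\<lambda>k. M * (norm (c k) * \<omega> k)) has_sum M * A) UNIV"
    by (rule has_sum_cmult_right[OF c(1)])
  have le: "norm (c k) * \<omega>' k \<le> M * (norm (c k) * \<omega> k)" for k
    using mult_left_mono[OF assms(2)[of k], of "norm (c k)"] by (simp add: mult_ac)
  have s: "(\<lambda>k. norm (c k) * \<omega>' k) summable_on UNIV"
    by (rule summable_on_comparison_test[OF has_sum_imp_summable[OF MA]]) (use le assms in auto)
  have "(\<Sum>\<^sub>\<infinity>k. norm (c k) * \<omega>' k) \<le> M * A"
    using has_sum_mono[OF has_sum_infsum[OF s] MA] le by auto
  also have "\<dots> \<le> M * C" using c assms by (intro mult_left_mono) auto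
  finally show ?thesis
    using c(3) assms(4) by (intro wienI[OF has_sum_infsum[OF s]]) auto
qed

lemma strip_mono: "s' \<le> s \<Longrightarrow> strip s' \<subseteq> strip s"
  unfolding strip_def by (auto intro: less_le_trans)

lemma Bs_shrink: "Bs s C u \<Longrightarrow> s' \<le> s \<Longrightarrow> Bs s' C u"
  using wien_change[of "\<lambda>k. exp (s * knorm k)" "strip s" C u "\<lambda>k. exp (s' * knorm k)" 1 "strip s'"]
  by (auto simp: strip_mono mult_right_mono)

lemma power_le_fact_exp: "0 \<le> x \<Longrightarrow> x ^ n \<le> fact n * exp (x :: real)"
proof -
  assume x: "0 \<le> x"
  have "(\<lambda>n. x ^ n / fact n) sums exp x"
    using exp_converges[of x] by (simp add: field_simps)
  then have "x ^ n / fact n \<le> exp x"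
    using sum_le_suminf[of "\<lambda>n. x ^ n / fact n" "{n}"] x by (auto simp: sums_iff)
  then show ?thesis by (simp add: field_simps)
qed

text \<open>Averaging a sum with a translate of itself, multiplied by a phase that restores
  frequency \<open>k\<close>, does not raise the bound on the supremum. A suitable translation
  cancels one other frequency; repeating this leaves the \<open>k\<close>-th term alone. The
  argument is free of integration.\<close>

lemma trig_coeff_bound_finite:
  assumes "finite F" "k \<in> F" "\<And>x. norm (\<Sum>l\<in>F. a l * em l (cvec x)) \<le> S"
  shows "norm (a k) \<le> S"
  using assms
proof (induction "card F" arbitrary: F a)
  case 0
  then show ?case by auto
next
  case (Suc n)
  show ?case
  proof (cases "F = {k}")
    case True
    then show ?thesis using Suc.prems(3)[of 0] by (simp add: norm_mult)
  next
    case False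
    then obtain l where l: "l \<in> F" "l \<noteq> k" using Suc.prems by auto
    then obtain j where j: "(l - k) $ j \<noteq> 0" by (auto simp: vec_eq_iff)
    \<comment> \<open>Half a period of the mode \<open>em (l - k)\<close>, in a direction in which
      \<open>l\<close> and \<open>k\<close> differ: frequency \<open>l\<close> changes sign relative
      to \<open>k\<close>.\<close>
    define t :: "real ^ 'a" where "t = axis j (1 / (2 * of_int ((l - k) $ j)))"
    have "kdot (l - k) (cvec t) = (\<Sum>i\<in>UNIV. if i = j then 1 / 2 else 0)"
      unfolding kdot_def using j by (intro sum.cong) (auto simp: cvec_def t_def axis_def)
    then have "kdot (l - k) (cvec t) = 1 / 2" by simp
    then have "em (l - k) (cvec t) = exp (2 * of_real pi * \<i> * (1 / 2))" by (simp only: em_def)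
    then have e: "em (l - k) (cvec t) = -1" by simp
    \<comment> \<open>Coefficients of the average: the factor applied to \<open>a m\<close> is 1 for
      \<open>m = k\<close> and 0 for \<open>m = l\<close>.\<close>
    define a' where "a' m = a m * (1 + em (m - k) (cvec t)) / 2" for m
    have "norm (a' k) \<le> S"
    proof (rule Suc.hyps(1)[of "F - {l}"])
      show "n = card (F - {l})" using Suc.hyps(2) Suc.prems(1) l by (simp add: card_Diff_singleton)
      fix x
      have "(\<Sum>m\<in>F - {l}. a' m * em m (cvec x)) = (\<Sum>m\<in>F. a' m * em m (cvec x))"
        using Suc.prems(1) l e by (simp add: sum_diff1 a'_def)
      also have "\<dots> = ((\<Sum>m\<in>F. a m * em m (cvec x)) + em (- k) (cvec t) * (\<Sum>m\<in>F. a m * em m (cvec (x + t)))) / 2"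
        unfolding sum_divide_distrib sum_distrib_left sum.distrib[symmetric] a'_def
      proof (rule sum.cong)
        fix m
        have "em m (cvec (x + t)) = em m (cvec x) * em m (cvec t)"
          unfolding em_add_right[symmetric] by (simp add: cvec_def plus_vec_def)
        moreover have "em (m - k) (cvec t) = em m (cvec t) * em (- k) (cvec t)"
          unfolding em_add[symmetric] by simp
        ultimately show "a m * (1 + em (m - k) (cvec t)) / 2 * em m (cvec x) =
          (a m * em m (cvec x) + em (- k) (cvec t) * (a m * em m (cvec (x + t)))) / 2"
          by (simp add: algebra_simps)
      qed auto
      finally have eq: "(\<Sum>m\<in>F - {l}. a' m * em m (cvec x)) =
        ((\<Sum>m\<in>F. a m * em m (cvec x)) + em (- k) (cvec t) * (\<Sum>m\<in>F. a m * em m (cvec (x + t)))) / 2" .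
      have "norm (\<Sum>m\<in>F - {l}. a' m * em m (cvec x)) \<le>
          (norm (\<Sum>m\<in>F. a m * em m (cvec x)) + norm (em (- k) (cvec t) * (\<Sum>m\<in>F. a m * em m (cvec (x + t))))) / 2"
        unfolding eq norm_divide using norm_triangle_ineq by auto
      also have "\<dots> \<le> (S + S) / 2"
        unfolding norm_mult norm_em_cvec by (intro divide_right_mono add_mono) (use Suc.prems in auto)
      finally show "norm (\<Sum>m\<in>F - {l}. a' m * em m (cvec x)) \<le> S" by simp
    qed (use Suc.prems l in auto)
    then show ?thesis by (simp add: a'_def)
  qed
qed

text \<open>Beyond a finite set containing \<open>k\<close> the coefficients sum to at most
  \<open>e\<close>, which is added to the bound for the finite sum.\<close>

lemma trig_coeff_bound:
  assumes c: "(\<lambda>k. norm (c k)) summable_on UNIV"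
    and S: "\<And>x. norm (\<Sum>\<^sub>\<infinity>k. c k * em k (cvec x)) \<le> S"
  shows "norm (c k) \<le> S"
proof (rule field_le_epsilon)
  fix e :: real assume e: "0 < e"
  obtain F where F: "finite F" "dist (\<Sum>k\<in>F. norm (c k)) (\<Sum>\<^sub>\<infinity>k. norm (c k)) \<le> e"
    using infsum_finite_approximation[OF c e] by auto
  define F' where "F' = insert k F"
  have F': "finite F'" using F by (simp add: F'_def)
  have co: "(\<lambda>k. norm (c k)) summable_on (- F')"
    using c by (rule summable_on_subset_banach) auto
  have split: "(\<Sum>\<^sub>\<infinity>k. norm (c k)) = (\<Sum>k\<in>F'. norm (c k)) + (\<Sum>\<^sub>\<infinity>k\<in>-F'. norm (c k))"
    using infsum_Un_disjoint[of "\<lambda>k. norm (c k)" F' "- F'"] co F' by (simp add: Compl_partition)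
  have "(\<Sum>k\<in>F. norm (c k)) \<le> (\<Sum>k\<in>F'. norm (c k))"
    using F' by (intro sum_mono2) (auto simp: F'_def)
  then have tail: "(\<Sum>\<^sub>\<infinity>k\<in>-F'. norm (c k)) \<le> e"
    using F(2) split by (simp add: dist_real_def)
  show "norm (c k) \<le> S + e"
  proof (rule trig_coeff_bound_finite[OF F'])
    fix x
    have n: "(\<lambda>k. norm (c k * em k (cvec x))) = (\<lambda>k. norm (c k))"
      by (simp add: norm_mult fun_eq_iff)
    have s: "(\<lambda>k. c k * em k (cvec x)) summable_on - F'"
      by (rule abs_summable_summable) (use co n in simp)
    have "(\<Sum>\<^sub>\<infinity>k. c k * em k (cvec x)) = (\<Sum>k\<in>F'. c k * em k (cvec x)) + (\<Sum>\<^sub>\<infinity>k\<in>-F'. c k * em k (cvec x))"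
      using infsum_Un_disjoint[of "\<lambda>k. c k * em k (cvec x)" F' "- F'"] s F' by (simp add: Compl_partition)
    moreover have "norm (\<Sum>\<^sub>\<infinity>k\<in>-F'. c k * em k (cvec x)) \<le> e"
      using norm_infsum_bound[of "\<lambda>k. c k * em k (cvec x)" "- F'"] co tail by (simp add: n)
    ultimately show "norm (\<Sum>l\<in>F'. c l * em l (cvec x)) \<le> S + e"
      using S[of x] norm_triangle_ineq4[of "\<Sum>\<^sub>\<infinity>k. c k * em k (cvec x)" "\<Sum>\<^sub>\<infinity>k\<in>-F'. c k * em k (cvec x)"] by simp
  qed (simp add: F'_def)
qed

text \<open>With \<open>f\<close> the sum of the series, \<open>c (- k) - cnj (c k)\<close> is the
  coefficient sequence of \<open>f (- x) - cnj (f (- x))\<close>. This function vanishes for real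
  \<open>f\<close>, so its coefficients are bounded by zero.\<close>

lemma trig_coeff_real:
  assumes c: "(\<lambda>k. norm (c k)) summable_on UNIV"
    and S: "\<And>x. (\<Sum>\<^sub>\<infinity>k. c k * em k (cvec x)) \<in> \<real>"
  shows "c (- k) = cnj (c k)"
proof -
  have bij: "bij (uminus :: int ^ 'a \<Rightarrow> _)" by (simp add: bij_uminus)
  have c': "(\<lambda>k. norm (c (- k))) summable_on UNIV"
    using summable_on_reindex_bij_betw[OF bij, of "\<lambda>k. norm (c k)"] c by simp
  have "norm (c (- k) - cnj (c k)) \<le> 0"
  proof (rule trig_coeff_bound[of "\<lambda>k. c (- k) - cnj (c k)"])
    show "(\<lambda>k. norm (c (- k) - cnj (c k))) summable_on UNIV"
      by (rule summable_on_comparison_test[OF summable_on_add[OF c' c]])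
        (auto intro: order_trans[OF norm_triangle_ineq4])
    fix x
    have n: "(\<lambda>k. c k * em k (cvec y)) summable_on UNIV" for y
      by (rule abs_summable_summable) (use c in \<open>simp add: norm_mult\<close>)
    have n': "(\<lambda>k. c (- k) * em k (cvec x)) summable_on UNIV"
      by (rule abs_summable_summable) (use c' in \<open>simp add: norm_mult\<close>)
    have n'': "(\<lambda>k. cnj (c k) * em k (cvec x)) summable_on UNIV"
      by (rule abs_summable_summable) (use c in \<open>simp add: norm_mult\<close>)
    have 1: "(\<Sum>\<^sub>\<infinity>k. c (- k) * em k (cvec x)) = (\<Sum>\<^sub>\<infinity>k. c k * em k (cvec (- x)))"
      using infsum_reindex_bij_betw[OF bij, of "\<lambda>k. c k * em (- k) (cvec x)"]
      by (simp add: em_def kdot_def cvec_def)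
    have 2: "(\<Sum>\<^sub>\<infinity>k. cnj (c k) * em k (cvec x)) = cnj (\<Sum>\<^sub>\<infinity>k. c k * em k (cvec (- x)))"
      by (simp add: infsum_cnj[symmetric] cnj_em_cvec del: infsum_cnj) (simp add: em_def kdot_def cvec_def)
    have "(\<Sum>\<^sub>\<infinity>k. (c (- k) - cnj (c k)) * em k (cvec x)) =
      (\<Sum>\<^sub>\<infinity>k. c k * em k (cvec (- x))) - cnj (\<Sum>\<^sub>\<infinity>k. c k * em k (cvec (- x)))"
      using infsumI[OF has_sum_add[OF has_sum_infsum[OF n'] has_sum_uminusI[OF has_sum_infsum[OF n'']]]]
      unfolding 1 2 by (simp add: left_diff_distrib)
    also have "\<dots> = 0" using S[of "- x"] by (simp add: Reals_cnj_iff)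
    finally show "norm (\<Sum>\<^sub>\<infinity>k. (c (- k) - cnj (c k)) * em k (cvec x)) \<le> 0" by simp
  qed
  then show ?thesis by simp
qed

text \<open>A function in the algebra of a strip that is bounded there lies in the algebras of the smaller
  strips, with a norm controlled by its supremum alone. Only this lemma makes compositions
  \<open>p(z + h(z))\<close> with high frequencies affordable.\<close>

lemma Bs_from_sup:
  obtains M where "0 < M" "\<And>s \<sigma> C S (u :: complex ^ 'd::finite \<Rightarrow> complex). Bs s C u \<Longrightarrow> 0 < \<sigma> \<Longrightarrow> \<sigma> \<le> s \<Longrightarrow> \<sigma> \<le> 1 \<Longrightarrow>
    (\<And>z. z \<in> strip s \<Longrightarrow> norm (u z) \<le> S) \<Longrightarrow> Bs (s - \<sigma>) (M / \<sigma> ^ (2 * CARD('d)) * S) u"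
proof -
  let ?n = "2 * CARD('d)"
  define Z where "Z = (\<Sum>\<^sub>\<infinity>k::int ^ 'd. 1 / (1 + knorm k) ^ ?n)"
  define M where "M = exp 1 * fact ?n * 2 ^ ?n * (Z + 1)"
  have Z0: "0 \<le> Z" unfolding Z_def by (rule infsum_nonneg) auto
  have Z: "((\<lambda>k::int ^ 'd. 1 / (1 + knorm k) ^ ?n) has_sum Z) UNIV"
    unfolding Z_def by (rule has_sum_infsum[OF summable_knorm])
  have "Bs (s - \<sigma>) (M / \<sigma> ^ ?n * S) u" if u: "Bs s C u" and \<sigma>: "0 < \<sigma>" "\<sigma> \<le> s" "\<sigma> \<le> 1"
    and S: "\<And>z. z \<in> strip s \<Longrightarrow> norm (u z) \<le> S" for s \<sigma> C S and u :: "complex ^ 'd \<Rightarrow> complex"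
  proof -
    obtain c A where c: "((\<lambda>k. norm (c k) * exp (s * knorm k)) has_sum A) UNIV" "A \<le> C"
      "\<And>z. z \<in> strip s \<Longrightarrow> ((\<lambda>k. c k * em k z) has_sum u z) UNIV"
      using u by (rule wienE) blast
    have S0: "0 \<le> S" using S[of 0] \<sigma> by (force simp: strip_def intro: order_trans[OF norm_ge_zero])
    have ck: "norm (c k) * exp ((s - \<sigma> / 2) * knorm k) \<le> S" for k
    proof -
      \<comment> \<open>At this purely imaginary point \<open>em k\<close> has modulus
        \<open>exp ((s - \<sigma> / 2) * knorm k)\<close>, because the sign of each imaginary part
        is adapted to \<open>k\<close>. Bounding the coefficients of the translate of
        \<open>u\<close> by \<open>y\<close> gives the Cauchy estimate. Half of \<sigma> is spent on
        staying inside the open strip.\<close>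
      define y :: "complex ^ 'd" where "y = (\<chi> j. - \<i> * of_real (sgn (of_int (k $ j)) * ((s - \<sigma> / 2) / (2 * pi))))"
      have str: "cvec x + y \<in> strip s" for x
        using \<sigma> by (auto simp: strip_def cvec_def y_def abs_mult sgn_if abs_if)
      then have y: "y \<in> strip s" using str[of 0] by (simp add: cvec_def zero_vec_def[symmetric])
      have "Im (kdot k y) = - (\<Sum>j\<in>UNIV. \<bar>of_int (k $ j)\<bar> * ((s - \<sigma> / 2) / (2 * pi)))"
        unfolding Im_kdot sum_negf[symmetric] y_def by (rule sum.cong) (auto simp: sgn_if)
      also have "\<dots> = - ((s - \<sigma> / 2) / (2 * pi) * knorm k)"
        by (simp only: knorm_def sum_distrib_right[symmetric] mult.commute)
      finally have ek: "norm (em k y) = exp ((s - \<sigma> / 2) * knorm k)"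
        by (simp add: norm_em)
      have "norm (c k * em k y) \<le> S"
      proof (rule trig_coeff_bound)
        show "(\<lambda>l. norm (c l * em l y)) summable_on UNIV"
          by (rule summable_on_comparison_test[OF has_sum_imp_summable[OF c(1)]])
            (use norm_em_strip[OF y] in \<open>auto simp: norm_mult intro!: mult_left_mono\<close>)
        fix x
        have "((\<lambda>l. c l * em l y * em l (cvec x)) has_sum u (cvec x + y)) UNIV"
          using c(3)[OF str[of x]] by (simp add: em_add_right mult_ac)
        then show "norm (\<Sum>\<^sub>\<infinity>l. c l * em l y * em l (cvec x)) \<le> S"
          using S[OF str[of x]] by (simp add: infsumI)
      qed
      then show ?thesis by (simp add: norm_mult ek)
    qed
    \<comment> \<open>The other half of \<sigma> is an exponential gain, exchanged for the summable
      factor \<open>1 / (1 + knorm k) ^ (2 * CARD('d))\<close>.\<close>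
    define w where "w = exp 1 * fact ?n * (2 / \<sigma>) ^ ?n * S"
    have w0: "0 \<le> w" using S0 \<sigma> by (auto simp: w_def)
    have le: "norm (c k) * exp ((s - \<sigma>) * knorm k) \<le> w * (1 / (1 + knorm k) ^ ?n)" for k
    proof -
      let ?x = "\<sigma> / 2 * (1 + knorm k)"
      have gen: "a \<le> a * X" if "1 \<le> X" "0 \<le> a" for a X :: real
        using mult_left_mono[OF that] by simp
      have "?x ^ ?n \<le> fact ?n * exp ?x"
        using \<sigma> by (intro power_le_fact_exp) auto
      also have "\<dots> \<le> fact ?n * (exp 1 * exp (\<sigma> / 2 * knorm k))"
        unfolding exp_add[symmetric] using \<sigma> by (intro mult_left_mono) (auto simp: field_simps)
      finally have "(\<sigma> / 2) ^ ?n * (1 + knorm k) ^ ?n \<le> fact ?n * exp 1 * exp (\<sigma> / 2 * knorm k)"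
        by (simp only: power_mult_distrib mult_ac)
      then have "1 \<le> exp 1 * fact ?n * (2 / \<sigma>) ^ ?n * exp (\<sigma> / 2 * knorm k) * (1 / (1 + knorm k) ^ ?n)"
        using \<sigma> by (simp add: field_simps power_divide add_pos_nonneg)
      then have "norm (c k) * exp ((s - \<sigma>) * knorm k) \<le> norm (c k) * exp ((s - \<sigma>) * knorm k) *
        (exp 1 * fact ?n * (2 / \<sigma>) ^ ?n * exp (\<sigma> / 2 * knorm k) * (1 / (1 + knorm k) ^ ?n))"
        by (rule gen) simp
      also have "\<dots> = (norm (c k) * exp ((s - \<sigma> / 2) * knorm k)) * (exp 1 * fact ?n * (2 / \<sigma>) ^ ?n * (1 / (1 + knorm k) ^ ?n))"
        by (simp add: exp_add[symmetric] algebra_simps)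
      also have "\<dots> \<le> S * (exp 1 * fact ?n * (2 / \<sigma>) ^ ?n * (1 / (1 + knorm k) ^ ?n))"
        using ck[of k] \<sigma> by (intro mult_right_mono) auto
      finally show ?thesis by (simp add: w_def mult_ac)
    qed
    have wZ: "((\<lambda>k::int ^ 'd. w * (1 / (1 + knorm k) ^ ?n)) has_sum w * Z) UNIV"
      by (rule has_sum_cmult_right[OF Z])
    have s: "(\<lambda>k. norm (c k) * exp ((s - \<sigma>) * knorm k)) summable_on UNIV"
      by (rule summable_on_comparison_test[OF has_sum_imp_summable[OF wZ]]) (use le in auto)
    have "(\<Sum>\<^sub>\<infinity>k. norm (c k) * exp ((s - \<sigma>) * knorm k)) \<le> w * Z"
      using has_sum_mono[OF has_sum_infsum[OF s] wZ] le by auto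
    also have "\<dots> \<le> w * (Z + 1)" using w0 by (intro mult_left_mono) auto
    also have "\<dots> = M / \<sigma> ^ ?n * S" by (simp add: w_def M_def power_divide)
    finally show ?thesis
      using c(3) strip_mono[of "s - \<sigma>" s] \<sigma> by (intro wienI[OF has_sum_infsum[OF s]]) auto
  qed
  moreover have "0 < M" unfolding M_def using Z0 by (intro mult_pos_pos) auto
  ultimately show thesis using that by blast
qed

section \<open>Differentiation and small divisors on strips\<close>

lemma infinite_int_vec: "infinite (UNIV :: (int ^ 'd::finite) set)"
proof
  assume "finite (UNIV :: (int ^ 'd) set)"
  then have "finite (range (\<lambda>n::nat. (\<chi> i. int n) :: int ^ 'd))"
    by (rule finite_subset[rotated]) auto
  moreover have "inj (\<lambda>n::nat. (\<chi> i. int n) :: int ^ 'd)"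
    by (auto simp: inj_def vec_eq_iff)
  ultimately show False by (simp add: finite_image_iff)
qed

text \<open>The exponents are arbitrary linear forms on a real normed space, so that the lemma
  serves complex strips and also, through \<open>cvec\<close>, the real space.\<close>

lemma has_derivative_exp_series:
  fixes l :: "int ^ 'd::finite \<Rightarrow> 'v::real_normed_vector \<Rightarrow> complex"
  assumes lin: "\<And>k. bounded_linear (l k)" and S: "open S" "convex S" "x \<in> S"
    and E: "\<And>k y. y \<in> S \<Longrightarrow> norm (exp (l k y)) \<le> E k" and L: "\<And>k w. norm (l k w) \<le> L k * norm w"
    and sm: "(\<lambda>k. norm (c k) * E k * L k) summable_on UNIV"
    and u: "\<And>y. y \<in> S \<Longrightarrow> ((\<lambda>k. c k * exp (l k y)) has_sum u y) UNIV"
  shows "(u has_derivative (\<lambda>w. \<Sum>\<^sub>\<infinity>k. l k w * c k * exp (l k x))) (at x)"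
proof -
  \<comment> \<open>An enumeration of the lattice turns unordered sums into series over
    \<open>nat\<close>, the setting of \<open>has_derivative_series\<close>.\<close>
  obtain b :: "nat \<Rightarrow> int ^ 'd" where b: "bij b"
    using bij_betw_from_nat_into[OF _ infinite_int_vec] by blast
  define f where "f n y = c (b n) * exp (l (b n) y)" for n y
  define f' where "f' n y w = l (b n) w * c (b n) * exp (l (b n) y)" for n y w
  define g' where "g' y w = (\<Sum>\<^sub>\<infinity>k. l k w * c k * exp (l k y))" for y w
  define B where "B n = norm (c (b n)) * E (b n) * L (b n)" for n
  have E0: "0 \<le> E k" for k using E[OF S(3)] norm_ge_zero order_trans by blast
  have B: "summable B"
    using sm summable_on_reindex_bij_betw[OF b, of "\<lambda>k. norm (c k) * E k * L k"]
    unfolding B_def by (auto intro: summable_on_imp_summable)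
  have f'B: "norm (f' n y w) \<le> B n * norm w" if "y \<in> S" for n y w
  proof -
    have "norm (f' n y w) = norm (c (b n)) * norm (exp (l (b n) y)) * norm (l (b n) w)"
      by (simp add: f'_def norm_mult mult_ac)
    also have "\<dots> \<le> norm (c (b n)) * E (b n) * (L (b n) * norm w)"
      using E[OF that] L E0 by (intro mult_mono) auto
    finally show ?thesis by (simp add: B_def mult_ac)
  qed
  have g': "(\<lambda>n. f' n y w) sums g' y w" if "y \<in> S" for y w
  proof -
    have "summable (\<lambda>n. norm (f' n y w))"
      using f'B[OF that] by (intro summable_comparison_test'[OF summable_mult2[OF B, of "norm w"]]) auto
    then have "(\<lambda>n. f' n y w) summable_on UNIV"
      by (intro norm_summable_imp_summable_on)
    then have "(\<lambda>k. l k w * c k * exp (l k y)) summable_on UNIV"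
      using summable_on_reindex_bij_betw[OF b, of "\<lambda>k. l k w * c k * exp (l k y)"] by (simp add: f'_def)
    then have "((\<lambda>n. f' n y w) has_sum g' y w) UNIV"
      using has_sum_reindex_bij_betw[OF b, of "\<lambda>k. l k w * c k * exp (l k y)" "g' y w"]
      by (simp add: f'_def g'_def)
    then show ?thesis by (rule has_sum_imp_sums)
  qed
  have fu: "(\<lambda>n. f n y) sums u y" if "y \<in> S" for y
    using u[OF that] has_sum_reindex_bij_betw[OF b, of "\<lambda>k. c k * exp (l k y)"]
    by (intro has_sum_imp_sums) (simp add: f_def)
  have "\<exists>g. \<forall>y\<in>S. (\<lambda>n. f n y) sums g y \<and> (g has_derivative g' y) (at y within S)"
  proof (rule has_derivative_series[where f = f and f' = f' and g' = g' and x = x and l = "u x", OF S(2)])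
    fix n y assume "y \<in> S"
    have "(exp has_field_derivative exp (l (b n) y)) (at (l (b n) y))"
      by (rule DERIV_exp)
    then have "((\<lambda>y. exp (l (b n) y)) has_derivative (\<lambda>w. exp (l (b n) y) * l (b n) w)) (at y within S)"
      using has_derivative_compose[OF bounded_linear_imp_has_derivative[OF lin[of "b n"]], of exp "(*) (exp (l (b n) y))" y S]
      by (simp add: has_field_derivative_def)
    from has_derivative_mult_right[OF this, of "c (b n)"]
    show "(f n has_derivative f' n y) (at y within S)"
      by (simp add: f_def[abs_def] f'_def[abs_def] mult_ac)
  next
    fix e :: real assume "0 < e"
    then obtain N where N: "\<And>n. n \<ge> N \<Longrightarrow> norm (\<Sum>i. B (i + n)) < e"
      using suminf_exist_split[OF _ B] by blast
    have "norm ((\<Sum>i<n. f' i y w) - g' y w) \<le> e * norm w" if "n \<ge> N" "y \<in> S" for n y w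
    proof -
      have Bn: "summable (\<lambda>i. B (i + n) * norm w)"
        by (intro summable_mult2 summable_ignore_initial_segment B)
      have "g' y w - (\<Sum>i<n. f' i y w) = (\<Sum>i. f' (i + n) y w)"
        using suminf_split_initial_segment[OF sums_summable[OF g'[OF that(2)]], of w n]
          sums_unique[OF g'[OF that(2)]] by simp
      also have "norm \<dots> \<le> (\<Sum>i. B (i + n) * norm w)"
        using f'B[OF that(2)] Bn by (rule norm_suminf_le)
      also have "\<dots> = (\<Sum>i. B (i + n)) * norm w"
        by (intro suminf_mult2[symmetric] summable_ignore_initial_segment B)
      also have "\<dots> \<le> e * norm w"
        using N[OF that(1)] by (intro mult_right_mono) auto
      finally show ?thesis by (simp add: norm_minus_commute)
    qed
    then show "\<forall>\<^sub>F n in sequentially. \<forall>y\<in>S. \<forall>w. norm ((\<Sum>i<n. f' i y w) - g' y w) \<le> e * norm w"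
      unfolding eventually_sequentially by blast
  qed (use S fu in auto)
  then obtain g where g: "\<And>y. y \<in> S \<Longrightarrow> (\<lambda>n. f n y) sums g y"
      "\<And>y. y \<in> S \<Longrightarrow> (g has_derivative g' y) (at y within S)" by blast
  have "g y = u y" if "y \<in> S" for y
    using sums_unique2[OF g(1)[OF that] fu[OF that]] .
  moreover have "(g has_derivative g' x) (at x)"
    using g(2)[OF S(3)] at_within_open[OF S(3,1)] by simp
  ultimately have "(u has_derivative g' x) (at x)"
    using S by (metis has_derivative_transform_within_open)
  then show ?thesis by (simp add: g'_def[abs_def])
qed

lemma bounded_linear_kdot: "bounded_linear (kdot k)"
  unfolding kdot_def[abs_def]
  by (intro bounded_linear_sum bounded_linear_const_mult bounded_linear_vec_nth)

lemma norm_kdot_le: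
  assumes "\<And>j. norm (w $ j) \<le> W"
  shows "norm (kdot k w) \<le> knorm k * W"
proof -
  have "norm (kdot k w) \<le> (\<Sum>j\<in>UNIV. norm (of_int (k $ j) * w $ j))"
    unfolding kdot_def by (rule norm_sum)
  also have "\<dots> \<le> (\<Sum>j\<in>UNIV. \<bar>of_int (k $ j)\<bar> * W)"
    using assms by (intro sum_mono) (auto simp: norm_mult intro!: mult_left_mono)
  finally show ?thesis by (simp add: knorm_def sum_distrib_right)
qed

lemma open_strip: "open (strip s)"
proof -
  have eq: "strip s = (\<Inter>j. {z. 2 * pi * \<bar>Im (z $ j)\<bar> < s})" by (auto simp: strip_def)
  have "open {z :: complex ^ 'a. 2 * pi * \<bar>Im (z $ j)\<bar> < s}" for j
    by (intro open_Collect_less continuous_intros)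
  then show ?thesis unfolding eq by (intro open_INT) auto
qed

lemma convex_strip: "convex (strip s)"
proof (rule convexI)
  fix x y :: "complex ^ 'a" and a b :: real
  assume *: "x \<in> strip s" "y \<in> strip s" "0 \<le> a" "0 \<le> b" "a + b = 1"
  have "2 * pi * \<bar>Im ((a *\<^sub>R x + b *\<^sub>R y) $ j)\<bar> < s" for j
  proof -
    have "\<bar>Im ((a *\<^sub>R x + b *\<^sub>R y) $ j)\<bar> \<le> a * \<bar>Im (x $ j)\<bar> + b * \<bar>Im (y $ j)\<bar>"
      using *(3,4) abs_triangle_ineq[of "a * Im (x $ j)" "b * Im (y $ j)"] by (simp add: abs_mult)
    then have "2 * pi * \<bar>Im ((a *\<^sub>R x + b *\<^sub>R y) $ j)\<bar> \<le> 2 * pi * (a * \<bar>Im (x $ j)\<bar> + b * \<bar>Im (y $ j)\<bar>)"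
      by (intro mult_left_mono) auto
    also have "\<dots> = a * (2 * pi * \<bar>Im (x $ j)\<bar>) + b * (2 * pi * \<bar>Im (y $ j)\<bar>)" by (simp add: algebra_simps)
    also have "\<dots> < s"
      using * by (intro convex_bound_lt) (auto simp: strip_def)
    finally show ?thesis .
  qed
  then show "a *\<^sub>R x + b *\<^sub>R y \<in> strip s" by (simp add: strip_def)
qed

text \<open>The slightly smaller strip leaves an exponential factor in reserve, which pays for the
  factor \<open>knorm k\<close> that differentiation brings down.\<close>

lemma strip_interior:
  fixes z :: "complex ^ 'd::finite"
  assumes "z \<in> strip s"
  obtains s' where "0 < s'" "s' < s" "z \<in> strip s'"
proof -
  define m where "m = Max (range (\<lambda>j. 2 * pi * \<bar>Im (z $ j)\<bar>))"
  have m: "2 * pi * \<bar>Im (z $ j)\<bar> \<le> m" for j unfolding m_def by (rule Max_ge) auto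
  have "m < s" unfolding m_def using assms by (subst Max_less_iff) (auto simp: strip_def)
  moreover have "0 \<le> m" using order_trans[OF _ m, of 0] by simp
  moreover have "2 * pi * \<bar>Im (z $ j)\<bar> < (m + s) / 2" for j
    by (rule le_less_trans[OF m]) (use \<open>m < s\<close> in simp)
  then have "z \<in> strip ((m + s) / 2)" unfolding strip_def by blast
  ultimately show ?thesis using that[of "(m + s) / 2"] by simp
qed

text \<open>From \<open>\<sigma> * x \<le> exp (\<sigma> * x)\<close>. It shows that one derivative
  costs a factor \<open>1 / \<sigma>\<close> when the strip shrinks by \<sigma>.\<close>

lemma x_exp_neg_le: "0 < \<sigma> \<Longrightarrow> x * exp ((s - \<sigma>) * x) \<le> 1 / \<sigma> * exp (s * x)" for x :: real
proof -
  assume \<sigma>: "0 < \<sigma>"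
  have "\<sigma> * x \<le> exp (\<sigma> * x)" using exp_ge_add_one_self[of "\<sigma> * x"] by linarith
  then have "\<sigma> * x * exp ((s - \<sigma>) * x) \<le> exp (\<sigma> * x) * exp ((s - \<sigma>) * x)"
    by (intro mult_right_mono) auto
  also have "\<dots> = exp (s * x)" by (simp add: exp_add[symmetric] algebra_simps)
  finally show ?thesis using \<sigma> by (simp add: field_simps)
qed

lemma has_derivative_strip:
  assumes c: "((\<lambda>k. norm (c k) * exp (s * knorm k)) has_sum A) UNIV"
    and u: "\<And>z. z \<in> strip s \<Longrightarrow> ((\<lambda>k. c k * em k z) has_sum u z) UNIV"
    and z: "z \<in> strip s"
  shows "(u has_derivative (\<lambda>w. \<Sum>\<^sub>\<infinity>k. (2 * of_real pi * \<i> * kdot k w) * c k * em k z)) (at z)"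
proof -
  obtain s' where s': "0 < s'" "s' < s" "z \<in> strip s'" using strip_interior[OF z] .
  show ?thesis
    unfolding em_def
  proof (rule has_derivative_exp_series[where S = "strip s'" and E = "\<lambda>k. exp (s' * knorm k)" and L = "\<lambda>k. 2 * pi * knorm k"])
    show "bounded_linear (\<lambda>z. 2 * of_real pi * \<i> * kdot k z)" for k
      by (intro bounded_linear_const_mult bounded_linear_kdot)
    show "norm (exp (2 * of_real pi * \<i> * kdot k y)) \<le> exp (s' * knorm k)" if "y \<in> strip s'" for k y
      using norm_em_strip[OF that] by (simp add: em_def)
    show "norm (2 * of_real pi * \<i> * kdot k w) \<le> 2 * pi * knorm k * norm w" for k w
      using norm_kdot_le[of w "norm w" k] Finite_Cartesian_Product.norm_nth_le[of w]
      by (simp add: norm_mult mult.assoc)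
    show "(\<lambda>k. norm (c k) * exp (s' * knorm k) * (2 * pi * knorm k)) summable_on UNIV"
    proof (rule summable_on_comparison_test[OF summable_on_cmult_right[OF has_sum_imp_summable[OF c]]])
      fix k
      have "norm (c k) * exp (s' * knorm k) * (2 * pi * knorm k) =
          2 * pi * norm (c k) * (knorm k * exp ((s - (s - s')) * knorm k))"
        by (simp add: mult_ac)
      also have "\<dots> \<le> 2 * pi * norm (c k) * (1 / (s - s') * exp (s * knorm k))"
        using s' by (intro mult_left_mono x_exp_neg_le) auto
      finally show "norm (c k) * exp (s' * knorm k) * (2 * pi * knorm k) \<le>
        2 * pi / (s - s') * (norm (c k) * exp (s * knorm k))" by (simp add: mult_ac)
    qed simp
    show "((\<lambda>k. c k * exp (2 * of_real pi * \<i> * kdot k y)) has_sum u y) UNIV" if "y \<in> strip s'" for y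
      using u[of y] that strip_mono[of s' s] s' by (auto simp: em_def)
  qed (use s' open_strip convex_strip in auto)
qed

definition Dd :: "complex ^ 'd \<Rightarrow> (complex ^ 'd::finite \<Rightarrow> complex) \<Rightarrow> complex ^ 'd \<Rightarrow> complex" where
  "Dd w u z = frechet_derivative u (at z) w"

lemma Dd_eqI: "(u has_derivative u') (at z) \<Longrightarrow> Dd w u z = u' w"
  unfolding Dd_def by (metis frechet_derivative_at)

lemma Dd_series:
  assumes c: "((\<lambda>k. norm (c k) * exp (s * knorm k)) has_sum A) UNIV"
    and u: "\<And>z. z \<in> strip s \<Longrightarrow> ((\<lambda>k. c k * em k z) has_sum u z) UNIV"
    and z: "z \<in> strip s"
  shows "Dd w u z = (\<Sum>\<^sub>\<infinity>k. (2 * of_real pi * \<i> * kdot k w) * c k * em k z)"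
  by (rule Dd_eqI[OF has_derivative_strip[OF assms]])

lemma Bs_DdE:
  assumes "Bs s C u"
  obtains c A where "((\<lambda>k. norm (c k) * exp (s * knorm k)) has_sum A) UNIV" "A \<le> C"
    "\<And>z. z \<in> strip s \<Longrightarrow> ((\<lambda>k. c k * em k z) has_sum u z) UNIV"
    "\<And>w z. z \<in> strip s \<Longrightarrow> Dd w u z = (\<Sum>\<^sub>\<infinity>k. (2 * of_real pi * \<i> * kdot k w) * c k * em k z)"
proof -
  obtain c A where c: "((\<lambda>k. norm (c k) * exp (s * knorm k)) has_sum A) UNIV" "A \<le> C"
    "\<And>z. z \<in> strip s \<Longrightarrow> ((\<lambda>k. c k * em k z) has_sum u z) UNIV"
    using assms by (rule wienE) blast
  show thesis by (rule that[OF c]) (auto intro!: Dd_series[OF c(1)] c(3))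
qed

lemma multiplier_Dd:
  assumes "\<And>j. norm (w $ j) \<le> W" "0 < \<sigma>"
  shows "norm (2 * of_real pi * \<i> * kdot k w) * exp ((s - \<sigma>) * knorm k) \<le> 2 * pi * W / \<sigma> * exp (s * knorm k)"
proof -
  have W0: "0 \<le> W" using order_trans[OF norm_ge_zero assms(1)] .
  have "norm (2 * of_real pi * \<i> * kdot k w) * exp ((s - \<sigma>) * knorm k)
      \<le> 2 * pi * (knorm k * W) * exp ((s - \<sigma>) * knorm k)"
    using norm_kdot_le[OF assms(1), of k] by (intro mult_right_mono) (auto simp: norm_mult)
  also have "\<dots> = 2 * pi * W * (knorm k * exp ((s - \<sigma>) * knorm k))" by (simp add: mult_ac)
  also have "\<dots> \<le> 2 * pi * W * (1 / \<sigma> * exp (s * knorm k))"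
    using W0 assms(2) by (intro mult_left_mono x_exp_neg_le) auto
  finally show ?thesis by simp
qed

lemma Bs_Dd:
  assumes "Bs s C u" "0 < \<sigma>" "\<sigma> \<le> s" "\<And>j. norm (w $ j) \<le> W"
  shows "Bs (s - \<sigma>) (2 * pi * W / \<sigma> * C) (Dd w u)"
proof -
  obtain c A where c: "((\<lambda>k. norm (c k) * exp (s * knorm k)) has_sum A) UNIV" "A \<le> C"
    "\<And>z. z \<in> strip s \<Longrightarrow> ((\<lambda>k. c k * em k z) has_sum u z) UNIV"
    "\<And>w z. z \<in> strip s \<Longrightarrow> Dd w u z = (\<Sum>\<^sub>\<infinity>k. (2 * of_real pi * \<i> * kdot k w) * c k * em k z)"
    using assms(1) by (rule Bs_DdE) blast
  have W0: "0 \<le> W" using order_trans[OF norm_ge_zero assms(4)] .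
  have MA: "2 * pi * W / \<sigma> * A \<le> 2 * pi * W / \<sigma> * C"
    using c(2) W0 assms(2) by (intro mult_left_mono) auto
  have "Bs (s - \<sigma>) (2 * pi * W / \<sigma> * C) (\<lambda>z. \<Sum>\<^sub>\<infinity>k. (2 * of_real pi * \<i> * kdot k w) * c k * em k z)"
    by (rule wien_multiplier(1)[OF c(1), where M = "2 * pi * W / \<sigma>"])
      (use multiplier_Dd[OF assms(4,2)] norm_em_strip MA in auto)
  then show ?thesis
    by (rule Bs_cong[rotated]) (use c(4) strip_mono[of "s - \<sigma>" s] assms in auto)
qed

lemma Bs_has_derivative:
  assumes "Bs s C u" "z \<in> strip s"
  shows "(u has_derivative (\<lambda>w. Dd w u z)) (at z)"
proof -
  obtain c A where c: "((\<lambda>k. norm (c k) * exp (s * knorm k)) has_sum A) UNIV" "A \<le> C"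
    "\<And>z. z \<in> strip s \<Longrightarrow> ((\<lambda>k. c k * em k z) has_sum u z) UNIV"
    "\<And>w z. z \<in> strip s \<Longrightarrow> Dd w u z = (\<Sum>\<^sub>\<infinity>k. (2 * of_real pi * \<i> * kdot k w) * c k * em k z)"
    using assms(1) by (rule Bs_DdE) blast
  show ?thesis
    using has_derivative_strip[OF c(1,3) assms(2)] by (simp add: c(4)[OF assms(2)])
qed

lemma kdot_expand: "kdot k w = (\<Sum>j\<in>UNIV. w $ j * kdot k (axis j 1))"
proof -
  have "kdot k (axis j 1) = (\<Sum>i\<in>UNIV. if i = j then of_int (k $ j) else 0)" for j
    unfolding kdot_def by (intro sum.cong) (auto simp: axis_def)
  then show ?thesis by (simp add: kdot_def mult.commute)
qed

lemma has_sum_finite_sum: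
  fixes f :: "'i \<Rightarrow> 'j \<Rightarrow> 'a::topological_comm_monoid_add"
  assumes "finite J" "\<And>j. j \<in> J \<Longrightarrow> ((\<lambda>i. f i j) has_sum a j) I"
  shows "((\<lambda>i. \<Sum>j\<in>J. f i j) has_sum (\<Sum>j\<in>J. a j)) I"
  using assms by (induction J) (auto intro!: has_sum_add)

text \<open>A Frechet derivative is by definition only real linear in the direction. Complex
  linearity comes from the series, where \<open>w\<close> enters through
  \<open>kdot k w\<close>.\<close>

lemma Dd_expand:
  assumes "Bs s C u" "z \<in> strip s"
  shows "Dd w u z = (\<Sum>j\<in>UNIV. w $ j * Dd (axis j 1) u z)"
proof -
  obtain c A where c: "((\<lambda>k. norm (c k) * exp (s * knorm k)) has_sum A) UNIV" "A \<le> C"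
    "\<And>z. z \<in> strip s \<Longrightarrow> ((\<lambda>k. c k * em k z) has_sum u z) UNIV"
    "\<And>w z. z \<in> strip s \<Longrightarrow> Dd w u z = (\<Sum>\<^sub>\<infinity>k. (2 * of_real pi * \<i> * kdot k w) * c k * em k z)"
    using assms(1) by (rule Bs_DdE) blast
  obtain s' where s': "0 < s'" "s' < s" "z \<in> strip s'" using strip_interior[OF assms(2)] .
  have "((\<lambda>k. (2 * of_real pi * \<i> * kdot k (axis j 1)) * c k * em k z) has_sum Dd (axis j 1) u z) UNIV" for j
    unfolding c(4)[OF assms(2)]
    by (rule wien_multiplier(2)[OF c(1), where \<omega>' = "\<lambda>k. exp (s' * knorm k)" and S = "strip s'" and M = "2 * pi * 1 / (s - s')"])
      (use multiplier_Dd[of "axis j 1" 1 "s - s'" _ s] s' norm_em_strip in \<open>auto simp: axis_def norm_em_strip\<close>)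
  then have "((\<lambda>k. \<Sum>j\<in>UNIV. w $ j * ((2 * of_real pi * \<i> * kdot k (axis j 1)) * c k * em k z)) has_sum
      (\<Sum>j\<in>UNIV. w $ j * Dd (axis j 1) u z)) UNIV"
    by (intro has_sum_finite_sum has_sum_cmult_right) auto
  then show ?thesis
    unfolding c(4)[OF assms(2)]
    by (intro infsumI) (simp add: kdot_expand[of _ w] sum_distrib_left sum_distrib_right mult_ac)
qed

text \<open>On the side of the coefficients both orders multiply by the same two factors.\<close>

lemma Dd_commute:
  assumes "Bs s C u" "z \<in> strip s"
  shows "Dd w (Dd w' u) z = Dd w' (Dd w u) z"
proof -
  obtain c A where c: "((\<lambda>k. norm (c k) * exp (s * knorm k)) has_sum A) UNIV" "A \<le> C"
    "\<And>z. z \<in> strip s \<Longrightarrow> ((\<lambda>k. c k * em k z) has_sum u z) UNIV"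
    "\<And>w z. z \<in> strip s \<Longrightarrow> Dd w u z = (\<Sum>\<^sub>\<infinity>k. (2 * of_real pi * \<i> * kdot k w) * c k * em k z)"
    using assms(1) by (rule Bs_DdE) blast
  obtain s' where s': "0 < s'" "s' < s" "z \<in> strip s'" using strip_interior[OF assms(2)] .
  have *: "Dd w (Dd w' u) z = (\<Sum>\<^sub>\<infinity>k. (2 * of_real pi * \<i> * kdot k w) * ((2 * of_real pi * \<i> * kdot k w') * c k) * em k z)" for w w'
  proof (rule Dd_series[OF _ _ s'(3)])
    let ?m = "\<lambda>k. 2 * of_real pi * \<i> * kdot k w'"
    have nw: "norm (w' $ j) \<le> norm w'" for j by (rule Finite_Cartesian_Product.norm_nth_le)
    show "((\<lambda>k. norm (?m k * c k) * exp (s' * knorm k)) has_sum (\<Sum>\<^sub>\<infinity>k. norm (?m k * c k) * exp (s' * knorm k))) UNIV"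
      by (rule has_sum_infsum, rule wien_multiplier(3)[OF c(1), where M = "2 * pi * norm w' / (s - s')" and S = "{}"])
        (use multiplier_Dd[OF nw, of "s - s'" _ s] s' in auto)
    show "((\<lambda>k. ?m k * c k * em k y) has_sum Dd w' u y) UNIV" if "y \<in> strip s'" for y
    proof -
      have y: "y \<in> strip s" using that strip_mono[of s' s] s' by auto
      show ?thesis
        unfolding c(4)[OF y]
        by (rule wien_multiplier(2)[OF c(1), where \<omega>' = "\<lambda>k. exp (s' * knorm k)" and M = "2 * pi * norm w' / (s - s')" and S = "strip s'"])
          (use multiplier_Dd[OF nw, of "s - s'" _ s] s' norm_em_strip that in auto)
    qed
  qed
  show ?thesis unfolding * by (simp add: mult_ac)
qed

definition realon :: "(complex ^ 'd::finite \<Rightarrow> complex) \<Rightarrow> bool" where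
  "realon u \<longleftrightarrow> (\<forall>x. u (cvec x) \<in> \<real>)"

lemma realon_Dd:
  assumes "Bs s C u" "0 < s" "realon u"
  shows "realon (Dd (cvec w) u)"
  unfolding realon_def
proof
  fix x
  have "((\<lambda>t. u (cvec x + t *\<^sub>R cvec w)) has_vector_derivative Dd (cvec w) u (cvec x)) (at 0)"
  proof -
    have "(u has_derivative (\<lambda>w. Dd w u (cvec x))) (at (cvec x + 0 *\<^sub>R cvec w))"
      using Bs_has_derivative[OF assms(1) cvec_in_strip[OF assms(2)]] by simp
    moreover have "((\<lambda>t. cvec x + t *\<^sub>R cvec w) has_derivative (\<lambda>t. t *\<^sub>R cvec w)) (at 0)"
      by (auto intro!: derivative_eq_intros)
    ultimately have "((\<lambda>t. u (cvec x + t *\<^sub>R cvec w)) has_derivative (\<lambda>t. Dd (t *\<^sub>R cvec w) u (cvec x))) (at 0)"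
      by (rule has_derivative_compose[rotated])
    moreover have "Dd (t *\<^sub>R cvec w) u (cvec x) = t *\<^sub>R Dd (cvec w) u (cvec x)" for t
      using linear_scale[OF has_derivative_linear[OF Bs_has_derivative[OF assms(1) cvec_in_strip[OF assms(2)]]]]
      by simp
    ultimately show ?thesis by (simp add: has_vector_derivative_def)
  qed
  from bounded_linear.has_vector_derivative[OF bounded_linear_Im this]
  have "((\<lambda>t. Im (u (cvec x + t *\<^sub>R cvec w))) has_vector_derivative Im (Dd (cvec w) u (cvec x))) (at 0)" .
  moreover have "Im (u (cvec x + t *\<^sub>R cvec w)) = 0" for t
  proof -
    have "cvec x + t *\<^sub>R cvec w = cvec (x + t *\<^sub>R w)"
      by (simp add: cvec_def vec_eq_iff) (simp add: scaleR_conv_of_real)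
    then show ?thesis using assms(3) by (simp add: realon_def complex_is_Real_iff)
  qed
  ultimately have "((\<lambda>t::real. 0::real) has_vector_derivative Im (Dd (cvec w) u (cvec x))) (at 0)" by simp
  then have "Im (Dd (cvec w) u (cvec x)) = 0"
    using vector_derivative_unique_at[OF _ has_vector_derivative_const] by blast
  then show "Dd (cvec w) u (cvec x) \<in> \<real>" by (simp add: complex_is_Real_iff)
qed

lemma trig_sum_real:
  assumes c: "(\<lambda>k. norm (c k)) summable_on UNIV" "\<And>k. c (- k) = cnj (c k)"
  shows "(\<Sum>\<^sub>\<infinity>k. c k * em k (cvec x)) \<in> \<real>"
proof -
  have bij: "bij (uminus :: int ^ 'a \<Rightarrow> _)" by (simp add: bij_uminus)
  have "cnj (\<Sum>\<^sub>\<infinity>k. c k * em k (cvec x)) = (\<Sum>\<^sub>\<infinity>k. c (- k) * em (- k) (cvec x))"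
    by (simp add: infsum_cnj[symmetric] cnj_em_cvec c(2) del: infsum_cnj)
  also have "\<dots> = (\<Sum>\<^sub>\<infinity>k. c k * em k (cvec x))"
    by (rule infsum_reindex_bij_betw[OF bij])
  finally show ?thesis by (simp add: Reals_cnj_iff)
qed

text \<open>The coefficients are divided by \<open>2 * pi * \<i> * kdot k (cvec v)\<close>, and the
  mean is the only obstruction. The Diophantine bound loses \<open>knorm k ^ \<tau>\<close>; the
  inequality \<open>(\<sigma> * knorm k) ^ \<tau> \<le> fact \<tau> * exp (\<sigma> * knorm
  k)\<close> charges this loss to the width of the strip. Real values at real points are tracked
  through the symmetry \<open>c (- k) = cnj (c k)\<close>.\<close>

lemma Bs_cohomological_equation:
  fixes v :: "real ^ 'd::finite"
  assumes "0 < \<gamma>" and dioph: "\<And>k. k \<noteq> 0 \<Longrightarrow> \<gamma> \<le> norm (kdot k (cvec v)) * knorm k ^ \<tau>"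
    and u: "Bs s C u" "realon u" and \<sigma>: "0 < \<sigma>" "\<sigma> < s"
  obtains \<mu> g where "\<bar>\<mu>\<bar> \<le> C" "Bs (s - \<sigma>) (fact \<tau> / (2 * pi * \<gamma> * \<sigma> ^ \<tau>) * C) g" "realon g"
    "\<And>z. z \<in> strip (s - \<sigma>) \<Longrightarrow> Dd (cvec v) g z = u z - of_real \<mu>"
proof -
  let ?M = "fact \<tau> / (2 * pi * \<gamma> * \<sigma> ^ \<tau>)"
  obtain c A where c: "((\<lambda>k. norm (c k) * exp (s * knorm k)) has_sum A) UNIV" "A \<le> C"
    "\<And>z. z \<in> strip s \<Longrightarrow> ((\<lambda>k. c k * em k z) has_sum u z) UNIV"
    using u(1) by (rule wienE) blast
  have cs: "(\<lambda>k. norm (c k)) summable_on UNIV"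
    by (rule summable_on_comparison_test[OF has_sum_imp_summable[OF c(1)]]) (use \<sigma> in \<open>auto simp: mult_le_cancel_left1\<close>)
  have creal: "c (- k) = cnj (c k)" for k
  proof (rule trig_coeff_real[OF cs])
    show "(\<Sum>\<^sub>\<infinity>k. c k * em k (cvec x)) \<in> \<real>" for x
      using infsumI[OF c(3)[OF cvec_in_strip]] \<sigma> u(2) by (simp add: realon_def)
  qed
  \<comment> \<open>The value at \<open>k = 0\<close> normalises the solution to mean zero.\<close>
  define m where "m k = (if k = 0 then 0 else 1 / (2 * of_real pi * \<i> * kdot k (cvec v)))" for k
  have kv: "kdot k (cvec v) \<noteq> 0" if "k \<noteq> 0" for k
    using dioph[OF that] assms(1) by auto
  have m: "norm (m k) * exp ((s - \<sigma>) * knorm k) \<le> ?M * exp (s * knorm k)" for k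
  proof (cases "k = 0")
    case True
    then show ?thesis using assms by (simp add: m_def)
  next
    case False
    have n0: "0 < norm (kdot k (cvec v))" using kv[OF False] by simp
    have "\<gamma> * \<sigma> ^ \<tau> \<le> norm (kdot k (cvec v)) * (\<sigma> * knorm k) ^ \<tau>"
      using mult_right_mono[OF dioph[OF False], of "\<sigma> ^ \<tau>"] \<sigma> by (simp add: power_mult_distrib mult_ac)
    also have "\<dots> \<le> norm (kdot k (cvec v)) * (fact \<tau> * exp (\<sigma> * knorm k))"
      using \<sigma> by (intro mult_left_mono power_le_fact_exp) auto
    finally have "norm (m k) \<le> ?M * exp (\<sigma> * knorm k)"
      using n0 False assms by (simp add: m_def norm_divide norm_mult field_simps)
    then have "norm (m k) * exp ((s - \<sigma>) * knorm k) \<le> ?M * exp (\<sigma> * knorm k) * exp ((s - \<sigma>) * knorm k)"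
      by (intro mult_right_mono) auto
    also have "\<dots> = ?M * exp (s * knorm k)" by (simp add: mult.assoc exp_add[symmetric] algebra_simps)
    finally show ?thesis .
  qed
  define g where "g z = (\<Sum>\<^sub>\<infinity>k. m k * c k * em k z)" for z
  note mult = wien_multiplier[OF c(1), where S = "strip (s - \<sigma>)" and \<omega>' = "\<lambda>k. exp ((s - \<sigma>) * knorm k)"
      and m = m and M = ?M and C = "?M * C", OF norm_em_strip m]
  have MA: "?M * A \<le> ?M * C" using c(2) assms by (intro mult_left_mono) auto
  have gs: "(\<lambda>k. norm (m k * c k) * exp ((s - \<sigma>) * knorm k)) summable_on UNIV"
    using mult(3) MA by auto
  have g: "Bs (s - \<sigma>) (?M * C) g" unfolding g_def[abs_def] using mult(1) MA by auto
  have mc: "m (- k) * c (- k) = cnj (m k * c k)" for k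
  proof -
    have "kdot (- k) (cvec v) = - kdot k (cvec v)" "cnj (kdot k (cvec v)) = kdot k (cvec v)"
      by (auto simp: kdot_def cvec_def sum_negf)
    then show ?thesis by (simp add: m_def creal)
  qed
  have "realon g"
    unfolding realon_def g_def
    by (intro allI trig_sum_real mc, rule summable_on_comparison_test[OF gs])
      (use \<sigma> in \<open>auto simp: mult_le_cancel_left1\<close>)
  moreover have "Dd (cvec v) g z = u z - of_real (Re (c 0))" if z: "z \<in> strip (s - \<sigma>)" for z
  proof -
    have zs: "z \<in> strip s" using z strip_mono[of "s - \<sigma>" s] \<sigma> by auto
    have "Dd (cvec v) g z = (\<Sum>\<^sub>\<infinity>k. (2 * of_real pi * \<i> * kdot k (cvec v)) * (m k * c k) * em k z)"
      by (rule Dd_series[OF has_sum_infsum[OF gs] _ z]) (use mult(2) MA in \<open>auto simp: g_def\<close>)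
    also have "\<dots> = (\<Sum>\<^sub>\<infinity>k. c k * em k z + (if k = 0 then - c 0 else 0))"
      by (intro infsum_cong) (auto simp: m_def kv)
    also have "\<dots> = u z + - c 0"
    proof (rule infsumI, rule has_sum_add[OF c(3)[OF zs]])
      show "((\<lambda>k. if k = 0 then - c 0 else 0) has_sum - c 0) UNIV"
        by (rule has_sum_finite_neutralI[where B = "{0}"]) auto
    qed
    also have "c 0 = of_real (Re (c 0))"
      using creal[of 0] by (simp add: complex_eq_iff)
    finally show ?thesis by simp
  qed
  moreover have "\<bar>Re (c 0)\<bar> \<le> C"
  proof -
    have "\<bar>Re (c 0)\<bar> \<le> norm (c 0)" by (rule abs_Re_le_cmod)
    also have "\<dots> \<le> A"
      using finite_sum_le_has_sum[OF c(1), of "{0}"] by simp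
    finally show ?thesis using c(2) by simp
  qed
  ultimately show thesis using that g by blast
qed

text \<open>A mode of the displaced point is the exponential of a linear combination of the
  \<open>h j\<close>. The bound is exponentially large in \<open>R * knorm k\<close>; it establishes
  membership in the algebra, and effective bounds then follow from the supremum by
  \<open>Bs_from_sup\<close>.\<close>

lemma Bs_em_comp:
  assumes "0 \<le> s" "\<And>j. Bs s R (h j)"
  shows "Bs s (exp (s * knorm k) * exp (2 * pi * R * knorm k)) (\<lambda>z. em k (z + (\<chi> j. h j z)))"
proof -
  have "Bs s (\<Sum>j\<in>UNIV. norm (2 * of_real pi * \<i> * of_int (k $ j)) * R) (\<lambda>z. \<Sum>j\<in>UNIV. 2 * of_real pi * \<i> * of_int (k $ j) * h j z)"
    using assms by (intro Bs_sum Bs_cmult) auto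
  moreover have "(\<Sum>j\<in>UNIV. norm (2 * of_real pi * \<i> * of_int (k $ j)) * R) = 2 * pi * R * knorm k"
    by (simp add: norm_mult knorm_def sum_distrib_left mult_ac)
  ultimately have "Bs s (exp (2 * pi * R * knorm k)) (\<lambda>z. exp (\<Sum>j\<in>UNIV. 2 * of_real pi * \<i> * of_int (k $ j) * h j z))"
    using assms(1) by (intro Bs_exp) auto
  then have "Bs s (exp (2 * pi * R * knorm k)) (\<lambda>z. em k (\<chi> j. h j z))"
    by (simp add: em_def kdot_def sum_distrib_left mult_ac)
  then show ?thesis
    using Bs_mult[OF assms(1) Bs_em[OF assms(1), of 1 k]] by (simp add: em_add_right)
qed

lemma has_sum_Reals:
  assumes "(f has_sum a) I" "\<And>i. i \<in> I \<Longrightarrow> f i \<in> \<real>"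
  shows "a \<in> (\<real> :: complex set)"
proof -
  have "((\<lambda>i. Im (f i)) has_sum Im a) I" by (rule has_sum_Im[OF assms(1)])
  moreover have "((\<lambda>i. Im (f i)) has_sum 0) I"
    by (rule has_sum_0) (use assms(2) in \<open>auto simp: complex_is_Real_iff\<close>)
  ultimately show ?thesis by (simp add: complex_is_Real_iff has_sum_unique)
qed

text \<open>\<open>1 + K\<close> is the Neumann series of the inverse of \<open>1 + D\<close>, and
  \<open>K\<close> is its part beyond the identity. With \<open>q = CARD('d) * \<theta>\<close> that
  part sums to at most \<open>q / (1 - q) \<le> 2 * q\<close>, so \<open>K\<close> is small together
  with \<open>D\<close>.\<close>

lemma Bs_neumann_inverse:
  fixes D :: "'d::finite \<Rightarrow> 'd \<Rightarrow> complex ^ 'd \<Rightarrow> complex"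
  assumes s: "0 < s" and D: "\<And>i j. Bs s \<theta> (D i j)" "\<And>i j. realon (D i j)" and \<theta>: "real CARD('d) * \<theta> \<le> 1 / 2"
  obtains K where "\<And>i j. Bs s (2 * (real CARD('d) * \<theta>)) (K i j)" "\<And>i j. realon (K i j)"
    "\<And>i j z. z \<in> strip s \<Longrightarrow> (\<Sum>l\<in>UNIV. (of_bool (i = l) + D i l z) * (of_bool (l = j) + K l j z)) = of_bool (i = j)"
proof -
  define q where "q = real CARD('d) * \<theta>"
  have \<theta>0: "0 \<le> \<theta>" using Bs_nonneg[OF _ D(1)] s by simp
  have q: "0 \<le> q" "q \<le> 1 / 2" using \<theta> \<theta>0 by (auto simp: q_def)
  \<comment> \<open>The matrix powers of \<open>- D\<close>.\<close>
  define P :: "nat \<Rightarrow> 'd \<Rightarrow> 'd \<Rightarrow> complex ^ 'd \<Rightarrow> complex" where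
    "P = rec_nat (\<lambda>i j z. of_bool (i = j)) (\<lambda>n Pn i j z. - (\<Sum>l\<in>UNIV. D i l z * Pn l j z))"
  have P0: "P 0 i j z = of_bool (i = j)" and PS: "P (Suc n) i j z = - (\<Sum>l\<in>UNIV. D i l z * P n l j z)" for n i j z
    by (simp_all add: P_def)
  have BP: "Bs s (q ^ n) (P n i j)" for n i j
  proof (induction n arbitrary: i j)
    case 0
    have "P 0 i j = (\<lambda>z. of_bool (i = j))" by (simp add: fun_eq_iff P0)
    then show ?case using s by (auto intro!: Bs_const)
  next
    case (Suc n)
    have "Bs s (\<Sum>l\<in>(UNIV::'d set). \<theta> * q ^ n) (\<lambda>z. \<Sum>l\<in>UNIV. D i l z * P n l j z)"
      using s by (intro Bs_sum Bs_mult D Suc) auto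
    then have "Bs s (q ^ Suc n) (\<lambda>z. - (\<Sum>l\<in>UNIV. D i l z * P n l j z))"
      using s by (intro Bs_uminus) (auto simp: q_def mult_ac)
    moreover have "P (Suc n) i j = (\<lambda>z. - (\<Sum>l\<in>UNIV. D i l z * P n l j z))" by (simp add: fun_eq_iff PS)
    ultimately show ?case by simp
  qed
  have RP: "realon (P n i j)" for n i j
    by (induction n arbitrary: i j)
      (use D(2) in \<open>auto simp: realon_def P0 PS of_bool_def intro!: Reals_minus sum_in_Reals Reals_mult\<close>)
  have geo: "((\<lambda>n. q ^ n) has_sum 1 / (1 - q)) UNIV"
    using q geometric_sums[of q] by (intro norm_summable_imp_has_sum) (auto simp: norm_power)
  have geo': "((\<lambda>n. q ^ Suc n) has_sum q * (1 / (1 - q))) UNIV"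
    using has_sum_cmult_right[OF geo, of q] by simp
  define K where "K i j z = (\<Sum>\<^sub>\<infinity>n. P (Suc n) i j z)" for i j z
  have sK: "((\<lambda>n. P (Suc n) i j z) has_sum K i j z) UNIV" if "z \<in> strip s" for i j z
    unfolding K_def using norm_sum_le_weighted(1)[OF geo'] Bs_bound[OF _ BP that] s by (metis less_imp_le)
  have "q * (1 / (1 - q)) \<le> q * 2" using q by (intro mult_left_mono) (auto simp: field_simps)
  moreover have "Bs s (q * (1 / (1 - q))) (K i j)" for i j
    by (rule Bs_series[OF _ BP geo' sK]) (use s in auto)
  ultimately have BK: "Bs s (2 * q) (K i j)" for i j
    using s by (metis Bs_mono less_imp_le mult.commute)
  have RK: "realon (K i j)" for i j
    unfolding realon_def using has_sum_Reals[OF sK[OF cvec_in_strip[OF s]]] RP by (auto simp: realon_def)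
  have "(\<Sum>l\<in>UNIV. (of_bool (i = l) + D i l z) * (of_bool (l = j) + K l j z)) = of_bool (i = j)"
    if z: "z \<in> strip s" for i j z
  proof -
    have full: "((\<lambda>n. P n l j z) has_sum of_bool (l = j) + K l j z) UNIV" for l
    proof -
      have "((\<lambda>n. P n l j z) has_sum K l j z) (range Suc)"
        using sK[OF z] has_sum_reindex[of Suc UNIV "\<lambda>n. P n l j z"] by (simp add: o_def)
      then have "((\<lambda>n. P n l j z) has_sum P 0 l j z + K l j z) (insert 0 (range Suc))"
        by (intro has_sum_insert) auto
      moreover have "insert 0 (range Suc) = UNIV" using not0_implies_Suc by auto
      ultimately show ?thesis by (simp add: P0)
    qed
    have "((\<lambda>n. \<Sum>l\<in>UNIV. D i l z * P n l j z) has_sum (\<Sum>l\<in>UNIV. D i l z * (of_bool (l = j) + K l j z))) UNIV"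
      by (intro has_sum_finite_sum has_sum_cmult_right full) auto
    then have "((\<lambda>n. P (Suc n) i j z) has_sum - (\<Sum>l\<in>UNIV. D i l z * (of_bool (l = j) + K l j z))) UNIV"
      unfolding PS by (rule has_sum_uminusI)
    then have "K i j z = - (\<Sum>l\<in>UNIV. D i l z * (of_bool (l = j) + K l j z))"
      using has_sum_unique[OF sK[OF z]] by blast
    moreover have "(\<Sum>l\<in>UNIV. of_bool (i = l) * (of_bool (l = j) + K l j z)) = of_bool (i = j) + K i j z"
      by (simp add: of_bool_def if_distrib[of "\<lambda>x. x * _"] cong: if_cong)
    ultimately show ?thesis by (simp add: ring_distribs(2) sum.distrib)
  qed
  then show thesis using that[of K] BK RK by (simp add: q_def)
qed

section \<open>The Newton step\<close>

text \<open>The two unknowns are the components along \<open>v\<close> and orthogonal to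
  \<open>v\<close> of one vector \<open>X\<close>, and the equations read
  \<open>X + M X = - \<nu>\<close>. As \<open>M\<close> has norm at most 1/2, the left side is
  injective in \<open>X\<close>, hence surjective in finite dimension, and \<open>X\<close> is at
  most twice as long as \<nu>.\<close>

lemma counterterm_system:
  fixes v \<nu> :: "real ^ 'd::finite" and \<mu> :: "'d \<Rightarrow> 'd \<Rightarrow> real"
  assumes v: "v \<noteq> 0" and \<mu>: "\<And>i j. \<bar>\<mu> i j\<bar> \<le> q" and q: "real CARD('d) * (real CARD('d) * q) \<le> 1 / 2"
  obtains \<alpha> \<omega> where "\<omega> \<bullet> v = 0" "\<bar>\<alpha>\<bar> * norm v \<le> 2 * norm \<nu>" "norm \<omega> \<le> 2 * norm \<nu>"
    "\<And>i. \<alpha> * v $ i + \<omega> $ i + (\<Sum>j\<in>UNIV. \<mu> i j * \<omega> $ j) = - \<nu> $ i"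
proof -
  define a where "a X = X \<bullet> v / (v \<bullet> v)" for X :: "real ^ 'd"
  define e where "e X = X - a X *\<^sub>R v" for X :: "real ^ 'd"
  define M where "M X = (\<chi> i. \<Sum>j\<in>UNIV. \<mu> i j * e X $ j)" for X :: "real ^ 'd"
  have vv: "v \<bullet> v > 0" using v by simp
  have ev: "e X \<bullet> v = 0" for X using vv by (simp add: e_def a_def inner_diff_left)
  have split: "X = e X + a X *\<^sub>R v" for X by (simp add: e_def)
  have nrm: "(norm X)\<^sup>2 = (norm (e X))\<^sup>2 + (norm (a X *\<^sub>R v))\<^sup>2" for X
  proof -
    have "orthogonal (e X) (a X *\<^sub>R v)" using ev by (simp add: orthogonal_def)
    from norm_add_Pythagorean[OF this] show ?thesis using split[of X] by simp
  qed
  have ne: "norm (e X) \<le> norm X" for X by (rule power2_le_imp_le) (simp_all add: nrm[of X])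
  have na: "norm (a X *\<^sub>R v) \<le> norm X" for X by (rule power2_le_imp_le) (simp_all add: nrm[of X])
  have nM: "norm (M X) \<le> norm X / 2" for X
  proof -
    have q0: "0 \<le> q" using \<mu> abs_ge_zero order_trans by blast
    have "norm (M X) \<le> (\<Sum>i\<in>UNIV. \<bar>M X $ i\<bar>)" by (rule norm_le_l1_cart)
    also have "\<dots> \<le> (\<Sum>i\<in>(UNIV::'d set). \<Sum>j\<in>(UNIV::'d set). q * norm X)"
    proof (rule sum_mono)
      fix i
      have "\<bar>M X $ i\<bar> \<le> (\<Sum>j\<in>UNIV. \<bar>\<mu> i j * e X $ j\<bar>)" by (simp add: M_def sum_abs)
      also have "\<dots> \<le> (\<Sum>j\<in>(UNIV::'d set). q * norm X)"
        using \<mu> order_trans[OF component_le_norm_cart ne] q0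
        by (intro sum_mono) (auto simp: abs_mult intro!: mult_mono)
      finally show "\<bar>M X $ i\<bar> \<le> (\<Sum>j\<in>(UNIV::'d set). q * norm X)" .
    qed
    also have "\<dots> = real CARD('d) * (real CARD('d) * q) * norm X" by simp
    also have "\<dots> \<le> 1 / 2 * norm X" using q by (intro mult_right_mono) auto
    finally show ?thesis by simp
  qed
  have linM: "linear M"
    by (rule linearI) (auto simp: M_def e_def a_def vec_eq_iff inner_add_left algebra_simps add_divide_distrib
        sum.distrib sum_subtractf sum_distrib_left)
  define L where "L X = X + M X" for X
  have linL: "linear L" unfolding L_def[abs_def] by (intro linear_compose_add linear_ident linM)
  have low: "norm X \<le> 2 * norm (L X)" for X
    using nM[of X] norm_triangle_ineq2[of X "- M X"] by (simp add: L_def)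
  have "inj L"
    unfolding linear_injective_0[OF linL] using low by (metis mult_zero_right norm_le_zero_iff norm_zero)
  then have "surj L" by (rule linear_inj_imp_surj[OF linL])
  then obtain X where X: "L X = - \<nu>" by (metis surjD)
  have nX: "norm X \<le> 2 * norm \<nu>" using low[of X] X by simp
  show thesis
  proof (rule that[of "e X" "a X"])
    show "\<bar>a X\<bar> * norm v \<le> 2 * norm \<nu>" using na[of X] nX by simp
    show "norm (e X) \<le> 2 * norm \<nu>" using ne[of X] nX by simp
    show "a X * v $ i + e X $ i + (\<Sum>j\<in>UNIV. \<mu> i j * e X $ j) = - \<nu> $ i" for i
    proof -
      have "a X * v $ i + e X $ i = X $ i" by (simp add: e_def)
      moreover have "X $ i + M X $ i = - \<nu> $ i" using arg_cong[OF X, of "\<lambda>x. x $ i"] by (simp add: L_def)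
      ultimately show ?thesis by (simp add: M_def)
    qed
  qed (rule ev)
qed

lemma norm_exp_minus_affine: "norm y \<le> 1 \<Longrightarrow> norm (exp y - 1 - y) \<le> exp 1 * (norm y)\<^sup>2" for y :: complex
proof -
  assume y: "norm y \<le> 1"
  have "norm (exp y - 1 - y) \<le> exp (norm y) * (norm y)\<^sup>2"
    using Taylor_exp_field[of y 1] by (simp add: power2_eq_square algebra_simps)
  also have "\<dots> \<le> exp 1 * (norm y)\<^sup>2" using y by (intro mult_right_mono) auto
  finally show ?thesis .
qed

text \<open>The real displacement \<open>h\<close> may be large compared with the width of the strip: only its gradient
  matters for the imaginary part of \<open>z + h(z)\<close>.\<close>

lemma strip_displacement:
  fixes h :: "'d::finite \<Rightarrow> complex ^ 'd \<Rightarrow> complex"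
  assumes s: "0 < s" and h: "\<And>j. Bs s R (h j)" "\<And>j. realon (h j)"
    and Dh: "\<And>i j. Bs s \<theta> (Dd (axis j 1) (h i))" and \<theta>: "real CARD('d) * \<theta> \<le> 1" and z: "z \<in> strip s"
  shows "2 * pi * \<bar>Im ((z + (\<chi> j. h j z)) $ i)\<bar> \<le> 2 * s"
proof -
  define x :: "real ^ 'd" where "x = (\<chi> j. Re (z $ j))"
  \<comment> \<open>The displacement is real at the real point below \<open>z\<close>, so its
    imaginary part at \<open>z\<close> is at most its increment along the purely imaginary vector
    \<open>y\<close>, which the gradient bound controls.\<close>
  define y where "y = z - cvec x"
  have yj: "y $ j = \<i> * of_real (Im (z $ j))" for j
    by (simp add: y_def x_def cvec_def complex_eq_iff)
  have xs: "cvec x \<in> strip s" using s by (rule cvec_in_strip)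
  have seg: "cvec x + t *\<^sub>R y \<in> strip s" if "0 \<le> t" "t \<le> 1" for t
  proof -
    have "cvec x + t *\<^sub>R y = (1 - t) *\<^sub>R cvec x + t *\<^sub>R z" by (simp add: y_def algebra_simps)
    then show ?thesis using convexD_alt[OF convex_strip xs z that] by simp
  qed
  have der: "((\<lambda>t. h i (cvec x + t *\<^sub>R y)) has_derivative (\<lambda>r. Dd (r *\<^sub>R y) (h i) (cvec x + t *\<^sub>R y))) (at t)"
    if "0 \<le> t" "t \<le> 1" for t
  proof -
    have "((\<lambda>t. cvec x + t *\<^sub>R y) has_derivative (\<lambda>t. t *\<^sub>R y)) (at t)"
      by (auto intro!: derivative_eq_intros)
    then show ?thesis
      using has_derivative_compose[of "\<lambda>t. cvec x + t *\<^sub>R y" _ t UNIV "h i"] Bs_has_derivative[OF h(1) seg[OF that]] by blast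
  qed
  have "\<exists>t\<in>{0<..<1}. norm (h i (cvec x + 1 *\<^sub>R y) - h i (cvec x + 0 *\<^sub>R y)) \<le> norm (Dd ((1 - 0) *\<^sub>R y) (h i) (cvec x + t *\<^sub>R y))"
    by (rule mvt_general) (use der in \<open>auto intro!: continuous_at_imp_continuous_on has_derivative_continuous\<close>)
  then obtain t where t: "0 < t" "t < 1" "norm (h i z - h i (cvec x)) \<le> norm (Dd y (h i) (cvec x + t *\<^sub>R y))"
    by (auto simp: y_def)
  have "norm (Dd y (h i) (cvec x + t *\<^sub>R y)) \<le> (\<Sum>j\<in>UNIV. norm (y $ j * Dd (axis j 1) (h i) (cvec x + t *\<^sub>R y)))"
    using Dd_expand[OF h(1) seg, of t y i] t by (simp add: norm_sum)
  also have "\<dots> \<le> (\<Sum>j\<in>(UNIV :: 'd set). s / (2 * pi) * \<theta>)"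
  proof (rule sum_mono)
    fix j
    have "norm (y $ j) \<le> s / (2 * pi)" using z by (simp add: yj norm_mult strip_def field_simps less_imp_le)
    moreover have "norm (Dd (axis j 1) (h i) (cvec x + t *\<^sub>R y)) \<le> \<theta>"
      using Bs_bound[OF _ Dh seg] s t by auto
    ultimately show "norm (y $ j * Dd (axis j 1) (h i) (cvec x + t *\<^sub>R y)) \<le> s / (2 * pi) * \<theta>"
      using s unfolding norm_mult by (intro mult_mono) auto
  qed
  also have "\<dots> = real CARD('d) * \<theta> * (s / (2 * pi))" by simp
  also have "\<dots> \<le> 1 * (s / (2 * pi))" using \<theta> s by (intro mult_right_mono) auto
  finally have "norm (h i z - h i (cvec x)) \<le> s / (2 * pi)" using t(3) by simp
  moreover have "Im (h i (cvec x)) = 0" using h(2)[of i] by (simp add: realon_def complex_is_Real_iff)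
  ultimately have "\<bar>Im (h i z)\<bar> \<le> s / (2 * pi)"
    using abs_Im_le_cmod[of "h i z - h i (cvec x)"] by simp
  moreover have "\<bar>Im (z $ i)\<bar> \<le> s / (2 * pi)" using z by (simp add: strip_def field_simps less_imp_le)
  ultimately have "\<bar>Im ((z + (\<chi> j. h j z)) $ i)\<bar> \<le> 2 * s / (2 * pi)"
    by simp
  then show ?thesis by (simp add: field_simps)
qed

definition trigp :: "(int ^ 'd::finite) set \<Rightarrow> ('d \<Rightarrow> int ^ 'd \<Rightarrow> complex) \<Rightarrow> 'd \<Rightarrow> complex ^ 'd \<Rightarrow> complex" where
  "trigp F a i z = (\<Sum>k\<in>F. a i k * em k z)"

definition disp :: "('d \<Rightarrow> complex ^ 'd \<Rightarrow> complex) \<Rightarrow> complex ^ 'd \<Rightarrow> complex ^ 'd::finite" where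
  "disp h z = z + (\<chi> j. h j z)"

text \<open>The residual of the conjugacy equation
  \<open>b (v + \<partial>\<^sub>v h) + w = V (x + h x)\<close> for the vector field
  \<open>V = v + trigp F a\<close>, continued to complex points.\<close>

definition defect :: "real ^ 'd::finite \<Rightarrow> (int ^ 'd) set \<Rightarrow> ('d \<Rightarrow> int ^ 'd \<Rightarrow> complex) \<Rightarrow>
  ('d \<Rightarrow> complex ^ 'd \<Rightarrow> complex) \<Rightarrow> real \<Rightarrow> real ^ 'd \<Rightarrow> 'd \<Rightarrow> complex ^ 'd \<Rightarrow> complex" where
  "defect v F a h b w i z = of_real b * (of_real (v $ i) + Dd (cvec v) (h i) z) + of_real (w $ i) - of_real (v $ i)
     - trigp F a i (disp h z)"

lemma em_disp: "em k (disp h z) = exp (2 * of_real pi * \<i> * (\<Sum>m\<in>UNIV. of_int (k $ m) * (z $ m + h m z)))"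
  by (simp add: em_def disp_def kdot_def)

lemma disp_cvec:
  assumes "\<And>j. realon (h j)"
  obtains y where "disp h (cvec x) = cvec y"
proof
  show "disp h (cvec x) = cvec (\<chi> j. x $ j + Re (h j (cvec x)))"
    using assms by (simp add: disp_def cvec_def vec_eq_iff realon_def complex_is_Real_iff complex_eq_iff)
qed

lemma Bs_trigp_disp:
  assumes "0 \<le> s" "finite F" "\<And>j. Bs s R (h j)"
  shows "\<exists>C. Bs s C (\<lambda>z. trigp F a i (disp h z))"
proof -
  have "Bs s (\<Sum>k\<in>F. norm (a i k) * (exp (s * knorm k) * exp (2 * pi * R * knorm k))) (\<lambda>z. \<Sum>k\<in>F. a i k * em k (disp h z))"
    unfolding disp_def by (intro Bs_sum Bs_cmult Bs_em_comp assms)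
  then show ?thesis unfolding trigp_def by blast
qed

lemma norm_em_disp:
  assumes "0 < s" "\<And>j. Bs s R (h j)" "\<And>j. realon (h j)" "\<And>i j. Bs s \<theta> (Dd (axis j 1) (h i))"
    "real CARD('d) * \<theta> \<le> 1" "z \<in> strip s"
  shows "norm (em k (disp h z :: complex ^ 'd::finite)) \<le> exp (2 * s * knorm k)"
  unfolding disp_def
  by (rule norm_em_le, rule strip_displacement[where \<theta> = \<theta> and R = R]) (use assms in auto)

lemma realon_defect:
  assumes "0 < s" "\<And>j. Bs s R (h j)" "\<And>j. realon (h j)" "realon (trigp F a i)"
  shows "realon (defect v F a h b w i)"
  unfolding realon_def
proof
  fix x
  obtain y where y: "disp h (cvec x) = cvec y" using assms(3) by (rule disp_cvec)
  have "realon (Dd (cvec v) (h i))" using assms(2)[of i] assms(1) assms(3)[of i] by (rule realon_Dd)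
  then have "Dd (cvec v) (h i) (cvec x) \<in> \<real>" by (simp add: realon_def)
  moreover have "trigp F a i (cvec y) \<in> \<real>" using assms(4) by (simp add: realon_def)
  ultimately show "defect v F a h b w i (cvec x) \<in> \<real>"
    unfolding defect_def y by (intro Reals_diff Reals_add Reals_mult Reals_of_real)
qed

definition remainder :: "(int ^ 'd::finite) set \<Rightarrow> ('d \<Rightarrow> int ^ 'd \<Rightarrow> complex) \<Rightarrow> ('d \<Rightarrow> complex ^ 'd \<Rightarrow> complex) \<Rightarrow>
    ('d \<Rightarrow> complex ^ 'd \<Rightarrow> complex) \<Rightarrow> 'd \<Rightarrow> complex ^ 'd \<Rightarrow> complex" where
  "remainder F a h \<delta> i z = (\<Sum>k\<in>F. a i k * em k (disp h z) *
     (exp (2 * of_real pi * \<i> * kdot k (\<chi> j. \<delta> j z)) - 1 - 2 * of_real pi * \<i> * kdot k (\<chi> j. \<delta> j z)))"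

text \<open>For \<open>s * knorm k \<le> 1\<close> a displaced mode is at most \<open>exp 2\<close>,
  and the increment of its exponent is at most 1, so that Taylor's formula for \<open>exp\<close>
  contributes \<open>exp 1\<close>. The weights \<open>(knorm k)\<^sup>2\<close> produced by
  squaring the increment are absorbed by the bound on the coefficients.\<close>

lemma norm_remainder_le:
  fixes h :: "'d::finite \<Rightarrow> complex ^ 'd \<Rightarrow> complex"
  assumes "0 < s" "\<And>j. Bs s R (h j)" "\<And>j. realon (h j)" "\<And>i j. Bs s \<theta> (Dd (axis j 1) (h i))"
    "real CARD('d) * \<theta> \<le> 1" and z: "z \<in> strip s"
    and F: "\<And>k. k \<in> F \<Longrightarrow> s * knorm k \<le> 1" and a: "(\<Sum>k\<in>F. norm (a i k) * (knorm k)\<^sup>2) \<le> 1"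
    and \<delta>: "\<And>j. norm (\<delta> j z) \<le> D" "2 * pi * D \<le> s"
  shows "norm (remainder F a h \<delta> i z) \<le> exp 3 * (2 * pi)\<^sup>2 * D\<^sup>2"
proof -
  have D0: "0 \<le> D" using \<delta>(1) norm_ge_zero order_trans by blast
  have "norm (remainder F a h \<delta> i z) \<le> (\<Sum>k\<in>F. (exp 3 * (2 * pi)\<^sup>2 * D\<^sup>2) * (norm (a i k) * (knorm k)\<^sup>2))"
    unfolding remainder_def
  proof (rule sum_norm_le)
    fix k assume k: "k \<in> F"
    let ?y = "2 * of_real pi * \<i> * kdot k (\<chi> j. \<delta> j z)"
    have y: "norm ?y \<le> 2 * pi * D * knorm k"
      using norm_kdot_le[of "\<chi> j. \<delta> j z" D k] \<delta>(1) by (simp add: norm_mult mult_ac)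
    also have "\<dots> \<le> s * knorm k" using \<delta>(2) by (intro mult_right_mono) auto
    also have "\<dots> \<le> 1" by (rule F[OF k])
    finally have "norm (exp ?y - 1 - ?y) \<le> exp 1 * (norm ?y)\<^sup>2" by (rule norm_exp_minus_affine)
    also have "\<dots> \<le> exp 1 * (2 * pi * D * knorm k)\<^sup>2" using y by (intro mult_left_mono power_mono) auto
    finally have e: "norm (exp ?y - 1 - ?y) \<le> exp 1 * (2 * pi * D * knorm k)\<^sup>2" .
    have "norm (em k (disp h z)) \<le> exp (2 * s * knorm k)" by (rule norm_em_disp) fact+
    also have "\<dots> \<le> exp 2" using F[OF k] by simp
    finally have "norm (a i k * em k (disp h z) * (exp ?y - 1 - ?y)) \<le> norm (a i k) * exp 2 * (exp 1 * (2 * pi * D * knorm k)\<^sup>2)"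
      unfolding norm_mult[of _ "exp ?y - 1 - ?y"] norm_mult[of "a i k"] using e by (intro mult_mono mult_nonneg_nonneg) auto
    also have "\<dots> = (exp 2 * exp 1) * ((2 * pi)\<^sup>2 * D\<^sup>2 * (norm (a i k) * (knorm k)\<^sup>2))"
      by (simp add: power_mult_distrib)
    also have "exp 2 * exp 1 = (exp 3 :: real)" by (simp add: exp_add[symmetric])
    finally show "norm (a i k * em k (disp h z) * (exp ?y - 1 - ?y)) \<le> (exp 3 * (2 * pi)\<^sup>2 * D\<^sup>2) * (norm (a i k) * (knorm k)\<^sup>2)"
      by (simp add: mult_ac)
  qed
  also have "\<dots> = exp 3 * (2 * pi)\<^sup>2 * D\<^sup>2 * (\<Sum>k\<in>F. norm (a i k) * (knorm k)\<^sup>2)" by (simp add: sum_distrib_left)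
  also have "\<dots> \<le> exp 3 * (2 * pi)\<^sup>2 * D\<^sup>2 * 1" using a by (intro mult_left_mono) auto
  finally show ?thesis by simp
qed

lemma remainder_eq:
  "remainder F a h \<delta> i z = trigp F a i (disp (\<lambda>j z. h j z + \<delta> j z) z) - trigp F a i (disp h z)
    - (\<Sum>k\<in>F. a i k * em k (disp h z) * (2 * of_real pi * \<i> * kdot k (\<chi> j. \<delta> j z)))"
proof -
  have "disp (\<lambda>j z. h j z + \<delta> j z) z = disp h z + (\<chi> j. \<delta> j z)"
    by (simp add: disp_def vec_eq_iff)
  then show ?thesis
    by (simp add: remainder_def trigp_def em_add_right em_def[of _ "\<chi> j. \<delta> j z"] sum_subtractf[symmetric] algebra_simps)
qed

lemma Dd_defect:
  fixes h :: "'d::finite \<Rightarrow> complex ^ 'd \<Rightarrow> complex"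
  assumes h: "\<And>j. Bs s R (h j)" and z: "z \<in> strip s"
  shows "Dd u (defect v F a h b w i) z = of_real b * Dd u (Dd (cvec v) (h i)) z -
    (\<Sum>k\<in>F. a i k * em k (disp h z) * (2 * of_real pi * \<i> * (\<Sum>m\<in>UNIV. of_int (k $ m) * (u $ m + Dd u (h m) z))))"
proof -
  obtain s' where s': "0 < s'" "s' < s" "z \<in> strip s'" using strip_interior[OF z] .
  have "Bs (s - (s - s')) (2 * pi * norm (cvec v) / (s - s') * R) (Dd (cvec v) (h i))"
    by (rule Bs_Dd[OF h]) (use s' Finite_Cartesian_Product.norm_nth_le in auto)
  then have Dv: "(Dd (cvec v) (h i) has_derivative (\<lambda>u. Dd u (Dd (cvec v) (h i)) z)) (at z)"
    by (rule Bs_has_derivative) (use s' in auto)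
  have hm: "(h m has_derivative (\<lambda>u. Dd u (h m) z)) (at z)" for m
    by (rule Bs_has_derivative[OF h z])
  have nth: "((\<lambda>z. z $ m) has_derivative (\<lambda>u. u $ m)) (at z)" for m
    by (rule bounded_linear_imp_has_derivative[OF bounded_linear_vec_nth])
  have ex: "((\<lambda>z. exp (f z)) has_derivative (\<lambda>u. exp (f z) * f' u)) (at z)" if "(f has_derivative f') (at z)"
    for f :: "complex ^ 'd \<Rightarrow> complex" and f'
    using has_derivative_compose[OF that, of exp "(*) (exp (f z))"] DERIV_exp[of "f z"] by (simp add: has_field_derivative_def)
  have emd: "((\<lambda>z. em k (disp h z)) has_derivative (\<lambda>u. em k (disp h z) *
      (2 * of_real pi * \<i> * (\<Sum>m\<in>UNIV. of_int (k $ m) * (u $ m + Dd u (h m) z))))) (at z)" for k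
    unfolding em_disp
    by (rule ex) (intro has_derivative_mult_right has_derivative_sum has_derivative_add nth hm)
  have "(defect v F a h b w i has_derivative (\<lambda>u. of_real b * (0 + Dd u (Dd (cvec v) (h i)) z) + 0 - 0 -
     (\<Sum>k\<in>F. a i k * (em k (disp h z) *
      (2 * of_real pi * \<i> * (\<Sum>m\<in>UNIV. of_int (k $ m) * (u $ m + Dd u (h m) z))))))) (at z)"
    unfolding defect_def[abs_def] trigp_def
    by (intro has_derivative_diff has_derivative_add has_derivative_mult_right has_derivative_sum has_derivative_const emd Dv)
  from Dd_eqI[OF this, of u] show ?thesis by (simp add: mult.assoc)
qed

text \<open>If \<open>K\<close> inverts \<open>1 + Dh\<close> and \<open>b \<partial>\<^sub>v g + \<alpha> v + K \<omega> = - K E\<close>, then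
  \<open>\<delta> = (1 + Dh) g\<close> solves the linearised equation up to the term \<open>DE g\<close>, because differentiating
  the equation shows that \<open>1 + Dh\<close> conjugates the linearised operator to \<open>b \<partial>\<^sub>v\<close> modulo \<open>DE\<close>.\<close>

lemma newton_identity:
  fixes h g :: "'d::finite \<Rightarrow> complex ^ 'd \<Rightarrow> complex"
  assumes h: "\<And>j. Bs s R (h j)" and g: "\<And>j. Bs s R' (g j)" and Dh: "\<And>i j. Bs s \<theta> (Dd (axis j 1) (h i))"
    and z: "z \<in> strip s"
    and K: "\<And>i j. (\<Sum>l\<in>UNIV. (of_bool (i = l) + Dd (axis l 1) (h i) z) * (of_bool (l = j) + K l j)) = of_bool (i = j)"
    and gE: "\<And>i. of_real b * Dd (cvec v) (g i) z = - (\<Sum>l\<in>UNIV. (of_bool (i = l) + K i l) * (defect v F a h b w l z + of_real (\<omega> $ l)))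
       - of_real (\<alpha> * v $ i)"
    and \<delta>: "\<delta> = (\<lambda>i z. g i z + (\<Sum>j\<in>UNIV. Dd (axis j 1) (h i) z * g j z))"
  shows "defect v F a (\<lambda>j z. h j z + \<delta> j z) (b + \<alpha>) (w + \<omega>) i z =
    (\<Sum>j\<in>UNIV. Dd (axis j 1) (defect v F a h b w i) z * g j z) + of_real \<alpha> * Dd (cvec v) (\<delta> i) z - remainder F a h \<delta> i z"
proof -
  let ?v = "cvec v" and ?E = "\<lambda>i. defect v F a h b w i z" and ?c = "2 * of_real pi * \<i> :: complex"
  have hd: "(h i has_derivative (\<lambda>u. Dd u (h i) z)) (at z)" for i by (rule Bs_has_derivative[OF h z])
  have gd: "(g i has_derivative (\<lambda>u. Dd u (g i) z)) (at z)" for i by (rule Bs_has_derivative[OF g z])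
  have Dhd: "(Dd (axis j 1) (h i) has_derivative (\<lambda>u. Dd u (Dd (axis j 1) (h i)) z)) (at z)" for i j
    by (rule Bs_has_derivative[OF Dh z])
  have dd: "(\<delta> i has_derivative (\<lambda>u. Dd u (g i) z + (\<Sum>j\<in>UNIV. Dd (axis j 1) (h i) z * Dd u (g j) z + Dd u (Dd (axis j 1) (h i)) z * g j z))) (at z)" for i
    unfolding \<delta> by (intro has_derivative_add has_derivative_sum has_derivative_mult gd Dhd)
  have Dvd: "Dd ?v (\<delta> i) z = Dd ?v (g i) z + (\<Sum>j\<in>UNIV. Dd (axis j 1) (h i) z * Dd ?v (g j) z) + (\<Sum>j\<in>UNIV. Dd ?v (Dd (axis j 1) (h i)) z * g j z)"
    unfolding Dd_eqI[OF dd] by (simp add: sum.distrib)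
  have Dhd': "Dd ?v (\<lambda>z. h i z + \<delta> i z) z = Dd ?v (h i) z + Dd ?v (\<delta> i) z"
    using Dd_eqI[OF has_derivative_add[OF hd dd]] Dd_eqI[OF dd] by simp
  \<comment> \<open>The derivative of the defect, contracted with \<open>g\<close>. Since
    \<open>\<delta> = (1 + Dh) g\<close>, the chain rule produces exactly the part of the increment
    of \<open>trigp\<close> that is linear in \<delta>.\<close>
  have "(\<Sum>j\<in>UNIV. Dd (axis j 1) (defect v F a h b w i) z * g j z) =
    of_real b * (\<Sum>j\<in>UNIV. Dd ?v (Dd (axis j 1) (h i)) z * g j z) -
    (\<Sum>k\<in>F. a i k * em k (disp h z) * (?c * kdot k (\<chi> j. \<delta> j z)))"
  proof -
    have inner: "(\<Sum>j\<in>UNIV. (\<Sum>m\<in>UNIV. of_int (k $ m) * (axis j 1 $ m + Dd (axis j 1) (h m) z)) * g j z) = kdot k (\<chi> j. \<delta> j z)" for k :: "int ^ 'd"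
    proof -
      have "(\<Sum>j\<in>UNIV. (\<Sum>m\<in>UNIV. of_int (k $ m) * (axis j 1 $ m + Dd (axis j 1) (h m) z)) * g j z) =
        (\<Sum>m\<in>UNIV. of_int (k $ m) * (\<Sum>j\<in>UNIV. (axis j 1 $ m + Dd (axis j 1) (h m) z) * g j z))"
        unfolding sum_distrib_left sum_distrib_right by (subst sum.swap) (simp add: mult_ac)
      also have "\<dots> = (\<Sum>m\<in>UNIV. of_int (k $ m) * \<delta> m z)"
        unfolding \<delta> by (simp add: distrib_right sum.distrib axis_def if_distrib[of "\<lambda>x. x * _"] cong: if_cong)
      finally show ?thesis by (simp add: kdot_def)
    qed
    have "(\<Sum>j\<in>UNIV. Dd (axis j 1) (defect v F a h b w i) z * g j z) =
      (\<Sum>j\<in>UNIV. of_real b * (Dd (axis j 1) (Dd ?v (h i)) z * g j z)) -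
      (\<Sum>j\<in>UNIV. \<Sum>k\<in>F. a i k * em k (disp h z) * (?c * ((\<Sum>m\<in>UNIV. of_int (k $ m) * (axis j 1 $ m + Dd (axis j 1) (h m) z)) * g j z)))"
      unfolding Dd_defect[OF h z] by (simp add: left_diff_distrib sum_subtractf sum_distrib_right mult.assoc)
    also have "(\<Sum>j\<in>UNIV. \<Sum>k\<in>F. a i k * em k (disp h z) * (?c * ((\<Sum>m\<in>UNIV. of_int (k $ m) * (axis j 1 $ m + Dd (axis j 1) (h m) z)) * g j z)))
      = (\<Sum>k\<in>F. a i k * em k (disp h z) * (?c * kdot k (\<chi> j. \<delta> j z)))"
      unfolding inner[symmetric] by (subst sum.swap) (simp add: sum_distrib_left)
    finally show ?thesis
      by (simp add: Dd_commute[OF h z, of _ ?v] sum_distrib_left)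
  qed
  \<comment> \<open>The equation for \<open>g\<close> multiplied by \<open>1 + Dh\<close>: the
    factor \<open>1 + K\<close> cancels, and \<open>v\<close> turns into
    \<open>v + \<partial>\<^sub>v h\<close>.\<close>
  moreover have "?E i + of_real (\<omega> $ i) + of_real \<alpha> * (of_real (v $ i) + Dd ?v (h i) z)
      + of_real b * (Dd ?v (g i) z + (\<Sum>j\<in>UNIV. Dd (axis j 1) (h i) z * Dd ?v (g j) z)) = 0"
  proof -
    have pick: "(\<Sum>l\<in>UNIV. (of_bool (i = l) + Dd (axis l 1) (h i) z) * X l) = X i + (\<Sum>l\<in>UNIV. Dd (axis l 1) (h i) z * X l)" for X
      by (simp add: distrib_right sum.distrib of_bool_def if_distrib[of "\<lambda>x. x * _"] cong: if_cong)
    have "of_real b * (Dd ?v (g i) z + (\<Sum>j\<in>UNIV. Dd (axis j 1) (h i) z * Dd ?v (g j) z)) =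
      (\<Sum>l\<in>UNIV. (of_bool (i = l) + Dd (axis l 1) (h i) z) * (of_real b * Dd ?v (g l) z))"
      unfolding pick by (simp add: distrib_left sum_distrib_left mult_ac)
    also have "\<dots> = - (\<Sum>l\<in>UNIV. \<Sum>j\<in>UNIV. (of_bool (i = l) + Dd (axis l 1) (h i) z) * (of_bool (l = j) + K l j) * (?E j + of_real (\<omega> $ j)))
       - (\<Sum>l\<in>UNIV. (of_bool (i = l) + Dd (axis l 1) (h i) z) * of_real (\<alpha> * v $ l))"
      unfolding gE by (simp add: right_diff_distrib sum_subtractf sum_negf[symmetric] sum_distrib_left mult.assoc del: sum_mult_of_bool_eq)
    also have "(\<Sum>l\<in>UNIV. \<Sum>j\<in>UNIV. (of_bool (i = l) + Dd (axis l 1) (h i) z) * (of_bool (l = j) + K l j) * (?E j + of_real (\<omega> $ j)))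
       = (\<Sum>j\<in>UNIV. (\<Sum>l\<in>UNIV. (of_bool (i = l) + Dd (axis l 1) (h i) z) * (of_bool (l = j) + K l j)) * (?E j + of_real (\<omega> $ j)))"
      unfolding sum_distrib_right by (rule sum.swap)
    also have "\<dots> = ?E i + of_real (\<omega> $ i)"
      unfolding K by (simp add: of_bool_def if_distrib[of "\<lambda>x. x * _"] cong: if_cong)
    also have "(\<Sum>l\<in>UNIV. (of_bool (i = l) + Dd (axis l 1) (h i) z) * of_real (\<alpha> * v $ l)) = of_real \<alpha> * (of_real (v $ i) + Dd ?v (h i) z)"
      unfolding pick Dd_expand[OF h z, of ?v] by (simp add: cvec_def distrib_left sum_distrib_left mult_ac)
    finally show ?thesis by simp
  qed
  ultimately show ?thesis
    unfolding remainder_eq defect_def[of v F a "\<lambda>j z. h j z + \<delta> j z"] defect_def[of v F a h b w i z] Dhd' Dvd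
    by (simp add: algebra_simps)
qed

text \<open>The bounds make the quadratic remainder estimate uniform in the size of the frequency
  set: modes stay bounded on the strip, and so do the second derivatives of the perturbation. The
  last condition keeps the iteration real.\<close>

definition trig_admissible :: "real \<Rightarrow> (int ^ 'd::finite) set \<Rightarrow> ('d \<Rightarrow> int ^ 'd \<Rightarrow> complex) \<Rightarrow> bool" where
  "trig_admissible s F a \<longleftrightarrow> finite F \<and> (\<forall>k\<in>F. s * knorm k \<le> 1) \<and>
     (\<forall>i. (\<Sum>k\<in>F. norm (a i k) * (knorm k)\<^sup>2) \<le> 1) \<and> (\<forall>i. realon (trigp F a i))"

locale diophantine =
  fixes v :: "real ^ 'd::finite" and \<gamma> :: real and \<tau> :: nat
  assumes gamma_pos: "0 < \<gamma>"
    and dioph: "k \<noteq> 0 \<Longrightarrow> \<gamma> \<le> norm (kdot k (cvec v)) * knorm k ^ \<tau>"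
begin

lemma v_nonzero: "v \<noteq> 0"
proof
  assume v: "v = 0"
  have "axis undefined 1 \<noteq> (0 :: int ^ 'd)" by (simp add: axis_eq_0_iff)
  from dioph[OF this] show False using gamma_pos by (simp add: v cvec_def kdot_def)
qed

definition approx_solution where
  "approx_solution \<theta> \<epsilon> s F a h b w \<longleftrightarrow> (\<exists>R. \<forall>j. Bs s R (h j)) \<and> (\<forall>j. realon (h j)) \<and>
     (\<forall>i j. Bs s \<theta> (Dd (axis j 1) (h i))) \<and> \<bar>b - 1\<bar> \<le> 1 / 2 \<and> (\<forall>i. Bs s \<epsilon> (defect v F a h b w i))"

text \<open>The worst loss of one Newton step in powers of the strip width. The small divisors cost
  \<tau> powers and enter the quadratic remainder squared; returning from a supremum to the weighted
  norm costs \<open>2 * CARD('d)\<close> more.\<close>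

definition Q :: nat where "Q = 2 * \<tau> + 2 * CARD('d)"

text \<open>With \<open>1 + K\<close> the inverse of \<open>1 + Dh\<close>, the equation to solve is
  \<open>b \<partial>\<^sub>v g = - (1 + K) (E + \<omega>) - \<alpha> v\<close>. The cohomological
  equation is solved for \<open>(1 + K) E\<close> and for each entry of \<open>K\<close> separately.
  Combining the solutions with the components of \<omega> yields \<open>g\<close>, and the means
  left over form the linear system that determines \<alpha> and \<omega>.\<close>

lemma newton_step:
  obtains C where "0 < C"
    "\<And>s F a h b w \<epsilon> \<theta>. 0 < s \<Longrightarrow> s \<le> 1 \<Longrightarrow> trig_admissible s F a \<Longrightarrow> approx_solution \<theta> \<epsilon> s F a h b w \<Longrightarrow>
      4 * real CARD('d) ^ 3 * \<theta> \<le> 1 \<Longrightarrow> C * \<epsilon> / s ^ Q \<le> s \<Longrightarrow>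
      \<exists>\<delta> \<alpha> \<omega>. (\<forall>i. Bs (s / 2) (C * \<epsilon> / s ^ Q) (\<delta> i) \<and> realon (\<delta> i)) \<and>
        (\<forall>i j. Bs (s / 2) (C * \<epsilon> / s ^ Q) (Dd (axis j 1) (\<delta> i))) \<and>
        \<bar>\<alpha>\<bar> \<le> C * \<epsilon> \<and> norm \<omega> \<le> C * \<epsilon> \<and> \<omega> \<bullet> v = 0 \<and>
        (\<forall>i. Bs (s / 2) (C * \<epsilon>\<^sup>2 / s ^ Q) (defect v F a (\<lambda>j z. h j z + \<delta> j z) (b + \<alpha>) (w + \<omega>) i))"
proof -
  define n where "n = CARD('d)"
  define d where "d = real n"
  have d1: "1 \<le> d" by (simp add: d_def n_def Suc_leI)
  have nv: "0 < norm v" using v_nonzero by simp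
  obtain M where M: "0 < M" "\<And>s \<sigma> C S (u :: complex ^ 'd \<Rightarrow> complex). Bs s C u \<Longrightarrow> 0 < \<sigma> \<Longrightarrow> \<sigma> \<le> s \<Longrightarrow> \<sigma> \<le> 1 \<Longrightarrow>
    (\<And>z. z \<in> strip s \<Longrightarrow> norm (u z) \<le> S) \<Longrightarrow> Bs (s - \<sigma>) (M / \<sigma> ^ (2 * n) * S) u"
    using Bs_from_sup[where 'd = 'd] unfolding n_def by blast
  define G0 where "G0 = fact \<tau> * 8 ^ \<tau> / (2 * pi * \<gamma>)"
  \<comment> \<open>Twice the constant in the bound for \<open>g\<close>, so that it also covers
    \<delta>. Below, \<open>C\<close> is a sum of all the constants that occur, so that each of them
    is at most \<open>C\<close>.\<close>
  define c1 where "c1 = 2 * (4 + 8 * d\<^sup>2) * G0"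
  define M1 where "M1 = M * 8 ^ (2 * n) * (exp 3 * (2 * pi)\<^sup>2) * c1\<^sup>2"
  define C where "C = c1 + 16 * pi * c1 + 80 * pi * d * c1 + M1 + 4 * d + 4 * d / norm v"
  have G0: "0 < G0" using gamma_pos by (simp add: G0_def)
  have c1: "0 < c1" unfolding c1_def using G0 by (intro mult_pos_pos add_pos_nonneg) auto
  have M1: "0 < M1" unfolding M1_def using M(1) c1 by (intro mult_pos_pos) auto
  have pos: "0 < 16 * pi * c1" "0 < 80 * pi * d * c1" "0 < 4 * d" "0 < 4 * d / norm v"
    using c1 d1 nv by auto
  have C: "0 < C" "c1 \<le> C" "16 * pi * c1 \<le> C" "80 * pi * d * c1 + M1 \<le> C" "4 * d \<le> C" "4 * d / norm v \<le> C"
    unfolding C_def using pos c1 M1 by linarith+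
  show thesis
  proof (rule that[OF C(1)])
    fix s F a h b w \<epsilon> \<theta>
    assume s: "0 < s" "s \<le> 1" and F: "trig_admissible s F a" and ap: "approx_solution \<theta> \<epsilon> s F a h b w"
      and \<theta>: "4 * real CARD('d) ^ 3 * \<theta> \<le> 1" and small: "C * \<epsilon> / s ^ Q \<le> s"
    obtain R where R: "\<And>j. Bs s R (h j)" and hr: "\<And>j. realon (h j)"
      and Dh: "\<And>i j. Bs s \<theta> (Dd (axis j 1) (h i))" and b: "\<bar>b - 1\<bar> \<le> 1 / 2"
      and E: "\<And>i. Bs s \<epsilon> (defect v F a h b w i)"
      using ap unfolding approx_solution_def by blast
    have fin: "finite F" and Fs: "\<And>k. k \<in> F \<Longrightarrow> s * knorm k \<le> 1"
      and Fa: "\<And>i. (\<Sum>k\<in>F. norm (a i k) * (knorm k)\<^sup>2) \<le> 1" and Fr: "\<And>i. realon (trigp F a i)"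
      using F unfolding trig_admissible_def by auto
    define E where "E = defect v F a h b w"
    have BE: "Bs s \<epsilon> (E i)" for i using E by (simp add: E_def)
    have RE: "realon (E i)" for i unfolding E_def by (rule realon_defect[OF s(1) R hr Fr])
    have \<epsilon>0: "0 \<le> \<epsilon>" using Bs_nonneg[OF _ BE] s by simp
    have \<theta>0: "0 \<le> \<theta>" using Bs_nonneg[OF _ Dh] s by simp
    have d3: "d * \<theta> \<le> d * d * d * \<theta>" "d * d * \<theta> \<le> d * d * d * \<theta>"
      using d1 \<theta>0 mult_mono[of 1 d 1 d] mult_mono[of 1 d "d*\<theta>" "d*\<theta>"] mult_mono[of 1 "d*d" "d*\<theta>" "d*\<theta>"]
       mult_mono[of 1 d "d*d*\<theta>" "d*d*\<theta>"] by (auto simp: mult_ac)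
    \<comment> \<open>The cube comes from \<open>counterterm_system\<close>, which needs
      \<open>d * (d * q) \<le> 1 / 2\<close> with the bound \<open>q = 2 * (d * \<theta>)\<close>
      for the means of \<open>K\<close>.\<close>
    have \<theta>': "4 * (d * d * d * \<theta>) \<le> 1" using \<theta> by (simp add: d_def n_def power3_eq_cube mult_ac)
    have d\<theta>: "d * \<theta> \<le> 1 / 4" "d * d * \<theta> \<le> 1 / 4" using d3 \<theta>' by linarith+
    \<comment> \<open>The strip shrinks three times: for the small divisors, for a derivative of
      \<delta>, and for the passage from supremum to norm. More than \<open>s / 2\<close>
      remains.\<close>
    define \<sigma> where "\<sigma> = s / 8"
    have \<sigma>: "0 < \<sigma>" "\<sigma> < s" "\<sigma> \<le> s" "\<sigma> \<le> 1" using s by (auto simp: \<sigma>_def)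
    define G where "G = fact \<tau> / (2 * pi * \<gamma> * \<sigma> ^ \<tau>)"
    have G: "G = G0 / s ^ \<tau>" by (simp add: G_def G0_def \<sigma>_def power_divide)
    have G0': "0 \<le> G" using G0 s by (simp add: G)
    have rD: "realon (Dd (axis j 1) (h i))" for i j
    proof -
      have "axis j 1 = cvec (axis j 1 :: real ^ 'd)" by (simp add: cvec_def axis_def vec_eq_iff)
      then show ?thesis using realon_Dd[OF R s(1) hr] by metis
    qed
    have d\<theta>2: "real CARD('d) * \<theta> \<le> 1 / 2" using d\<theta> by (simp add: d_def n_def)
    obtain K where K: "\<And>i j. Bs s (2 * (d * \<theta>)) (K i j)" "\<And>i j. realon (K i j)"
      "\<And>i j z. z \<in> strip s \<Longrightarrow> (\<Sum>l\<in>UNIV. (of_bool (i = l) + Dd (axis l 1) (h i) z) * (of_bool (l = j) + K l j z)) = of_bool (i = j)"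
      unfolding d_def n_def
      using s(1) Dh rD d\<theta>2 by (rule Bs_neumann_inverse[where D = "\<lambda>i j. Dd (axis j 1) (h i)"]) blast
    define KE where "KE i z = E i z + (\<Sum>j\<in>UNIV. K i j z * E j z)" for i z
    have BKE: "Bs s (2 * \<epsilon>) (KE i)" for i
    proof (rule Bs_mono)
      show "Bs s (\<epsilon> + (\<Sum>j\<in>(UNIV::'d set). 2 * (d * \<theta>) * \<epsilon>)) (KE i)"
        unfolding KE_def[abs_def] by (intro Bs_add Bs_sum Bs_mult BE K) (use s in auto)
      have "d * (2 * (d * \<theta>) * \<epsilon>) = 2 * (d * d * \<theta>) * \<epsilon>" by simp
      also have "\<dots> \<le> 1 * \<epsilon>" using d\<theta> \<epsilon>0 by (intro mult_right_mono) auto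
      finally show "\<epsilon> + (\<Sum>j\<in>(UNIV::'d set). 2 * (d * \<theta>) * \<epsilon>) \<le> 2 * \<epsilon>" by (simp add: d_def n_def)
    qed (use s in auto)
    have RKE: "realon (KE i)" for i
      using RE K(2) unfolding KE_def realon_def by (intro allI Reals_add sum_in_Reals Reals_mult) auto
    have coh: "\<exists>p. \<bar>fst p\<bar> \<le> B \<and> Bs (s - \<sigma>) (G * B) (snd p) \<and> realon (snd p) \<and>
        (\<forall>z\<in>strip (s - \<sigma>). Dd (cvec v) (snd p) z = u z - of_real (fst p))" if uB: "Bs s B u" "realon u" for B u
    proof -
      obtain \<mu> g where "\<bar>\<mu>\<bar> \<le> B" "Bs (s - \<sigma>) (fact \<tau> / (2 * pi * \<gamma> * \<sigma> ^ \<tau>) * B) g" "realon g"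
        "\<And>z. z \<in> strip (s - \<sigma>) \<Longrightarrow> Dd (cvec v) g z = u z - of_real \<mu>"
        using gamma_pos dioph uB \<sigma>(1,2) by (rule Bs_cohomological_equation) blast+
      then show ?thesis unfolding G_def by (intro exI[of _ "(\<mu>, g)"]) auto
    qed
    have "\<forall>i. \<exists>p. \<bar>fst p\<bar> \<le> 2 * \<epsilon> \<and> Bs (s - \<sigma>) (G * (2 * \<epsilon>)) (snd p) \<and> realon (snd p) \<and>
        (\<forall>z\<in>strip (s - \<sigma>). Dd (cvec v) (snd p) z = KE i z - of_real (fst p))"
      using coh[OF BKE RKE] by blast
    from choice[OF this] obtain p where p: "\<And>i. \<bar>fst (p i)\<bar> \<le> 2 * \<epsilon>" "\<And>i. Bs (s - \<sigma>) (G * (2 * \<epsilon>)) (snd (p i))"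
        "\<And>i. realon (snd (p i))" "\<And>i z. z\<in>strip (s - \<sigma>) \<Longrightarrow> Dd (cvec v) (snd (p i)) z = KE i z - of_real (fst (p i))" by blast
    have "\<forall>ij. \<exists>p. \<bar>fst p\<bar> \<le> 2 * (d * \<theta>) \<and> Bs (s - \<sigma>) (G * (2 * (d * \<theta>))) (snd p) \<and> realon (snd p) \<and>
        (\<forall>z\<in>strip (s - \<sigma>). Dd (cvec v) (snd p) z = K (fst ij) (snd ij) z - of_real (fst p))"
      using coh[OF K(1,2)] by blast
    from choice[OF this] obtain r where r: "\<And>ij. \<bar>fst (r ij)\<bar> \<le> 2 * (d * \<theta>)" "\<And>ij. Bs (s - \<sigma>) (G * (2 * (d * \<theta>))) (snd (r ij))"
        "\<And>ij. realon (snd (r ij))" "\<And>ij z. z\<in>strip (s - \<sigma>) \<Longrightarrow> Dd (cvec v) (snd (r ij)) z = K (fst ij) (snd ij) z - of_real (fst (r ij))" by blast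
    define \<nu> :: "real ^ 'd" where "\<nu> = (\<chi> i. fst (p i))"
    have n\<nu>: "2 * norm \<nu> \<le> 4 * d * \<epsilon>"
    proof -
      have "norm \<nu> \<le> (\<Sum>i\<in>UNIV. \<bar>\<nu> $ i\<bar>)" by (rule norm_le_l1_cart)
      also have "\<dots> \<le> (\<Sum>i\<in>(UNIV::'d set). 2 * \<epsilon>)" using p(1) by (intro sum_mono) (simp add: \<nu>_def)
      finally show ?thesis by (simp add: d_def n_def algebra_simps)
    qed
    obtain \<alpha> \<omega> where sys: "\<omega> \<bullet> v = 0" "\<bar>\<alpha>\<bar> * norm v \<le> 2 * norm \<nu>" "norm \<omega> \<le> 2 * norm \<nu>"
      "\<And>i. \<alpha> * v $ i + \<omega> $ i + (\<Sum>j\<in>UNIV. fst (r (i, j)) * \<omega> $ j) = - \<nu> $ i"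
    proof (rule counterterm_system[OF v_nonzero, of "\<lambda>i j. fst (r (i, j))" "2 * (d * \<theta>)" \<nu>])
      show "real CARD('d) * (real CARD('d) * (2 * (d * \<theta>))) \<le> 1 / 2" using \<theta>' by (simp add: d_def n_def mult_ac)
    qed (use r in auto)
    have \<alpha>: "\<bar>\<alpha>\<bar> * norm v \<le> 4 * d * \<epsilon>" and \<omega>: "norm \<omega> \<le> 4 * d * \<epsilon>" using sys n\<nu> by linarith+
    have \<omega>j: "\<bar>\<omega> $ j\<bar> \<le> 4 * d * \<epsilon>" for j using component_le_norm_cart[of \<omega> j] \<omega> by linarith
    \<comment> \<open>The sign and the factor \<open>1 / b\<close> come from the equation for
      \<open>g\<close>; the means cancel against \<open>\<alpha> v + \<omega>\<close> by the choice
      of the counterterms.\<close>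
    define g where "g i z = of_real (- (1 / b)) * (snd (p i) z + (\<Sum>j\<in>UNIV. of_real (\<omega> $ j) * snd (r (i, j)) z))" for i z
    have b2: "1 / 2 \<le> b" using b by linarith
    define D where "D = c1 * \<epsilon> / s ^ \<tau>"
    have D0: "0 \<le> D" using c1 \<epsilon>0 s by (simp add: D_def)
    have s0: "0 \<le> s - \<sigma>" "0 \<le> s - \<sigma> - \<sigma>" using s by (simp_all add: \<sigma>_def)
    have Bg: "Bs (s - \<sigma>) (D / 2) (g i)" for i
    proof (rule Bs_mono)
      show "Bs (s - \<sigma>) (norm (of_real (- (1 / b)) :: complex) * (G * (2 * \<epsilon>) + (\<Sum>j\<in>UNIV. norm (of_real (\<omega> $ j) :: complex) * (G * (2 * (d * \<theta>)))))) (g i)"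
        unfolding g_def[abs_def] by (intro Bs_cmult Bs_add Bs_sum p r s0) auto
      have "(\<Sum>j\<in>UNIV. \<bar>\<omega> $ j\<bar> * (G * (2 * (d * \<theta>)))) \<le> (\<Sum>j\<in>(UNIV::'d set). 4 * d * \<epsilon> * (G * 1))"
        using \<omega>j d\<theta> G0' \<epsilon>0 d1 \<theta>0 by (intro sum_mono mult_mono) auto
      also have "\<dots> = 4 * d\<^sup>2 * \<epsilon> * G" by (simp add: d_def n_def power2_eq_square)
      finally have "G * (2 * \<epsilon>) + (\<Sum>j\<in>UNIV. \<bar>\<omega> $ j\<bar> * (G * (2 * (d * \<theta>)))) \<le> G * (2 * \<epsilon>) + 4 * d\<^sup>2 * \<epsilon> * G" by simp
      then have "\<bar>1 / b\<bar> * (G * (2 * \<epsilon>) + (\<Sum>j\<in>UNIV. \<bar>\<omega> $ j\<bar> * (G * (2 * (d * \<theta>))))) \<le> 2 * (G * (2 * \<epsilon>) + 4 * d\<^sup>2 * \<epsilon> * G)"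
        using b2 G0' \<epsilon>0 d1 \<theta>0 by (intro mult_mono) (auto simp: field_simps intro!: add_nonneg_nonneg sum_nonneg mult_nonneg_nonneg)
      also have "\<dots> = D / 2" by (simp add: D_def c1_def G add_divide_distrib algebra_simps)
      finally show "norm (of_real (- (1 / b)) :: complex) * (G * (2 * \<epsilon>) + (\<Sum>j\<in>UNIV. norm (of_real (\<omega> $ j) :: complex) * (G * (2 * (d * \<theta>))))) \<le> D / 2"
        by (simp add: norm_divide)
    qed (rule s0)
    have Rg: "realon (g i)" for i
      using p(3) r(3) unfolding g_def realon_def by (intro allI Reals_add sum_in_Reals Reals_mult Reals_of_real) auto
    define \<delta> where "\<delta> = (\<lambda>i z. g i z + (\<Sum>j\<in>UNIV. Dd (axis j 1) (h i) z * g j z))"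
    have B\<delta>: "Bs (s - \<sigma>) D (\<delta> i)" for i
    proof (rule Bs_mono)
      show "Bs (s - \<sigma>) (D / 2 + (\<Sum>j\<in>(UNIV::'d set). \<theta> * (D / 2))) (\<delta> i)"
        unfolding \<delta>_def using \<sigma> by (intro Bs_add Bs_sum Bs_mult Bg s0 Bs_shrink[OF Dh]) auto
      have "d * (\<theta> * (D / 2)) = d * \<theta> * (D / 2)" by simp
      also have "\<dots> \<le> 1 * (D / 2)" using d\<theta> D0 by (intro mult_right_mono) auto
      finally show "D / 2 + (\<Sum>j\<in>(UNIV::'d set). \<theta> * (D / 2)) \<le> D" by (simp add: d_def n_def)
    qed (rule s0)
    have R\<delta>: "realon (\<delta> i)" for i
    proof -
      show ?thesis
        using Rg rD unfolding \<delta>_def realon_def by (intro allI Reals_add sum_in_Reals Reals_mult) auto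
    qed
    have BD\<delta>: "Bs (s - \<sigma> - \<sigma>) (2 * pi * W / \<sigma> * D) (Dd u (\<delta> i))" if "\<And>j. norm (u $ j) \<le> W" for u W i
      by (rule Bs_Dd[OF B\<delta>]) (use \<sigma> that in \<open>auto simp: \<sigma>_def\<close>)
    have pw: "X / s ^ q \<le> C' / s ^ Q" if "X \<le> C'" "0 \<le> X" "q \<le> Q" for X C' q
    proof -
      have "s ^ Q \<le> s ^ q" using s that by (intro power_decreasing) auto
      then show ?thesis using that s by (intro frac_le) auto
    qed
    have Qn: "Q = 2 * \<tau> + 2 * n" by (simp add: Q_def n_def)
    have n1: "1 \<le> n" by (simp add: n_def Suc_leI)
    have q: "\<tau> \<le> Q" "\<tau> + 1 \<le> Q" "2 * \<tau> + 2 * n \<le> Q" using n1 by (auto simp: Qn)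
    have DC: "D \<le> C * \<epsilon> / s ^ Q" unfolding D_def using C \<epsilon>0 c1 q by (intro pw mult_right_mono) auto
    have "2 * pi / \<sigma> * D = 16 * pi * c1 * \<epsilon> / s ^ (\<tau> + 1)" by (simp add: D_def \<sigma>_def)
    also have "\<dots> \<le> C * \<epsilon> / s ^ Q" using C \<epsilon>0 c1 q by (intro pw mult_right_mono) auto
    finally have DC': "2 * pi / \<sigma> * D \<le> C * \<epsilon> / s ^ Q" .
    have D1: "2 * pi * D \<le> s"
    proof -
      have "2 * pi * D = 2 * pi * c1 * \<epsilon> / s ^ \<tau>" by (simp add: D_def)
      also have "\<dots> \<le> C * \<epsilon> / s ^ Q"
      proof (intro pw mult_right_mono)
        have "2 * pi * c1 \<le> 16 * pi * c1" using c1 by simp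
        then show "2 * pi * c1 \<le> C" using C by linarith
      qed (use \<epsilon>0 c1 q in auto)
      also note small
      finally show ?thesis .
    qed
    have sub: "strip (s - \<sigma> - \<sigma>) \<subseteq> strip s" "strip (s - \<sigma> - \<sigma>) \<subseteq> strip (s - \<sigma>)"
      using \<sigma> by (auto intro!: strip_mono)
    have id: "defect v F a (\<lambda>j z. h j z + \<delta> j z) (b + \<alpha>) (w + \<omega>) i z =
      (\<Sum>j\<in>UNIV. Dd (axis j 1) (E i) z * g j z) + of_real \<alpha> * Dd (cvec v) (\<delta> i) z - remainder F a h \<delta> i z"
      if "z \<in> strip (s - \<sigma> - \<sigma>)" for z i
    proof -
      have z: "z \<in> strip (s - \<sigma>)" "z \<in> strip s" using that sub by auto
      show ?thesis
        unfolding E_def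
      proof (rule newton_identity[OF _ Bg _ z(1), where K = "\<lambda>i j. K i j z" and \<delta> = \<delta>])
        show "Bs (s - \<sigma>) R (h j)" "Bs (s - \<sigma>) \<theta> (Dd (axis j 1) (h i))" for i j
          using Bs_shrink[OF R] Bs_shrink[OF Dh] \<sigma> by auto
        show "of_real b * Dd (cvec v) (g i) z = - (\<Sum>l\<in>UNIV. (of_bool (i = l) + K i l z) * (defect v F a h b w l z + of_real (\<omega> $ l)))
          - of_real (\<alpha> * v $ i)" for i
        proof -
          have pd: "(snd (p i) has_derivative (\<lambda>u. Dd u (snd (p i)) z)) (at z)" by (rule Bs_has_derivative[OF p(2) z(1)])
          have rd: "(snd (r (i, j)) has_derivative (\<lambda>u. Dd u (snd (r (i, j))) z)) (at z)" for j by (rule Bs_has_derivative[OF r(2) z(1)])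
          have "(g i has_derivative (\<lambda>u. of_real (- (1 / b)) * (Dd u (snd (p i)) z + (\<Sum>j\<in>UNIV. of_real (\<omega> $ j) * Dd u (snd (r (i, j))) z)))) (at z)"
            unfolding g_def[abs_def] by (intro has_derivative_mult_right has_derivative_add has_derivative_sum pd rd)
          from Dd_eqI[OF this] have "Dd (cvec v) (g i) z = of_real (- (1 / b)) * (KE i z - of_real (fst (p i)) +
              (\<Sum>j\<in>UNIV. of_real (\<omega> $ j) * (K i j z - of_real (fst (r (i, j))))))"
            using p(4)[OF z(1)] r(4)[OF z(1)] by simp
          moreover have "b \<noteq> 0" using b2 by auto
          ultimately have "of_real b * Dd (cvec v) (g i) z = - (KE i z - of_real (fst (p i)) +
              (\<Sum>j\<in>UNIV. of_real (\<omega> $ j) * (K i j z - of_real (fst (r (i, j))))))" by simp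
          also have "\<dots> = - KE i z - (\<Sum>j\<in>UNIV. of_real (\<omega> $ j) * K i j z) + of_real (\<nu> $ i + (\<Sum>j\<in>UNIV. fst (r (i, j)) * \<omega> $ j))"
            by (simp add: \<nu>_def right_diff_distrib sum_subtractf mult_ac)
          also have "\<nu> $ i + (\<Sum>j\<in>UNIV. fst (r (i, j)) * \<omega> $ j) = - (\<alpha> * v $ i) - \<omega> $ i" using sys(4)[of i] by linarith
          also have "- KE i z - (\<Sum>j\<in>UNIV. of_real (\<omega> $ j) * K i j z) + of_real (- (\<alpha> * v $ i) - \<omega> $ i) =
             - (\<Sum>l\<in>UNIV. (of_bool (i = l) + K i l z) * (E l z + of_real (\<omega> $ l))) - of_real (\<alpha> * v $ i)"
            by (simp add: KE_def distrib_left distrib_right sum.distrib of_bool_def mult_delta_left mult.commute)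
              (simp add: mult_delta_right)
          finally show ?thesis by (simp add: E_def)
        qed
      qed (use K(3)[OF z(2)] in \<open>auto simp: \<delta>_def\<close>)
    qed
    have Brem: "Bs (s - \<sigma> - \<sigma> - \<sigma>) (M / \<sigma> ^ (2 * n) * (exp 3 * (2 * pi)\<^sup>2 * D\<^sup>2)) (remainder F a h \<delta> i)" for i
    proof -
      \<comment> \<open>Any finite norm will do, since \<open>Bs_from_sup\<close> replaces it by the
        supremum. A direct estimate of the norm would bring in the large exponentials of
        \<open>Bs_em_comp\<close>.\<close>
      have "\<exists>C. Bs (s - \<sigma> - \<sigma>) C (remainder F a h \<delta> i)"
      proof -
        have B: "Bs (s - \<sigma> - \<sigma>) (R + D) (\<lambda>z. h j z + \<delta> j z)" "Bs (s - \<sigma> - \<sigma>) R (h j)" for j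
          using Bs_shrink[OF R, of "s - \<sigma> - \<sigma>" j] Bs_shrink[OF B\<delta>, of "s - \<sigma> - \<sigma>" j] s0 \<sigma> by (auto intro: Bs_add)
        obtain C1 C2 where C12: "Bs (s - \<sigma> - \<sigma>) C1 (\<lambda>z. trigp F a i (disp (\<lambda>j z. h j z + \<delta> j z) z))"
          "Bs (s - \<sigma> - \<sigma>) C2 (\<lambda>z. trigp F a i (disp h z))"
          using Bs_trigp_disp[of _ _ _ "\<lambda>j z. h j z + \<delta> j z", OF s0(2) fin B(1), of a i] Bs_trigp_disp[of _ _ _ h, OF s0(2) fin B(2), of a i] by blast
        have k\<delta>: "Bs (s - \<sigma> - \<sigma>) (\<Sum>j\<in>UNIV. norm (of_int (k $ j) :: complex) * D) (\<lambda>z. kdot k (\<chi> j. \<delta> j z))" for k :: "int ^ 'd"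
          unfolding kdot_def vec_lambda_beta by (intro Bs_sum Bs_cmult s0 Bs_shrink[OF B\<delta>]) (use \<sigma> in auto)
        have "Bs (s - \<sigma> - \<sigma>) (\<Sum>k\<in>F. norm (a i k) * (exp ((s - \<sigma> - \<sigma>) * knorm k) * exp (2 * pi * R * knorm k)) *
            (norm (2 * of_real pi * \<i>) * (\<Sum>j\<in>UNIV. norm (of_int (k $ j) :: complex) * D)))
          (\<lambda>z. \<Sum>k\<in>F. a i k * em k (disp h z) * (2 * of_real pi * \<i> * kdot k (\<chi> j. \<delta> j z)))"
          unfolding disp_def by (intro Bs_sum Bs_mult[OF s0(2)] Bs_cmult Bs_em_comp s0 fin B k\<delta>)
        from Bs_diff[OF s0(2) Bs_diff[OF s0(2) C12] this] show ?thesis unfolding remainder_eq[abs_def] by blast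
      qed
      then obtain C0 where C0: "Bs (s - \<sigma> - \<sigma>) C0 (remainder F a h \<delta> i)" by blast
      show ?thesis
      proof (rule M(2)[OF C0 \<sigma>(1) _ \<sigma>(4)])
        show "\<sigma> \<le> s - \<sigma> - \<sigma>" using s by (simp add: \<sigma>_def)
        fix z :: "complex ^ 'd" assume z: "z \<in> strip (s - \<sigma> - \<sigma>)"
        show "norm (remainder F a h \<delta> i z) \<le> exp 3 * (2 * pi)\<^sup>2 * D\<^sup>2"
        proof (rule norm_remainder_le[OF s(1) R hr Dh _ _ Fs Fa _ D1])
          show "norm (\<delta> j z) \<le> D" for j using Bs_bound[OF s0(1) B\<delta>] z sub by blast
        qed (use d\<theta> z sub in \<open>auto simp: d_def n_def\<close>)
      qed
    qed
    have "Bs (s - \<sigma> - \<sigma> - \<sigma>) ((\<Sum>j\<in>(UNIV::'d set). (2 * pi * 1 / \<sigma> * \<epsilon>) * (D / 2)) + norm (of_real \<alpha> :: complex) * (2 * pi * norm v / \<sigma> * D)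
        + M / \<sigma> ^ (2 * n) * (exp 3 * (2 * pi)\<^sup>2 * D\<^sup>2))
        (\<lambda>z. (\<Sum>j\<in>UNIV. Dd (axis j 1) (E i) z * g j z) + of_real \<alpha> * Dd (cvec v) (\<delta> i) z - remainder F a h \<delta> i z)" for i
    proof (intro Bs_diff Bs_add Bs_sum Bs_mult Bs_cmult Brem)
      show "Bs (s - \<sigma> - \<sigma> - \<sigma>) (2 * pi * 1 / \<sigma> * \<epsilon>) (Dd (axis j 1) (E i))" for j
        by (rule Bs_shrink[OF Bs_Dd[OF BE \<sigma>(1,3)]]) (use \<sigma> in \<open>auto simp: axis_def\<close>)
      show "Bs (s - \<sigma> - \<sigma> - \<sigma>) (D / 2) (g j)" for j by (rule Bs_shrink[OF Bg]) (use \<sigma> in auto)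
      show "Bs (s - \<sigma> - \<sigma> - \<sigma>) (2 * pi * norm v / \<sigma> * D) (Dd (cvec v) (\<delta> i))"
        by (rule Bs_shrink[OF BD\<delta>]) (use \<sigma> component_le_norm_cart[of v] in \<open>auto simp: cvec_def\<close>)
      show "Bs (s - \<sigma> - \<sigma> - \<sigma>) (norm (of_real \<alpha> :: complex)) (\<lambda>z :: complex ^ 'd. of_real \<alpha>)"
        by (rule Bs_const) (use s in \<open>auto simp: \<sigma>_def\<close>)
    qed (use s in \<open>auto simp: \<sigma>_def\<close>)
    then have "Bs (s - \<sigma> - \<sigma> - \<sigma>) ((\<Sum>j\<in>(UNIV::'d set). (2 * pi * 1 / \<sigma> * \<epsilon>) * (D / 2)) + norm (of_real \<alpha> :: complex) * (2 * pi * norm v / \<sigma> * D)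
        + M / \<sigma> ^ (2 * n) * (exp 3 * (2 * pi)\<^sup>2 * D\<^sup>2))
        (defect v F a (\<lambda>j z. h j z + \<delta> j z) (b + \<alpha>) (w + \<omega>) i)" for i
      by (rule Bs_cong[rotated]) (use id[of _ i] s strip_mono[of "s - \<sigma> - \<sigma> - \<sigma>" "s - \<sigma> - \<sigma>"] \<sigma> in \<open>auto simp: \<sigma>_def\<close>)
    moreover have "(\<Sum>j\<in>(UNIV::'d set). (2 * pi * 1 / \<sigma> * \<epsilon>) * (D / 2)) + norm (of_real \<alpha> :: complex) * (2 * pi * norm v / \<sigma> * D)
        + M / \<sigma> ^ (2 * n) * (exp 3 * (2 * pi)\<^sup>2 * D\<^sup>2) \<le> C * \<epsilon>\<^sup>2 / s ^ Q"
    proof -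
      \<comment> \<open>All three contributions are quadratic in \<epsilon>. The term
        \<open>DE g\<close> and the term with \<alpha> are at most 16 and 64 times one and the same
        quantity, whence the 80 in \<open>C\<close>; the Taylor remainder gives
        \<open>M1\<close>.\<close>
      have "(\<Sum>j\<in>(UNIV::'d set). (2 * pi * 1 / \<sigma> * \<epsilon>) * (D / 2)) = d * pi / \<sigma> * \<epsilon> * D" by (simp add: d_def n_def)
      also have "\<dots> \<le> 16 * (d * pi * 1 / s * \<epsilon> * D)" using D0 \<epsilon>0 d1 s by (simp add: \<sigma>_def field_simps)
      finally have 1: "(\<Sum>j\<in>(UNIV::'d set). (2 * pi * 1 / \<sigma> * \<epsilon>) * (D / 2)) \<le> 16 * (d * pi * 1 / s * \<epsilon> * D)" .
      have "norm (of_real \<alpha> :: complex) * (2 * pi * norm v / \<sigma> * D) = \<bar>\<alpha>\<bar> * norm v * (16 * pi / s * D)"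
        by (simp add: \<sigma>_def)
      also have "\<dots> \<le> 4 * d * \<epsilon> * (16 * pi / s * D)" using \<alpha> D0 s by (intro mult_right_mono) auto
      also have "\<dots> = 64 * (d * pi * 1 / s * \<epsilon> * D)" by simp
      finally have 2: "norm (of_real \<alpha> :: complex) * (2 * pi * norm v / \<sigma> * D) \<le> 64 * (d * pi * 1 / s * \<epsilon> * D)" .
      have 3: "80 * (d * pi * 1 / s * \<epsilon> * D) = 80 * pi * d * c1 * \<epsilon>\<^sup>2 / s ^ (\<tau> + 1)"
        by (simp add: D_def power2_eq_square)
      have 4: "80 * pi * d * c1 * \<epsilon>\<^sup>2 / s ^ (\<tau> + 1) \<le> 80 * pi * d * c1 * \<epsilon>\<^sup>2 / s ^ Q"
        using c1 d1 q by (intro pw) auto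
      have 5: "M / \<sigma> ^ (2 * n) * (exp 3 * (2 * pi)\<^sup>2 * D\<^sup>2) = M1 * \<epsilon>\<^sup>2 / s ^ (2 * \<tau> + 2 * n)"
      proof -
        have "D\<^sup>2 = c1\<^sup>2 * \<epsilon>\<^sup>2 / s ^ (2 * \<tau>)" by (simp add: D_def power_divide power_mult_distrib power_mult[symmetric] mult.commute)
        moreover have "M / \<sigma> ^ (2 * n) = M * 8 ^ (2 * n) / s ^ (2 * n)" by (simp add: \<sigma>_def power_divide)
        ultimately show ?thesis by (simp add: M1_def power_add mult_ac)
      qed
      have 6: "M1 * \<epsilon>\<^sup>2 / s ^ (2 * \<tau> + 2 * n) \<le> M1 * \<epsilon>\<^sup>2 / s ^ Q" using M1 q by (intro pw) auto
      have "80 * pi * d * c1 * \<epsilon>\<^sup>2 / s ^ Q + M1 * \<epsilon>\<^sup>2 / s ^ Q = (80 * pi * d * c1 + M1) * \<epsilon>\<^sup>2 / s ^ Q"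
        by (simp add: add_divide_distrib distrib_right)
      also have "\<dots> \<le> C * \<epsilon>\<^sup>2 / s ^ Q" using C s by (intro divide_right_mono mult_right_mono) auto
      finally have 7: "80 * pi * d * c1 * \<epsilon>\<^sup>2 / s ^ Q + M1 * \<epsilon>\<^sup>2 / s ^ Q \<le> C * \<epsilon>\<^sup>2 / s ^ Q" .
      have "x + x' + u \<le> c" if "x \<le> 16 * y" "x' \<le> 64 * y" "80 * y = p" "p \<le> p'" "u = m" "m \<le> m'" "p' + m' \<le> c"
        for x x' y p p' u m m' c :: real using that by linarith
      from this[OF 1 2 3 4 5 6 7] show ?thesis .
    qed
    ultimately have fin': "Bs (s - \<sigma> - \<sigma> - \<sigma>) (C * \<epsilon>\<^sup>2 / s ^ Q) (defect v F a (\<lambda>j z. h j z + \<delta> j z) (b + \<alpha>) (w + \<omega>) i)" for i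
      by (rule Bs_mono[rotated]) (use s in \<open>auto simp: \<sigma>_def\<close>)
    have sh: "s / 2 \<le> s - \<sigma> - \<sigma> - \<sigma>" "s / 2 \<le> s - \<sigma> - \<sigma>" "s / 2 \<le> s - \<sigma>" using s by (auto simp: \<sigma>_def)
    have "\<bar>\<alpha>\<bar> \<le> C * \<epsilon>"
    proof -
      have "\<bar>\<alpha>\<bar> \<le> 4 * d / norm v * \<epsilon>" using \<alpha> nv by (simp add: field_simps)
      also have "\<dots> \<le> C * \<epsilon>" using C \<epsilon>0 by (intro mult_right_mono) auto
      finally show ?thesis .
    qed
    moreover have "norm \<omega> \<le> C * \<epsilon>"
      using \<omega> mult_right_mono[OF C(5) \<epsilon>0] by linarith
    moreover have "Bs (s / 2) (C * \<epsilon> / s ^ Q) (\<delta> i)" for i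
      by (rule Bs_mono[OF _ Bs_shrink[OF B\<delta> sh(3)] DC]) (use s in auto)
    moreover have "Bs (s / 2) (C * \<epsilon> / s ^ Q) (Dd (axis j 1) (\<delta> i))" for i j
    proof (rule Bs_mono[OF _ Bs_shrink[OF BD\<delta>[where W = 1] sh(2)]])
      show "2 * pi * 1 / \<sigma> * D \<le> C * \<epsilon> / s ^ Q" using DC' by simp
    qed (use s in \<open>auto simp: axis_def\<close>)
    ultimately show "\<exists>\<delta> \<alpha> \<omega>. (\<forall>i. Bs (s / 2) (C * \<epsilon> / s ^ Q) (\<delta> i) \<and> realon (\<delta> i)) \<and>
        (\<forall>i j. Bs (s / 2) (C * \<epsilon> / s ^ Q) (Dd (axis j 1) (\<delta> i))) \<and>
        \<bar>\<alpha>\<bar> \<le> C * \<epsilon> \<and> norm \<omega> \<le> C * \<epsilon> \<and> \<omega> \<bullet> v = 0 \<and>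
        (\<forall>i. Bs (s / 2) (C * \<epsilon>\<^sup>2 / s ^ Q) (defect v F a (\<lambda>j z. h j z + \<delta> j z) (b + \<alpha>) (w + \<omega>) i))"
      using R\<delta> sys(1) Bs_shrink[OF fin' sh(1)]
      by (intro exI[of _ \<delta>] exI[of _ \<alpha>] exI[of _ \<omega>] conjI allI) auto
  qed
qed

end

section \<open>The Newton iteration\<close>

lemma finite_knorm_le: "finite {k :: int ^ 'd::finite. knorm k \<le> N}"
proof -
  have "k $ j \<in> {- \<lceil>N\<rceil>..\<lceil>N\<rceil>}" if "knorm k \<le> N" for k :: "int ^ 'd" and j
  proof -
    have "\<bar>of_int (k $ j)\<bar> \<le> N" using component_le_knorm[of k j] that by linarith
    then show ?thesis by (simp add: abs_le_iff) linarith
  qed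
  then have "vec_nth ` {k :: int ^ 'd. knorm k \<le> N} \<subseteq> PiE UNIV (\<lambda>_. {- \<lceil>N\<rceil>..\<lceil>N\<rceil>})"
    by auto
  then have "finite (vec_nth ` {k :: int ^ 'd. knorm k \<le> N})"
    by (rule finite_subset) (auto intro!: finite_PiE)
  then show ?thesis by (rule finite_imageD) (auto simp: inj_on_def vec_eq_iff)
qed

lemma realon_trigp:
  assumes "\<And>k. a i (- k) = cnj (a i k)" "\<And>k. k \<in> F \<Longrightarrow> - k \<in> F"
  shows "realon (trigp F a i)"
  unfolding realon_def
proof
  fix x
  have "cnj (trigp F a i (cvec x)) = (\<Sum>k\<in>F. a i (- k) * em (- k) (cvec x))"
    by (simp add: trigp_def cnj_em_cvec assms)
  also have "\<dots> = trigp F a i (cvec x)"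
    unfolding trigp_def by (rule sum.reindex_bij_witness[of _ uminus uminus]) (use assms in auto)
  finally show "trigp F a i (cvec x) \<in> \<real>" by (simp add: Reals_cnj_iff)
qed

context diophantine begin

text \<open>The Newton step for the truncation \<open>F\<close> reaches width \<open>s / 2\<close>.
  The frequencies in \<open>F' - F\<close> are then added to the defect: at displaced points of that
  strip their modes are at most \<open>exp (s * knorm k) \<le> exp 4\<close>, and their supremum is
  converted to a norm on width \<open>s / 4\<close>.\<close>

lemma kam_step:
  obtains C where "0 < C"
    "\<And>s F F' a h b w \<epsilon> \<theta> t. 0 < s \<Longrightarrow> s \<le> 1 \<Longrightarrow> trig_admissible s F a \<Longrightarrow> F \<subseteq> F' \<Longrightarrow> finite F' \<Longrightarrow>
      (\<And>k. k \<in> F' \<Longrightarrow> s * knorm k \<le> 4) \<Longrightarrow> approx_solution \<theta> \<epsilon> s F a h b w \<Longrightarrow>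
      4 * real CARD('d) ^ 3 * (\<theta> + C * \<epsilon> / s ^ Q) \<le> 1 \<Longrightarrow> C * \<epsilon> / s ^ Q \<le> s \<Longrightarrow> \<bar>b - 1\<bar> + C * \<epsilon> \<le> 1 / 2 \<Longrightarrow>
      (\<And>i. (\<Sum>k\<in>F' - F. norm (a i k)) \<le> t) \<Longrightarrow>
      \<exists>\<delta> \<alpha> \<omega>. (\<forall>i. Bs (s / 4) (C * \<epsilon> / s ^ Q) (\<delta> i) \<and> realon (\<delta> i)) \<and>
        (\<forall>i j. Bs (s / 4) (C * \<epsilon> / s ^ Q) (Dd (axis j 1) (\<delta> i))) \<and>
        \<bar>\<alpha>\<bar> \<le> C * \<epsilon> \<and> norm \<omega> \<le> C * \<epsilon> \<and> \<omega> \<bullet> v = 0 \<and>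
        approx_solution (\<theta> + C * \<epsilon> / s ^ Q) (C * \<epsilon>\<^sup>2 / s ^ Q + C * t / s ^ Q) (s / 4) F' a (\<lambda>j z. h j z + \<delta> j z) (b + \<alpha>) (w + \<omega>)"
proof -
  let ?n = "2 * CARD('d)"
  obtain C0 where C0: "0 < C0" and nt:
    "\<And>s F a h b w \<epsilon> \<theta>. 0 < s \<Longrightarrow> s \<le> 1 \<Longrightarrow> trig_admissible s F a \<Longrightarrow> approx_solution \<theta> \<epsilon> s F a h b w \<Longrightarrow>
      4 * real CARD('d) ^ 3 * \<theta> \<le> 1 \<Longrightarrow> C0 * \<epsilon> / s ^ Q \<le> s \<Longrightarrow>
      \<exists>\<delta> \<alpha> \<omega>. (\<forall>i. Bs (s / 2) (C0 * \<epsilon> / s ^ Q) (\<delta> i) \<and> realon (\<delta> i)) \<and>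
        (\<forall>i j. Bs (s / 2) (C0 * \<epsilon> / s ^ Q) (Dd (axis j 1) (\<delta> i))) \<and>
        \<bar>\<alpha>\<bar> \<le> C0 * \<epsilon> \<and> norm \<omega> \<le> C0 * \<epsilon> \<and> \<omega> \<bullet> v = 0 \<and>
        (\<forall>i. Bs (s / 2) (C0 * \<epsilon>\<^sup>2 / s ^ Q) (defect v F a (\<lambda>j z. h j z + \<delta> j z) (b + \<alpha>) (w + \<omega>) i))"
    using newton_step by blast
  obtain M where M: "0 < M" "\<And>s \<sigma> C S (u :: complex ^ 'd \<Rightarrow> complex). Bs s C u \<Longrightarrow> 0 < \<sigma> \<Longrightarrow> \<sigma> \<le> s \<Longrightarrow> \<sigma> \<le> 1 \<Longrightarrow>
    (\<And>z. z \<in> strip s \<Longrightarrow> norm (u z) \<le> S) \<Longrightarrow> Bs (s - \<sigma>) (M / \<sigma> ^ ?n * S) u"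
    using Bs_from_sup[where 'd = 'd] by blast
  define M' where "M' = M * 4 ^ ?n * exp 4"
  have M': "0 < M'" using M(1) by (simp add: M'_def)
  define C where "C = C0 + M'"
  have C: "0 < C" "C0 \<le> C" "M' \<le> C" using C0 M' by (auto simp: C_def)
  show thesis
  proof (rule that[OF C(1)])
    fix s F F' a h b w \<epsilon> \<theta> t
    assume s: "0 < s" "s \<le> 1" and F: "trig_admissible s F a" and F': "F \<subseteq> F'" "finite F'" "\<And>k. k \<in> F' \<Longrightarrow> s * knorm k \<le> 4"
      and ap: "approx_solution \<theta> \<epsilon> s F a h b w" and \<theta>: "4 * real CARD('d) ^ 3 * (\<theta> + C * \<epsilon> / s ^ Q) \<le> 1"
      and small: "C * \<epsilon> / s ^ Q \<le> s" and b: "\<bar>b - 1\<bar> + C * \<epsilon> \<le> 1 / 2" and t: "\<And>i. (\<Sum>k\<in>F' - F. norm (a i k)) \<le> t"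
    obtain R where R: "\<And>j. Bs s R (h j)" and hr: "\<And>j. realon (h j)"
      and Dh: "\<And>i j. Bs s \<theta> (Dd (axis j 1) (h i))" and E: "\<And>i. Bs s \<epsilon> (defect v F a h b w i)"
      using ap unfolding approx_solution_def by blast
    have \<epsilon>0: "0 \<le> \<epsilon>" using Bs_nonneg[OF _ E] s by simp
    have \<theta>0: "0 \<le> \<theta>" using Bs_nonneg[OF _ Dh] s by simp
    have t0: "0 \<le> t" using order_trans[OF sum_nonneg t] by simp
    have le: "C0 * \<epsilon> / s ^ Q \<le> C * \<epsilon> / s ^ Q" "C0 * \<epsilon> \<le> C * \<epsilon>" "0 \<le> C * \<epsilon> / s ^ Q" "C0 * \<epsilon>\<^sup>2 / s ^ Q \<le> C * \<epsilon>\<^sup>2 / s ^ Q"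
      using C s \<epsilon>0 by (auto intro!: divide_right_mono mult_right_mono)
    have "4 * real CARD('d) ^ 3 * \<theta> \<le> 4 * real CARD('d) ^ 3 * (\<theta> + C * \<epsilon> / s ^ Q)"
      using le by (intro mult_left_mono) auto
    then have "4 * real CARD('d) ^ 3 * \<theta> \<le> 1" using \<theta> by linarith
    moreover have "C0 * \<epsilon> / s ^ Q \<le> s" using small le by linarith
    ultimately obtain \<delta> \<alpha> \<omega> where \<delta>: "\<And>i. Bs (s / 2) (C0 * \<epsilon> / s ^ Q) (\<delta> i)" "\<And>i. realon (\<delta> i)"
        "\<And>i j. Bs (s / 2) (C0 * \<epsilon> / s ^ Q) (Dd (axis j 1) (\<delta> i))" and \<alpha>: "\<bar>\<alpha>\<bar> \<le> C0 * \<epsilon>" "norm \<omega> \<le> C0 * \<epsilon>" "\<omega> \<bullet> v = 0"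
        and E': "\<And>i. Bs (s / 2) (C0 * \<epsilon>\<^sup>2 / s ^ Q) (defect v F a (\<lambda>j z. h j z + \<delta> j z) (b + \<alpha>) (w + \<omega>) i)"
      using nt[OF s F ap] by blast
    let ?h = "\<lambda>j z. h j z + \<delta> j z"
    have s2: "0 \<le> s / 2" "0 < s / 2" "0 \<le> s / 4" "s / 4 \<le> s / 2" "s / 4 \<le> s" "s / 2 \<le> s" using s by auto
    have Bh: "Bs (s / 2) (R + C0 * \<epsilon> / s ^ Q) (?h j)" for j
      by (intro Bs_add \<delta> Bs_shrink[OF R] s2)
    have Rh: "realon (?h j)" for j using hr \<delta>(2) by (simp add: realon_def)
    have BDh: "Bs (s / 2) (\<theta> + C0 * \<epsilon> / s ^ Q) (Dd (axis j 1) (?h i))" for i j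
    proof (rule Bs_cong[OF s2(1)])
      show "Bs (s / 2) (\<theta> + C0 * \<epsilon> / s ^ Q) (\<lambda>z. Dd (axis j 1) (h i) z + Dd (axis j 1) (\<delta> i) z)"
        by (intro Bs_add \<delta> Bs_shrink[OF Dh] s2)
      fix z :: "complex ^ 'd" assume z: "z \<in> strip (s / 2)"
      show "Dd (axis j 1) (h i) z + Dd (axis j 1) (\<delta> i) z = Dd (axis j 1) (?h i) z"
        by (rule Dd_eqI[symmetric, OF has_derivative_add[OF Bs_has_derivative Bs_has_derivative]], rule Bs_shrink[OF R s2(6)], rule z, rule \<delta>(1), rule z)
    qed
    have d3: "real CARD('d) * x \<le> 1" if "4 * real CARD('d) ^ 3 * x \<le> 1" "0 \<le> x" for x
    proof -
      have "1 \<le> real CARD('d)" by (simp add: Suc_leI)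
      then have "real CARD('d) ^ 1 \<le> real CARD('d) ^ 3" by (intro power_increasing) auto
      then have "real CARD('d) \<le> 4 * real CARD('d) ^ 3"
        using zero_le_power[of "real CARD('d)" 3] unfolding power_one_right by linarith
      then have "real CARD('d) * x \<le> (4 * real CARD('d) ^ 3) * x" using that(2) by (rule mult_right_mono)
      then show ?thesis using that by linarith
    qed
    have T1: "Bs (s / 2 - s / 4) (M / (s / 4) ^ ?n * (exp 4 * t)) (\<lambda>z. trigp (F' - F) a i (disp ?h z))" for i
    proof -
      obtain B where B: "Bs (s / 2) B (\<lambda>z. trigp (F' - F) a i (disp ?h z))"
        using Bs_trigp_disp[of "s / 2" "F' - F" _ ?h, OF s2(1) _ Bh] F' by blast
      show ?thesis
      proof (rule M(2)[OF B])
        fix z :: "complex ^ 'd" assume z: "z \<in> strip (s / 2)"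
        have "norm (trigp (F' - F) a i (disp ?h z)) \<le> (\<Sum>k\<in>F' - F. norm (a i k) * exp 4)"
          unfolding trigp_def
        proof (rule sum_norm_le)
          fix k assume k: "k \<in> F' - F"
          have "norm (em k (disp ?h z)) \<le> exp (2 * (s / 2) * knorm k)"
          proof (rule norm_em_disp[where R = "R + C0 * \<epsilon> / s ^ Q" and \<theta> = "\<theta> + C0 * \<epsilon> / s ^ Q"])
            have "\<theta> + C0 * \<epsilon> / s ^ Q \<le> \<theta> + C * \<epsilon> / s ^ Q" using le by simp
            then have "real CARD('d) * (\<theta> + C0 * \<epsilon> / s ^ Q) \<le> real CARD('d) * (\<theta> + C * \<epsilon> / s ^ Q)" by (intro mult_left_mono) auto
            also have "\<dots> \<le> 1" using le \<theta>0 by (intro d3 \<theta>) auto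
            finally show "real CARD('d) * (\<theta> + C0 * \<epsilon> / s ^ Q) \<le> 1" .
          qed (use s2 Bh Rh BDh z in auto)
          also have "\<dots> \<le> exp 4" using F'(3)[of k] k by simp
          finally show "norm (a i k * em k (disp ?h z)) \<le> norm (a i k) * exp 4"
            unfolding norm_mult by (intro mult_left_mono) auto
        qed
        also have "\<dots> \<le> t * exp 4" unfolding sum_distrib_right[symmetric] by (intro mult_right_mono t) auto
        finally show "norm (trigp (F' - F) a i (disp ?h z)) \<le> exp 4 * t" by (simp add: mult.commute)
      qed (use s in auto)
    qed
    have T2: "M / (s / 4) ^ ?n * (exp 4 * t) \<le> C * t / s ^ Q"
    proof -
      have "M / (s / 4) ^ ?n * (exp 4 * t) = M' * t / s ^ ?n" by (simp add: M'_def power_divide)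
      also have "\<dots> \<le> C * t / s ^ Q"
        using C M' t0 s by (intro frac_le mult_right_mono power_decreasing) (auto simp: Q_def)
      finally show ?thesis .
    qed
    have eq: "s / 2 - s / 4 = s / 4" by simp
    have Bt: "Bs (s / 4) (C * t / s ^ Q) (\<lambda>z. trigp (F' - F) a i (disp ?h z))" for i
      by (rule Bs_mono[OF s2(3) T1[unfolded eq, of i] T2])
    have E4: "Bs (s / 4) (C * \<epsilon>\<^sup>2 / s ^ Q) (defect v F a ?h (b + \<alpha>) (w + \<omega>) i)" for i
      by (rule Bs_mono[OF _ Bs_shrink[OF E'] le(4)]) (use s2 in auto)
    have "Bs (s / 4) (C * \<epsilon>\<^sup>2 / s ^ Q + C * t / s ^ Q) (defect v F' a ?h (b + \<alpha>) (w + \<omega>) i)" for i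
    proof -
      have "trigp F' a i z = trigp F a i z + trigp (F' - F) a i z" for z
        using sum.subset_diff[OF F'(1,2), of "\<lambda>k. a i k * em k z"] by (simp add: trigp_def)
      then have "defect v F' a ?h (b + \<alpha>) (w + \<omega>) i = (\<lambda>z. defect v F a ?h (b + \<alpha>) (w + \<omega>) i z - trigp (F' - F) a i (disp ?h z))"
        by (auto simp: defect_def)
      then show ?thesis using Bs_diff[OF s2(3) E4 Bt] by simp
    qed
    moreover have "\<bar>b + \<alpha> - 1\<bar> \<le> 1 / 2" using b \<alpha> le by linarith
    ultimately have "approx_solution (\<theta> + C * \<epsilon> / s ^ Q) (C * \<epsilon>\<^sup>2 / s ^ Q + C * t / s ^ Q) (s / 4) F' a ?h (b + \<alpha>) (w + \<omega>)"
      unfolding approx_solution_def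
      using Bs_shrink[OF Bh s2(4)] Rh Bs_mono[OF s2(3) Bs_shrink[OF BDh s2(4)], of "\<theta> + C * \<epsilon> / s ^ Q"] le by auto
    then show "\<exists>\<delta> \<alpha> \<omega>. (\<forall>i. Bs (s / 4) (C * \<epsilon> / s ^ Q) (\<delta> i) \<and> realon (\<delta> i)) \<and>
        (\<forall>i j. Bs (s / 4) (C * \<epsilon> / s ^ Q) (Dd (axis j 1) (\<delta> i))) \<and>
        \<bar>\<alpha>\<bar> \<le> C * \<epsilon> \<and> norm \<omega> \<le> C * \<epsilon> \<and> \<omega> \<bullet> v = 0 \<and>
        approx_solution (\<theta> + C * \<epsilon> / s ^ Q) (C * \<epsilon>\<^sup>2 / s ^ Q + C * t / s ^ Q) (s / 4) F' a (\<lambda>j z. h j z + \<delta> j z) (b + \<alpha>) (w + \<omega>)"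
      using \<delta>(2) \<alpha> le Bs_mono[OF s2(3) Bs_shrink[OF \<delta>(1) s2(4)] le(1)] Bs_mono[OF s2(3) Bs_shrink[OF \<delta>(3) s2(4)] le(1)]
      by (intro exI[of _ \<delta>] exI[of _ \<alpha>] exI[of _ \<omega>]) auto
  qed
qed

definition F :: "nat \<Rightarrow> (int ^ 'd) set" where "F n = {k. knorm k \<le> 4 ^ n}"

lemma finite_F: "finite (F n)"
  unfolding F_def by (rule finite_knorm_le)

lemma F_uminus: "k \<in> F n \<Longrightarrow> - k \<in> F n"
  by (simp add: F_def)

lemma F_mono: "F n \<subseteq> F (Suc n)"
  using power_increasing[of n "Suc n" "4 :: real"] by (auto simp: F_def intro: order_trans)

text \<open>The perturbation is merely smooth. The \<open>n\<close>-th approximation solves the equation for its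
  truncation to frequencies at most \<open>4\<^sup>n\<close>, which is controlled on the strip of width \<open>4\<^sup>-\<^sup>n\<close>.\<close>

definition newton_sequence where
  "newton_sequence c0 a h b w e \<longleftrightarrow>
    h 0 = (\<lambda>i z. 0) \<and> b 0 = 1 \<and> (\<forall>n. w n \<bullet> v = 0) \<and>
    (\<forall>n i. Bs ((1 / 4) ^ n) (e n) (defect v (F n) a (h n) (b n) (w n) i)) \<and>
    (\<forall>n i. realon (h n i)) \<and>
    (\<forall>n i. Bs ((1 / 4) ^ Suc n) (e n) (\<lambda>z. h (Suc n) i z - h n i z)) \<and>
    (\<forall>n i j. Bs ((1 / 4) ^ Suc n) (e n) (Dd (axis j 1) (\<lambda>z. h (Suc n) i z - h n i z))) \<and>
    (\<forall>n. \<bar>b (Suc n) - b n\<bar> \<le> e n \<and> norm (w (Suc n) - w n) \<le> e n) \<and>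
    (\<forall>n. e n \<le> c0 / 2 * (1 / 4) ^ n) \<and> (\<forall>m. \<exists>K. \<forall>n. e n \<le> K * (1 / 4) ^ (m * n))"

text \<open>The bound to propagate is \<open>\<epsilon> n \<le> c * s n ^ (Q + 1)\<close>. Up to
  constants, the quadratic term becomes \<open>c\<^sup>2 * s n ^ (Q + 2)\<close>, and weights of
  order \<open>2 * Q + 1\<close> make the new frequencies contribute \<open>s n ^ (Q + 1)\<close>
  after the loss of \<open>s n ^ Q\<close>. As the next strip has a quarter of the width, each has
  to stay below half of \<open>c * (1 / 4) ^ (Q + 1) * s n ^ (Q + 1)\<close>: the first by the
  choice of \<open>c\<close>, the second by that of \<eta>.\<close>

lemma kam_sequence:
  assumes "0 < c0" "c0 \<le> 1 / 2" "4 * real CARD('d) ^ 3 * c0 \<le> 1"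
  obtains \<eta> where "0 < \<eta>"
    "\<And>a. (\<And>i k. a i (- k) = cnj (a i k)) \<Longrightarrow> (\<And>i m. (\<lambda>k. norm (a i k) * (1 + knorm k) ^ m) summable_on UNIV) \<Longrightarrow>
      (\<And>i. (\<Sum>\<^sub>\<infinity>k. norm (a i k) * (1 + knorm k) ^ (2 * Q + 1)) \<le> \<eta>) \<Longrightarrow>
      \<exists>h b w e. newton_sequence c0 a h b w e"
proof -
  obtain C1 where C1: "0 < C1" and step:
    "\<And>s F F' a h b w \<epsilon> \<theta> t. 0 < s \<Longrightarrow> s \<le> 1 \<Longrightarrow> trig_admissible s F a \<Longrightarrow> F \<subseteq> F' \<Longrightarrow> finite F' \<Longrightarrow>
      (\<And>k. k \<in> F' \<Longrightarrow> s * knorm k \<le> 4) \<Longrightarrow> approx_solution \<theta> \<epsilon> s F a h b w \<Longrightarrow>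
      4 * real CARD('d) ^ 3 * (\<theta> + C1 * \<epsilon> / s ^ Q) \<le> 1 \<Longrightarrow> C1 * \<epsilon> / s ^ Q \<le> s \<Longrightarrow> \<bar>b - 1\<bar> + C1 * \<epsilon> \<le> 1 / 2 \<Longrightarrow>
      (\<And>i. (\<Sum>k\<in>F' - F. norm (a i k)) \<le> t) \<Longrightarrow>
      \<exists>\<delta> \<alpha> \<omega>. (\<forall>i. Bs (s / 4) (C1 * \<epsilon> / s ^ Q) (\<delta> i) \<and> realon (\<delta> i)) \<and>
        (\<forall>i j. Bs (s / 4) (C1 * \<epsilon> / s ^ Q) (Dd (axis j 1) (\<delta> i))) \<and>
        \<bar>\<alpha>\<bar> \<le> C1 * \<epsilon> \<and> norm \<omega> \<le> C1 * \<epsilon> \<and> \<omega> \<bullet> v = 0 \<and>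
        approx_solution (\<theta> + C1 * \<epsilon> / s ^ Q) (C1 * \<epsilon>\<^sup>2 / s ^ Q + C1 * t / s ^ Q) (s / 4) F' a (\<lambda>j z. h j z + \<delta> j z) (b + \<alpha>) (w + \<omega>)"
    using kam_step by blast
  define C where "C = max C1 1"
  define c where "c = c0 / (2 * C * 4 ^ (Q + 2))"
  \<comment> \<open>The 1 gives the bound on second derivatives in \<open>trig_admissible\<close>;
    the other entry makes the initial error and the tails fit the bound with
    \<open>c\<close>.\<close>
  define \<eta> where "\<eta> = min 1 (c / (2 * exp 1 * C * 4 ^ (Q + 1) * real CARD('d)))"
  define s where "s n = (1 / 4 :: real) ^ n" for n :: nat
  have C: "1 \<le> C" "C1 \<le> C" "0 < C" by (auto simp: C_def)
  have c: "0 < c" using assms C by (simp add: c_def)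
  have cC: "C * c = c0 / (2 * 4 ^ (Q + 2))" using C by (simp add: c_def)
  have \<eta>: "0 < \<eta>" "\<eta> \<le> 1" using c C by (auto simp: \<eta>_def)
  have s: "0 < s n" "s n \<le> 1" "s (Suc n) = s n / 4" "s n * 4 ^ n = 1" for n
    by (auto simp: s_def power_le_one power_one_over)
  show thesis
  proof (rule that[OF \<eta>(1)])
    fix a :: "'d \<Rightarrow> int ^ 'd \<Rightarrow> complex"
    assume herm: "\<And>i k. a i (- k) = cnj (a i k)" and sm: "\<And>i m. (\<lambda>k. norm (a i k) * (1 + knorm k) ^ m) summable_on UNIV"
      and a\<eta>: "\<And>i. (\<Sum>\<^sub>\<infinity>k. norm (a i k) * (1 + knorm k) ^ (2 * Q + 1)) \<le> \<eta>"
    define A where "A m = (\<Sum>i\<in>UNIV. \<Sum>\<^sub>\<infinity>k. norm (a i k) * (1 + knorm k) ^ m)" for m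
    have A0: "0 \<le> A m" for m unfolding A_def by (intro sum_nonneg infsum_nonneg) auto
    have A\<eta>: "A (2 * Q + 1) \<le> real CARD('d) * \<eta>"
    proof -
      have "A (2 * Q + 1) \<le> (\<Sum>i\<in>(UNIV::'d set). \<eta>)" unfolding A_def by (intro sum_mono a\<eta>)
      then show ?thesis by simp
    qed
    have fs: "(\<Sum>k\<in>G. norm (a i k) * (1 + knorm k) ^ m) \<le> (\<Sum>\<^sub>\<infinity>k. norm (a i k) * (1 + knorm k) ^ m)" if "finite G" for G i m
      using that by (intro finite_sum_le_infsum sm) auto
    have adm: "trig_admissible (s n) (F n) a" for n
      unfolding trig_admissible_def
    proof (intro conjI ballI allI)
      show "realon (trigp (F n) a i)" for i using herm F_uminus by (rule realon_trigp)
      show "s n * knorm k \<le> 1" if "k \<in> F n" for k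
      proof -
        have "s n * knorm k \<le> s n * 4 ^ n" using that s(1)[of n] by (intro mult_left_mono) (auto simp: F_def)
        then show ?thesis using s(4) by simp
      qed
      show "(\<Sum>k\<in>F n. norm (a i k) * (knorm k)\<^sup>2) \<le> 1" for i
      proof -
        have Q2: "2 \<le> 2 * Q + 1" by (simp add: Q_def Suc_leI)
        have "(\<Sum>k\<in>F n. norm (a i k) * (knorm k)\<^sup>2) \<le> (\<Sum>k\<in>F n. norm (a i k) * (1 + knorm k) ^ (2 * Q + 1))"
        proof (intro sum_mono mult_left_mono)
          fix k :: "int ^ 'd"
          have "(knorm k)\<^sup>2 \<le> (1 + knorm k)\<^sup>2" by (intro power_mono) auto
          also have "\<dots> \<le> (1 + knorm k) ^ (2 * Q + 1)" using Q2 by (intro power_increasing) auto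
          finally show "(knorm k)\<^sup>2 \<le> (1 + knorm k) ^ (2 * Q + 1)" .
        qed auto
        also have "\<dots> \<le> \<eta>" using fs[OF finite_F] a\<eta> order_trans by blast
        finally show ?thesis using \<eta> by simp
      qed
    qed (rule finite_F)
    define t where "t n = (\<Sum>i\<in>UNIV. \<Sum>k\<in>F (Suc n) - F n. norm (a i k))" for n
    have t0: "0 \<le> t n" for n unfolding t_def by (intro sum_nonneg) auto
    have ti: "(\<Sum>k\<in>F (Suc n) - F n. norm (a i k)) \<le> t n" for i n
      unfolding t_def by (rule member_le_sum) (auto intro: sum_nonneg)
    \<comment> \<open>Outside \<open>F n\<close> the product \<open>s n * (1 + knorm k)\<close> is
      at least 1, so any power of it may be inserted.\<close>
    have tA: "t n \<le> A m * s n ^ m" for n m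
    proof -
      have "t n \<le> (\<Sum>i\<in>UNIV. s n ^ m * (\<Sum>\<^sub>\<infinity>k. norm (a i k) * (1 + knorm k) ^ m))"
        unfolding t_def
      proof (rule sum_mono)
        fix i
        have "(\<Sum>k\<in>F (Suc n) - F n. norm (a i k)) \<le> (\<Sum>k\<in>F (Suc n) - F n. s n ^ m * (norm (a i k) * (1 + knorm k) ^ m))"
        proof (rule sum_mono)
          fix k assume "k \<in> F (Suc n) - F n"
          then have "4 ^ n \<le> 1 + knorm k" by (auto simp: F_def)
          then have "s n * 4 ^ n \<le> s n * (1 + knorm k)" using s(1)[of n] by (intro mult_left_mono) auto
          then have "1 \<le> (s n * (1 + knorm k)) ^ m" using s(4) by (intro one_le_power) simp
          then have "norm (a i k) * 1 \<le> norm (a i k) * (s n * (1 + knorm k)) ^ m" by (intro mult_left_mono) auto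
          then show "norm (a i k) \<le> s n ^ m * (norm (a i k) * (1 + knorm k) ^ m)" by (simp add: power_mult_distrib mult_ac)
        qed
        also have "\<dots> = s n ^ m * (\<Sum>k\<in>F (Suc n) - F n. norm (a i k) * (1 + knorm k) ^ m)" by (simp add: sum_distrib_left)
        also have "\<dots> \<le> s n ^ m * (\<Sum>\<^sub>\<infinity>k. norm (a i k) * (1 + knorm k) ^ m)"
          using s(1)[of n] finite_F[of "Suc n"] by (intro mult_left_mono fs) auto
        finally show "(\<Sum>k\<in>F (Suc n) - F n. norm (a i k)) \<le> s n ^ m * (\<Sum>\<^sub>\<infinity>k. norm (a i k) * (1 + knorm k) ^ m)" .
      qed
      then show ?thesis by (simp add: A_def sum_distrib_left mult.commute)
    qed
    \<comment> \<open>The recursion of \<open>kam_step\<close>. At the start the frequencies in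
      \<open>F 0\<close> satisfy \<open>knorm k \<le> 1\<close> and the strip has width 1, which
      accounts for \<open>exp 1\<close>.\<close>
    define \<epsilon> where "\<epsilon> = rec_nat (exp 1 * A (2 * Q + 1)) (\<lambda>n e. C1 * e\<^sup>2 / s n ^ Q + C1 * t n / s n ^ Q)"
    have \<epsilon>_0: "\<epsilon> 0 = exp 1 * A (2 * Q + 1)" and \<epsilon>_Suc: "\<epsilon> (Suc n) = C1 * (\<epsilon> n)\<^sup>2 / s n ^ Q + C1 * t n / s n ^ Q" for n
      by (simp_all add: \<epsilon>_def)
    have \<epsilon>0: "0 \<le> \<epsilon> n" for n
      by (cases n) (use A0 C1 s(1) t0 in \<open>auto simp: \<epsilon>_0 \<epsilon>_Suc less_imp_le\<close>)
    have dn: "1 \<le> real CARD('d)" by (simp add: Suc_leI)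
    have A_small: "exp 1 * A (2 * Q + 1) \<le> c" "C1 * A (2 * Q + 1) \<le> c / 2 * (1 / 4) ^ (Q + 1)"
    proof -
      have "real CARD('d) * \<eta> \<le> real CARD('d) * (c / (2 * exp 1 * C * 4 ^ (Q + 1) * real CARD('d)))"
        unfolding \<eta>_def by (intro mult_left_mono) auto
      also have "\<dots> = c / (2 * exp 1 * C * 4 ^ (Q + 1))" by simp
      finally have A: "A (2 * Q + 1) \<le> c / (2 * exp 1 * C * 4 ^ (Q + 1))" using A\<eta> by linarith
      then have "exp 1 * A (2 * Q + 1) \<le> exp 1 * (c / (2 * exp 1 * C * 4 ^ (Q + 1)))" by (intro mult_left_mono) auto
      also have "\<dots> = c / (2 * C * 4 ^ (Q + 1))" by simp
      also have "\<dots> \<le> c / 1"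
      proof (rule divide_left_mono)
        have "1 * 1 * 1 \<le> 2 * C * 4 ^ (Q + 1)" using C by (intro mult_mono one_le_power) auto
        then show "1 \<le> 2 * C * 4 ^ (Q + 1)" by simp
      qed (use c C in auto)
      finally show "exp 1 * A (2 * Q + 1) \<le> c" by simp
      have "C1 * A (2 * Q + 1) \<le> C * (c / (2 * exp 1 * C * 4 ^ (Q + 1)))"
        using A A0 C C1 by (intro mult_mono) auto
      also have "\<dots> = c / (2 * 4 ^ (Q + 1)) / exp 1" using C by simp
      also have "\<dots> \<le> c / (2 * 4 ^ (Q + 1)) / 1" using c by (intro divide_left_mono) auto
      finally show "C1 * A (2 * Q + 1) \<le> c / 2 * (1 / 4) ^ (Q + 1)" unfolding power_one_over by simp
    qed
    have \<epsilon>c: "\<epsilon> n \<le> c * s n ^ (Q + 1)" for n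
    proof (induction n)
      case 0
      then show ?case using A_small(1) by (simp add: \<epsilon>_0 s_def)
    next
      case (Suc n)
      have sq: "0 < s n ^ Q" using s(1) by simp
      have "C1 * (\<epsilon> n)\<^sup>2 / s n ^ Q \<le> C * (c * s n ^ (Q + 1))\<^sup>2 / s n ^ Q"
        using C C1 Suc \<epsilon>0 sq by (intro divide_right_mono mult_mono power_mono) auto
      also have "(c * s n ^ (Q + 1))\<^sup>2 = (c * c * s n ^ (Q + 1) * s n) * s n ^ Q"
        by (simp add: power2_eq_square)
      also have "C * ((c * c * s n ^ (Q + 1) * s n) * s n ^ Q) / s n ^ Q = (C * c) * c * s n ^ (Q + 1) * s n"
        using sq by simp
      also have "\<dots> \<le> (C * c) * c * s n ^ (Q + 1) * 1"
        using s(1,2)[of n] C c by (intro mult_left_mono mult_nonneg_nonneg) auto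
      also have "C * c \<le> (1 / 4) ^ (Q + 1) / 2"
      proof -
        have "c0 / (2 * 4 ^ (Q + 2)) \<le> 1 / (2 * 4 ^ (Q + 2))" using assms by (intro divide_right_mono) auto
        also have "\<dots> \<le> (1 / 4) ^ (Q + 1) / 2" by (simp add: power_one_over field_simps)
        finally show ?thesis using cC by simp
      qed
      then have "(C * c) * c * s n ^ (Q + 1) * 1 \<le> (1 / 4) ^ (Q + 1) / 2 * c * s n ^ (Q + 1) * 1"
        using s(1)[of n] c by (intro mult_right_mono) auto
      finally have 1: "C1 * (\<epsilon> n)\<^sup>2 / s n ^ Q \<le> (1 / 4) ^ (Q + 1) / 2 * c * s n ^ (Q + 1)" by simp
      have "C1 * t n / s n ^ Q \<le> C1 * (A (2 * Q + 1) * s n ^ (2 * Q + 1)) / s n ^ Q"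
        using tA[of n "2 * Q + 1"] C1 sq by (intro divide_right_mono mult_left_mono) auto
      also have "s n ^ (2 * Q + 1) = s n ^ (Q + 1) * s n ^ Q" by (simp add: power_add[symmetric] mult_2)
      also have "C1 * (A (2 * Q + 1) * (s n ^ (Q + 1) * s n ^ Q)) / s n ^ Q = C1 * A (2 * Q + 1) * s n ^ (Q + 1)"
        using sq by simp
      also have "\<dots> \<le> c / 2 * (1 / 4) ^ (Q + 1) * s n ^ (Q + 1)"
        using s(1)[of n] by (intro mult_right_mono A_small) auto
      finally have 2: "C1 * t n / s n ^ Q \<le> (1 / 4) ^ (Q + 1) / 2 * c * s n ^ (Q + 1)" by (simp add: mult_ac)
      have "s (Suc n) ^ (Q + 1) = (1 / 4) ^ (Q + 1) * s n ^ (Q + 1)" unfolding s(3) by (simp add: power_divide)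
      moreover have "c * (y * z) = y / 2 * c * z + y / 2 * c * z" for y z :: real by simp
      ultimately have "c * s (Suc n) ^ (Q + 1) = (1 / 4) ^ (Q + 1) / 2 * c * s n ^ (Q + 1) + (1 / 4) ^ (Q + 1) / 2 * c * s n ^ (Q + 1)"
        by (simp only:)
      then show ?case using 1 2 unfolding \<epsilon>_Suc by linarith
    qed
    define e where "e n = C1 * \<epsilon> n / s n ^ Q" for n
    have e0: "0 \<le> e n" for n using \<epsilon>0 C1 s(1)[of n] by (simp add: e_def less_imp_le)
    have Cce: "C1 * \<epsilon> n \<le> e n" for n
    proof -
      have "C1 * \<epsilon> n / 1 \<le> C1 * \<epsilon> n / s n ^ Q"
        using s(1,2)[of n] \<epsilon>0[of n] C1 by (intro divide_left_mono power_le_one) auto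
      then show ?thesis by (simp add: e_def)
    qed
    have es: "e n \<le> c0 / 2 * s n" for n
    proof -
      have sq: "0 < s n ^ Q" using s(1) by simp
      have "e n \<le> C * (c * s n ^ (Q + 1)) / s n ^ Q"
        unfolding e_def using C C1 \<epsilon>0 \<epsilon>c sq by (intro divide_right_mono mult_mono) auto
      also have "\<dots> = C * c * s n" using sq by simp
      also have "\<dots> \<le> c0 / 2 * s n"
      proof (rule mult_right_mono)
        have "c0 / (2 * 4 ^ (Q + 2)) \<le> c0 / (2 * 1)" using assms by (intro divide_left_mono mult_left_mono one_le_power) auto
        then show "C * c \<le> c0 / 2" using cC by simp
      qed (use s(1)[of n] in simp)
      finally show ?thesis .
    qed
    define \<theta> where "\<theta> n = (\<Sum>j<n. e j)" for n
    \<comment> \<open>The bounds are compared with \<open>s n - s (Suc n) = 3 / 4 * s n\<close> and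
      telescope, so that their sum never exceeds \<open>c0\<close>.\<close>
    have \<theta>c: "\<theta> n \<le> c0 * (1 - s n)" for n
    proof (induction n)
      case (Suc n)
      have "0 < c0 * s n" using s(1)[of n] assms(1) by simp
      then have "e n \<le> 3 / 4 * (c0 * s n)" using es[of n] by linarith
      then show ?case using Suc by (simp add: \<theta>_def s(3) algebra_simps)
    qed (simp add: \<theta>_def s_def)
    have \<theta>c': "\<theta> n \<le> c0" for n
    proof -
      have "c0 * (1 - s n) \<le> c0 * 1" using assms s(1)[of n] by (intro mult_left_mono) auto
      then show ?thesis using \<theta>c[of n] by simp
    qed
    \<comment> \<open>The invariant for dependent choice. Its clause for \<open>n = 0\<close>
      records the starting point, which a mere choice of a sequence would not retain.\<close>
    define I where "I n st \<longleftrightarrow> (case st of (h, b, w) \<Rightarrow> approx_solution (\<theta> n) (\<epsilon> n) (s n) (F n) a h b w \<and> \<bar>b - 1\<bar> \<le> \<theta> n \<and> w \<bullet> v = 0 \<and>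
       (n = 0 \<longrightarrow> h = (\<lambda>i z. 0) \<and> b = 1))" for n st
    define Rl where "Rl n st st' \<longleftrightarrow> (case st of (h, b, w) \<Rightarrow> case st' of (h', b', w') \<Rightarrow>
       (\<forall>i. Bs (s (Suc n)) (e n) (\<lambda>z. h' i z - h i z)) \<and>
       (\<forall>i j. Bs (s (Suc n)) (e n) (Dd (axis j 1) (\<lambda>z. h' i z - h i z))) \<and> \<bar>b' - b\<bar> \<le> e n \<and> norm (w' - w) \<le> e n)"
       for n and st st' :: "('d \<Rightarrow> complex ^ 'd \<Rightarrow> complex) \<times> real \<times> (real ^ 'd)"
    have "\<exists>f. \<forall>n. I n (f n) \<and> Rl n (f n) (f (Suc n))"
    proof (rule dependent_nat_choice)
      show "\<exists>st. I 0 st"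
      proof (rule exI[of _ "(\<lambda>i z. 0, 1, 0)"])
        have D0: "Dd u (\<lambda>z. 0) = (\<lambda>z. 0)" for u :: "complex ^ 'd" by (rule ext, rule Dd_eqI[OF has_derivative_const])
        have "defect v (F 0) a (\<lambda>i z. 0) 1 0 i = (\<lambda>z. - trigp (F 0) a i z)" for i
          by (auto simp: defect_def D0 disp_def zero_vec_def[symmetric])
        moreover have "Bs 1 (\<epsilon> 0) (\<lambda>z. - trigp (F 0) a i z)" for i
        proof (intro Bs_uminus Bs_mono[of 1 _ _ "\<epsilon> 0"])
          show "Bs 1 (\<Sum>k\<in>F 0. norm (a i k) * exp (1 * knorm k)) (trigp (F 0) a i)"
            unfolding trigp_def[abs_def] by (intro Bs_sum Bs_em finite_F) auto
          have "(\<Sum>k\<in>F 0. norm (a i k) * exp (1 * knorm k)) \<le> (\<Sum>k\<in>F 0. exp 1 * (norm (a i k) * (1 + knorm k) ^ (2 * Q + 1)))"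
          proof (rule sum_mono)
            fix k assume k: "k \<in> F 0"
            have "norm (a i k) * exp (1 * knorm k) \<le> norm (a i k) * (exp 1 * (1 + knorm k) ^ (2 * Q + 1))"
            proof (intro mult_left_mono)
              have "exp (1 * knorm k) * 1 \<le> exp 1 * (1 + knorm k) ^ (2 * Q + 1)"
                using k by (intro mult_mono one_le_power) (auto simp: F_def)
              then show "exp (1 * knorm k) \<le> exp 1 * (1 + knorm k) ^ (2 * Q + 1)" by simp
            qed auto
            then show "norm (a i k) * exp (1 * knorm k) \<le> exp 1 * (norm (a i k) * (1 + knorm k) ^ (2 * Q + 1))" by (simp add: mult_ac)
          qed
          also have "\<dots> \<le> exp 1 * (\<Sum>\<^sub>\<infinity>k. norm (a i k) * (1 + knorm k) ^ (2 * Q + 1))"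
            unfolding sum_distrib_left[symmetric] by (intro mult_left_mono fs finite_F) auto
          also have "\<dots> \<le> exp 1 * A (2 * Q + 1)"
            unfolding A_def by (intro mult_left_mono member_le_sum) (auto intro: infsum_nonneg)
          finally show "(\<Sum>k\<in>F 0. norm (a i k) * exp (1 * knorm k)) \<le> \<epsilon> 0" by (simp add: \<epsilon>_0)
        qed auto
        moreover have "Bs 1 0 (\<lambda>z :: complex ^ 'd. 0)" by (rule Bs_const) auto
        ultimately show "I 0 (\<lambda>i z. 0, 1, 0)"
          unfolding I_def approx_solution_def
          by (auto simp: \<theta>_def s_def D0 realon_def intro: exI[of _ 0])
      qed
      fix st n assume I: "I n st"
      obtain h b w where st: "st = (h, b, w)" by (cases st)
      have ap: "approx_solution (\<theta> n) (\<epsilon> n) (s n) (F n) a h b w" and b: "\<bar>b - 1\<bar> \<le> \<theta> n" and w: "w \<bullet> v = 0"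
        using I by (auto simp: I_def st)
      have \<theta>S: "\<theta> (Suc n) = \<theta> n + C1 * \<epsilon> n / s n ^ Q" by (simp add: \<theta>_def e_def)
      have "\<exists>\<delta> \<alpha> \<omega>. (\<forall>i. Bs (s n / 4) (C1 * \<epsilon> n / s n ^ Q) (\<delta> i) \<and> realon (\<delta> i)) \<and>
        (\<forall>i j. Bs (s n / 4) (C1 * \<epsilon> n / s n ^ Q) (Dd (axis j 1) (\<delta> i))) \<and>
        \<bar>\<alpha>\<bar> \<le> C1 * \<epsilon> n \<and> norm \<omega> \<le> C1 * \<epsilon> n \<and> \<omega> \<bullet> v = 0 \<and>
        approx_solution (\<theta> n + C1 * \<epsilon> n / s n ^ Q) (C1 * (\<epsilon> n)\<^sup>2 / s n ^ Q + C1 * t n / s n ^ Q) (s n / 4) (F (Suc n)) a (\<lambda>j z. h j z + \<delta> j z) (b + \<alpha>) (w + \<omega>)"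
      proof (rule step[OF s(1,2) adm F_mono finite_F _ ap])
        show "s n * knorm k \<le> 4" if "k \<in> F (Suc n)" for k
        proof -
          have "s n * knorm k \<le> s n * 4 ^ Suc n" using that s(1)[of n] by (intro mult_left_mono) (auto simp: F_def)
          then show ?thesis using s(4)[of n] by simp
        qed
        have "4 * real CARD('d) ^ 3 * \<theta> (Suc n) \<le> 4 * real CARD('d) ^ 3 * c0"
          using \<theta>c'[of "Suc n"] by (intro mult_left_mono) auto
        then show "4 * real CARD('d) ^ 3 * (\<theta> n + C1 * \<epsilon> n / s n ^ Q) \<le> 1" using assms(3) unfolding \<theta>S[symmetric] by linarith
        have "c0 / 2 * s n \<le> 1 * s n" using assms s(1)[of n] by (intro mult_right_mono) auto
        then show "C1 * \<epsilon> n / s n ^ Q \<le> s n" using es[of n] unfolding e_def by linarith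
        have "\<bar>b - 1\<bar> + C1 * \<epsilon> n \<le> \<theta> (Suc n)" using b Cce[of n] by (simp add: \<theta>_def)
        then show "\<bar>b - 1\<bar> + C1 * \<epsilon> n \<le> 1 / 2" using \<theta>c'[of "Suc n"] assms(2) by linarith
      qed (rule ti)
      then obtain \<delta> \<alpha> \<omega> where \<delta>: "\<And>i. Bs (s n / 4) (C1 * \<epsilon> n / s n ^ Q) (\<delta> i)"
        "\<And>i j. Bs (s n / 4) (C1 * \<epsilon> n / s n ^ Q) (Dd (axis j 1) (\<delta> i))" "\<bar>\<alpha>\<bar> \<le> C1 * \<epsilon> n" "norm \<omega> \<le> C1 * \<epsilon> n" "\<omega> \<bullet> v = 0"
        "approx_solution (\<theta> n + C1 * \<epsilon> n / s n ^ Q) (C1 * (\<epsilon> n)\<^sup>2 / s n ^ Q + C1 * t n / s n ^ Q) (s n / 4) (F (Suc n)) a (\<lambda>j z. h j z + \<delta> j z) (b + \<alpha>) (w + \<omega>)"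
        by blast
      let ?st = "(\<lambda>j z. h j z + \<delta> j z, b + \<alpha>, w + \<omega>)"
      have "\<bar>b + \<alpha> - 1\<bar> \<le> \<theta> (Suc n)" using b \<delta>(3) Cce[of n] by (simp add: \<theta>_def)
      then have "I (Suc n) ?st"
        using \<delta>(5,6) w unfolding I_def by (simp add: \<theta>S \<epsilon>_Suc s(3) inner_add_left)
      moreover have "Rl n st ?st"
        using \<delta> Cce[of n] unfolding Rl_def st by (simp add: s(3) e_def)
      ultimately show "\<exists>st'. I (Suc n) st' \<and> Rl n st st'" by blast
    qed
    then obtain f where f: "\<And>n. I n (f n)" "\<And>n. Rl n (f n) (f (Suc n))" by blast
    define h where "h n = fst (f n)" for n
    define b where "b n = fst (snd (f n))" for n
    define w where "w n = snd (snd (f n))" for n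
    have fn: "f n = (h n, b n, w n)" for n by (simp add: h_def b_def w_def)
    have ap: "approx_solution (\<theta> n) (\<epsilon> n) (s n) (F n) a (h n) (b n) (w n)" and wv: "w n \<bullet> v = 0" for n
      using f(1)[of n] unfolding I_def fn by auto
    have h0: "h 0 = (\<lambda>i z. 0)" "b 0 = 1" using f(1)[of 0] unfolding I_def fn by auto
    have diff: "Bs (s (Suc n)) (e n) (\<lambda>z. h (Suc n) i z - h n i z)" "Bs (s (Suc n)) (e n) (Dd (axis j 1) (\<lambda>z. h (Suc n) i z - h n i z))"
       "\<bar>b (Suc n) - b n\<bar> \<le> e n" "norm (w (Suc n) - w n) \<le> e n" for n i j
      using f(2)[of n] unfolding Rl_def fn by auto
    \<comment> \<open>A bootstrap: in the square one factor is bounded by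
      \<open>c * s n ^ (Q + 1)\<close>, which cancels the loss and leaves a further power of
      \<open>s n\<close>, while the tails decay to any order. The smoothness of the limit rests on
      this, since no strip survives.\<close>
    have decay: "\<exists>K. \<forall>n. \<epsilon> n \<le> K * s n ^ m" for m
    proof (induction m)
      case 0
      have "\<epsilon> n \<le> c" for n
      proof -
        have "c * s n ^ (Q + 1) \<le> c * 1" using c s(1,2)[of n] by (intro mult_left_mono power_le_one) auto
        then show ?thesis using \<epsilon>c[of n] by simp
      qed
      then show ?case by auto
    next
      case (Suc m)
      then obtain K where K: "\<And>n. \<epsilon> n \<le> K * s n ^ m" by blast
      have K0: "0 \<le> K" using order_trans[OF \<epsilon>0 K[of 0]] by (simp add: s_def)
      define K' where "K' = max (\<epsilon> 0) ((C1 * c * K + C1 * A (Suc m + Q)) * 4 ^ Suc m)"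
      have "\<epsilon> n \<le> K' * s n ^ Suc m" for n
      proof (cases n)
        case 0
        then show ?thesis by (simp add: s_def K'_def)
      next
        case (Suc n')
        have sq: "0 < s n' ^ Q" using s(1) by simp
        have "(\<epsilon> n')\<^sup>2 \<le> (c * s n' ^ (Q + 1)) * (K * s n' ^ m)"
          unfolding power2_eq_square using \<epsilon>c K \<epsilon>0 c s(1)[of n'] by (intro mult_mono) auto
        then have "C1 * (\<epsilon> n')\<^sup>2 / s n' ^ Q \<le> C1 * ((c * s n' ^ (Q + 1)) * (K * s n' ^ m)) / s n' ^ Q"
          using C1 sq by (intro divide_right_mono mult_left_mono) auto
        also have "\<dots> = C1 * c * K * s n' ^ Suc m" using sq by simp
        finally have 1: "C1 * (\<epsilon> n')\<^sup>2 / s n' ^ Q \<le> C1 * c * K * s n' ^ Suc m" .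
        have "C1 * t n' / s n' ^ Q \<le> C1 * (A (Suc m + Q) * s n' ^ (Suc m + Q)) / s n' ^ Q"
          using tA[of n' "Suc m + Q"] C1 sq by (intro divide_right_mono mult_left_mono) auto
        also have "\<dots> = C1 * A (Suc m + Q) * s n' ^ Suc m" using sq by (simp add: power_add)
        finally have "\<epsilon> n \<le> (C1 * c * K + C1 * A (Suc m + Q)) * s n' ^ Suc m"
          using 1 unfolding Suc \<epsilon>_Suc by (simp add: distrib_right)
        also have "\<dots> = ((C1 * c * K + C1 * A (Suc m + Q)) * 4 ^ Suc m) * s n ^ Suc m"
          unfolding Suc s(3) by (simp add: power_divide)
        also have "\<dots> \<le> K' * s n ^ Suc m" unfolding K'_def using s(1)[of n] by (intro mult_right_mono) auto
        finally show ?thesis .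
      qed
      then show ?case by blast
    qed
    have decay_e: "\<exists>K. \<forall>n. e n \<le> K * s n ^ m" for m
    proof -
      obtain K where K: "\<And>n. \<epsilon> n \<le> K * s n ^ (m + Q)" using decay by blast
      have "e n \<le> C1 * K * s n ^ m" for n
      proof -
        have sq: "0 < s n ^ Q" using s(1) by simp
        have "e n \<le> C1 * (K * s n ^ (m + Q)) / s n ^ Q"
          unfolding e_def using C1 K sq by (intro divide_right_mono mult_left_mono) auto
        also have "\<dots> = C1 * K * s n ^ m" using sq s(1)[of n] by (simp add: power_add)
        finally show ?thesis .
      qed
      then show ?thesis by blast
    qed
    \<comment> \<open>\<open>newton_sequence\<close> has a single bound for corrections and
      defects.\<close>
    define e' where "e' n = max (e n) (\<epsilon> n)" for n
    have E\<epsilon>: "Bs (s n) (max (e n) (\<epsilon> n)) (defect v (F n) a (h n) (b n) (w n) i)" for n i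
      using ap[of n] s(1)[of n] unfolding approx_solution_def by (auto intro: Bs_mono)
    have e'e: "e' n \<le> c0 / 2 * s n" for n
    proof -
      have "\<epsilon> n \<le> c * s n ^ (Q + 1)" by (rule \<epsilon>c)
      also have "\<dots> \<le> c * s n" using c s(1,2)[of n] power_le_one[of "s n" Q] by (intro mult_left_mono) (auto simp: mult_le_cancel_left1)
      also have "\<dots> \<le> c0 / 2 * s n"
      proof (rule mult_right_mono)
        have "c0 / (2 * C * 4 ^ (Q + 2)) \<le> c0 / (2 * 1 * 1)" using assms C by (intro divide_left_mono mult_mono one_le_power) auto
        then show "c \<le> c0 / 2" by (simp add: c_def)
      qed (use s(1)[of n] in simp)
      finally show ?thesis using es[of n] by (simp add: e'_def)
    qed
    have decay': "\<exists>K. \<forall>n. e' n \<le> K * (1 / 4) ^ (m * n)" for m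
    proof -
      obtain K1 K2 where K: "\<And>n. e n \<le> K1 * s n ^ m" "\<And>n. \<epsilon> n \<le> K2 * s n ^ m" using decay decay_e by blast
      have "e' n \<le> max K1 K2 * (1 / 4) ^ (m * n)" for n
      proof -
        have sm: "s n ^ m = (1 / 4) ^ (m * n)" by (simp add: s_def power_mult[symmetric] mult.commute)
        have "K1 * s n ^ m \<le> max K1 K2 * s n ^ m" "K2 * s n ^ m \<le> max K1 K2 * s n ^ m"
          using s(1)[of n] by (auto intro!: mult_right_mono)
        then show ?thesis using K[of n] unfolding e'_def sm by linarith
      qed
      then show ?thesis by blast
    qed
    have ee': "e n \<le> e' n" for n by (simp add: e'_def)
    show "\<exists>h b w e. newton_sequence c0 a h b w e"
      unfolding newton_sequence_def
    proof (rule exI[of _ h], rule exI[of _ b], rule exI[of _ w], rule exI[of _ e'], intro conjI allI)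
      show "Bs ((1 / 4) ^ n) (e' n) (defect v (F n) a (h n) (b n) (w n) i)" for n i
        using E\<epsilon>[of n i] by (simp add: s_def e'_def)
      show "Bs ((1 / 4) ^ Suc n) (e' n) (\<lambda>z. h (Suc n) i z - h n i z)" for n i
        by (rule Bs_mono[OF _ diff(1)[unfolded s_def] ee']) simp
      show "Bs ((1 / 4) ^ Suc n) (e' n) (Dd (axis j 1) (\<lambda>z. h (Suc n) i z - h n i z))" for n i j
        by (rule Bs_mono[OF _ diff(2)[unfolded s_def] ee']) simp
      show "realon (h n i)" for n i using ap unfolding approx_solution_def by blast
      show "\<bar>b (Suc n) - b n\<bar> \<le> e' n" "norm (w (Suc n) - w n) \<le> e' n" for n
        using diff(3,4)[of n] ee'[of n] by linarith+
      show "e' n \<le> c0 / 2 * (1 / 4) ^ n" for n using e'e[of n] by (simp add: s_def)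
    qed (use h0 wv decay' in auto)
  qed
qed

end

section \<open>Passage to the limit\<close>

lemma Ck_SucI:
  assumes "\<And>x. (f has_derivative f' x) (at x)" "\<And>u. Ck_on k UNIV (\<lambda>x. f' x u)"
  shows "Ck_on (Suc k) UNIV f"
proof -
  have "frechet_derivative f (at x) = f' x" for x using frechet_derivative_at[OF assms(1)] by simp
  then show ?thesis using assms(2) differentiableI[OF assms(1)] by simp
qed

lemma Ck_SucE:
  assumes "Ck_on (Suc k) UNIV f"
  obtains f' where "\<And>x. (f has_derivative f' x) (at x)" "\<And>u. Ck_on k UNIV (\<lambda>x. f' x u)"
  using assms frechet_derivative_works by (metis Ck_on.simps(2) UNIV_I)

lemma Ck_Suc_imp: "Ck_on (Suc k) UNIV f \<Longrightarrow> Ck_on k UNIV f"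
proof (induction k arbitrary: f)
  case 0
  then show ?case by (auto simp: differentiable_imp_continuous_on differentiable_on_def intro!: differentiable_at_imp_differentiable_on)
next
  case (Suc k)
  obtain f' where f': "\<And>x. (f has_derivative f' x) (at x)" "\<And>u. Ck_on (Suc k) UNIV (\<lambda>x. f' x u)"
    using Suc.prems by (rule Ck_SucE) blast
  show ?case by (rule Ck_SucI[OF f'(1) Suc.IH[OF f'(2)]])
qed

lemma Ck_continuous: "Ck_on k UNIV f \<Longrightarrow> continuous_on UNIV f"
  by (induction k) (use Ck_Suc_imp in auto)

lemma Ck_bounded_linear:
  assumes "bounded_linear L" "Ck_on k UNIV f"
  shows "Ck_on k UNIV (\<lambda>x. L (f x))"
  using assms(2)
proof (induction k arbitrary: f)
  case 0
  then show ?case using bounded_linear.continuous_on[OF assms(1)] by auto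
next
  case (Suc k)
  obtain f' where f': "\<And>x. (f has_derivative f' x) (at x)" "\<And>u. Ck_on k UNIV (\<lambda>x. f' x u)"
    using Suc.prems by (rule Ck_SucE) blast
  show ?case by (rule Ck_SucI[OF bounded_linear.has_derivative[OF assms(1) f'(1)] Suc.IH[OF f'(2)]])
qed

lemma Ck_add:
  "Ck_on k UNIV f \<Longrightarrow> Ck_on k UNIV g \<Longrightarrow> Ck_on k UNIV (\<lambda>x. f x + g x)"
proof (induction k arbitrary: f g)
  case 0
  then show ?case by (auto intro!: continuous_intros)
next
  case (Suc k)
  obtain f' where f': "\<And>x. (f has_derivative f' x) (at x)" "\<And>u. Ck_on k UNIV (\<lambda>x. f' x u)"
    using Suc.prems(1) by (rule Ck_SucE) blast
  obtain g' where g': "\<And>x. (g has_derivative g' x) (at x)" "\<And>u. Ck_on k UNIV (\<lambda>x. g' x u)"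
    using Suc.prems(2) by (rule Ck_SucE) blast
  show ?case by (rule Ck_SucI[OF has_derivative_add[OF f'(1) g'(1)] Suc.IH[OF f'(2) g'(2)]])
qed

lemma Ck_sum:
  "finite I \<Longrightarrow> (\<And>i. i \<in> I \<Longrightarrow> Ck_on k UNIV (f i)) \<Longrightarrow> Ck_on k UNIV (\<lambda>x. \<Sum>i\<in>I. f i x)"
  by (induction I rule: finite_induct) (auto intro!: Ck_add Ck_on_const)

lemma Ck_bilinear:
  assumes "bounded_bilinear B"
  shows "Ck_on k UNIV f \<Longrightarrow> Ck_on k UNIV g \<Longrightarrow> Ck_on k UNIV (\<lambda>x. B (f x) (g x))"
proof (induction k arbitrary: f g)
  case 0
  then show ?case using bounded_bilinear.continuous_on[OF assms] by auto
next
  case (Suc k)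
  obtain f' where f': "\<And>x. (f has_derivative f' x) (at x)" "\<And>u. Ck_on k UNIV (\<lambda>x. f' x u)"
    using Suc.prems(1) by (rule Ck_SucE) blast
  obtain g' where g': "\<And>x. (g has_derivative g' x) (at x)" "\<And>u. Ck_on k UNIV (\<lambda>x. g' x u)"
    using Suc.prems(2) by (rule Ck_SucE) blast
  show ?case
    by (rule Ck_SucI[OF bounded_bilinear.FDERIV[OF assms f'(1) g'(1)]])
      (intro Ck_add Suc.IH f'(2) g'(2) Ck_Suc_imp[OF Suc.prems(1)] Ck_Suc_imp[OF Suc.prems(2)])
qed

lemmas Ck_mult = Ck_bilinear[OF bounded_bilinear_mult]
lemmas Ck_scaleR = Ck_bilinear[OF bounded_bilinear_scaleR]

lemma Ck_prod:
  fixes f :: "'i \<Rightarrow> 'a::real_normed_vector \<Rightarrow> 'b::real_normed_field"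
  shows "finite I \<Longrightarrow> (\<And>i. i \<in> I \<Longrightarrow> Ck_on k UNIV (f i)) \<Longrightarrow> Ck_on k UNIV (\<lambda>x. \<Prod>i\<in>I. f i x)"
  by (induction I rule: finite_induct) (auto intro!: Ck_mult Ck_on_const)

lemma Ck_inverse:
  fixes f :: "'a::real_normed_vector \<Rightarrow> 'b::real_normed_field"
  assumes "\<And>x. f x \<noteq> 0"
  shows "Ck_on k UNIV f \<Longrightarrow> Ck_on k UNIV (\<lambda>x. inverse (f x))"
proof (induction k)
  case 0
  then show ?case using assms by (auto intro!: continuous_intros)
next
  case (Suc k)
  obtain f' where f': "\<And>x. (f has_derivative f' x) (at x)" "\<And>u. Ck_on k UNIV (\<lambda>x. f' x u)"
    using Suc.prems by (rule Ck_SucE) blast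
  have inv: "Ck_on k UNIV (\<lambda>x. inverse (f x))" by (rule Suc.IH[OF Ck_Suc_imp[OF Suc.prems]])
  have "Ck_on k UNIV (\<lambda>x. - (inverse (f x) * f' x u * inverse (f x)))" for u
    by (intro Ck_bounded_linear[OF bounded_linear_minus[OF bounded_linear_ident]] Ck_mult inv f')
  then show ?case by (rule Ck_SucI[where f' = "\<lambda>x u. - (inverse (f x) * f' x u * inverse (f x))", rotated])
      (rule Deriv.has_derivative_inverse[OF assms f'(1)])
qed

lemma Ck_compose:
  fixes f :: "'a::real_normed_vector \<Rightarrow> 'b::euclidean_space"
  shows "Ck_on k UNIV f \<Longrightarrow> Ck_on k UNIV g \<Longrightarrow> Ck_on k UNIV (\<lambda>x. g (f x))"
proof (induction k arbitrary: g)
  case 0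
  then show ?case using continuous_on_compose2[of UNIV g UNIV f] by auto
next
  case (Suc k)
  obtain f' where f': "\<And>x. (f has_derivative f' x) (at x)" "\<And>u. Ck_on k UNIV (\<lambda>x. f' x u)"
    using Suc.prems(1) by (rule Ck_SucE) blast
  obtain g' where g': "\<And>x. (g has_derivative g' x) (at x)" "\<And>u. Ck_on k UNIV (\<lambda>x. g' x u)"
    using Suc.prems(2) by (rule Ck_SucE) blast
  \<comment> \<open>In the chain rule the direction \<open>f' x u\<close> varies with
    \<open>x\<close>. Expanding it in the basis leaves derivatives of \<open>g\<close> in fixed
    directions, to which the induction hypothesis applies.\<close>
  have "Ck_on k UNIV (\<lambda>x. \<Sum>b\<in>Basis. (f' x u \<bullet> b) *\<^sub>R g' (f x) b)" for u
    by (intro Ck_sum Ck_scaleR Ck_bounded_linear[OF bounded_linear_inner_left] f'(2) Suc.IH Ck_Suc_imp[OF Suc.prems(1)] g'(2)) auto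
  moreover have "g' (f x) (f' x u) = (\<Sum>b\<in>Basis. (f' x u \<bullet> b) *\<^sub>R g' (f x) b)" for x u
  proof -
    have lin: "linear (g' (f x))" by (rule has_derivative_linear[OF g'(1)])
    have "g' (f x) (f' x u) = g' (f x) (\<Sum>b\<in>Basis. (f' x u \<bullet> b) *\<^sub>R b)" by (simp add: euclidean_representation)
    also have "\<dots> = (\<Sum>b\<in>Basis. (f' x u \<bullet> b) *\<^sub>R g' (f x) b)" by (simp add: linear_sum[OF lin] linear_scale[OF lin])
    finally show ?thesis .
  qed
  ultimately have "Ck_on k UNIV (\<lambda>x. g' (f x) (f' x u))" for u by simp
  then show ?case by (rule Ck_SucI[OF has_derivative_compose[OF f'(1) g'(1)]])
qed

lemma Ck_vec:
  fixes f :: "'a::real_normed_vector \<Rightarrow> real ^ 'd::finite"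
  assumes "\<And>i. Ck_on k UNIV (\<lambda>x. f x $ i)"
  shows "Ck_on k UNIV f"
proof -
  have "Ck_on k UNIV (\<lambda>x. \<Sum>i\<in>UNIV. f x $ i *\<^sub>R (axis i 1 :: real ^ 'd))"
    by (intro Ck_sum Ck_scaleR assms Ck_on_const) auto
  moreover have "(\<Sum>i\<in>UNIV. f x $ i *\<^sub>R axis i 1) = f x" for x
    by (simp add: vec_eq_iff axis_def if_distrib cong: if_cong)
  ultimately show ?thesis by (simp only:)
qed

lemma Ck_det:
  fixes M :: "'a::real_normed_vector \<Rightarrow> real ^ 'd::finite ^ 'd"
  assumes "\<And>i j. Ck_on k UNIV (\<lambda>x. M x $ i $ j)"
  shows "Ck_on k UNIV (\<lambda>x. det (M x))"
  unfolding det_def by (intro Ck_sum Ck_mult Ck_prod Ck_on_const assms) auto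

text \<open>Cramer's rule writes the solution as a rational function of the entries of
  \<open>M\<close>. It is applied to the derivative of an inverse map.\<close>

lemma Ck_solve:
  fixes M :: "'a::real_normed_vector \<Rightarrow> real ^ 'd::finite ^ 'd"
  assumes M: "\<And>i j. Ck_on k UNIV (\<lambda>x. M x $ i $ j)" and det: "\<And>x. det (M x) \<noteq> 0" and sol: "\<And>x. M x *v N x = u"
  shows "Ck_on k UNIV N"
proof (rule Ck_vec)
  fix i
  have "Ck_on k UNIV (\<lambda>x. (\<chi> l j. if j = i then u $ l else M x $ l $ j) $ l $ j)" for l j
    by (cases "j = i") (simp_all add: Ck_on_const M)
  then have "Ck_on k UNIV (\<lambda>x. det (\<chi> l j. if j = i then u $ l else M x $ l $ j) * inverse (det (M x)))"
    by (intro Ck_mult Ck_inverse Ck_det det M)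
  moreover have "N x $ i = det (\<chi> l j. if j = i then u $ l else M x $ l $ j) * inverse (det (M x))" for x
    using cramer[OF det, of x "N x" u] sol by (simp add: divide_inverse)
  ultimately show "Ck_on k UNIV (\<lambda>x. N x $ i)" by simp
qed

lemma has_derivative_dominated_series:
  fixes f :: "nat \<Rightarrow> 'a::real_normed_vector \<Rightarrow> 'b::banach"
  assumes "\<And>n x. (f n has_derivative f' n x) (at x)" "\<And>n x u. norm (f' n x u) \<le> B n * norm u" "summable B"
    "\<And>x. (\<lambda>n. f n x) sums g x"
  shows "(g has_derivative (\<lambda>u. \<Sum>n. f' n x u)) (at x)" "(\<lambda>n. f' n x u) sums (\<Sum>n. f' n x u)"
proof -
  have Bu: "summable (\<lambda>n. B n * norm u)" for u :: 'a by (rule summable_mult2[OF assms(3)])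
  have sm: "summable (\<lambda>n. f' n x u)" for x u
    by (rule summable_comparison_test'[OF Bu assms(2)])
  show "(\<lambda>n. f' n x u) sums (\<Sum>n. f' n x u)" by (rule summable_sums[OF sm])
  have "\<exists>G. \<forall>x\<in>UNIV. (\<lambda>n. f n x) sums G x \<and> (G has_derivative (\<lambda>u. \<Sum>n. f' n x u)) (at x within UNIV)"
  proof (rule has_derivative_series[where f' = f' and x = x and l = "g x"])
    fix e :: real assume "0 < e"
    then obtain N where N: "\<And>n. n \<ge> N \<Longrightarrow> norm (\<Sum>i. B (i + n)) < e"
      using suminf_exist_split[OF _ assms(3)] by blast
    have "norm ((\<Sum>i<n. f' i y w) - (\<Sum>n. f' n y w)) \<le> e * norm w" if "n \<ge> N" for n y w
    proof -
      have "(\<Sum>n. f' n y w) - (\<Sum>i<n. f' i y w) = (\<Sum>i. f' (i + n) y w)"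
        using suminf_split_initial_segment[OF sm, of y w n] by simp
      also have "norm \<dots> \<le> (\<Sum>i. B (i + n) * norm w)"
        by (rule norm_suminf_le[OF assms(2) summable_ignore_initial_segment[OF Bu]])
      also have "\<dots> = (\<Sum>i. B (i + n)) * norm w"
        by (intro suminf_mult2[symmetric] summable_ignore_initial_segment assms)
      also have "\<dots> \<le> e * norm w"
        using N[OF that] by (intro mult_right_mono) auto
      finally show ?thesis by (simp add: norm_minus_commute)
    qed
    then show "\<forall>\<^sub>F n in sequentially. \<forall>y\<in>UNIV. \<forall>w. norm ((\<Sum>i<n. f' i y w) - (\<Sum>n. f' n y w)) \<le> e * norm w"
      unfolding eventually_sequentially by blast
  qed (use assms in auto)
  then obtain G where G: "\<And>x. (\<lambda>n. f n x) sums G x" "\<And>x. (G has_derivative (\<lambda>u. \<Sum>n. f' n x u)) (at x)" by auto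
  have "G = g" using sums_unique2[OF G(1) assms(4)] by auto
  then show "(g has_derivative (\<lambda>u. \<Sum>n. f' n x u)) (at x)" using G(2) by simp
qed

section \<open>Differentiability of Fourier series on the real space\<close>

lemma cvec_add: "cvec (x + y) = cvec x + cvec y"
  by (simp add: cvec_def vec_eq_iff)

lemma cvec_scaleR: "cvec (r *\<^sub>R x) = r *\<^sub>R cvec x"
  by (simp add: cvec_def vec_eq_iff) (simp add: scaleR_conv_of_real)

lemma bounded_linear_cvec: "bounded_linear (cvec :: real ^ 'd::finite \<Rightarrow> _)"
  by (rule linear_conv_bounded_linear[THEN iffD1], rule linearI) (auto simp: cvec_add cvec_scaleR)

lemma wien_power_derivative:
  fixes u :: "complex ^ 'd::finite \<Rightarrow> complex"
  assumes "wien (\<lambda>k. (1 + knorm k) ^ Suc m) (range cvec) C u"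
  obtains U where "\<And>x. ((\<lambda>x. u (cvec x)) has_derivative (\<lambda>w. U w (cvec x))) (at x)"
    "\<And>w. \<exists>C. wien (\<lambda>k. (1 + knorm k) ^ m) (range cvec) C (U w)"
proof -
  obtain c A where c: "((\<lambda>k. norm (c k) * (1 + knorm k) ^ Suc m) has_sum A) UNIV" "A \<le> C"
    "\<And>z. z \<in> range cvec \<Longrightarrow> ((\<lambda>k. c k * em k z) has_sum u z) UNIV"
    using assms by (rule wienE) blast
  define U :: "real ^ 'd \<Rightarrow> complex ^ 'd \<Rightarrow> complex" where
    "U w z = (\<Sum>\<^sub>\<infinity>k. (2 * of_real pi * \<i> * kdot k (cvec w)) * c k * em k z)" for w z
  have kb: "norm (2 * of_real pi * \<i> * kdot k (cvec w)) \<le> 2 * pi * knorm k * norm w" for k and w :: "real ^ 'd"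
    using norm_kdot_le[of "cvec w" "norm w" k] component_le_norm_cart[of w]
    by (simp add: norm_mult cvec_def mult.assoc)
  show thesis
  proof (rule that[of U])
    show "((\<lambda>x. u (cvec x)) has_derivative (\<lambda>w. U w (cvec x))) (at x)" for x
      unfolding U_def em_def
    proof (rule has_derivative_exp_series[where S = UNIV and E = "\<lambda>k. 1" and L = "\<lambda>k. 2 * pi * knorm k"])
      show "bounded_linear (\<lambda>x :: real ^ 'd. 2 * of_real pi * \<i> * kdot k (cvec x))" for k
        by (intro bounded_linear_const_mult bounded_linear_compose[OF bounded_linear_kdot bounded_linear_cvec])
      show "norm (exp (2 * of_real pi * \<i> * kdot k (cvec y))) \<le> 1" for k and y :: "real ^ 'd"
        using norm_em_cvec[of k y] by (simp add: em_def)
      show "(\<lambda>k. norm (c k) * 1 * (2 * pi * knorm k)) summable_on UNIV"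
      proof (rule summable_on_comparison_test[OF summable_on_cmult_right[OF has_sum_imp_summable[OF c(1)]]])
        fix k :: "int ^ 'd"
        have "(1 + knorm k) ^ 1 \<le> (1 + knorm k) ^ Suc m" by (rule power_increasing) auto
        then have "knorm k \<le> (1 + knorm k) ^ Suc m" unfolding power_one_right by linarith
        then have "norm (c k) * (2 * pi) * knorm k \<le> norm (c k) * (2 * pi) * (1 + knorm k) ^ Suc m"
          by (intro mult_left_mono) auto
        then show "norm (c k) * 1 * (2 * pi * knorm k) \<le> (2 * pi) * (norm (c k) * (1 + knorm k) ^ Suc m)"
          by (simp only: mult_ac mult_1_right mult_1)
      qed simp
      show "((\<lambda>k. c k * exp (2 * of_real pi * \<i> * kdot k (cvec y))) has_sum u (cvec y)) UNIV" for y
        using c(3)[of "cvec y"] by (simp add: em_def)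
    qed (use kb in auto)
    show "\<exists>C. wien (\<lambda>k. (1 + knorm k) ^ m) (range cvec) C (U w)" for w
    proof (rule exI)
      show "wien (\<lambda>k. (1 + knorm k) ^ m) (range cvec) (2 * pi * norm w * A) (U w)"
        unfolding U_def[abs_def]
      proof (rule wien_multiplier(1)[OF c(1)])
        show "norm (em k z) \<le> (1 + knorm k) ^ m" if "z \<in> range cvec" for z and k :: "int ^ 'd"
          using that by (auto intro!: one_le_power)
        show "norm (2 * of_real pi * \<i> * kdot k (cvec w)) * (1 + knorm k) ^ m \<le> 2 * pi * norm w * (1 + knorm k) ^ Suc m" for k
        proof -
          have "2 * pi * norm w * (1 + knorm k) = 2 * pi * norm w + 2 * pi * knorm k * norm w" "0 \<le> 2 * pi * norm w"
            by (auto simp: algebra_simps)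
          then have "norm (2 * of_real pi * \<i> * kdot k (cvec w)) \<le> 2 * pi * norm w * (1 + knorm k)"
            using kb[of k w] by linarith
          then have "norm (2 * of_real pi * \<i> * kdot k (cvec w)) * (1 + knorm k) ^ m \<le> 2 * pi * norm w * (1 + knorm k) * (1 + knorm k) ^ m"
            by (intro mult_right_mono) auto
          then show ?thesis by (simp add: mult.assoc)
        qed
      qed auto
    qed
  qed
qed

text \<open>Each derivative uses one power of the weight, by \<open>wien_power_derivative\<close>.
  The last power gives continuity, by way of one more derivative.\<close>

lemma Ck_wien_power:
  assumes "wien (\<lambda>k. (1 + knorm k) ^ Suc m) (range cvec) C u"
  shows "Ck_on m UNIV (\<lambda>x. u (cvec x))"
  using assms
proof (induction m arbitrary: u C)
  case 0
  obtain U where "\<And>x. ((\<lambda>x. u (cvec x)) has_derivative (\<lambda>w. U w (cvec x))) (at x)"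
    using 0 by (rule wien_power_derivative) blast
  then have "isCont (\<lambda>x. u (cvec x)) x" for x by (rule has_derivative_continuous)
  then show ?case by (simp add: continuous_at_imp_continuous_on)
next
  case (Suc m)
  obtain U where U: "\<And>x. ((\<lambda>x. u (cvec x)) has_derivative (\<lambda>w. U w (cvec x))) (at x)"
    "\<And>w. \<exists>C. wien (\<lambda>k. (1 + knorm k) ^ Suc m) (range cvec) C (U w)"
    using Suc.prems by (rule wien_power_derivative) blast
  show ?case by (rule Ck_SucI[OF U(1)]) (use U(2) Suc.IH in blast)
qed

lemma em_periodic: "em k (cvec (x + (\<chi> j. of_int (m $ j)))) = em k (cvec x)"
proof -
  have "kdot k (cvec (\<chi> j. of_int (m $ j))) = of_int (\<Sum>j\<in>UNIV. k $ j * m $ j)"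
    by (simp add: kdot_def cvec_def)
  then have "em k (cvec (\<chi> j. of_int (m $ j))) = exp (2 * of_real pi * \<i> * of_int (\<Sum>j\<in>UNIV. k $ j * m $ j))"
    by (simp add: em_def)
  also have "\<dots> = 1" by (simp only: exp_eq_1) (auto intro: exI[of _ "\<Sum>j\<in>UNIV. k $ j * m $ j"])
  finally show ?thesis by (simp add: cvec_add em_add_right)
qed

lemma wien_periodic:
  assumes "wien \<omega> (range cvec) C u"
  shows "u (cvec (x + (\<chi> j. of_int (m $ j)))) = u (cvec x)"
proof -
  obtain c A where c: "((\<lambda>k. norm (c k) * \<omega> k) has_sum A) UNIV" "A \<le> C"
    "\<And>z. z \<in> range cvec \<Longrightarrow> ((\<lambda>k. c k * em k z) has_sum u z) UNIV"
    using assms by (rule wienE) blast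
  have "((\<lambda>k. c k * em k (cvec x)) has_sum u (cvec (x + (\<chi> j. of_int (m $ j))))) UNIV"
    using c(3)[of "cvec (x + (\<chi> j. of_int (m $ j)))"] by (simp add: em_periodic)
  then show ?thesis using c(3)[of "cvec x"] has_sum_unique by blast
qed

text \<open>A polynomial weight of order \<open>m\<close> costs \<open>s ^ m\<close> in the
  denominator. Along the iteration this is a factor \<open>4 ^ (m * n)\<close>, which corrections
  decaying to every order outweigh.\<close>

lemma Bs_imp_power:
  assumes "Bs s C u" "0 < s" "s \<le> 1"
  shows "wien (\<lambda>k. (1 + knorm k) ^ m) (range cvec) (fact m * exp 1 / s ^ m * C) u"
proof (rule wien_change[OF assms(1)])
  fix k :: "int ^ 'a"
  have "(s * (1 + knorm k)) ^ m \<le> fact m * exp (s * (1 + knorm k))"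
    using assms by (intro power_le_fact_exp) auto
  also have "\<dots> \<le> fact m * (exp 1 * exp (s * knorm k))"
    unfolding exp_add[symmetric] using assms by (intro mult_left_mono) (auto simp: algebra_simps)
  finally have "s ^ m * (1 + knorm k) ^ m \<le> fact m * exp 1 * exp (s * knorm k)" by (simp add: power_mult_distrib)
  then show "(1 + knorm k) ^ m \<le> fact m * exp 1 / s ^ m * exp (s * knorm k)" using assms by (simp add: field_simps)
qed (use assms cvec_in_strip in auto)

section \<open>Convergence of the Newton sequence\<close>

context diophantine begin

lemma kam:
  assumes "0 < c0"
  obtains \<eta> where "0 < \<eta>"
    "\<And>a. (\<And>i k. a i (- k) = cnj (a i k)) \<Longrightarrow> (\<And>i m. (\<lambda>k. norm (a i k) * (1 + knorm k) ^ m) summable_on UNIV) \<Longrightarrow>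
      (\<And>i. (\<Sum>\<^sub>\<infinity>k. norm (a i k) * (1 + knorm k) ^ (2 * Q + 1)) \<le> \<eta>) \<Longrightarrow>
      \<exists>h h' b w. (\<forall>m. Ck_on m UNIV h) \<and> (\<forall>x. (h has_derivative h' x) (at x)) \<and>
        (\<forall>x m. h (x + (\<chi> j. of_int (m $ j))) = h x) \<and> (\<forall>x u. norm (h' x u) \<le> c0 * norm u) \<and>
        \<bar>b - 1\<bar> \<le> c0 \<and> w \<bullet> v = 0 \<and>
        (\<forall>x i. b * (v $ i + h' x v $ i) + w $ i = v $ i + Re (\<Sum>\<^sub>\<infinity>k. a i k * em k (cvec (x + h x))))"
proof -
  define d where "d = real CARD('d)"
  have d1: "1 \<le> d" by (simp add: d_def Suc_leI)
  \<comment> \<open>The bounds \<open>1 / 2\<close> and \<open>1 / (4 * d ^ 3)\<close> are required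
    by \<open>kam_sequence\<close>. The last one is there because turning entrywise bounds on the
    gradient into a Euclidean bound costs \<open>d\<^sup>2\<close>.\<close>
  define ct where "ct = min (1 / 2) (min (1 / (4 * d ^ 3)) (c0 / d\<^sup>2))"
  have ct: "0 < ct" "ct \<le> 1 / 2" "4 * d ^ 3 * ct \<le> 1" "d\<^sup>2 * ct \<le> c0"
  proof -
    show "0 < ct" using assms d1 by (simp add: ct_def)
    show "ct \<le> 1 / 2" unfolding ct_def by (rule min.cobounded1)
    have "ct \<le> 1 / (4 * d ^ 3)" "ct \<le> c0 / d\<^sup>2" unfolding ct_def by linarith+
    then show "4 * d ^ 3 * ct \<le> 1" "d\<^sup>2 * ct \<le> c0" using d1 by (simp_all add: field_simps)
  qed
  obtain \<eta> where \<eta>: "0 < \<eta>" and seq: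
    "\<And>a. (\<And>i k. a i (- k) = cnj (a i k)) \<Longrightarrow> (\<And>i m. (\<lambda>k. norm (a i k) * (1 + knorm k) ^ m) summable_on UNIV) \<Longrightarrow>
      (\<And>i. (\<Sum>\<^sub>\<infinity>k. norm (a i k) * (1 + knorm k) ^ (2 * Q + 1)) \<le> \<eta>) \<Longrightarrow>
      \<exists>h b w e. newton_sequence ct a h b w e"
    using kam_sequence[OF ct(1,2)] ct(3) unfolding d_def by blast
  show thesis
  proof (rule that[OF \<eta>])
    fix a :: "'d \<Rightarrow> int ^ 'd \<Rightarrow> complex"
    assume herm: "\<And>i k. a i (- k) = cnj (a i k)" and sm: "\<And>i m. (\<lambda>k. norm (a i k) * (1 + knorm k) ^ m) summable_on UNIV"
      and a\<eta>: "\<And>i. (\<Sum>\<^sub>\<infinity>k. norm (a i k) * (1 + knorm k) ^ (2 * Q + 1)) \<le> \<eta>"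
    obtain h b w e where X: "newton_sequence ct a h b w e"
      using seq[of a, OF herm sm a\<eta>] by blast
    have h0: "h 0 = (\<lambda>i z. 0)" and b0: "b 0 = 1" and wv: "\<And>n. w n \<bullet> v = 0"
      and def: "\<And>n i. Bs ((1 / 4) ^ n) (e n) (defect v (F n) a (h n) (b n) (w n) i)"
      and hr: "\<And>n i. realon (h n i)"
      and d0: "\<And>n i. Bs ((1 / 4) ^ Suc n) (e n) (\<lambda>z. h (Suc n) i z - h n i z)"
      and d1': "\<And>n i j. Bs ((1 / 4) ^ Suc n) (e n) (Dd (axis j 1) (\<lambda>z. h (Suc n) i z - h n i z))"
      and bw: "\<And>n. \<bar>b (Suc n) - b n\<bar> \<le> e n" "\<And>n. norm (w (Suc n) - w n) \<le> e n"
      and es: "\<And>n. e n \<le> ct / 2 * (1 / 4) ^ n" and dec: "\<And>m. \<exists>K. \<forall>n. e n \<le> K * (1 / 4) ^ (m * n)"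
      using X unfolding newton_sequence_def by blast+
    define \<delta> where "\<delta> n i z = h (Suc n) i z - h n i z" for n i z
    have B\<delta>: "Bs ((1 / 4) ^ Suc n) (e n) (\<delta> n i)" "Bs ((1 / 4) ^ Suc n) (e n) (Dd (axis j 1) (\<delta> n i))" for n i j
      using d0 d1' unfolding \<delta>_def[abs_def] by blast+
    have sp: "0 < (1 / 4 :: real) ^ n" "(1 / 4 :: real) ^ n \<le> 1" for n by (auto simp: power_le_one)
    have cs: "cvec x \<in> strip ((1 / 4) ^ n)" for x :: "real ^ 'd" and n by (rule cvec_in_strip) simp
    have e0: "0 \<le> e n" for n using Bs_nonneg[OF _ def] sp(1)[of n] by (meson less_imp_le)
    have esum: "summable e" "suminf e \<le> ct"
    proof -
      have g: "(\<lambda>n. ct / 2 * (1 / 4) ^ n) sums (ct / 2 * (1 / (1 - 1 / 4)))"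
        by (intro sums_mult geometric_sums) simp
      show "summable e" using es e0 by (intro summable_comparison_test'[OF sums_summable[OF g]]) auto
      from suminf_le[OF es this sums_summable[OF g]] have "suminf e \<le> ct / 2 * (1 / (1 - 1 / 4))" using sums_unique[OF g] by simp
      then show "suminf e \<le> ct" using ct(1) by simp
    qed
    have e_lim: "e \<longlonglongrightarrow> 0" by (rule summable_LIMSEQ_zero[OF esum(1)])
    have D\<delta>: "norm (Dd (cvec u) (\<delta> n i) (cvec x)) \<le> d * e n * norm u" for u x n i
    proof -
      have "norm (Dd (cvec u) (\<delta> n i) (cvec x)) \<le> (\<Sum>j\<in>UNIV. norm (cvec u $ j * Dd (axis j 1) (\<delta> n i) (cvec x)))"
        unfolding Dd_expand[OF B\<delta>(1) cs, of "cvec u" n i x] by (rule norm_sum)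
      also have "\<dots> \<le> (\<Sum>j\<in>(UNIV::'d set). norm u * e n)"
      proof (rule sum_mono)
        fix j
        have "norm (cvec u $ j) \<le> norm u" using component_le_norm_cart[of u j] by (simp add: cvec_def)
        moreover have "norm (Dd (axis j 1) (\<delta> n i) (cvec x)) \<le> e n" by (rule Bs_bound[OF _ B\<delta>(2) cs]) simp
        ultimately show "norm (cvec u $ j * Dd (axis j 1) (\<delta> n i) (cvec x)) \<le> norm u * e n"
          unfolding norm_mult by (intro mult_mono) auto
      qed
      finally show ?thesis by (simp add: d_def mult_ac)
    qed
    have n\<delta>: "norm (\<delta> n i (cvec x)) \<le> e n" for n i x by (rule Bs_bound[OF _ B\<delta>(1) cs]) simp
    have sum\<delta>: "summable (\<lambda>n. norm (\<delta> n i (cvec x)))" for i x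
      by (rule summable_comparison_test'[OF esum(1)]) (use n\<delta> in simp)
    define U where "U i z = (\<Sum>n. \<delta> n i z)" for i z
    have U: "(\<lambda>n. \<delta> n i (cvec x)) sums U i (cvec x)" for i x
      unfolding U_def by (rule summable_sums[OF summable_norm_cancel[OF sum\<delta>]])
    have Uhas: "((\<lambda>n. \<delta> n i (cvec x)) has_sum U i (cvec x)) UNIV" for i x
      by (rule norm_summable_imp_has_sum[OF sum\<delta> U])
    have hsum: "h n i z = (\<Sum>j<n. \<delta> j i z)" for n i z
      by (induction n) (auto simp: h0 \<delta>_def)
    have hU: "(\<lambda>n. h n i (cvec x)) \<longlonglongrightarrow> U i (cvec x)" for i x
      using U[of i x] unfolding sums_def hsum .
    have Uw: "\<exists>C. wien (\<lambda>k. (1 + knorm k) ^ m) (range cvec) C (U i)" for i m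
    proof -
      \<comment> \<open>Order \<open>Suc m\<close> instead of \<open>m\<close>: after the loss of
        \<open>4 ^ (m * n)\<close> a convergent geometric series remains.\<close>
      obtain K where K: "\<And>n. e n \<le> K * (1 / 4) ^ (Suc m * n)" using dec by blast
      have K0: "0 \<le> K" using order_trans[OF e0 K[of 0]] by simp
      define C where "C n = fact m * exp 1 * 4 ^ m * K * (1 / 4) ^ n" for n
      have le: "fact m * exp 1 / ((1 / 4) ^ Suc n) ^ m * e n \<le> C n" for n
      proof -
        have "fact m * exp 1 / ((1 / 4) ^ Suc n) ^ m * e n \<le> fact m * exp 1 / ((1 / 4) ^ Suc n) ^ m * (K * (1 / 4) ^ (Suc m * n))"
          using K by (intro mult_left_mono) auto
        also have "\<dots> = C n"
        proof -
          have "((1 / 4 :: real) ^ Suc n) ^ m = (1 / 4) ^ m * (1 / 4) ^ (m * n)"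
            by (simp only: power_mult[symmetric] power_add[symmetric]) (simp add: algebra_simps)
          moreover have "(1 / 4 :: real) ^ (Suc m * n) = (1 / 4) ^ n * (1 / 4) ^ (m * n)"
            by (simp only: power_add[symmetric]) simp
          ultimately show ?thesis by (simp add: C_def power_one_over)
        qed
        finally show ?thesis .
      qed
      have "(\<lambda>n. (1 / 4 :: real) ^ n) sums (1 / (1 - 1 / 4))" by (intro geometric_sums) simp
      then have "(C has_sum (fact m * exp 1 * 4 ^ m * K * (1 / (1 - 1 / 4)))) UNIV"
        unfolding C_def[abs_def] by (intro has_sum_cmult_right norm_summable_imp_has_sum) (auto simp: norm_power intro!: summable_geometric)
      then have "wien (\<lambda>k. (1 + knorm k) ^ m) (range cvec) (fact m * exp 1 * 4 ^ m * K * (1 / (1 - 1 / 4))) (U i)"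
      proof (rule fourier_weight.wien_series[OF fourier_weight_power, rotated])
        show "wien (\<lambda>k. (1 + knorm k) ^ m) (range cvec) (C n) (\<delta> n i)" for n
          by (rule fourier_weight.wien_mono[OF fourier_weight_power Bs_imp_power[OF B\<delta>(1) sp] le])
        show "((\<lambda>n. \<delta> n i z) has_sum U i z) UNIV" if "z \<in> range cvec" for z using Uhas that by auto
      qed
      then show ?thesis by blast
    qed
    define H :: "real ^ 'd \<Rightarrow> real ^ 'd" where "H x = (\<chi> i. Re (U i (cvec x)))" for x
    define H' :: "real ^ 'd \<Rightarrow> real ^ 'd \<Rightarrow> real ^ 'd" where "H' x u = (\<chi> i. Re (\<Sum>n. Dd (cvec u) (\<delta> n i) (cvec x)))" for x u
    have CkH: "Ck_on m UNIV H" for m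
    proof (rule Ck_vec)
      fix i
      obtain C where "wien (\<lambda>k. (1 + knorm k) ^ Suc m) (range cvec) C (U i)" using Uw by blast
      then have "Ck_on m UNIV (\<lambda>x. U i (cvec x))" by (rule Ck_wien_power)
      then show "Ck_on m UNIV (\<lambda>x. H x $ i)" unfolding H_def using Ck_bounded_linear[OF bounded_linear_Re] by simp
    qed
    have d\<delta>: "((\<lambda>x. \<delta> n i (cvec x)) has_derivative (\<lambda>u. Dd (cvec u) (\<delta> n i) (cvec x))) (at x)" for n i x
      using has_derivative_compose[OF bounded_linear_imp_has_derivative[OF bounded_linear_cvec], of "\<delta> n i" "\<lambda>w. Dd w (\<delta> n i) (cvec x)"]
        Bs_has_derivative[OF B\<delta>(1) cs] by blast
    have dB: "summable (\<lambda>n. d * e n)" by (rule summable_mult[OF esum(1)])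
    have dU: "((\<lambda>x. U i (cvec x)) has_derivative (\<lambda>u. \<Sum>n. Dd (cvec u) (\<delta> n i) (cvec x))) (at x)"
      "(\<lambda>n. Dd (cvec u) (\<delta> n i) (cvec x)) sums (\<Sum>n. Dd (cvec u) (\<delta> n i) (cvec x))" for i x u
      using has_derivative_dominated_series[where f = "\<lambda>n x. \<delta> n i (cvec x)" and f' = "\<lambda>n x u. Dd (cvec u) (\<delta> n i) (cvec x)"
          and B = "\<lambda>n. d * e n" and g = "\<lambda>x. U i (cvec x)", OF d\<delta> D\<delta> dB U] by blast+
    have dH: "(H has_derivative H' x) (at x)" for x
    proof (rule has_derivative_componentwise_within[THEN iffD2], rule ballI)
      fix k :: "real ^ 'd" assume "k \<in> Basis"
      then obtain i where k: "k = axis i 1" by (auto simp: Basis_vec_def)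
      show "((\<lambda>x. H x \<bullet> k) has_derivative (\<lambda>y. H' x y \<bullet> k)) (at x)"
        unfolding k inner_axis H_def H'_def using bounded_linear.has_derivative[OF bounded_linear_Re dU(1)] by simp
    qed
    have perH: "H (x + (\<chi> j. of_int (m $ j))) = H x" for x m
    proof -
      have "U i (cvec (x + (\<chi> j. of_int (m $ j)))) = U i (cvec x)" for i
        using Uw[of 0 i] wien_periodic by blast
      then show ?thesis by (simp add: H_def)
    qed
    have nH': "norm (H' x u) \<le> c0 * norm u" for x u
    proof -
      have "norm (H' x u) \<le> (\<Sum>i\<in>UNIV. \<bar>H' x u $ i\<bar>)" by (rule norm_le_l1_cart)
      also have "\<dots> \<le> (\<Sum>i\<in>(UNIV::'d set). d * ct * norm u)"
      proof (rule sum_mono)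
        fix i
        have "\<bar>H' x u $ i\<bar> \<le> norm (\<Sum>n. Dd (cvec u) (\<delta> n i) (cvec x))"
          unfolding H'_def using abs_Re_le_cmod by simp
        also have "\<dots> \<le> (\<Sum>n. d * e n * norm u)" by (rule norm_suminf_le[OF D\<delta> summable_mult2[OF dB]])
        also have "\<dots> = d * suminf e * norm u"
          using suminf_mult2[OF dB, of "norm u"] suminf_mult[OF esum(1), of d] by simp
        also have "\<dots> \<le> d * ct * norm u" using esum d1 by (intro mult_right_mono mult_left_mono) auto
        finally show "\<bar>H' x u $ i\<bar> \<le> d * ct * norm u" .
      qed
      also have "\<dots> = d\<^sup>2 * ct * norm u" by (simp add: d_def power2_eq_square)
      also have "\<dots> \<le> c0 * norm u" using ct by (intro mult_right_mono) auto
      finally show ?thesis .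
    qed
    have sb: "summable (\<lambda>n. norm (b (Suc n) - b n))" using bw(1) by (intro summable_comparison_test'[OF esum(1)]) auto
    define B where "B = b 0 + (\<Sum>n. b (Suc n) - b n)"
    have bB: "b \<longlonglongrightarrow> B"
    proof -
      have "(\<lambda>n. \<Sum>j<n. b (Suc j) - b j) \<longlonglongrightarrow> (\<Sum>n. b (Suc n) - b n)"
        using summable_sums[OF summable_norm_cancel[OF sb]] by (simp add: sums_def)
      then have "(\<lambda>n. b 0 + (\<Sum>j<n. b (Suc j) - b j)) \<longlonglongrightarrow> B" unfolding B_def by (intro tendsto_intros)
      then show ?thesis by (simp add: sum_lessThan_telescope)
    qed
    have B1: "\<bar>B - 1\<bar> \<le> c0"
    proof -
      have "\<bar>B - 1\<bar> \<le> (\<Sum>n. norm (b (Suc n) - b n))" using summable_norm[OF sb] by (simp add: B_def b0)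
      also have "\<dots> \<le> suminf e" using bw(1) by (intro suminf_le sb esum) auto
      also have "\<dots> \<le> ct" by (rule esum)
      also have "\<dots> \<le> d\<^sup>2 * ct" using ct(1) d1 by (simp add: mult_le_cancel_right1 one_le_power)
      finally show ?thesis using ct(4) by linarith
    qed
    have sw: "summable (\<lambda>n. norm (w (Suc n) - w n))" using bw(2) by (intro summable_comparison_test'[OF esum(1)]) auto
    define W where "W = w 0 + (\<Sum>n. w (Suc n) - w n)"
    have wW: "w \<longlonglongrightarrow> W"
    proof -
      have "(\<lambda>n. \<Sum>j<n. w (Suc j) - w j) \<longlonglongrightarrow> (\<Sum>n. w (Suc n) - w n)"
        using summable_sums[OF summable_norm_cancel[OF sw]] by (simp add: sums_def)
      then have "(\<lambda>n. w 0 + (\<Sum>j<n. w (Suc j) - w j)) \<longlonglongrightarrow> W" unfolding W_def by (intro tendsto_intros)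
      then show ?thesis by (simp add: sum_lessThan_telescope)
    qed
    have Wv: "W \<bullet> v = 0"
      using LIMSEQ_unique[OF tendsto_inner[OF wW tendsto_const, of v]] wv by simp
    define P where "P i z = (\<Sum>\<^sub>\<infinity>k. a i k * em k z)" for i z
    have asum: "(\<lambda>k. norm (a i k)) summable_on UNIV" for i using sm[of i 0] by simp
    have ahas: "((\<lambda>k. a i k * em k (cvec y)) has_sum P i (cvec y)) UNIV" for i y
      unfolding P_def by (rule has_sum_infsum, rule abs_summable_summable) (simp add: norm_mult asum)
    have contP: "continuous_on UNIV (\<lambda>y. P i (cvec y))" for i
    proof -
      have "wien (\<lambda>k. (1 + knorm k) ^ Suc 0) (range cvec) (\<Sum>\<^sub>\<infinity>k. norm (a i k) * (1 + knorm k) ^ Suc 0) (P i)"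
        by (rule wienI[OF has_sum_infsum[OF sm]]) (use ahas in auto)
      then show ?thesis by (intro Ck_continuous[OF Ck_wien_power])
    qed
    \<comment> \<open>The truncated fields are evaluated at moving points, so their convergence to
      \<open>P\<close> must be uniform on the real space. Outside \<open>F n\<close> one power of
      the weight supplies the factor \<open>(1 / 4) ^ n\<close>.\<close>
    have tail: "norm (trigp (F n) a i (cvec y) - P i (cvec y)) \<le> (1 / 4) ^ n * (\<Sum>\<^sub>\<infinity>k. norm (a i k) * (1 + knorm k) ^ 1)" for n i y
    proof -
      have "((\<lambda>k. a i k * em k (cvec y)) has_sum (P i (cvec y) - trigp (F n) a i (cvec y))) (UNIV - F n)"
        unfolding trigp_def by (rule has_sum_Diff[OF ahas has_sum_finite[OF finite_F]]) auto
      moreover have "((\<lambda>k. (1 / 4) ^ n * (norm (a i k) * (1 + knorm k) ^ 1)) has_sum (\<Sum>\<^sub>\<infinity>k\<in>UNIV - F n. (1 / 4) ^ n * (norm (a i k) * (1 + knorm k) ^ 1))) (UNIV - F n)"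
        by (rule has_sum_infsum, rule summable_on_subset_banach[OF summable_on_cmult_right[OF sm]]) auto
      moreover have "norm (a i k * em k (cvec y)) \<le> (1 / 4) ^ n * (norm (a i k) * (1 + knorm k) ^ 1)" if "k \<in> UNIV - F n" for k
      proof -
        have "4 ^ n \<le> 1 + knorm k" using that by (auto simp: F_def)
        then have "1 \<le> (1 / 4) ^ n * (1 + knorm k)" by (simp add: power_one_over field_simps)
        then have "norm (a i k) * 1 \<le> norm (a i k) * ((1 / 4) ^ n * (1 + knorm k))" by (intro mult_left_mono) auto
        then show ?thesis by (simp add: norm_mult mult_ac)
      qed
      ultimately have "norm (P i (cvec y) - trigp (F n) a i (cvec y)) \<le> (\<Sum>\<^sub>\<infinity>k\<in>UNIV - F n. (1 / 4) ^ n * (norm (a i k) * (1 + knorm k) ^ 1))"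
        by (rule norm_infsum_le)
      also have "\<dots> \<le> (\<Sum>\<^sub>\<infinity>k. (1 / 4) ^ n * (norm (a i k) * (1 + knorm k) ^ 1))"
        by (intro infsum_mono2 summable_on_cmult_right summable_on_subset_banach[OF summable_on_cmult_right[OF sm]] sm) auto
      also have "\<dots> = (1 / 4) ^ n * (\<Sum>\<^sub>\<infinity>k. norm (a i k) * (1 + knorm k) ^ 1)" by (rule infsum_cmult_right'[of _ _ UNIV])
      finally show ?thesis by (simp add: norm_minus_commute)
    qed
    \<comment> \<open>Termwise limit of the defect, which itself tends to zero; the derivatives
      along \<open>v\<close> converge to the derivative of the limit by \<open>dU\<close>.\<close>
    have main: "B * (v $ i + H' x v $ i) + W $ i = v $ i + Re (P i (cvec (x + H x)))" for x i
    proof -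
      define y where "y n = x + (\<chi> j. Re (h n j (cvec x)))" for n
      have disp: "disp (h n) (cvec x) = cvec (y n)" for n
        using hr[of n] by (simp add: disp_def y_def cvec_def vec_eq_iff realon_def complex_is_Real_iff complex_eq_iff)
      have ylim: "y \<longlonglongrightarrow> x + H x"
        unfolding y_def H_def by (intro tendsto_add tendsto_const tendsto_vec_lambda tendsto_Re hU)
      have t1: "(\<lambda>n. P i (cvec (y n))) \<longlonglongrightarrow> P i (cvec (x + H x))"
      proof (rule isCont_tendsto_compose[OF _ ylim])
        show "isCont (\<lambda>y. P i (cvec y)) (x + H x)"
          using contP[of i] continuous_on_eq_continuous_at[OF open_UNIV] by blast
      qed
      have z: "(\<lambda>n. (1 / 4) ^ n * (\<Sum>\<^sub>\<infinity>k. norm (a i k) * (1 + knorm k) ^ 1)) \<longlonglongrightarrow> 0"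
        by (intro tendsto_mult_left_zero LIMSEQ_power_zero) simp
      have "(\<lambda>n. trigp (F n) a i (cvec (y n)) - P i (cvec (y n))) \<longlonglongrightarrow> 0"
        by (rule Lim_null_comparison[OF _ z]) (use tail in auto)
      from tendsto_add[OF this t1] have t2: "(\<lambda>n. trigp (F n) a i (disp (h n) (cvec x))) \<longlonglongrightarrow> P i (cvec (x + H x))"
        by (simp add: disp)
      have hder: "(h n i has_derivative (\<lambda>u. \<Sum>j<n. Dd u (\<delta> j i) (cvec x))) (at (cvec x))" for n
        unfolding hsum[abs_def] by (intro has_derivative_sum Bs_has_derivative[OF B\<delta>(1) cs])
      have t3: "(\<lambda>n. Dd (cvec v) (h n i) (cvec x)) \<longlonglongrightarrow> (\<Sum>n. Dd (cvec v) (\<delta> n i) (cvec x))"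
        using dU(2)[where u = v and i = i and x = x] unfolding sums_def Dd_eqI[OF hder] .
      have "(\<lambda>n. defect v (F n) a (h n) (b n) (w n) i (cvec x)) \<longlonglongrightarrow>
        of_real B * (of_real (v $ i) + (\<Sum>n. Dd (cvec v) (\<delta> n i) (cvec x))) + of_real (W $ i) - of_real (v $ i) - P i (cvec (x + H x))"
        unfolding defect_def by (intro tendsto_intros t2 t3 bB wW)
      moreover have "(\<lambda>n. defect v (F n) a (h n) (b n) (w n) i (cvec x)) \<longlonglongrightarrow> 0"
        by (rule Lim_null_comparison[OF _ e_lim]) (use Bs_bound[OF _ def cs] in \<open>auto simp: less_imp_le\<close>)
      ultimately have "of_real B * (of_real (v $ i) + (\<Sum>n. Dd (cvec v) (\<delta> n i) (cvec x))) + of_real (W $ i) - of_real (v $ i) - P i (cvec (x + H x)) = 0"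
        using LIMSEQ_unique by blast
      from arg_cong[OF this, of Re] show ?thesis by (simp add: H'_def)
    qed
    show "\<exists>h h' b w. (\<forall>m. Ck_on m UNIV h) \<and> (\<forall>x. (h has_derivative h' x) (at x)) \<and>
        (\<forall>x m. h (x + (\<chi> j. of_int (m $ j))) = h x) \<and> (\<forall>x u. norm (h' x u) \<le> c0 * norm u) \<and>
        \<bar>b - 1\<bar> \<le> c0 \<and> w \<bullet> v = 0 \<and>
        (\<forall>x i. b * (v $ i + h' x v $ i) + w $ i = v $ i + Re (\<Sum>\<^sub>\<infinity>k. a i k * em k (cvec (x + h x))))"
      using CkH dH perH nH' B1 Wv main unfolding P_def by (intro exI[of _ H] exI[of _ H'] exI[of _ B] exI[of _ W]) auto
  qed
qed

end

section \<open>Fourier coefficients of smooth periodic functions\<close>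

definition periodic :: "(real ^ 'd::finite \<Rightarrow> 'b) \<Rightarrow> bool" where
  "periodic f \<longleftrightarrow> (\<forall>x m. f (x + (\<chi> j. of_int (m $ j))) = f x)"

lemma periodicD: "periodic f \<Longrightarrow> f (x + (\<chi> j. of_int (m $ j))) = f x"
  by (simp add: periodic_def)

lemma periodic_axis:
  fixes f :: "real ^ 'd::finite \<Rightarrow> 'b"
  assumes "periodic f"
  shows "f (x + axis i 1) = f x"
proof -
  have "(axis i 1 :: real ^ 'd) = (\<chi> j. of_int ((axis i 1 :: int ^ 'd) $ j))" by (simp add: vec_eq_iff axis_def)
  then show ?thesis using periodicD[OF assms, of x "axis i 1"] by simp
qed

abbreviation ones :: "real ^ 'd::finite" where "ones \<equiv> \<chi> i. 1"

lemma ones_eq_One: "ones = (One :: real ^ 'd::finite)"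
proof (rule euclidean_eqI)
  fix b :: "real ^ 'd" assume b: "b \<in> Basis"
  then obtain i where "b = axis i 1" by (auto simp: Basis_vec_def)
  then have "ones \<bullet> b = 1" by (simp add: inner_axis)
  then show "ones \<bullet> b = One \<bullet> b" using b by simp
qed

lemma content_ones: "measure lborel (cbox (0 :: real ^ 'd::finite) ones) = 1"
  unfolding ones_eq_One by (rule content_unit)

lemma mem_unit_cube: "x \<in> cbox (0 :: real ^ 'd::finite) ones \<longleftrightarrow> (\<forall>i. 0 \<le> x $ i \<and> x $ i \<le> 1)"
  by (simp add: mem_box_cart)

lemma reduce_to_unit_cube:
  fixes x :: "real ^ 'd::finite"
  obtains y and m :: "int ^ 'd" where "x = y + (\<chi> j. of_int (m $ j))" "y \<in> cbox 0 ones"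
proof
  let ?m = "\<chi> j. \<lfloor>x $ j\<rfloor> :: int ^ 'd"
  show "x = (x - (\<chi> j. of_int (?m $ j))) + (\<chi> j. of_int (?m $ j))" by simp
  have "x $ i \<le> 1 + of_int \<lfloor>x $ i\<rfloor>" for i by linarith
  then show "x - (\<chi> j. of_int (?m $ j)) \<in> cbox 0 ones" by (simp add: mem_unit_cube diff_le_eq)
qed

lemma periodic_bounded:
  fixes f :: "real ^ 'd::finite \<Rightarrow> 'b::real_normed_vector"
  assumes "periodic f" "continuous_on UNIV f"
  obtains B where "\<And>x. norm (f x) \<le> B"
proof -
  have "compact (f ` cbox 0 ones)"
    by (intro compact_continuous_image continuous_on_subset[OF assms(2)]) auto
  then obtain B where "\<forall>y\<in>f ` cbox 0 ones. norm y \<le> B"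
    using compact_imp_bounded bounded_iff by blast
  then have B: "\<And>y. y \<in> cbox 0 ones \<Longrightarrow> norm (f y) \<le> B" by blast
  have "norm (f x) \<le> B" for x
  proof -
    obtain y and m :: "int ^ 'd" where "x = y + (\<chi> j. of_int (m $ j))" "y \<in> cbox 0 ones" by (rule reduce_to_unit_cube)
    then show ?thesis using B periodicD[OF assms(1), of y m] by simp
  qed
  then show thesis by (rule that)
qed

section \<open>Means over the unit cube and Fourier coefficients\<close>

definition cmean :: "(real ^ 'd::finite \<Rightarrow> 'b::euclidean_space) \<Rightarrow> 'b" where
  "cmean u = integral (cbox 0 ones) u"

lemma cont_integrable: "continuous_on UNIV u \<Longrightarrow> u integrable_on cbox a b"
  for u :: "real ^ 'd::finite \<Rightarrow> 'b::euclidean_space"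
  by (rule integrable_continuous, erule continuous_on_subset) simp

lemma cmean_add: "continuous_on UNIV u \<Longrightarrow> continuous_on UNIV v \<Longrightarrow> cmean (\<lambda>x. u x + v x) = cmean u + cmean v"
  unfolding cmean_def by (intro integral_add cont_integrable)

lemma cmean_diff: "continuous_on UNIV u \<Longrightarrow> continuous_on UNIV v \<Longrightarrow> cmean (\<lambda>x. u x - v x) = cmean u - cmean v"
  unfolding cmean_def by (intro integral_diff cont_integrable)

lemma cmean_cmult: "cmean (\<lambda>x. c * u x) = c * cmean u" for c :: complex
  unfolding cmean_def by (rule integral_mult_right)

lemma norm_cmean_le:
  assumes "continuous_on UNIV u" "\<And>x. norm (u x) \<le> B"
  shows "norm (cmean u) \<le> B"
proof -
  have "0 \<le> B" using assms(2) norm_ge_zero order_trans by blast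
  from has_integral_bound[OF this integrable_integral[OF cont_integrable[OF assms(1)]], of 0 ones] assms(2)
  show ?thesis by (simp add: cmean_def content_ones)
qed

lemma integral_shift_cbox:
  fixes u :: "'a::euclidean_space \<Rightarrow> 'b::euclidean_space"
  assumes "u integrable_on cbox (a + c) (b + c)"
  shows "integral (cbox a b) (\<lambda>x. u (x + c)) = integral (cbox (a + c) (b + c)) u"
  using has_integral_affinity'[OF integrable_integral[OF assms], of 1 c]
  by (intro integral_unique) simp

text \<open>Cut the cube at height \<open>t\<close> and the translated cube at height 1 in direction
  \<open>i\<close>. They share one piece, and their other pieces differ by a unit translation, under
  which \<open>u\<close> is invariant.\<close>

lemma cmean_shift:
  fixes u :: "real ^ 'd::finite \<Rightarrow> 'b::euclidean_space"
  assumes u: "continuous_on UNIV u" "periodic u" and t: "0 \<le> t" "t \<le> 1"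
  shows "cmean (\<lambda>x. u (x + t *\<^sub>R axis i 1)) = cmean u"
proof -
  let ?e = "axis i 1 :: real ^ 'd"
  have eB: "?e \<in> Basis" by (simp add: axis_in_Basis_iff)
  note int = cont_integrable[OF u(1)]
  have xe: "x \<bullet> ?e = x $ i" for x by (simp add: inner_axis)
  have nth: "(c *\<^sub>R ?e) $ j = (if j = i then c else 0)" for c j by (simp add: axis_def)
  have enth: "?e $ j = (if j = i then 1 else 0)" for j by (simp add: axis_def)
  have 1: "integral (cbox 0 ones) u = integral (cbox 0 (ones - (1 - t) *\<^sub>R ?e)) u + integral (cbox (t *\<^sub>R ?e) ones) u"
  proof -
    have "cbox 0 ones \<inter> {x. x \<bullet> ?e \<le> t} = cbox 0 (ones - (1 - t) *\<^sub>R ?e)"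
      by (rule Set.set_eqI, simp only: Int_iff mem_Collect_eq xe mem_box_cart vector_minus_component vector_add_component nth enth
          zero_index vec_lambda_beta) (use t in \<open>smt (verit)\<close>)
    moreover have "cbox 0 ones \<inter> {x. x \<bullet> ?e \<ge> t} = cbox (t *\<^sub>R ?e) ones"
      by (rule Set.set_eqI, simp only: Int_iff mem_Collect_eq xe mem_box_cart vector_minus_component vector_add_component nth enth
          zero_index vec_lambda_beta) (use t in \<open>smt (verit)\<close>)
    ultimately show ?thesis using integral_split[OF int eB, of 0 ones t] by simp
  qed
  have 2: "integral (cbox (t *\<^sub>R ?e) (ones + t *\<^sub>R ?e)) u = integral (cbox (t *\<^sub>R ?e) ones) u + integral (cbox ?e (ones + t *\<^sub>R ?e)) u"
  proof -
    have "cbox (t *\<^sub>R ?e) (ones + t *\<^sub>R ?e) \<inter> {x. x \<bullet> ?e \<le> 1} = cbox (t *\<^sub>R ?e) ones"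
      by (rule Set.set_eqI, simp only: Int_iff mem_Collect_eq xe mem_box_cart vector_minus_component vector_add_component nth enth
          zero_index vec_lambda_beta) (use t in \<open>smt (verit)\<close>)
    moreover have "cbox (t *\<^sub>R ?e) (ones + t *\<^sub>R ?e) \<inter> {x. x \<bullet> ?e \<ge> 1} = cbox ?e (ones + t *\<^sub>R ?e)"
      by (rule Set.set_eqI, simp only: Int_iff mem_Collect_eq xe mem_box_cart vector_minus_component vector_add_component nth enth
          zero_index vec_lambda_beta) (use t in \<open>smt (verit)\<close>)
    ultimately show ?thesis using integral_split[OF int eB, of "t *\<^sub>R ?e" "ones + t *\<^sub>R ?e" 1] by simp
  qed
  have 3: "integral (cbox 0 (ones - (1 - t) *\<^sub>R ?e)) u = integral (cbox ?e (ones + t *\<^sub>R ?e)) u"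
  proof -
    have "ones - (1 - t) *\<^sub>R ?e + ?e = ones + t *\<^sub>R ?e" by (simp add: algebra_simps)
    then show ?thesis
      using integral_shift_cbox[of u 0 ?e "ones - (1 - t) *\<^sub>R ?e"] int unfolding periodic_axis[OF u(2)]
      by (simp only: add_0)
  qed
  have "integral (cbox 0 ones) (\<lambda>x. u (x + t *\<^sub>R ?e)) = integral (cbox (t *\<^sub>R ?e) (ones + t *\<^sub>R ?e)) u"
    using integral_shift_cbox[of u 0 "t *\<^sub>R ?e" ones] int by simp
  then show ?thesis unfolding cmean_def using 1 2 3 by simp
qed

lemma has_derivative_imp_continuous_on:
  assumes "\<And>x. (f has_derivative f' x) (at x)"
  shows "continuous_on UNIV f"
  by (intro continuous_at_imp_continuous_on ballI has_derivative_continuous[OF assms])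

text \<open>By \<open>cmean_shift\<close> the mean of a translate of \<open>u\<close> by
  \<open>t\<close> along the axis does not depend on \<open>t\<close>; differentiation under the
  integral at \<open>t = 0\<close> yields the mean of the derivative. The shift is restricted to the
  unit interval, so the derivative is taken within it.\<close>

lemma cmean_derivative:
  fixes u :: "real ^ 'd::finite \<Rightarrow> 'b::euclidean_space"
  assumes "periodic u" and u': "\<And>x. (u has_derivative u' x) (at x)" and cont: "continuous_on UNIV (\<lambda>x. u' x (axis i 1))"
  shows "cmean (\<lambda>x. u' x (axis i 1)) = 0"
proof -
  let ?e = "axis i 1 :: real ^ 'd"
  have cu: "continuous_on UNIV u" using u' by (rule has_derivative_imp_continuous_on)
  have "((\<lambda>t. integral (cbox 0 ones) (\<lambda>x. u (x + t *\<^sub>R ?e))) has_vector_derivative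
      integral (cbox 0 ones) (\<lambda>x. u' (x + 0 *\<^sub>R ?e) ?e)) (at 0 within {0..1})"
  proof (rule leibniz_rule_vector_derivative)
    fix t :: real and x :: "real ^ 'd"
    have "((\<lambda>t. x + t *\<^sub>R ?e) has_derivative (\<lambda>r. r *\<^sub>R ?e)) (at t within {0..1})"
      by (auto intro!: derivative_eq_intros)
    from has_derivative_compose[OF this u'] have "((\<lambda>t. u (x + t *\<^sub>R ?e)) has_derivative (\<lambda>r. u' (x + t *\<^sub>R ?e) (r *\<^sub>R ?e))) (at t within {0..1})" .
    then show "((\<lambda>t. u (x + t *\<^sub>R ?e)) has_vector_derivative u' (x + t *\<^sub>R ?e) ?e) (at t within {0..1})"
      unfolding has_vector_derivative_def by (simp add: linear_scale[OF has_derivative_linear[OF u']])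
  next
    show "(\<lambda>x. u (x + t *\<^sub>R ?e)) integrable_on cbox 0 ones" for t
      by (intro cont_integrable continuous_on_compose2[OF cu] continuous_intros) auto
    show "continuous_on ({0..1} \<times> cbox 0 ones) (\<lambda>(t, x). u' (x + t *\<^sub>R ?e) ?e)"
      unfolding split_beta by (intro continuous_on_compose2[OF cont] continuous_intros) auto
  qed auto
  then have "((\<lambda>t. cmean (\<lambda>x. u (x + t *\<^sub>R ?e))) has_vector_derivative cmean (\<lambda>x. u' x ?e)) (at 0 within {0..1})"
    by (simp add: cmean_def)
  then have "((\<lambda>t. cmean u) has_vector_derivative cmean (\<lambda>x. u' x ?e)) (at 0 within {0..1})"
    by (rule has_vector_derivative_transform[rotated 2]) (use cmean_shift[OF cu assms(1), of _ i] in auto)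
  then show ?thesis
    using vector_derivative_unique_within_closed_interval[of 0 1 0 "\<lambda>t. cmean u" "cmean (\<lambda>x. u' x ?e)" 0] by simp
qed

lemma em_has_derivative:
  "((\<lambda>x. em k (cvec x)) has_derivative (\<lambda>w. 2 * of_real pi * \<i> * kdot k (cvec w) * em k (cvec x))) (at x)"
proof -
  have 1: "((\<lambda>x. 2 * of_real pi * \<i> * kdot k (cvec x)) has_derivative (\<lambda>w. 2 * of_real pi * \<i> * kdot k (cvec w))) (at x)"
    by (intro bounded_linear_imp_has_derivative bounded_linear_const_mult bounded_linear_compose[OF bounded_linear_kdot bounded_linear_cvec])
  have 2: "(exp has_derivative (*) (exp y)) (at y)" for y :: complex
    using DERIV_exp[of y] by (simp add: has_field_derivative_def)
  show ?thesis
    unfolding em_def by (rule has_derivative_eq_rhs[OF has_derivative_compose[OF 1 2]]) (simp add: fun_eq_iff)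
qed

lemma continuous_em: "continuous_on UNIV (\<lambda>x. em k (cvec x))"
  by (rule has_derivative_imp_continuous_on[OF em_has_derivative])

lemma kdot_axis: "kdot k (cvec (axis i 1)) = of_int (k $ i)"
proof -
  have "kdot k (cvec (axis i 1)) = (\<Sum>j\<in>UNIV. if j = i then of_int (k $ i) else 0)"
    unfolding kdot_def by (intro sum.cong) (auto simp: cvec_def axis_def)
  then show ?thesis by simp
qed

lemma periodic_em: "periodic (\<lambda>x. em k (cvec x))"
  unfolding periodic_def using em_periodic by blast

definition fcoeff :: "(real ^ 'd::finite \<Rightarrow> complex) \<Rightarrow> int ^ 'd \<Rightarrow> complex" where
  "fcoeff u k = cmean (\<lambda>x. u x * em (- k) (cvec x))"

lemma fcoeff_derivative:
  assumes "periodic u" and u': "\<And>x. (u has_derivative u' x) (at x)" and cont: "continuous_on UNIV (\<lambda>x. u' x (axis i 1))"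
  shows "fcoeff (\<lambda>x. u' x (axis i 1)) k = 2 * of_real pi * \<i> * of_int (k $ i) * fcoeff u k"
proof -
  let ?e = "axis i 1 :: real ^ 'a"
  have cu: "continuous_on UNIV u" using u' by (rule has_derivative_imp_continuous_on)
  let ?w' = "\<lambda>x h. u x * (2 * of_real pi * \<i> * kdot (- k) (cvec h) * em (- k) (cvec x)) + u' x h * em (- k) (cvec x)"
  have w': "((\<lambda>x. u x * em (- k) (cvec x)) has_derivative ?w' x) (at x)" for x
    by (rule has_derivative_mult[OF u' em_has_derivative])
  have k: "kdot (- k) (cvec ?e) = - of_int (k $ i)" by (simp add: kdot_axis)
  have c1: "continuous_on UNIV (\<lambda>x. - (2 * of_real pi * \<i> * of_int (k $ i)) * (u x * em (- k) (cvec x)))"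
    by (intro continuous_intros cu continuous_em)
  have c2: "continuous_on UNIV (\<lambda>x. u' x ?e * em (- k) (cvec x))"
    by (intro continuous_intros cont continuous_em)
  have w'e: "?w' x ?e = - (2 * of_real pi * \<i> * of_int (k $ i)) * (u x * em (- k) (cvec x)) + u' x ?e * em (- k) (cvec x)" for x
    unfolding k by (simp add: algebra_simps)
  have "cmean (\<lambda>x. ?w' x ?e) = 0"
  proof (rule cmean_derivative[OF _ w'])
    show "periodic (\<lambda>x. u x * em (- k) (cvec x))"
      using assms(1) periodic_em[of "- k"] by (simp add: periodic_def)
    show "continuous_on UNIV (\<lambda>x. ?w' x ?e)" unfolding w'e using c1 c2 by (rule continuous_on_add)
  qed
  then have "- (2 * of_real pi * \<i> * of_int (k $ i)) * cmean (\<lambda>x. u x * em (- k) (cvec x)) + cmean (\<lambda>x. u' x ?e * em (- k) (cvec x)) = 0"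
    unfolding w'e cmean_add[OF c1 c2] cmean_cmult .
  then show ?thesis unfolding fcoeff_def by (simp add: add_eq_0_iff2 eq_neg_iff_add_eq_0)
qed

text \<open>For \<open>k \<noteq> 0\<close> the mode is, up to a nonzero factor, a partial
  derivative of itself.\<close>

lemma cmean_em: "cmean (\<lambda>x. em k (cvec x)) = of_bool (k = 0)"
proof (cases "k = 0")
  case True
  then show ?thesis by (simp add: cmean_def content_ones)
next
  case False
  then obtain i where i: "k $ i \<noteq> 0" by (auto simp: vec_eq_iff)
  have "cmean (\<lambda>x. 2 * of_real pi * \<i> * kdot k (cvec (axis i 1)) * em k (cvec x)) = 0"
    by (rule cmean_derivative[OF periodic_em em_has_derivative]) (intro continuous_intros continuous_em)
  then show ?thesis using i False by (simp add: cmean_cmult kdot_axis)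
qed

lemma norm_fcoeff_le: "continuous_on UNIV u \<Longrightarrow> (\<And>x. norm (u x) \<le> B) \<Longrightarrow> norm (fcoeff u k) \<le> B"
  unfolding fcoeff_def by (rule norm_cmean_le) (auto intro!: continuous_intros continuous_em simp: norm_mult)

lemma le_zero_if_le_scaled_epsilon:
  fixes x R :: real
  assumes "0 \<le> R" "\<And>e. 0 < e \<Longrightarrow> x \<le> R * e"
  shows "x \<le> 0"
proof (rule field_le_epsilon)
  fix e :: real assume e: "0 < e"
  have "x \<le> R * (e / (R + 1))" using e assms(1) by (intro assms(2)) auto
  also have "\<dots> \<le> e" using assms(1) e by (simp add: field_simps)
  finally show "x \<le> 0 + e" by simp
qed

text \<open>Finite partial sums approximate \<open>q\<close> uniformly, and for them the claim holds
  term by term. It will be applied to polynomials in the modes and to a Fourier series with one term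
  removed.\<close>

lemma cmean_absolutely_convergent:
  fixes r :: "real ^ 'd::finite \<Rightarrow> complex"
  assumes r: "continuous_on UNIV r" "periodic r" and c: "(\<lambda>k. norm (c k)) summable_on UNIV"
    and 0: "\<And>k. c k = 0 \<or> cmean (\<lambda>x. r x * em k (cvec x)) = 0"
    and q: "continuous_on UNIV q" "\<And>x. q x = (\<Sum>\<^sub>\<infinity>k. c k * em k (cvec x))"
  shows "cmean (\<lambda>x. r x * q x) = 0"
proof -
  obtain R where R: "\<And>x. norm (r x) \<le> R" using periodic_bounded[OF r(2,1)] by blast
  have R0: "0 \<le> R" using R norm_ge_zero order_trans by blast
  have "norm (cmean (\<lambda>x. r x * q x)) \<le> R * e" if e: "0 < e" for e
  proof -
    obtain F where F: "finite F" "dist (\<Sum>k\<in>F. norm (c k)) (\<Sum>\<^sub>\<infinity>k. norm (c k)) \<le> e"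
      using infsum_finite_approximation[OF c e] by auto
    have co: "(\<lambda>k. norm (c k)) summable_on (- F)" using c by (rule summable_on_subset_banach) auto
    have "(\<Sum>\<^sub>\<infinity>k. norm (c k)) = (\<Sum>k\<in>F. norm (c k)) + (\<Sum>\<^sub>\<infinity>k\<in>-F. norm (c k))"
      using infsum_Un_disjoint[of "\<lambda>k. norm (c k)" F "- F"] co F by (simp add: Compl_partition)
    then have tail: "(\<Sum>\<^sub>\<infinity>k\<in>-F. norm (c k)) \<le> e" using F(2) by (simp add: dist_real_def)
    define T where "T x = (\<Sum>k\<in>F. c k * em k (cvec x))" for x
    have cT: "continuous_on UNIV T" unfolding T_def by (intro continuous_intros continuous_em)
    have qT: "norm (q x - T x) \<le> e" for x
    proof -
      have n: "(\<lambda>k. norm (c k * em k (cvec x))) = (\<lambda>k. norm (c k))" by (simp add: norm_mult fun_eq_iff)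
      have s: "(\<lambda>k. c k * em k (cvec x)) summable_on - F" by (rule abs_summable_summable) (use co n in simp)
      have "q x - T x = (\<Sum>\<^sub>\<infinity>k\<in>-F. c k * em k (cvec x))"
        using infsum_Un_disjoint[of "\<lambda>k. c k * em k (cvec x)" F "- F"] s F by (simp add: Compl_partition q(2) T_def)
      then show ?thesis using norm_infsum_bound[of "\<lambda>k. c k * em k (cvec x)" "- F"] co tail by (simp add: n)
    qed
    have "cmean (\<lambda>x. r x * T x) = (\<Sum>k\<in>F. c k * cmean (\<lambda>x. r x * em k (cvec x)))"
    proof -
      have "cmean (\<lambda>x. r x * T x) = cmean (\<lambda>x. \<Sum>k\<in>F. c k * (r x * em k (cvec x)))"
        unfolding T_def by (simp add: sum_distrib_left mult_ac)
      also have "\<dots> = (\<Sum>k\<in>F. cmean (\<lambda>x. c k * (r x * em k (cvec x))))"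
        unfolding cmean_def by (intro integral_sum F cont_integrable continuous_intros continuous_em r)
      finally show ?thesis by (simp only: cmean_cmult)
    qed
    also have "\<dots> = 0" using 0 by (intro sum.neutral) auto
    finally have T0: "cmean (\<lambda>x. r x * T x) = 0" .
    have "cmean (\<lambda>x. r x * q x) = cmean (\<lambda>x. r x * q x - r x * T x)"
      by (subst cmean_diff) (auto intro!: continuous_intros r q cT simp: T0)
    also have "norm \<dots> \<le> R * e"
    proof (rule norm_cmean_le)
      show "continuous_on UNIV (\<lambda>x. r x * q x - r x * T x)" by (intro continuous_intros r q cT)
      show "norm (r x * q x - r x * T x) \<le> R * e" for x
        unfolding right_diff_distrib[symmetric] norm_mult using R qT R0 by (intro mult_mono) auto
    qed
    finally show ?thesis .
  qed
  then have "norm (cmean (\<lambda>x. r x * q x)) \<le> 0" by (rule le_zero_if_le_scaled_epsilon[OF R0])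
  then show ?thesis by simp
qed

text \<open>The embedding of the torus as a product of unit circles, a compact set to which the
  Stone-Weierstrass theorem applies.\<close>

definition torus_exp :: "real ^ 'd::finite \<Rightarrow> complex ^ 'd" where
  "torus_exp x = (\<chi> j. em (axis j 1) (cvec x))"

lemma torus_exp_nth: "torus_exp x $ j = exp (\<i> * of_real (2 * pi * x $ j))"
proof -
  have "kdot (axis j 1) (cvec x) = (\<Sum>i\<in>UNIV. if i = j then of_real (x $ j) else 0)"
    unfolding kdot_def by (intro sum.cong) (auto simp: cvec_def axis_def)
  then show ?thesis by (simp add: torus_exp_def em_def mult_ac)
qed

lemma torus_exp_eqD:
  assumes "periodic g" "torus_exp x = torus_exp y"
  shows "g x = g y"
proof -
  have "\<exists>n::int. x $ j = y $ j + of_int n" for j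
  proof -
    have "exp (\<i> * of_real (2 * pi * x $ j)) = exp (\<i> * of_real (2 * pi * y $ j))"
      using arg_cong[OF assms(2), of "\<lambda>z. z $ j"] by (simp only: torus_exp_nth)
    then obtain n :: int where "\<i> * of_real (2 * pi * x $ j) = \<i> * of_real (2 * pi * y $ j) + of_real (of_int (2 * n) * pi) * \<i>"
      unfolding exp_eq by auto
    then have "2 * pi * x $ j = 2 * pi * y $ j + of_int (2 * n) * pi"
      unfolding complex_eq_iff by simp
    then have "2 * pi * x $ j = 2 * pi * (y $ j + of_int n)" by (simp add: algebra_simps)
    then have "x $ j = y $ j + of_int n" by simp
    then show ?thesis by blast
  qed
  then obtain n where n: "\<And>j. x $ j = y $ j + of_int (n j)" by metis
  have "x = y + (\<chi> j. of_int ((\<chi> j. n j) $ j))" using n by (simp add: vec_eq_iff)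
  then show ?thesis using periodicD[OF assms(1), of y "\<chi> j. n j"] by simp
qed

lemma periodic_factor:
  fixes g :: "real ^ 'd::finite \<Rightarrow> 'b::topological_space"
  assumes g: "periodic g" "continuous_on UNIV g"
  obtains G where "continuous_on {z. \<forall>j. norm (z $ j) = 1} G" "\<And>x. G (torus_exp x) = g x"
proof
  define G where "G z = g (\<chi> j. Im (Ln (z $ j)) / (2 * pi))" for z :: "complex ^ 'd"
  have unit: "exp (\<i> * of_real (Im (Ln w))) = w" if "norm w = 1" for w
  proof -
    have "w \<noteq> 0" using that by auto
    then have "exp (Ln w) = w" "Re (Ln w) = 0" using that by auto
    moreover have "\<i> * of_real (Im (Ln w)) = Ln w" using \<open>Re (Ln w) = 0\<close> by (simp add: complex_eq_iff)
    ultimately show ?thesis by simp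
  qed
  show GE: "G (torus_exp x) = g x" for x
    unfolding G_def
  proof (rule torus_exp_eqD[OF g(1)])
    have "norm (torus_exp x $ j) = 1" for j by (simp add: torus_exp_nth)
    then show "torus_exp (\<chi> j. Im (Ln (torus_exp x $ j)) / (2 * pi)) = torus_exp x"
      by (simp add: vec_eq_iff torus_exp_nth[of "\<chi> j. _ j"] unit)
  qed
  show "continuous_on {z. \<forall>j. norm (z $ j) = 1} G"
    unfolding continuous_on_eq_continuous_within
  proof
    fix z0 :: "complex ^ 'd" assume z0: "z0 \<in> {z. \<forall>j. norm (z $ j) = 1}"
    define x0 :: "real ^ 'd" where "x0 = (\<chi> j. Im (Ln (z0 $ j)) / (2 * pi))"
    have x0: "torus_exp x0 = z0" using z0 by (simp add: vec_eq_iff torus_exp_nth x0_def unit)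
    \<comment> \<open>\<open>Ln\<close> jumps on the negative axis. The angle is therefore measured
      from \<open>z0\<close>, through quotients that are close to 1, where \<open>Ln\<close> is
      continuous; by periodicity the value of \<open>G\<close> is unchanged.\<close>
    let ?y = "\<lambda>z. x0 + (\<chi> j. Im (Ln (z $ j / z0 $ j)) / (2 * pi))"
    have eq: "G z = g (?y z)" if z: "z \<in> {z. \<forall>j. norm (z $ j) = 1}" for z
    proof -
      have "torus_exp (?y z) = z"
      proof (simp only: vec_eq_iff, rule allI)
        fix j
        have "torus_exp (?y z) $ j = torus_exp x0 $ j * exp (\<i> * of_real (Im (Ln (z $ j / z0 $ j))))"
          by (simp add: torus_exp_nth exp_add[symmetric] algebra_simps)
        also have "\<dots> = z0 $ j * (z $ j / z0 $ j)"
          using z z0 by (subst unit) (auto simp: x0 norm_divide)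
        also have "z0 $ j \<noteq> 0" using z0 by (auto dest!: spec[of _ j])
        then have "z0 $ j * (z $ j / z0 $ j) = z $ j" by simp
        finally show "torus_exp (?y z) $ j = z $ j" .
      qed
      then show ?thesis using GE[of "?y z"] by simp
    qed
    have "z0 $ j \<noteq> 0" for j using z0 by (metis (mono_tags) mem_Collect_eq norm_zero zero_neq_one)
    then have "((\<lambda>z. ?y z) \<longlongrightarrow> ?y z0) (at z0 within {z. \<forall>j. norm (z $ j) = 1})"
      by (intro tendsto_intros tendsto_vec_lambda) auto
    then have "((\<lambda>z. g (?y z)) \<longlongrightarrow> g (?y z0)) (at z0 within {z. \<forall>j. norm (z $ j) = 1})"
      using g(2) continuous_on_eq_continuous_at[OF open_UNIV] isCont_tendsto_compose by blast
    then show "continuous (at z0 within {z. \<forall>j. norm (z $ j) = 1}) G"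
      unfolding continuous_within eq[OF z0]
      by (rule Lim_transform_within[where d = 1]) (use eq in auto)
  qed
qed

text \<open>Functions with an absolutely convergent Fourier series; the weight is constantly 1. A
  function on the real space is extended to complex vectors through their real parts, so that
  \<open>wien\<close> applies to it.\<close>

definition Wf :: "(real ^ 'd::finite \<Rightarrow> complex) \<Rightarrow> bool" where
  "Wf T \<longleftrightarrow> (\<exists>C. wien (\<lambda>k. (1 + knorm k) ^ 0) (range cvec) C (\<lambda>z. T (\<chi> j. Re (z $ j))))"

lemma Re_cvec [simp]: "(\<chi> j. Re (cvec x $ j)) = x"
  by (simp add: cvec_def)

lemma Wf_const: "Wf (\<lambda>x. c)"
  unfolding Wf_def by (intro exI[of _ "norm c"] fourier_weight.wien_const[OF fourier_weight_power order_refl])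

lemma Wf_add: "Wf f \<Longrightarrow> Wf g \<Longrightarrow> Wf (\<lambda>x. f x + g x)"
  unfolding Wf_def by (elim exE) (rule exI, rule fourier_weight.wien_add[OF fourier_weight_power])

lemma Wf_mult: "Wf f \<Longrightarrow> Wf g \<Longrightarrow> Wf (\<lambda>x. f x * g x)"
  unfolding Wf_def by (elim exE) (rule exI, rule fourier_weight.wien_mult[OF fourier_weight_power])

lemma Wf_em:
  fixes k :: "int ^ 'd::finite"
  shows "Wf (\<lambda>x. em k (cvec x))"
  unfolding Wf_def
proof
  show "wien (\<lambda>k. (1 + knorm k) ^ 0) (range cvec) (norm (1 :: complex) * (1 + knorm k) ^ 0) (\<lambda>z :: complex ^ 'd. em k (cvec (\<chi> j. Re (z $ j))))"
    by (rule fourier_weight.wien_cong[OF fourier_weight_power fourier_weight.wien_em[OF fourier_weight_power]]) auto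
qed

lemma Wf_cnj_em: "Wf (\<lambda>x. cnj (em k (cvec x)))"
  unfolding cnj_em_cvec by (rule Wf_em)

lemma Wf_sum: "finite I \<Longrightarrow> (\<And>i. i \<in> I \<Longrightarrow> Wf (f i)) \<Longrightarrow> Wf (\<lambda>x. \<Sum>i\<in>I. f i x)"
  by (induction I rule: finite_induct) (auto intro: Wf_const Wf_add)

text \<open>Real and imaginary parts of the coordinates are combinations of a mode and its
  conjugate, which is again a mode. The rest follows because absolutely convergent series form an
  algebra.\<close>

lemma Wf_real_polynomial:
  fixes P :: "complex ^ 'd::finite \<Rightarrow> real"
  assumes "real_polynomial_function P"
  shows "Wf (\<lambda>x. of_real (P (torus_exp x)))"
  using assms
proof induction
  case (linear f)
  have lin: "linear f" using linear by (simp add: linear_conv_bounded_linear)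
  have split_term: "of_real (Re w * a + Im w * b) = (w + cnj w) * (of_real a / 2) + (w + (- 1) * cnj w) * (of_real b / (2 * \<i>))"
    for w :: complex and a b
  proof -
    have "w + cnj w = 2 * of_real (Re w)" "w + (- 1) * cnj w = 2 * \<i> * of_real (Im w)"
      by (auto simp: complex_eq_iff)
    then show ?thesis by (simp add: complex_eq_iff)
  qed
  have 1: "of_real (f (torus_exp x)) = (\<Sum>j\<in>UNIV. (em (axis j 1) (cvec x) + cnj (em (axis j 1) (cvec x))) * (of_real (f (axis j 1)) / 2)
      + (em (axis j 1) (cvec x) + (- 1) * cnj (em (axis j 1) (cvec x))) * (of_real (f (axis j \<i>)) / (2 * \<i>)))" for x
  proof -
    have z: "z = (\<Sum>j\<in>UNIV. Re (z $ j) *\<^sub>R axis j 1 + Im (z $ j) *\<^sub>R axis j \<i>)" for z :: "complex ^ 'd"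
      by (simp add: vec_eq_iff axis_def sum.distrib if_distrib cong: if_cong) (simp add: complex_eq_iff)
    have "f (torus_exp x) = (\<Sum>j\<in>UNIV. Re (torus_exp x $ j) * f (axis j 1) + Im (torus_exp x $ j) * f (axis j \<i>))"
      by (subst z) (simp add: linear_sum[OF lin] linear_add[OF lin] linear_scale[OF lin])
    also have "of_real \<dots> = (\<Sum>j\<in>UNIV. of_real (Re (torus_exp x $ j) * f (axis j 1) + Im (torus_exp x $ j) * f (axis j \<i>)) :: complex)"
      by (rule of_real_sum)
    finally show ?thesis unfolding split_term by (simp only: torus_exp_def vec_lambda_beta)
  qed
  show ?case unfolding 1 by (intro Wf_sum Wf_add Wf_mult Wf_em Wf_cnj_em Wf_const) auto
next
  case (const c)
  show ?case by (rule Wf_const)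
next
  case (add f g)
  show ?case unfolding of_real_add by (rule Wf_add[OF add.IH])
next
  case (mult f g)
  show ?case unfolding of_real_mult by (rule Wf_mult[OF mult.IH])
qed

text \<open>Approximate \<open>cnj r\<close> uniformly by a polynomial in the modes and their
  conjugates. Its Fourier series converges absolutely, so its product with \<open>r\<close> has mean
  zero, and the mean of \<open>r * cnj r\<close> is arbitrarily small. A continuous function whose
  squared modulus has integral zero vanishes.\<close>

lemma fcoeff_zero_imp_zero:
  fixes r :: "real ^ 'd::finite \<Rightarrow> complex"
  assumes r: "continuous_on UNIV r" "periodic r" and 0: "\<And>k. cmean (\<lambda>x. r x * em k (cvec x)) = 0"
  shows "r x = 0"
proof -
  obtain R where R: "\<And>x. norm (r x) \<le> R" using periodic_bounded[OF r(2,1)] by blast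
  have R0: "0 \<le> R" using R norm_ge_zero order_trans by blast
  have cr: "continuous_on UNIV (\<lambda>x. cnj (r x))" "periodic (\<lambda>x. cnj (r x))"
    using r by (auto intro!: continuous_intros simp: periodic_def)
  obtain G where G: "continuous_on {z. \<forall>j. norm (z $ j) = 1} G" "\<And>x. G (torus_exp x) = cnj (r x)"
    using periodic_factor[OF cr(2,1)] by blast
  have S: "compact {z :: complex ^ 'd. \<forall>j. norm (z $ j) = 1}"
  proof (rule compact_eq_bounded_closed[THEN iffD2], rule conjI)
    show "bounded {z :: complex ^ 'd. \<forall>j. norm (z $ j) = 1}"
      unfolding bounded_iff
    proof (intro exI ballI)
      fix z :: "complex ^ 'd" assume z: "z \<in> {z. \<forall>j. norm (z $ j) = 1}"
      have "norm z \<le> (\<Sum>j\<in>UNIV. norm (z $ j))" unfolding norm_vec_def by (rule L2_set_le_sum) auto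
      then show "norm z \<le> real CARD('d)" using z by simp
    qed
    have "{z :: complex ^ 'd. \<forall>j. norm (z $ j) = 1} = (\<Inter>j. {z. norm (z $ j) = 1})" by auto
    moreover have "closed {z :: complex ^ 'd. norm (z $ j) = 1}" for j
      by (intro closed_Collect_eq continuous_intros)
    ultimately show "closed {z :: complex ^ 'd. \<forall>j. norm (z $ j) = 1}" by auto
  qed
  have small: "norm (cmean (\<lambda>x. r x * cnj (r x))) \<le> R * e" if e: "0 < e" for e
  proof -
    obtain P where P: "polynomial_function P" "\<And>z. z \<in> {z. \<forall>j. norm (z $ j) = 1} \<Longrightarrow> norm (G z - P z) < e"
      using Stone_Weierstrass_polynomial_function[OF S G(1) e] by blast
    define T where "T x = P (torus_exp x)" for x
    have "Wf T"
    proof -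
      have "real_polynomial_function (Re \<circ> P)" "real_polynomial_function (Im \<circ> P)"
        using P(1) unfolding polynomial_function_def by (auto intro: bounded_linear_Re bounded_linear_Im)
      from Wf_add[OF Wf_real_polynomial[OF this(1)] Wf_mult[OF Wf_const[of \<i>] Wf_real_polynomial[OF this(2)]]]
      have "Wf (\<lambda>x. of_real (Re (P (torus_exp x))) + \<i> * of_real (Im (P (torus_exp x))))" by simp
      then show ?thesis unfolding T_def complex_eq[symmetric] .
    qed
    then obtain C where u: "wien (\<lambda>k. (1 + knorm k) ^ 0) (range cvec) C (\<lambda>z. T (\<chi> j. Re (z $ j)))"
      unfolding Wf_def by blast
    obtain c A where c: "((\<lambda>k. norm (c k) * (1 + knorm k) ^ 0) has_sum A) UNIV" "A \<le> C"
      "\<And>z. z \<in> range cvec \<Longrightarrow> ((\<lambda>k. c k * em k z) has_sum T (\<chi> j. Re (z $ j))) UNIV"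
      using u by (rule wienE) blast
    have cE: "continuous_on UNIV (torus_exp :: real ^ 'd \<Rightarrow> _)"
      unfolding torus_exp_def by (intro continuous_intros continuous_em)
    have cT: "continuous_on UNIV T"
      unfolding T_def by (rule continuous_on_compose2[OF continuous_on_polymonial_function[OF P(1)] cE]) auto
    have "cmean (\<lambda>x. r x * T x) = 0"
    proof (rule cmean_absolutely_convergent[OF r _ _ cT])
      show "(\<lambda>k. norm (c k)) summable_on UNIV" using has_sum_imp_summable[OF c(1)] by simp
      show "T x = (\<Sum>\<^sub>\<infinity>k. c k * em k (cvec x))" for x using infsumI[OF c(3)[of "cvec x"]] by simp
    qed (use 0 in blast)
    then have "cmean (\<lambda>x. r x * cnj (r x)) = cmean (\<lambda>x. r x * cnj (r x) - r x * T x)"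
      by (subst cmean_diff) (auto intro!: continuous_intros r cT)
    also have "norm \<dots> \<le> R * e"
    proof (rule norm_cmean_le)
      show "continuous_on UNIV (\<lambda>x. r x * cnj (r x) - r x * T x)" by (intro continuous_intros r cT)
      have "norm (cnj (r x) - T x) \<le> e" for x
        using P(2)[of "torus_exp x"] by (simp add: T_def G(2) torus_exp_nth less_imp_le)
      then show "norm (r x * cnj (r x) - r x * T x) \<le> R * e" for x
        unfolding right_diff_distrib[symmetric] norm_mult using R R0 by (intro mult_mono) auto
    qed
    finally show ?thesis .
  qed
  have "norm (cmean (\<lambda>x. r x * cnj (r x))) \<le> 0" by (rule le_zero_if_le_scaled_epsilon[OF R0 small])
  then have z: "cmean (\<lambda>x. r x * cnj (r x)) = 0" by simp
  have c2: "continuous_on UNIV (\<lambda>x. r x * cnj (r x))" by (intro continuous_intros r)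
  have hi: "((\<lambda>x. r x * cnj (r x)) has_integral 0) (cbox 0 ones)"
    using integrable_integral[OF cont_integrable[OF c2], of 0 ones] z by (simp add: cmean_def)
  have hi': "((\<lambda>x. (norm (r x))\<^sup>2) has_integral 0) (cbox 0 ones)"
    using has_integral_linear[OF hi bounded_linear_Re] by (simp add: o_def complex_norm_square[symmetric])
  obtain y and m :: "int ^ 'd" where y: "x = y + (\<chi> j. of_int (m $ j))" "y \<in> cbox 0 ones" by (rule reduce_to_unit_cube)
  have "(norm (r y))\<^sup>2 = 0"
  proof (rule has_integral_0_cbox_imp_0[OF _ _ hi' _ y(2)])
    show "continuous_on (cbox 0 ones) (\<lambda>x. (norm (r x))\<^sup>2)"
      by (intro continuous_intros continuous_on_subset[OF r(1)]) auto
  qed (auto simp: interval_ne_empty_cart)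
  then show ?thesis using periodicD[OF r(2), of y m] y(1) by simp
qed

text \<open>The sum of the series has the same Fourier coefficients as \<open>u\<close>, so the two
  agree by \<open>fcoeff_zero_imp_zero\<close>. The weight of order one makes this sum
  continuous.\<close>

lemma fourier_inversion:
  fixes u :: "real ^ 'd::finite \<Rightarrow> complex"
  assumes u: "continuous_on UNIV u" "periodic u" and s: "(\<lambda>k. norm (fcoeff u k) * (1 + knorm k)) summable_on UNIV"
  shows "u x = (\<Sum>\<^sub>\<infinity>k. fcoeff u k * em k (cvec x))"
proof -
  let ?c = "fcoeff u"
  have cs: "(\<lambda>k. norm (?c k)) summable_on UNIV"
    by (rule summable_on_comparison_test[OF s]) (auto simp: mult_le_cancel_left1 not_less)
  have hs: "((\<lambda>k. ?c k * em k (cvec x)) has_sum (\<Sum>\<^sub>\<infinity>k. ?c k * em k (cvec x))) UNIV" for x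
    by (rule has_sum_infsum, rule abs_summable_summable) (simp add: norm_mult cs)
  define q where "q x = (\<Sum>\<^sub>\<infinity>k. ?c k * em k (cvec x))" for x
  define qz where "qz z = (\<Sum>\<^sub>\<infinity>k. ?c k * em k z)" for z
  have W: "wien (\<lambda>k. (1 + knorm k) ^ Suc 0) (range cvec) (\<Sum>\<^sub>\<infinity>k. norm (?c k) * (1 + knorm k) ^ Suc 0) qz"
    by (rule wienI[OF has_sum_infsum]) (use s hs in \<open>auto simp: qz_def\<close>)
  have cq: "continuous_on UNIV q"
    using Ck_continuous[OF Ck_wien_power[OF W]] by (simp add: qz_def q_def)
  have pq: "periodic q" unfolding periodic_def q_def by (simp add: em_periodic)
  have "u x - q x = 0"
  proof (rule fcoeff_zero_imp_zero)
    show "continuous_on UNIV (\<lambda>x. u x - q x)" by (intro continuous_intros u cq)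
    show "periodic (\<lambda>x. u x - q x)" using u(2) pq by (simp add: periodic_def)
    fix l
    have ce: "continuous_on UNIV (\<lambda>x. q x * em l (cvec x))" "continuous_on UNIV (\<lambda>x. u x * em l (cvec x))"
      by (intro continuous_intros cq u continuous_em)+
    \<comment> \<open>Only frequency \<open>- l\<close> has a nonzero mean against
      \<open>em l\<close>; with that term removed the mean vanishes.\<close>
    have "cmean (\<lambda>x. em l (cvec x) * (q x - ?c (- l) * em (- l) (cvec x))) = 0"
    proof (rule cmean_absolutely_convergent[OF continuous_em periodic_em, where c = "\<lambda>k. if k = - l then 0 else ?c k"])
      show "(\<lambda>k. norm (if k = - l then 0 else ?c k)) summable_on UNIV"
        by (rule summable_on_comparison_test[OF cs]) auto
      show "(if k = - l then 0 else ?c k) = 0 \<or> cmean (\<lambda>x. em l (cvec x) * em k (cvec x)) = 0" for k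
        unfolding em_add[symmetric] cmean_em by (auto simp: add_eq_0_iff)
      show "continuous_on UNIV (\<lambda>x. q x - ?c (- l) * em (- l) (cvec x))" by (intro continuous_intros cq continuous_em)
      show "q x - ?c (- l) * em (- l) (cvec x) = (\<Sum>\<^sub>\<infinity>k. (if k = - l then 0 else ?c k) * em k (cvec x))" for x
      proof -
        have "((\<lambda>k. ?c k * em k (cvec x) + (if k = - l then - (?c (- l) * em (- l) (cvec x)) else 0)) has_sum q x + - (?c (- l) * em (- l) (cvec x))) UNIV"
          unfolding q_def by (rule has_sum_add[OF hs]) (rule has_sum_finite_neutralI[where B = "{- l}"], auto)
        moreover have "(\<lambda>k. ?c k * em k (cvec x) + (if k = - l then - (?c (- l) * em (- l) (cvec x)) else 0)) = (\<lambda>k. (if k = - l then 0 else ?c k) * em k (cvec x))"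
          by auto
        ultimately show ?thesis by (simp add: infsumI)
      qed
    qed
    moreover have "em l (cvec x) * (q x - ?c (- l) * em (- l) (cvec x)) = q x * em l (cvec x) - ?c (- l)" for x
      using em_add[of l "- l" "cvec x"] by (simp add: algebra_simps)
    ultimately have "cmean (\<lambda>x. q x * em l (cvec x) - ?c (- l)) = 0" by simp
    then have "cmean (\<lambda>x. q x * em l (cvec x)) = cmean (\<lambda>x :: real ^ 'd. ?c (- l))"
      using cmean_diff[OF ce(1) continuous_on_const[of UNIV "?c (- l)"]] by simp
    also have "\<dots> = cmean (\<lambda>x. u x * em l (cvec x))" by (simp add: cmean_def fcoeff_def content_ones)
    finally show "cmean (\<lambda>x. (u x - q x) * em l (cvec x)) = 0"
      unfolding left_diff_distrib cmean_diff[OF ce(2,1)] by simp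
  qed
  then show ?thesis by (simp add: q_def)
qed

section \<open>Decay of the Fourier coefficients of smooth functions\<close>

lemma has_derivative_periodic:
  fixes f :: "real ^ 'd::finite \<Rightarrow> 'b::real_normed_vector"
  assumes "periodic f" and f': "\<And>x. (f has_derivative f' x) (at x)"
  shows "f' (x + (\<chi> j. of_int (m $ j))) = f' x"
proof -
  define c :: "real ^ 'd" where "c = (\<chi> j. of_int (m $ j))"
  have "((\<lambda>x. x + c) has_derivative (\<lambda>w. w)) (at x)" by (auto intro!: derivative_eq_intros)
  then have "((\<lambda>x. f (x + c)) has_derivative (\<lambda>w. f' (x + c) w)) (at x)"
    by (rule has_derivative_compose) (rule f')
  moreover have "(\<lambda>x. f (x + c)) = f" unfolding c_def by (intro ext periodicD assms)
  ultimately have "(f has_derivative f' (x + c)) (at x)" by simp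
  from has_derivative_unique[OF this f'] show ?thesis unfolding c_def .
qed

lemma iter_partial_smooth:
  assumes "\<And>m. Ck_on m UNIV f" "periodic f"
  shows "Ck_on m UNIV (iter_partial is f) \<and> periodic (iter_partial is f)"
proof (induction "is" arbitrary: m)
  case Nil
  then show ?case using assms by simp
next
  case (Cons i "is")
  have C: "Ck_on (Suc m) UNIV (iter_partial is f)" for m using Cons by blast
  have D: "(iter_partial is f has_derivative frechet_derivative (iter_partial is f) (at x)) (at x)" for x
    using C[of 0] by (simp add: frechet_derivative_works)
  have "periodic (iter_partial (i # is) f)"
    unfolding periodic_def using has_derivative_periodic[OF _ D] Cons by simp
  then show ?case using C[of m] by simp
qed

lemma iter_partial_has_derivative:
  assumes "\<And>m. Ck_on m UNIV f" "periodic f"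
  shows "(iter_partial is f has_derivative frechet_derivative (iter_partial is f) (at x)) (at x)"
  using iter_partial_smooth[OF assms, of "Suc 0" "is"] by (simp add: frechet_derivative_works)

lemma fcoeff_iter_partial:
  fixes P :: "real ^ 'd::finite \<Rightarrow> real ^ 'd"
  assumes P: "\<And>m. Ck_on m UNIV P" "periodic P"
  shows "fcoeff (\<lambda>x. of_real (iter_partial (replicate N i) P x $ j)) k = (2 * of_real pi * \<i> * of_int (k $ i)) ^ N * fcoeff (\<lambda>x. of_real (P x $ j)) k"
proof (induction N)
  case (Suc N)
  let ?R = "iter_partial (replicate N i) P"
  let ?L = "\<lambda>y :: real ^ 'd. of_real (y $ j) :: complex"
  have L: "bounded_linear ?L"
    by (rule bounded_linear_compose[OF bounded_linear_of_real bounded_linear_vec_nth])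
  have "fcoeff (\<lambda>x. ?L (frechet_derivative ?R (at x) (axis i 1))) k = 2 * of_real pi * \<i> * of_int (k $ i) * fcoeff (\<lambda>x. ?L (?R x)) k"
  proof (rule fcoeff_derivative)
    show "periodic (\<lambda>x. ?L (?R x))" using iter_partial_smooth[OF P, of 0 "replicate N i"] by (simp add: periodic_def)
    show "((\<lambda>x. ?L (?R x)) has_derivative (\<lambda>w. ?L (frechet_derivative ?R (at x) w))) (at x)" for x
      by (rule bounded_linear.has_derivative[OF L iter_partial_has_derivative[OF P]])
    have "continuous_on UNIV (iter_partial (i # replicate N i) P)"
      using iter_partial_smooth[OF P, of 0 "i # replicate N i"] by (simp only: Ck_on.simps)
    then show "continuous_on UNIV (\<lambda>x. ?L (frechet_derivative ?R (at x) (axis i 1)))"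
      using bounded_linear.continuous_on[OF L] by simp
  qed
  then show ?case using Suc by simp
qed simp

lemma knorm_le_component:
  fixes k :: "int ^ 'd::finite"
  obtains i where "knorm k \<le> real CARD('d) * \<bar>of_int (k $ i)\<bar>"
proof -
  obtain i where i: "\<And>j. \<bar>k $ j\<bar> \<le> \<bar>k $ i\<bar>"
    using Max_in[of "range (\<lambda>j. \<bar>k $ j\<bar>)"] Max_ge[of "range (\<lambda>j. \<bar>k $ j\<bar>)"] by (metis (mono_tags, lifting) UNIV_not_empty finite finite_imageI image_iff image_is_empty rangeI)
  have "knorm k \<le> (\<Sum>j\<in>(UNIV::'d set). \<bar>of_int (k $ i)\<bar>)"
    unfolding knorm_def by (rule sum_mono) (use i in \<open>simp flip: of_int_abs\<close>)
  then show thesis by (intro that[of i]) simp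
qed

lemma continuous_of_real_component:
  fixes P :: "'a::topological_space \<Rightarrow> real ^ 'd::finite"
  assumes "continuous_on S P"
  shows "continuous_on S (\<lambda>x. of_real (P x $ j) :: complex)"
  using assms by (auto intro!: continuous_intros)

lemma fcoeff_cnj:
  fixes P :: "real ^ 'd::finite \<Rightarrow> real ^ 'd"
  assumes P: "continuous_on UNIV P"
  shows "fcoeff (\<lambda>x. of_real (P x $ j)) (- k) = cnj (fcoeff (\<lambda>x. of_real (P x $ j)) k)"
proof -
  have "cnj (fcoeff (\<lambda>x. of_real (P x $ j)) k) = cmean (\<lambda>x. cnj (of_real (P x $ j) * em (- k) (cvec x)))"
    unfolding fcoeff_def cmean_def
    by (rule integral_linear[OF cont_integrable bounded_linear_cnj, unfolded o_def, symmetric])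
      (intro continuous_intros continuous_of_real_component P continuous_em)
  then show ?thesis unfolding fcoeff_def by (simp add: cnj_em_cvec)
qed

text \<open>For each frequency, differentiate \<open>m + 2 * CARD('d)\<close> times in the direction
  of its largest component, which is comparable to \<open>knorm k\<close>. The surplus of
  \<open>2 * CARD('d)\<close> powers makes the sum over the lattice converge.\<close>

lemma fcoeff_decay:
  fixes P :: "real ^ 'd::finite \<Rightarrow> real ^ 'd"
  assumes P: "\<And>m. Ck_on m UNIV P" "periodic P"
    and B: "\<And>i x. norm (iter_partial (replicate (m + 2 * CARD('d)) i) P x) \<le> B" "\<And>x. norm (P x) \<le> B"
  defines "a \<equiv> \<lambda>j. fcoeff (\<lambda>x. of_real (P x $ j))"
  shows "(\<lambda>k. norm (a j k) * (1 + knorm k) ^ m) summable_on UNIV \<and>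
      (\<Sum>\<^sub>\<infinity>k. norm (a j k) * (1 + knorm k) ^ m) \<le> (2 * real CARD('d)) ^ (m + 2 * CARD('d)) * B * (\<Sum>\<^sub>\<infinity>k::int ^ 'd. 1 / (1 + knorm k) ^ (2 * CARD('d)))"
proof -
  have cP: "continuous_on UNIV (\<lambda>x. of_real (iter_partial is P x $ j) :: complex)" for "is" j
    using iter_partial_smooth[OF P, of 0 "is"] by (intro continuous_of_real_component) simp
  have cP0: "continuous_on UNIV (\<lambda>x. of_real (P x $ j) :: complex)" for j
    using cP[of "[]"] by simp
  let ?N = "m + 2 * CARD('d)" and ?d = "real CARD('d)"
  have B0: "0 \<le> B" using B(2) norm_ge_zero order_trans by blast
  have "1 \<le> CARD('d)" by (simp add: Suc_leI)
  then have d1: "1 \<le> 2 * ?d" by linarith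
  have bound: "norm (a j k) * (1 + knorm k) ^ ?N \<le> (2 * ?d) ^ ?N * B" for k
  proof (cases "k = 0")
    case True
    have "norm (a j k) \<le> B"
      unfolding a_def by (rule norm_fcoeff_le[OF cP0]) (use B(2) component_le_norm_cart order_trans in \<open>auto simp: \<close>, blast)
    also have "\<dots> \<le> (2 * ?d) ^ ?N * B" using B0 d1 one_le_power[OF d1, of ?N] by (simp add: mult_le_cancel_right1)
    finally show ?thesis using True by simp
  next
    case False
    obtain i where i: "knorm k \<le> ?d * \<bar>of_int (k $ i)\<bar>" using knorm_le_component[of k] by blast
    have "norm (fcoeff (\<lambda>x. of_real (iter_partial (replicate ?N i) P x $ j)) k) \<le> B"
      by (rule norm_fcoeff_le[OF cP]) (use B(1)[of i] component_le_norm_cart order_trans in \<open>auto simp: \<close>, blast)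
    then have 1: "(2 * pi * \<bar>of_int (k $ i)\<bar>) ^ ?N * norm (a j k) \<le> B"
      unfolding fcoeff_iter_partial[OF P] a_def by (simp add: norm_mult norm_power)
    have "1 + knorm k \<le> 2 * knorm k" using knorm_ge_1[OF False] by simp
    also have "\<dots> \<le> 2 * ?d * \<bar>of_int (k $ i)\<bar>" using i by simp
    also have "\<dots> \<le> 2 * ?d * (2 * pi * \<bar>of_int (k $ i)\<bar>)"
      using pi_gt3 by (intro mult_left_mono) (auto simp: mult_le_cancel_right1)
    finally have "(1 + knorm k) ^ ?N \<le> (2 * ?d * (2 * pi * \<bar>of_int (k $ i)\<bar>)) ^ ?N" by (intro power_mono) auto
    then have "norm (a j k) * (1 + knorm k) ^ ?N \<le> norm (a j k) * (2 * ?d * (2 * pi * \<bar>of_int (k $ i)\<bar>)) ^ ?N"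
      by (intro mult_left_mono) auto
    also have "\<dots> = (2 * ?d) ^ ?N * ((2 * pi * \<bar>of_int (k $ i)\<bar>) ^ ?N * norm (a j k))"
      by (simp only: power_mult_distrib mult_ac)
    also have "\<dots> \<le> (2 * ?d) ^ ?N * B" using 1 by (intro mult_left_mono) auto
    finally show ?thesis .
  qed
  have le: "norm (a j k) * (1 + knorm k) ^ m \<le> (2 * ?d) ^ ?N * B * (1 / (1 + knorm k) ^ (2 * CARD('d)))" for k
  proof -
    have "0 < (1 + knorm k) ^ (2 * CARD('d))" by (intro zero_less_power add_pos_nonneg) auto
    then show ?thesis using bound[of k] by (simp add: field_simps power_add)
  qed
  have Z: "((\<lambda>k::int ^ 'd. (2 * ?d) ^ ?N * B * (1 / (1 + knorm k) ^ (2 * CARD('d)))) has_sum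
      (2 * ?d) ^ ?N * B * (\<Sum>\<^sub>\<infinity>k::int ^ 'd. 1 / (1 + knorm k) ^ (2 * CARD('d)))) UNIV"
    by (rule has_sum_cmult_right[OF has_sum_infsum[OF summable_knorm]])
  have s: "(\<lambda>k. norm (a j k) * (1 + knorm k) ^ m) summable_on UNIV"
    by (rule summable_on_comparison_test[OF has_sum_imp_summable[OF Z]]) (use le in auto)
  then show ?thesis using has_sum_mono[OF has_sum_infsum[OF s] Z] le by auto
qed

lemma fcoeff_summable:
  fixes P :: "real ^ 'd::finite \<Rightarrow> real ^ 'd"
  assumes P: "\<And>m. Ck_on m UNIV P" "periodic P"
  shows "(\<lambda>k. norm (fcoeff (\<lambda>x. of_real (P x $ j)) k) * (1 + knorm k) ^ m) summable_on UNIV"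
proof -
  have "\<exists>B. \<forall>x. norm (iter_partial is P x) \<le> B" for "is"
    using periodic_bounded iter_partial_smooth[OF P, of 0 "is"] by (metis Ck_on.simps(1))
  then obtain B where B: "\<And>is x. norm (iter_partial is P x) \<le> B is" by metis
  define B' where "B' = (\<Sum>i\<in>UNIV. B (replicate (m + 2 * CARD('d)) i)) + B []"
  have Bn: "0 \<le> B is" for "is" using B norm_ge_zero order_trans by blast
  have "B (replicate (m + 2 * CARD('d)) i) \<le> B'" for i
    unfolding B'_def by (rule add_increasing2[OF Bn member_le_sum[where f = "\<lambda>i. B (replicate (m + 2 * CARD('d)) i)"]]) (auto simp: Bn)
  moreover have "B [] \<le> B'" unfolding B'_def using Bn by (simp add: sum_nonneg)
  ultimately show ?thesis using fcoeff_decay[OF P, of m B' j] B order_trans by (metis iter_partial.simps(1))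
qed

lemma fourier_expansion:
  fixes P :: "real ^ 'd::finite \<Rightarrow> real ^ 'd"
  assumes P: "\<And>m. Ck_on m UNIV P" "periodic P"
  shows "P x $ j = Re (\<Sum>\<^sub>\<infinity>k. fcoeff (\<lambda>x. of_real (P x $ j)) k * em k (cvec x))"
proof -
  have pP: "periodic (\<lambda>x. of_real (P x $ j) :: complex)" using P(2) by (simp add: periodic_def)
  have cP: "continuous_on UNIV P" using P(1)[of 0] by simp
  have "of_real (P x $ j) = (\<Sum>\<^sub>\<infinity>k. fcoeff (\<lambda>x. of_real (P x $ j)) k * em k (cvec x))"
    by (rule fourier_inversion[OF continuous_of_real_component[OF cP] pP]) (use fcoeff_summable[OF P, of j 1] in simp)
  then have "Re (of_real (P x $ j)) = Re (\<Sum>\<^sub>\<infinity>k. fcoeff (\<lambda>x. of_real (P x $ j)) k * em k (cvec x))" by (rule arg_cong)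
  then show ?thesis unfolding Re_complex_of_real .
qed

text \<open>A real \<open>SUP\<close> dominates the members of a set only if the set is bounded
  above. Here finitely many derivatives occur, and each is periodic and continuous, hence
  bounded.\<close>

lemma norm_iter_partial_le_Cr_norm:
  fixes f :: "'d::finite torus \<Rightarrow> 'b::real_normed_vector"
  assumes "smooth_fun f" "length is \<le> r"
  shows "norm (iter_partial is (f \<circ> to_torus) x) \<le> Cr_norm r f"
proof -
  have P: "Ck_on m UNIV (f \<circ> to_torus)" for m using assms(1) by (simp add: smooth_fun_def smooth_on_def)
  have "to_torus (x + (\<chi> j. of_int (m $ j))) = to_torus x" for x and m :: "int ^ 'd"
    by (simp add: torus.abs_eq_iff)
  then have per: "periodic (f \<circ> to_torus)" by (simp add: periodic_def)
  have "\<exists>B. \<forall>x. norm (iter_partial is (f \<circ> to_torus) x) \<le> B" for "is"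
    using periodic_bounded iter_partial_smooth[OF P per, of 0 "is"] by (metis Ck_on.simps(1))
  then obtain B where B: "\<And>is x. norm (iter_partial is (f \<circ> to_torus) x) \<le> B is" by metis
  have Bn: "0 \<le> B is" for "is" using B norm_ge_zero order_trans by blast
  have fin: "finite {is :: 'd list. length is \<le> r}"
    using finite_lists_length_le[of "UNIV :: 'd set" r] by simp
  have "bdd_above ((\<lambda>(is, x). norm (iter_partial is (f \<circ> to_torus) x)) ` ({is. length is \<le> r} \<times> UNIV))"
  proof (rule bdd_aboveI2[where M = "\<Sum>is | length is \<le> r. B is"], clarsimp simp del: comp_apply)
    fix "is" :: "'d list" and x assume "length is \<le> r"
    then have "B is \<le> (\<Sum>is | length is \<le> r. B is)" using fin Bn by (intro member_le_sum) auto
    then show "norm (iter_partial is (f \<circ> to_torus) x) \<le> (\<Sum>is | length is \<le> r. B is)" using B order_trans by blast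
  qed
  from cSUP_upper[OF _ this, of "(is, x)"] assms(2) show ?thesis unfolding Cr_norm_def by simp
qed

section \<open>Diophantine eigenvectors\<close>

text \<open>The vector \<open>q(B) u\<close> in Horner form, which avoids forming polynomials of
  matrices.\<close>

definition poly_act :: "'a::field ^ 'n ^ 'n \<Rightarrow> 'a poly \<Rightarrow> 'a ^ 'n \<Rightarrow> 'a ^ 'n" where
  "poly_act B q u = fold_coeffs (\<lambda>a w. a *s u + B *v w) q 0"

lemma poly_act_0 [simp]: "poly_act B 0 u = 0"
  by (simp add: poly_act_def)

lemma poly_act_pCons: "poly_act B (pCons a q) u = a *s u + B *v poly_act B q u"
  by (cases "a = 0 \<and> q = 0") (auto simp: poly_act_def matrix_vector_mult_0_right)

lemma poly_act_add: "poly_act B (p + q) u = poly_act B p u + poly_act B q u"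
  by (induction p q rule: poly_induct2)
    (auto simp: poly_act_pCons matrix_vector_right_distrib vector_sadd_rdistrib algebra_simps)

lemma poly_act_smult: "poly_act B (smult c p) u = c *s poly_act B p u"
  by (induction p) (auto simp: poly_act_pCons vector_add_ldistrib vector_smult_assoc vec.scale_right_distrib vector_scalar_commute)

lemma poly_act_sum: "finite I \<Longrightarrow> poly_act B (\<Sum>i\<in>I. p i) u = (\<Sum>i\<in>I. poly_act B (p i) u)"
  by (induction I rule: finite_induct) (auto simp: poly_act_add)

lemma poly_act_monom: "poly_act B (monom c n) u = c *s (((*v) B) ^^ n) u"
  by (induction n) (auto simp: monom_0 monom_Suc poly_act_pCons vector_scalar_commute)

lemma poly_act_linear_factor:
  "poly_act B ([:- z, 1:] * p) u = poly_act B p (B *v u - z *s u)"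
proof -
  have eq: "poly_act B p (B *v u - z *s u) = B *v poly_act B p u - z *s poly_act B p u"
  proof (induction p)
    case (pCons a p)
    show ?case unfolding poly_act_pCons pCons.IH
      by (simp add: matrix_vector_right_distrib vector_scalar_commute vec.scale_right_distrib
        vec.scale_right_diff_distrib matrix_vector_mult_diff_distrib mult.commute)
  qed simp
  have "[:- z, 1:] * p = smult (- z) p + pCons 0 p" by simp
  then show ?thesis unfolding eq by (simp add: poly_act_add poly_act_smult poly_act_pCons del: smult_minus_left)
qed

text \<open>Split off a linear factor belonging to a root \<open>z\<close>. Either \<open>u\<close>
  is an eigenvector for \<open>z\<close>, or \<open>B u - z u\<close> is a nonzero vector
  annihilated by the quotient, which has smaller degree.\<close>

lemma poly_act_zero_imp_eigenvector:
  fixes B :: "complex ^ 'n ^ 'n"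
  assumes "q \<noteq> 0" "u \<noteq> 0" "poly_act B q u = 0"
  obtains z w where "poly q z = 0" "w \<noteq> 0" "B *v w = z *s w"
proof -
  have "\<exists>z w. poly q z = 0 \<and> w \<noteq> 0 \<and> B *v w = z *s w"
    using assms
  proof (induction "degree q" arbitrary: q u rule: less_induct)
    case less
    have "degree q \<noteq> 0"
    proof
      assume "degree q = 0"
      then obtain c where "q = [:c:]" by (rule degree_eq_zeroE)
      then show False using less.prems by (simp add: poly_act_pCons matrix_vector_mult_0_right)
    qed
    then obtain z where z: "poly q z = 0"
      using fundamental_theorem_of_algebra[of q] constant_degree by metis
    then obtain p where p: "q = [:- z, 1:] * p" by (auto simp: poly_eq_0_iff_dvd)
    have p0: "p \<noteq> 0" using p less.prems(1) by auto
    show ?case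
    proof (cases "B *v u = z *s u")
      case True
      then show ?thesis using z less.prems(2) by blast
    next
      case False
      have "degree q = degree [:- z, 1:] + degree p" unfolding p using p0 by (intro degree_mult_eq) auto
      then have "degree p < degree q" by simp
      moreover have "B *v u - z *s u \<noteq> 0" "poly_act B p (B *v u - z *s u) = 0"
        using False less.prems(3) unfolding p poly_act_linear_factor by auto
      ultimately obtain z' w where "poly p z' = 0" "w \<noteq> 0" "B *v w = z' *s w"
        using less.hyps[OF _ p0] by blast
      then show ?thesis unfolding p by (intro exI[of _ z'] exI[of _ w]) simp
    qed
  qed
  then show thesis using that by blast
qed

lemma map_poly_of_rat_eval:
  fixes z :: complex
  shows "poly (map_poly of_rat (p + q)) z = poly (map_poly of_rat p) z + poly (map_poly of_rat q) z"
    "poly (map_poly of_rat (p * q)) z = poly (map_poly of_rat p) z * poly (map_poly of_rat q) z"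
proof -
  have add: "poly (map_poly of_rat (p + q)) z = poly (map_poly of_rat p) z + poly (map_poly of_rat q) z" for p q
    by (induction p q rule: poly_induct2) (simp_all add: map_poly_pCons of_rat_add algebra_simps)
  have smult: "poly (map_poly of_rat (smult c p)) z = of_rat c * poly (map_poly of_rat p) z" for c p
    by (induction p) (simp_all add: map_poly_pCons of_rat_mult algebra_simps)
  show "poly (map_poly of_rat (p * q)) z = poly (map_poly of_rat p) z * poly (map_poly of_rat q) z"
    by (induction p) (simp_all add: add smult map_poly_pCons algebra_simps)
  show "poly (map_poly of_rat (p + q)) z = poly (map_poly of_rat p) z + poly (map_poly of_rat q) z" by (rule add)
qed

text \<open>Evaluation at \<open>z\<close> is a ring homomorphism and so commutes with the
  determinant.\<close>

lemma charpoly_eval: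
  fixes A :: "int ^ 'n ^ 'n"
  shows "poly (map_poly of_rat (charpoly A)) z = det (mat z - map_matrix of_int A :: complex ^ 'n ^ 'n)"
proof -
  let ?h = "\<lambda>p. poly (map_poly of_rat p) z"
  let ?M = "mat [:0, 1:] - map_matrix (\<lambda>a. [:of_int a:]) A :: rat poly ^ 'n ^ 'n"
  have sum: "?h (sum f I) = (\<Sum>i\<in>I. ?h (f i))" for f and I :: "'b set"
    by (induction I rule: infinite_finite_induct) (simp_all add: map_poly_of_rat_eval)
  have prod: "?h (prod f I) = (\<Prod>i\<in>I. ?h (f i))" for f and I :: "'b set"
    by (induction I rule: infinite_finite_induct) (simp_all add: map_poly_of_rat_eval)
  have int: "?h (of_int m) = of_int m" for m
    by (simp add: of_int_poly map_poly_pCons)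
  have entry: "?h (?M $ i $ j) = (mat z - map_matrix of_int A :: complex ^ 'n ^ 'n) $ i $ j" for i j
    by (simp add: mat_def map_poly_pCons of_rat_minus)
  show ?thesis unfolding charpoly_def det_def sum map_poly_of_rat_eval prod int entry ..
qed

text \<open>Off-diagonal entries are constants, so every permutation other than the identity
  contributes a polynomial of smaller degree.\<close>

lemma degree_charpoly:
  fixes A :: "int ^ 'n ^ 'n"
  shows "degree (charpoly A) = CARD('n)"
proof -
  let ?M = "mat [:0, 1:] - map_matrix (\<lambda>a. [:of_int a:]) A :: rat poly ^ 'n ^ 'n"
  let ?t = "\<lambda>p. of_int (sign p) * (\<Prod>i\<in>UNIV. ?M $ i $ p i)"
  have diag: "?M $ i $ i = [:- of_int (A $ i $ i), 1:]" for i by (simp add: mat_def)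
  have off: "?M $ i $ j = [:- of_int (A $ i $ j):]" if "i \<noteq> j" for i j using that by (simp add: mat_def)
  have id: "degree (?t id) = CARD('n)"
    by (simp add: degree_prod_sum_eq diag del: vector_minus_component)
  have less: "degree (?t p) < CARD('n)" if p: "p \<in> {p. p permutes UNIV} - {id}" for p :: "'n \<Rightarrow> 'n"
  proof -
    obtain i where i: "i \<noteq> p i" using p by fastforce
    have "degree (?t p) \<le> degree (\<Prod>i\<in>UNIV. ?M $ i $ p i)"
      using degree_mult_le[of "of_int (sign p)" "\<Prod>i\<in>UNIV. ?M $ i $ p i"] by simp
    also have "\<dots> \<le> (\<Sum>i\<in>UNIV. degree (?M $ i $ p i))"
      using degree_prod_sum_le[of UNIV "\<lambda>i. ?M $ i $ p i"] by (simp add: o_def)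
    also have "\<dots> < (\<Sum>i\<in>(UNIV :: 'n set). 1)"
    proof (rule sum_strict_mono_ex1)
      have "degree (?M $ i $ j) \<le> 1" for i j by (cases "i = j") (simp_all add: diag off del: vector_minus_component)
      then show "\<forall>i\<in>UNIV. degree (?M $ i $ p i) \<le> 1" by blast
      show "\<exists>i\<in>UNIV. degree (?M $ i $ p i) < 1" using i by (intro bexI[of _ i]) (simp_all add: off del: vector_minus_component)
    qed simp
    finally show ?thesis by simp
  qed
  have "charpoly A = ?t id + (\<Sum>p\<in>{p. p permutes UNIV} - {id}. ?t p)"
    unfolding charpoly_def det_def by (rule sum.remove) (auto simp: permutes_id)
  moreover have "degree (\<Sum>p\<in>{p. p permutes UNIV} - {id}. ?t p) < CARD('n)"
    using less by (rule degree_sum_less) auto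
  ultimately show ?thesis using id by (simp add: degree_add_eq_left)
qed

text \<open>The transpose appears because frequencies are moved by the transpose of
  \<open>A\<close>; its determinant is the same.\<close>

lemma charpoly_root:
  fixes A :: "int ^ 'n ^ 'n" and w :: "complex ^ 'n"
  assumes "w \<noteq> 0" "transpose (map_matrix of_int A) *v w = z *s w"
  shows "poly (map_poly of_rat (charpoly A)) z = 0"
proof -
  let ?N = "transpose (mat z - map_matrix of_int A :: complex ^ 'n ^ 'n)"
  have "?N = mat z - transpose (map_matrix of_int A)" by (auto simp: vec_eq_iff transpose_def mat_def)
  moreover have "mat z *v w = z *s w" by (simp add: vec_eq_iff matrix_vector_mult_def mat_def if_distrib[of "\<lambda>a. a * _"] cong: if_cong)
  ultimately have "?N *v w = 0" using assms(2) by (simp add: matrix_vector_mult_diff_rdistrib)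
  then have "\<not> invertible ?N" using assms(1) unfolding invertible_left_inverse matrix_left_invertible_ker by blast
  then show ?thesis unfolding charpoly_eval invertible_det_nz det_transpose by simp
qed

text \<open>A nonzero rational polynomial of least degree vanishing at \<open>z\<close> divides
  every rational polynomial that vanishes there. It would divide \<open>p0\<close>, hence have the
  degree of \<open>p0\<close>, and yet its degree would be at most that of \<open>q\<close>.\<close>

lemma irreducible_no_common_root:
  fixes p0 q :: "rat poly" and z :: complex
  assumes "irreducible p0" "poly (map_poly of_rat p0) z = 0" "q \<noteq> 0" "degree q < degree p0"
  shows "poly (map_poly of_rat q) z \<noteq> 0"
proof
  assume z: "poly (map_poly of_rat q) z = 0"
  let ?P = "\<lambda>p. p \<noteq> 0 \<and> poly (map_poly of_rat p) z = 0"
  define m where "m = arg_min degree ?P"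
  have Pq: "?P q" using z assms(3) by blast
  have m: "?P m" and min: "\<And>p. ?P p \<Longrightarrow> degree m \<le> degree p"
    using arg_min_nat_lemma[where P = ?P and m = degree, OF Pq] unfolding m_def by blast+
  have dvd: "m dvd p" if p: "poly (map_poly of_rat p) z = 0" for p
  proof (rule ccontr)
    assume nd: "\<not> m dvd p"
    have "poly (map_poly of_rat p) z = poly (map_poly of_rat (p div m)) z * poly (map_poly of_rat m) z + poly (map_poly of_rat (p mod m)) z"
      unfolding map_poly_of_rat_eval[symmetric] by simp
    then have "poly (map_poly of_rat (p mod m)) z = 0" using p m by simp
    moreover have "p mod m \<noteq> 0" using nd by (simp add: mod_eq_0_iff_dvd)
    ultimately have "degree m \<le> degree (p mod m)" using min by blast
    then show False using degree_mod_less_degree[OF conjunct1[OF m] nd] by simp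
  qed
  obtain s where s: "p0 = m * s" using dvd[OF assms(2)] by (rule dvdE)
  have "degree m \<le> degree q" using min Pq by blast
  have "m dvd 1 \<or> s dvd 1" using assms(1) s by (rule irreducibleD)
  then show False
  proof
    assume "m dvd 1"
    then obtain c where "m = [:c:]" using m by (auto simp: is_unit_poly_iff)
    then show False using m by (simp add: map_poly_pCons)
  next
    assume "s dvd 1"
    then obtain c where "s = [:c:]" "c \<noteq> 0" by (auto simp: is_unit_poly_iff dvd_field_iff)
    then have "degree p0 = degree m" unfolding s by simp
    then show False using \<open>degree m \<le> degree q\<close> assms(4) by simp
  qed
qed

abbreviation krylov :: "int ^ 'n ^ 'n \<Rightarrow> int ^ 'n \<Rightarrow> nat \<Rightarrow> int ^ 'n" where
  "krylov A k n \<equiv> ((*v) (transpose A) ^^ n) k"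

lemma of_int_krylov:
  fixes A :: "int ^ 'n ^ 'n" and k :: "int ^ 'n"
  shows "((*v) (transpose (map_matrix of_int A)) ^^ n) (\<chi> j. of_int (k $ j)) = (\<chi> j. of_int (krylov A k n $ j) :: 'a::comm_ring_1 ^ 'n)"
  by (induction n) (simp_all add: vec_eq_iff matrix_vector_mult_def transpose_def)

text \<open>The Krylov vectors \<open>(A\<^sup>T)\<^sup>n k\<close> of an irreducible matrix are linearly independent: a rational
  relation is a polynomial annihilating \<open>k\<close>, and it would share a root with the characteristic polynomial.\<close>

lemma krylov_det_nonzero:
  fixes A :: "int ^ 'n ^ 'n" and k :: "int ^ 'n"
  assumes "irreducible_aut A" "k \<noteq> 0" and e: "bij_betw e (UNIV :: 'n set) {0..<CARD('n)}"
  shows "det (\<chi> i. krylov A k (e i)) \<noteq> 0"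
proof
  define M :: "rat ^ 'n ^ 'n" where "M = map_matrix of_int (\<chi> i. krylov A k (e i))"
  assume "det (\<chi> i. krylov A k (e i)) = 0"
  moreover have "det M = of_int (det (\<chi> i. krylov A k (e i)))" by (simp add: M_def det_def)
  ultimately have "\<not> invertible M" by (simp add: invertible_det_nz)
  then obtain c l where c: "(\<Sum>i\<in>UNIV. c i *s row i M) = 0" "c l \<noteq> 0"
    unfolding invertible_right_inverse matrix_right_invertible_independent_rows by blast
  have inj: "e i = e j \<longleftrightarrow> i = j" for i j using e by (auto simp: bij_betw_def inj_on_def)
  have lt: "e i < CARD('n)" for i using e by (auto simp: bij_betw_def)
  \<comment> \<open>The linear relation among the Krylov vectors, read as a polynomial that
    annihilates \<open>k\<close> and has smaller degree than the characteristic polynomial.\<close>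
  define q where "q = (\<Sum>i\<in>UNIV. monom (c i) (e i))"
  have "coeff q (e l) = c l" unfolding q_def by (simp add: coeff_sum inj)
  then have q0: "q \<noteq> 0" using c(2) by auto
  have dq: "degree q < CARD('n)" unfolding q_def
    by (rule degree_sum_less) (use lt degree_monom_le le_less_trans in \<open>blast, simp\<close>)
  define Q :: "complex poly" where "Q = map_poly of_rat q"
  have Q: "Q = (\<Sum>i\<in>UNIV. monom (of_rat (c i)) (e i))"
    unfolding Q_def q_def by (rule poly_eqI) (simp add: coeff_map_poly coeff_sum of_rat_sum if_distrib cong: if_cong)
  have Q0: "Q \<noteq> 0" using q0 unfolding Q_def by (simp add: map_poly_eq_0_iff)
  let ?u = "\<chi> j. of_int (k $ j) :: complex ^ 'n" and ?B = "transpose (map_matrix of_int A) :: complex ^ 'n ^ 'n"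
  have "poly_act ?B Q ?u = (\<Sum>i\<in>UNIV. of_rat (c i) *s (\<chi> j. of_int (krylov A k (e i) $ j)))"
    unfolding Q by (simp add: poly_act_sum poly_act_monom of_int_krylov)
  also have "\<dots> = 0"
  proof -
    have "(\<Sum>i\<in>UNIV. c i * of_int (krylov A k (e i) $ j)) = 0" for j
      using arg_cong[OF c(1), of "\<lambda>x. x $ j"] by (simp add: M_def row_def)
    then have "(\<Sum>i\<in>UNIV. of_rat (c i) * of_int (krylov A k (e i) $ j)) = (0 :: complex)" for j
      using arg_cong[of _ 0 "of_rat :: rat \<Rightarrow> complex"] by (fastforce simp: of_rat_sum of_rat_mult)
    then show ?thesis by (simp add: vec_eq_iff)
  qed
  finally have "poly_act ?B Q ?u = 0" .
  moreover have "?u \<noteq> 0" using assms(2) by (auto simp: vec_eq_iff)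
  ultimately obtain z w where z: "poly Q z = 0" "w \<noteq> 0" "?B *v w = z *s w"
    using poly_act_zero_imp_eigenvector[OF Q0] by blast
  have "poly (map_poly of_rat q) z \<noteq> 0"
    using assms(1) charpoly_root[OF z(2,3)] q0 dq
    by (intro irreducible_no_common_root[of "charpoly A"]) (auto simp: irreducible_aut_def degree_charpoly)
  then show False using z(1) by (simp add: Q_def)
qed

lemma det_bound:
  fixes N :: "real ^ 'n ^ 'n"
  assumes "\<And>i j. \<bar>N $ i $ j\<bar> \<le> C"
  shows "\<bar>det N\<bar> \<le> fact CARD('n) * C ^ CARD('n)"
proof -
  have "\<bar>det N\<bar> \<le> (\<Sum>p\<in>{p. p permutes (UNIV :: 'n set)}. \<bar>of_int (sign p) * (\<Prod>i\<in>UNIV. N $ i $ p i)\<bar>)"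
    unfolding det_def by (rule sum_abs)
  also have "\<dots> \<le> (\<Sum>p\<in>{p. p permutes (UNIV :: 'n set)}. C ^ CARD('n))"
  proof (rule sum_mono)
    fix p :: "'n \<Rightarrow> 'n"
    have "\<bar>of_int (sign p) * (\<Prod>i\<in>UNIV. N $ i $ p i)\<bar> = (\<Prod>i\<in>UNIV. \<bar>N $ i $ p i\<bar>)"
      by (simp add: abs_mult abs_prod sign_def)
    also have "\<dots> \<le> (\<Prod>i\<in>(UNIV :: 'n set). C)" by (rule prod_mono) (use assms in auto)
    finally show "\<bar>of_int (sign p) * (\<Prod>i\<in>UNIV. N $ i $ p i)\<bar> \<le> C ^ CARD('n)" by simp
  qed
  also have "\<dots> = fact CARD('n) * C ^ CARD('n)" by (simp add: card_permutations[OF refl])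
  finally show ?thesis .
qed

lemma knorm_transpose_power:
  fixes A :: "int ^ 'n ^ 'n"
  obtains S where "1 \<le> S" "\<And>n k. knorm (krylov A k n) \<le> S ^ n * knorm k"
proof
  let ?S = "1 + (\<Sum>i\<in>UNIV. \<Sum>j\<in>UNIV. real_of_int \<bar>A $ i $ j\<bar>)"
  show S1: "1 \<le> ?S" by (simp add: sum_nonneg)
  have step: "knorm (transpose A *v k) \<le> ?S * knorm k" for k
  proof -
    have "knorm (transpose A *v k) \<le> (\<Sum>j\<in>UNIV. \<Sum>i\<in>UNIV. real_of_int \<bar>A $ i $ j\<bar> * real_of_int \<bar>k $ i\<bar>)"
      unfolding knorm_def matrix_vector_mult_def transpose_def
      by (rule sum_mono) (simp add: order_trans[OF sum_abs] flip: abs_mult)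
    also have "\<dots> = (\<Sum>i\<in>UNIV. (\<Sum>j\<in>UNIV. real_of_int \<bar>A $ i $ j\<bar>) * real_of_int \<bar>k $ i\<bar>)"
      by (subst sum.swap) (simp add: sum_distrib_right)
    also have "\<dots> \<le> (\<Sum>i\<in>UNIV. ?S * real_of_int \<bar>k $ i\<bar>)"
    proof (intro sum_mono mult_right_mono)
      fix i
      have "(\<Sum>j\<in>UNIV. real_of_int \<bar>A $ i $ j\<bar>) \<le> (\<Sum>i\<in>UNIV. \<Sum>j\<in>UNIV. real_of_int \<bar>A $ i $ j\<bar>)"
        by (rule member_le_sum[of i UNIV "\<lambda>i. \<Sum>j\<in>UNIV. real_of_int \<bar>A $ i $ j\<bar>"]) (auto simp: sum_nonneg)
      then show "(\<Sum>j\<in>UNIV. real_of_int \<bar>A $ i $ j\<bar>) \<le> ?S" by simp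
    qed simp
    also have "\<dots> = ?S * knorm k" by (simp add: knorm_def sum_distrib_left)
    finally show ?thesis .
  qed
  show "knorm (krylov A k n) \<le> ?S ^ n * knorm k" for n k
  proof (induction n)
    case (Suc n)
    have "knorm (krylov A k (Suc n)) \<le> ?S * knorm (krylov A k n)" using step by (simp only: funpow.simps comp_apply)
    also have "\<dots> \<le> ?S * (?S ^ n * knorm k)" using S1 by (intro mult_left_mono Suc) linarith
    finally show ?case by (simp only: power_Suc mult.assoc)
  qed simp
qed

text \<open>Let \<open>M\<close> have the Krylov vectors of \<open>k\<close> as rows, and let
  \<open>s\<close> be the pairing of \<open>k\<close> with \<open>v\<close>. Then \<open>M\<close>
  maps \<open>v\<close> to \<open>s\<close> times a vector of powers of \<open>lam\<close>. By
  Cramer's rule \<open>v $ l * det M\<close> is \<open>s\<close> times a determinant whose entries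
  are at most \<open>C * knorm k\<close>. Since \<open>det M\<close> is a nonzero integer, the
  modulus of \<open>s\<close> is at least a constant divided by
  \<open>knorm k ^ CARD('n)\<close>.\<close>

lemma eigenvector_diophantine:
  fixes A :: "int ^ 'n ^ 'n" and v :: "real ^ 'n"
  assumes irr: "irreducible_aut A" and v: "eigenvector (map_matrix of_int A) v lam"
  obtains \<gamma> where "0 < \<gamma>" "\<And>k. k \<noteq> 0 \<Longrightarrow> \<gamma> \<le> \<bar>\<Sum>j\<in>UNIV. of_int (k $ j) * v $ j\<bar> * knorm k ^ CARD('n)"
proof -
  obtain e where e: "bij_betw e (UNIV :: 'n set) {0..<CARD('n)}" using ex_bij_betw_finite_nat[of "UNIV :: 'n set"] by auto
  have lt: "e i < CARD('n)" for i using e by (auto simp: bij_betw_def)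
  obtain S where S: "1 \<le> S" "\<And>n k. knorm (krylov A k n) \<le> S ^ n * knorm k" by (rule knorm_transpose_power[of A]) blast
  obtain l where l: "v $ l \<noteq> 0" using v by (auto simp: eigenvector_def vec_eq_iff)
  \<comment> \<open>It dominates both the growth of the Krylov vectors and the powers of
    \<open>lam\<close>, so that one constant bounds all entries of the determinant.\<close>
  define T where "T = max S (1 + \<bar>lam\<bar>)"
  define C where "C = T ^ CARD('n)"
  have T1: "1 \<le> T" unfolding T_def using S(1) by simp
  have Tn: "S ^ e i \<le> C" "\<bar>lam\<bar> ^ e i \<le> C" for i
  proof -
    have "T ^ e i \<le> C" unfolding C_def using T1 lt[of i] by (intro power_increasing) auto
    moreover have "S ^ e i \<le> T ^ e i" "\<bar>lam\<bar> ^ e i \<le> T ^ e i" using S(1) by (auto intro!: power_mono simp: T_def)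
    ultimately show "S ^ e i \<le> C" "\<bar>lam\<bar> ^ e i \<le> C" by auto
  qed
  have C1: "1 \<le> C" unfolding C_def using T1 by (rule one_le_power)
  show thesis
  proof (rule that[of "\<bar>v $ l\<bar> / (fact CARD('n) * C ^ CARD('n))"])
    show "0 < \<bar>v $ l\<bar> / (fact CARD('n) * C ^ CARD('n))" using l C1 by simp
    fix k :: "int ^ 'n" assume k: "k \<noteq> 0"
      let ?s = "\<Sum>j\<in>UNIV. real_of_int (k $ j) * v $ j"
    define M :: "real ^ 'n ^ 'n" where "M = map_matrix of_int (\<chi> i. krylov A k (e i))"
    have "det M = of_int (det (\<chi> i. krylov A k (e i)))" by (simp add: M_def det_def)
    then have detM: "1 \<le> \<bar>det M\<bar>" using krylov_det_nonzero[OF irr k e] by linarith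
    have step: "(\<Sum>j\<in>UNIV. real_of_int ((transpose A *v m) $ j) * v $ j) = lam * (\<Sum>j\<in>UNIV. real_of_int (m $ j) * v $ j)" for m
    proof -
      have "(\<Sum>j\<in>UNIV. real_of_int ((transpose A *v m) $ j) * v $ j) = (\<Sum>j\<in>UNIV. \<Sum>i\<in>UNIV. of_int (m $ i) * (of_int (A $ i $ j) * v $ j))"
        by (simp add: matrix_vector_mult_def transpose_def sum_distrib_left mult_ac)
      also have "\<dots> = (\<Sum>i\<in>UNIV. of_int (m $ i) * (map_matrix of_int A *v v) $ i)"
        by (subst sum.swap) (simp add: matrix_vector_mult_def sum_distrib_left)
      also have "map_matrix of_int A *v v = lam *s v" using v by (simp add: eigenvector_def)
      finally show ?thesis by (simp add: sum_distrib_left mult_ac)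
    qed
    have Kn: "(\<Sum>j\<in>UNIV. real_of_int (krylov A k n $ j) * v $ j) = lam ^ n * ?s" for n
      by (induction n) (simp_all add: step del: transpose_matrix_vector)
    have Mv: "M *v v = ?s *s (\<chi> i. lam ^ e i)"
      unfolding vec_eq_iff by (simp add: M_def matrix_vector_mult_def Kn)
    have s0: "?s \<noteq> 0"
    proof
      assume "?s = 0"
      then have "M *v v = 0" using Mv by simp
      moreover have "invertible M" using detM by (simp add: invertible_det_nz)
      ultimately have "v = 0" unfolding invertible_left_inverse matrix_left_invertible_ker by blast
      then show False using l by simp
    qed
    let ?N = "\<chi> i j. if j = l then lam ^ e i else M $ i $ j"
    have "det ?N = (v $ l / ?s) * det M"
    proof -
      have "M *v ((1 / ?s) *s v) = (\<chi> i. lam ^ e i)"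
        unfolding vector_scalar_commute Mv using s0 by (simp add: vec_eq_iff)
      then show ?thesis using cramer_lemma[of l M "(1 / ?s) *s v"] by (simp only: vec_lambda_beta) simp
    qed
    then have "\<bar>v $ l\<bar> * \<bar>det M\<bar> = \<bar>?s\<bar> * \<bar>det ?N\<bar>" using s0 by (simp add: abs_mult)
    moreover have "\<bar>v $ l\<bar> * 1 \<le> \<bar>v $ l\<bar> * \<bar>det M\<bar>" using detM by (intro mult_left_mono) auto
    moreover have "\<bar>det ?N\<bar> \<le> fact CARD('n) * (C * knorm k) ^ CARD('n)"
    proof (rule det_bound)
      fix i j
      have "\<bar>real_of_int (krylov A k (e i) $ j)\<bar> \<le> knorm (krylov A k (e i))"
        unfolding knorm_def using member_le_sum[of j UNIV "\<lambda>j. real_of_int \<bar>krylov A k (e i) $ j\<bar>"] by simp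
      also have "\<dots> \<le> S ^ e i * knorm k" by (rule S(2))
      also have "\<dots> \<le> C * knorm k" using Tn by (intro mult_right_mono) auto
      finally have "\<bar>M $ i $ j\<bar> \<le> C * knorm k" by (simp add: M_def)
      moreover have "\<bar>lam\<bar> ^ e i \<le> C * knorm k"
        using Tn(2)[of i] C1 mult_left_mono[OF knorm_ge_1[OF k], of C] by linarith
      ultimately show "\<bar>?N $ i $ j\<bar> \<le> C * knorm k" by (simp add: power_abs)
    qed
    ultimately have "\<bar>v $ l\<bar> \<le> \<bar>?s\<bar> * (fact CARD('n) * (C * knorm k) ^ CARD('n))"
      by (smt (verit) abs_ge_zero mult_left_mono)
    then show "\<bar>v $ l\<bar> / (fact CARD('n) * C ^ CARD('n)) \<le> \<bar>?s\<bar> * knorm k ^ CARD('n)"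
      using C1 by (simp add: divide_le_eq power_mult_distrib mult_ac)
  qed
qed

text \<open>A coordinate of \<open>v\<close> is its pairing with a unit integer vector, to which the
  Diophantine bound applies.\<close>

lemma eigenvector_component_nonzero:
  fixes A :: "int ^ 'n ^ 'n" and v :: "real ^ 'n"
  assumes "irreducible_aut A" "eigenvector (map_matrix of_int A) v lam"
  shows "v $ i \<noteq> 0"
proof
  assume 0: "v $ i = 0"
  obtain \<gamma> where g: "0 < \<gamma>" "\<And>k. k \<noteq> 0 \<Longrightarrow> \<gamma> \<le> \<bar>\<Sum>j\<in>UNIV. of_int (k $ j) * v $ j\<bar> * knorm k ^ CARD('n)"
    using eigenvector_diophantine[OF assms] by blast
  have "(\<Sum>j\<in>UNIV. real_of_int (axis i 1 $ j) * v $ j) = v $ i"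
    by (simp add: axis_def if_distrib[of "\<lambda>a. of_int a * _"] cong: if_cong)
  then show False using g(1) g(2)[of "axis i 1"] 0 by simp
qed

text \<open>Subtracting from \<open>u\<close> the multiple of \<open>v\<close> that cancels one
  coordinate leaves a solution of the same eigenvalue equation with a vanishing coordinate, which
  must be zero.\<close>

lemma eigenspace_one_dimensional:
  fixes A :: "int ^ 'n ^ 'n" and v u :: "real ^ 'n"
  assumes irr: "irreducible_aut A" and v: "eigenvector (map_matrix of_int A) v lam"
    and u: "map_matrix of_int A *v u = lam *s u"
  obtains c where "u = c *\<^sub>R v"
proof -
  fix i :: 'n
  have vi: "v $ i \<noteq> 0" by (rule eigenvector_component_nonzero[OF irr v])
  let ?w = "u - (u $ i / v $ i) *s v"
  have "?w $ i = 0" using vi by simp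
  moreover have "map_matrix of_int A *v ?w = lam *s ?w"
    using u v by (simp add: eigenvector_def matrix_vector_mult_diff_distrib vector_scalar_commute vec.scale_right_diff_distrib mult.commute)
  ultimately have "?w = 0" using eigenvector_component_nonzero[OF irr, of ?w lam i] unfolding eigenvector_def by blast
  then show thesis by (intro that[of "u $ i / v $ i"]) (simp add: scalar_mult_eq_scaleR)
qed

lemma eigenvalue_nonzero:
  fixes A :: "int ^ 'n ^ 'n" and v :: "real ^ 'n"
  assumes "invertible A" "eigenvector (map_matrix of_int A) v lam"
  shows "lam \<noteq> 0"
proof
  assume "lam = 0"
  then have 0: "map_matrix of_int A *v v = 0" "v \<noteq> 0" using assms(2) by (auto simp: eigenvector_def)
  obtain B where "B ** A = mat 1" using assms(1) by (auto simp: invertible_def)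
  then have "map_matrix real_of_int (B ** A) = mat 1" by (simp add: vec_eq_iff mat_def)
  moreover have "map_matrix real_of_int (B ** A) = map_matrix of_int B ** map_matrix of_int A"
    by (simp add: vec_eq_iff matrix_matrix_mult_def)
  ultimately have "v = map_matrix of_int B *v (map_matrix of_int A *v v)" by (simp add: matrix_vector_mul_assoc)
  then show False using 0 by simp
qed

lemma ergodic_no_fixed_vector:
  fixes A :: "int ^ 'n ^ 'n" and u :: "real ^ 'n"
  assumes "ergodic_aut A" "map_matrix of_int A *v u = u"
  shows "u = 0"
proof (rule ccontr)
  assume "u \<noteq> 0"
  then have "cvec u \<noteq> 0" by (auto simp: cvec_def vec_eq_iff)
  moreover have "map_matrix of_int A *v cvec u = 1 *s cvec u"
    unfolding vec_eq_iff
  proof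
    fix i
    have "of_real ((map_matrix of_int A *v u) $ i) = (map_matrix of_int A *v cvec u) $ i"
      by (simp add: matrix_vector_mult_def cvec_def)
    then show "(map_matrix of_int A *v cvec u) $ i = (1 *s cvec u) $ i" using assms(2) by (simp add: cvec_def)
  qed
  ultimately have "eigenvector (map_matrix of_int A) (cvec u) 1" by (simp add: eigenvector_def)
  then show False using assms(1) unfolding ergodic_aut_def by (metis power_one zero_less_one)
qed

section \<open>Lifts of torus maps and flows\<close>

lemma Ck_has_derivative:
  assumes "Ck_on (Suc k) UNIV f" "\<And>x. (f has_derivative f' x) (at x)"
  shows "Ck_on k UNIV (\<lambda>x. f' x u)"
proof -
  have "frechet_derivative f (at x) = f' x" for x using frechet_derivative_at[OF assms(2)] by simp
  then show ?thesis using assms(1) by simp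
qed

text \<open>\<open>N y\<close> is the fixed point of the contraction
  \<open>x \<mapsto> y - h x\<close>. The derivative of \<open>N\<close> solves a linear system
  whose matrix depends on \<open>N y\<close>, so Cramer's rule turns the differentiability already
  known for \<open>N\<close> into one order more.\<close>

lemma near_identity_inverse:
  fixes h :: "real ^ 'd::finite \<Rightarrow> real ^ 'd"
  assumes Ck: "\<And>m. Ck_on m UNIV h" and h': "\<And>x. (h has_derivative h' x) (at x)"
    and small: "\<And>x u. norm (h' x u) \<le> norm u / 2"
  obtains N N' where "\<And>x. N (x + h x) = x" "\<And>y. N y + h (N y) = y" "\<And>m. Ck_on m UNIV N"
    "\<And>y. (N has_derivative N' y) (at y)" "\<And>y u. N' y u + h' (N y) (N' y u) = u" "\<And>y u. N' y (u + h' (N y) u) = u"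
proof -
  have lin: "linear (h' x)" for x using has_derivative_bounded_linear[OF h'] bounded_linear.linear by blast
  have lip: "norm (h x - h y) \<le> 1 / 2 * norm (x - y)" for x y
  proof (rule differentiable_bound[where S = UNIV])
    show "(h has_derivative h' x) (at x within UNIV)" for x using h' .
    show "onorm (h' x) \<le> 1 / 2" for x by (rule onorm_bound) (use small in auto)
  qed auto
  have "\<exists>x. x + h x = y" for y
  proof -
    have "\<exists>!x\<in>UNIV. y - h x = x"
    proof (rule Banach_fix[where c = "1 / 2"])
      show "dist (y - h x) (y - h z) \<le> 1 / 2 * dist x z" for x z
        using lip[of z x] by (simp add: dist_norm norm_minus_commute)
    qed (auto simp: complete_UNIV)
    then show ?thesis by (metis diff_add_cancel)
  qed
  then obtain N where N: "\<And>y. N y + h (N y) = y" by metis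
  have inj: "x = z" if "x + h x = z + h z" for x z
  proof -
    have "x - z = h z - h x" using that by (simp add: algebra_simps)
    then have "norm (x - z) \<le> 1 / 2 * norm (x - z)" using lip[of z x] by (simp add: norm_minus_commute)
    then show ?thesis by simp
  qed
  have N2: "N (x + h x) = x" for x using inj N by blast
  have Nlip: "norm (N y - N z) \<le> 2 * norm (y - z)" for y z
  proof -
    have "y - z = (N y - N z) + (h (N y) - h (N z))" using N[of y] N[of z] by (simp add: algebra_simps)
    then have "norm (N y - N z) \<le> norm (y - z) + norm (h (N y) - h (N z))"
      by (metis add_diff_cancel norm_triangle_ineq4)
    then show ?thesis using lip[of "N y" "N z"] by linarith
  qed
  have contN: "continuous_on UNIV N"
    by (rule lipschitz_on_continuous_on[OF lipschitz_onI[of UNIV N 2]]) (use Nlip in \<open>auto simp: dist_norm\<close>)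
  define M where "M y = matrix (\<lambda>u. u + h' (N y) u)" for y
  have M: "M y *v u = u + h' (N y) u" for y u
    unfolding M_def by (rule fun_cong[OF matrix_vector_mul(2)]) (intro linear_compose_add linear_ident lin)
  have "M y *v u = 0 \<Longrightarrow> u = 0" for y u
    using small[of "N y" u] unfolding M by (auto simp: add_eq_0_iff)
  then have inv: "invertible (M y)" for y unfolding invertible_left_inverse matrix_left_invertible_ker by blast
  then obtain B where B: "\<And>y. M y ** B y = mat 1" "\<And>y. B y ** M y = mat 1" unfolding invertible_def by metis
  define N' where "N' y u = B y *v u" for y u
  have 1: "N' y (M y *v u) = u" and 2: "M y *v N' y u = u" for y u
    unfolding N'_def matrix_vector_mul_assoc by (simp_all add: B)
  have der: "(N has_derivative N' y) (at y)" for y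
  proof (rule has_derivative_inverse_basic[where f = "\<lambda>x. x + h x" and f' = "\<lambda>u. u + h' (N y) u" and T = UNIV])
    show "((\<lambda>x. x + h x) has_derivative (\<lambda>u. u + h' (N y) u)) (at (N y))"
      by (intro has_derivative_add has_derivative_ident h')
    show "bounded_linear (N' y)" unfolding N'_def by (rule matrix_vector_mul_bounded_linear)
    show "N' y \<circ> (\<lambda>u. u + h' (N y) u) = id" using 1 unfolding M by (simp add: fun_eq_iff)
    show "continuous (at y) N" using contN continuous_on_eq_continuous_at[OF open_UNIV] by blast
  qed (use N in auto)
  have "Ck_on m UNIV N" for m
  proof (induction m)
    case 0
    then show ?case using contN by simp
  next
    case (Suc m)
    have "Ck_on m UNIV (\<lambda>y. N' y u)" for u
    proof (rule Ck_solve[where M = M])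
      show "Ck_on m UNIV (\<lambda>y. M y $ i $ j)" for i j
      proof -
        have "M y $ i $ j = (axis j 1 + h' (N y) (axis j 1)) $ i" for y unfolding M_def matrix_def by simp
        moreover have "Ck_on m UNIV (\<lambda>y. (axis j 1 + h' (N y) (axis j 1)) $ i)"
          by (intro Ck_bounded_linear[OF bounded_linear_vec_nth] Ck_add Ck_on_const Ck_compose[OF Suc] Ck_has_derivative[OF Ck h'])
        ultimately show ?thesis by simp
      qed
      show "det (M y) \<noteq> 0" for y using inv by (simp add: invertible_det_nz)
      show "M y *v N' y u = u" for y by (rule 2)
    qed
    then show ?case by (rule Ck_SucI[OF der])
  qed
  then show thesis using that[OF N2 N _ der] 1 2 unfolding M by blast
qed

section \<open>Lifts and velocities of curves in the torus\<close>

lemma to_torus_eq_iff: "to_torus x = to_torus y \<longleftrightarrow> (\<forall>i. x $ i - y $ i \<in> \<int>)"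
  by (rule torus.abs_eq_iff)

lemma to_torus_add_int: "to_torus (x + (\<chi> j. of_int (m $ j))) = to_torus x"
  by (simp add: to_torus_eq_iff)

lemma to_torus_eqE:
  fixes x y :: "real ^ 'd::finite"
  assumes "to_torus x = to_torus y"
  obtains m :: "int ^ 'd" where "x = y + (\<chi> j. of_int (m $ j))"
proof -
  have "\<exists>n. x $ i - y $ i = of_int n" for i using assms by (auto simp: to_torus_eq_iff elim: Ints_cases)
  then obtain n where "\<And>i. x $ i - y $ i = of_int (n i)" by metis
  then have "x = y + (\<chi> j. of_int ((\<chi> i. n i) $ j))" by (simp add: vec_eq_iff algebra_simps)
  then show thesis by (rule that)
qed

text \<open>A continuous function with integer values is locally constant. Applied to the difference
  of two lifts, this makes velocities unique.\<close>

lemma has_vector_derivative_integer_valued: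
  fixes \<phi> :: "real \<Rightarrow> real ^ 'd::finite"
  assumes int: "\<forall>\<^sub>F s in nhds t. \<forall>i. \<phi> s $ i \<in> \<int>" and D: "(\<phi> has_vector_derivative D) (at t)"
  shows "D = 0"
proof -
  have "isCont \<phi> t" using D by (rule has_vector_derivative_continuous)
  then have near: "\<forall>\<^sub>F s in nhds t. dist (\<phi> s) (\<phi> t) < 1"
    using tendstoD[of \<phi> "\<phi> t" "nhds t" 1] by (simp add: continuous_at tendsto_at_iff_tendsto_nhds isCont_def)
  have t: "\<forall>i. \<phi> t $ i \<in> \<int>" using eventually_nhds_x_imp_x[OF int] .
  from near int have "\<forall>\<^sub>F s in nhds t. \<phi> s = \<phi> t"
  proof eventually_elim
    case (elim s)
    show ?case unfolding vec_eq_iff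
    proof
      fix i
      have "\<bar>\<phi> s $ i - \<phi> t $ i\<bar> < 1" using elim(1) component_le_norm_cart[of "\<phi> s - \<phi> t" i] by (simp add: dist_norm)
      moreover have "\<phi> s $ i - \<phi> t $ i \<in> \<int>" using elim(2) t by simp
      ultimately show "\<phi> s $ i = \<phi> t $ i" by (metis Ints_nonzero_abs_less1 eq_iff_diff_eq_0)
    qed
  qed
  then obtain S where S: "open S" "t \<in> S" "\<And>s. s \<in> S \<Longrightarrow> \<phi> s = \<phi> t" unfolding eventually_nhds by blast
  have "((\<lambda>_. \<phi> t) has_vector_derivative D) (at t)"
    by (rule has_vector_derivative_transform_within_open[OF D S(1,2) S(3)])
  then show ?thesis using vector_derivative_unique_at[OF _ has_vector_derivative_const] by blast
qed

lemma has_velocity_lift: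
  assumes "has_velocity \<gamma> w t" "\<gamma> t = to_torus x"
  obtains c where "c t = x" "(c has_vector_derivative w) (at t)" "\<forall>\<^sub>F s in nhds t. \<gamma> s = to_torus (c s)"
proof -
  obtain c where c: "(c has_vector_derivative w) (at t)" "\<forall>\<^sub>F s in nhds t. \<gamma> s = to_torus (c s)"
    using assms(1) by (auto simp: has_velocity_def)
  have "to_torus (c t) = to_torus x" using eventually_nhds_x_imp_x[OF c(2)] assms(2) by simp
  then obtain m where m: "c t = x + (\<chi> j. of_int (m $ j))" by (rule to_torus_eqE)
  have "to_torus (c s - (\<chi> j. of_int (m $ j))) = to_torus (c s)" for s by (simp add: to_torus_eq_iff)
  moreover have "((\<lambda>s. c s - (\<chi> j. of_int (m $ j))) has_vector_derivative w) (at t)"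
    using has_vector_derivative_diff[OF c(1) has_vector_derivative_const] by simp
  ultimately show thesis using c(2) m by (intro that[of "\<lambda>s. c s - (\<chi> j. of_int (m $ j))"]) simp_all
qed

lemma has_velocity_unique:
  assumes "has_velocity \<gamma> w t" "has_velocity \<gamma> w' t"
  shows "w = w'"
proof -
  obtain c where c: "(c has_vector_derivative w) (at t)" "\<forall>\<^sub>F s in nhds t. \<gamma> s = to_torus (c s)"
    using assms(1) by (auto simp: has_velocity_def)
  obtain c' where c': "(c' has_vector_derivative w') (at t)" "\<forall>\<^sub>F s in nhds t. \<gamma> s = to_torus (c' s)"
    using assms(2) by (auto simp: has_velocity_def)
  have "\<forall>\<^sub>F s in nhds t. \<forall>i. (c s - c' s) $ i \<in> \<int>"
    using c(2) c'(2)
  proof eventually_elim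
    case (elim s)
    then have "to_torus (c s) = to_torus (c' s)" by simp
    then show ?case by (simp add: to_torus_eq_iff)
  qed
  from has_vector_derivative_integer_valued[OF this has_vector_derivative_diff[OF c(1) c'(1)]]
  show ?thesis by simp
qed

lemma has_velocity_map:
  assumes "has_velocity \<gamma> w t" "\<gamma> t = to_torus x" and F': "(F has_derivative F') (at x)"
    and lift: "\<And>x. \<Phi> (to_torus x) = to_torus (F x)"
  shows "has_velocity (\<lambda>s. \<Phi> (\<gamma> s)) (F' w) t"
proof -
  obtain c where c: "c t = x" "(c has_vector_derivative w) (at t)" "\<forall>\<^sub>F s in nhds t. \<gamma> s = to_torus (c s)"
    using has_velocity_lift[OF assms(1,2)] by blast
  interpret F': bounded_linear F' using F' by (rule has_derivative_bounded_linear)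
  have "((\<lambda>s. F (c s)) has_derivative (\<lambda>s. F' (s *\<^sub>R w))) (at t)"
    using has_derivative_compose[of c "\<lambda>s. s *\<^sub>R w" t UNIV F F'] c(1,2) F' by (simp add: has_vector_derivative_def)
  then have "((\<lambda>s. F (c s)) has_vector_derivative F' w) (at t)"
    by (simp add: has_vector_derivative_def F'.scaleR)
  moreover have "\<forall>\<^sub>F s in nhds t. \<Phi> (\<gamma> s) = to_torus (F (c s))"
    using c(3) by eventually_elim (simp add: lift)
  ultimately show ?thesis by (auto simp: has_velocity_def)
qed

lemma has_velocity_scale:
  assumes "has_velocity \<gamma> w 0"
  shows "has_velocity (\<lambda>s. \<gamma> (a * s)) (a *\<^sub>R w) 0"
proof -
  obtain c where c: "(c has_vector_derivative w) (at 0)" "\<forall>\<^sub>F s in nhds 0. \<gamma> s = to_torus (c s)"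
    using assms by (auto simp: has_velocity_def)
  have "((\<lambda>s. a * s) has_vector_derivative a) (at 0)" by (auto intro!: derivative_eq_intros)
  then have "((c \<circ> (\<lambda>s. a * s)) has_vector_derivative a *\<^sub>R w) (at 0)"
    by (rule vector_diff_chain_at) (use c(1) in simp)
  moreover have "filterlim (\<lambda>s. a * s) (nhds 0) (nhds 0)"
    by (auto intro!: tendsto_eq_intros filterlim_ident)
  then have "\<forall>\<^sub>F s in nhds 0. \<gamma> (a * s) = to_torus (c (a * s))"
    using c(2) by (rule eventually_compose_filterlim[rotated])
  ultimately show ?thesis unfolding has_velocity_def o_def by blast
qed

lemma has_velocity_diff_line:
  assumes "has_velocity \<gamma> w t"
  shows "has_velocity (\<lambda>s. \<gamma> s - to_torus (s *\<^sub>R u)) (w - u) t"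
proof -
  obtain c where c: "(c has_vector_derivative w) (at t)" "\<forall>\<^sub>F s in nhds t. \<gamma> s = to_torus (c s)"
    using assms by (auto simp: has_velocity_def)
  have "((\<lambda>s. s *\<^sub>R u) has_vector_derivative u) (at t)" by (auto intro!: derivative_eq_intros)
  from has_vector_derivative_diff[OF c(1) this]
  have "((\<lambda>s. c s - s *\<^sub>R u) has_vector_derivative w - u) (at t)" .
  moreover have "\<forall>\<^sub>F s in nhds t. \<gamma> s - to_torus (s *\<^sub>R u) = to_torus (c s - s *\<^sub>R u)"
    using c(2) by eventually_elim (simp add: minus_torus.abs_eq)
  ultimately show ?thesis by (auto simp: has_velocity_def)
qed

text \<open>The coordinates of \<open>torus_exp\<close> are well defined on the torus and separate
  its points, which reduces the claim to complex-valued curves with zero derivative.\<close>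

lemma has_velocity_zero_imp_constant:
  fixes \<gamma> :: "real \<Rightarrow> 'd::finite torus"
  assumes "\<And>t. has_velocity \<gamma> 0 t"
  shows "\<gamma> t = \<gamma> 0"
proof -
  have rep: "em k (cvec (rep_torus (to_torus x))) = em k (cvec x)" for k and x :: "real ^ 'd"
  proof -
    have "to_torus (rep_torus (to_torus x)) = to_torus x" using Quotient_torus by (rule Quotient_abs_rep)
    then obtain m where "rep_torus (to_torus x) = x + (\<chi> j. of_int (m $ j))" by (rule to_torus_eqE)
    then show ?thesis by (simp add: em_periodic)
  qed
  define \<psi> where "\<psi> j s = em (axis j 1) (cvec (rep_torus (\<gamma> s)))" for j s
  have "(\<psi> j has_vector_derivative 0) (at s)" for j s
  proof -
    obtain c where c: "(c has_vector_derivative 0) (at s)" "\<forall>\<^sub>F s in nhds s. \<gamma> s = to_torus (c s)"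
      using assms[of s] by (auto simp: has_velocity_def)
    obtain S where S: "open S" "s \<in> S" "\<And>r. r \<in> S \<Longrightarrow> \<gamma> r = to_torus (c r)" using c(2) unfolding eventually_nhds by blast
    have "(c has_derivative (\<lambda>s. 0)) (at s)" using c(1) by (simp add: has_vector_derivative_def)
    then have "((\<lambda>r. em (axis j 1) (cvec (c r))) has_derivative
        (\<lambda>r. 2 * of_real pi * \<i> * kdot (axis j 1) (cvec 0) * em (axis j 1) (cvec (c s)))) (at s)"
      by (rule has_derivative_compose) (rule em_has_derivative)
    then have "((\<lambda>r. em (axis j 1) (cvec (c r))) has_vector_derivative 0) (at s)"
      by (simp add: has_vector_derivative_def cvec_def kdot_def)
    then show ?thesis
      by (rule has_vector_derivative_transform_within_open[OF _ S(1,2)])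
        (simp add: \<psi>_def S(3) rep)
  qed
  then have "\<psi> j t = \<psi> j 0" for j
    using has_derivative_zero_unique[of UNIV "\<psi> j" t 0] by (simp add: has_vector_derivative_def)
  then have e: "torus_exp (rep_torus (\<gamma> t)) = torus_exp (rep_torus (\<gamma> 0))"
    by (simp add: vec_eq_iff torus_exp_def \<psi>_def)
  have "periodic (to_torus :: real ^ 'd \<Rightarrow> _)" by (simp add: periodic_def to_torus_add_int)
  then have "to_torus (rep_torus (\<gamma> t)) = to_torus (rep_torus (\<gamma> 0))" using e by (rule torus_exp_eqD)
  then show ?thesis by (simp add: Quotient_abs_rep[OF Quotient_torus])
qed

text \<open>The derivative along \<open>v\<close> multiplies the coefficient of frequency
  \<open>k\<close> by \<open>2 * pi * \<i> * kdot k (cvec v)\<close>, which is nonzero for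
  \<open>k \<noteq> 0\<close>.\<close>

lemma constant_if_directional_derivative_zero:
  fixes u :: "real ^ 'd::finite \<Rightarrow> complex" and v :: "real ^ 'd"
  assumes "periodic u" and u': "\<And>x. (u has_derivative u' x) (at x)" and cont: "\<And>e. continuous_on UNIV (\<lambda>x. u' x e)"
    and zero: "\<And>x. u' x v = 0" and indep: "\<And>k. k \<noteq> 0 \<Longrightarrow> kdot k (cvec v) \<noteq> 0"
  shows "u x = cmean u"
proof -
  have cu: "continuous_on UNIV u" using u' by (rule has_derivative_imp_continuous_on)
  have c0: "fcoeff u k = 0" if "k \<noteq> 0" for k
  proof -
    have "0 = fcoeff (\<lambda>x. \<Sum>j\<in>UNIV. of_real (v $ j) * u' x (axis j 1)) k"
    proof -
      have "(\<Sum>j\<in>UNIV. of_real (v $ j) * u' x (axis j 1)) = 0" for x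
      proof -
        have lin: "linear (u' x)" using has_derivative_bounded_linear[OF u'] bounded_linear.linear by blast
        have "v = (\<Sum>j\<in>UNIV. v $ j *\<^sub>R axis j 1)"
          by (simp add: vec_eq_iff axis_def if_distrib cong: if_cong)
        then have "u' x v = u' x (\<Sum>j\<in>UNIV. v $ j *\<^sub>R axis j 1)" by (rule arg_cong[where f = "u' x"])
        also have "\<dots> = (\<Sum>j\<in>UNIV. v $ j *\<^sub>R u' x (axis j 1))"
          by (simp only: linear_sum[OF lin] linear_scale[OF lin])
        finally have "u' x v = (\<Sum>j\<in>UNIV. v $ j *\<^sub>R u' x (axis j 1))" .
        then show ?thesis using zero by (simp add: scaleR_conv_of_real)
      qed
      then show ?thesis by (simp add: fcoeff_def cmean_def)
    qed
    also have "\<dots> = (\<Sum>j\<in>UNIV. of_real (v $ j) * fcoeff (\<lambda>x. u' x (axis j 1)) k)"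
    proof -
      have "fcoeff (\<lambda>x. \<Sum>j\<in>UNIV. of_real (v $ j) * u' x (axis j 1)) k
          = cmean (\<lambda>x. \<Sum>j\<in>UNIV. of_real (v $ j) * (u' x (axis j 1) * em (- k) (cvec x)))"
        unfolding fcoeff_def by (simp add: sum_distrib_right mult.assoc)
      also have "\<dots> = (\<Sum>j\<in>UNIV. cmean (\<lambda>x. of_real (v $ j) * (u' x (axis j 1) * em (- k) (cvec x))))"
        unfolding cmean_def by (intro integral_sum cont_integrable continuous_intros cont continuous_em) auto
      finally show ?thesis by (simp only: cmean_cmult fcoeff_def)
    qed
    also have "\<dots> = 2 * of_real pi * \<i> * kdot k (cvec v) * fcoeff u k"
      unfolding fcoeff_derivative[OF assms(1) u' cont]
      by (simp add: kdot_def cvec_def sum_distrib_left sum_distrib_right mult_ac)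
    finally show ?thesis using indep[OF that] by simp
  qed
  have "u x - cmean u = 0"
  proof (rule fcoeff_zero_imp_zero)
    show "continuous_on UNIV (\<lambda>x. u x - cmean u)" by (intro continuous_intros cu)
    show "periodic (\<lambda>x. u x - cmean u)" using assms(1) by (simp add: periodic_def)
    fix k
    have "cmean (\<lambda>x. (u x - cmean u) * em k (cvec x)) = cmean (\<lambda>x. u x * em k (cvec x)) - cmean u * cmean (\<lambda>x :: real ^ 'd. em k (cvec x))"
      unfolding left_diff_distrib cmean_cmult[symmetric] by (intro cmean_diff continuous_intros cu continuous_em)
    also have "\<dots> = 0"
    proof (cases "k = 0")
      case True
      then show ?thesis by (simp add: cmean_def content_ones)
    next
      case False
      then show ?thesis using c0[of "- k"] by (simp add: cmean_em fcoeff_def)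
    qed
    finally show "cmean (\<lambda>x. (u x - cmean u) * em k (cvec x)) = 0" .
  qed
  then show ?thesis by simp
qed

section \<open>Vanishing of the counterterm\<close>

lemma unbounded_if_derivative_ge:
  fixes \<phi> :: "real \<Rightarrow> real"
  assumes "\<And>t. (\<phi> has_real_derivative \<phi>' t) (at t)" "\<And>t. \<mu> \<le> \<phi>' t" "0 < \<mu>" "\<And>t. \<bar>\<phi> t\<bar> \<le> C"
  shows False
proof -
  \<comment> \<open>By this time the growth is at least \<open>2 * C + 1\<close>, more than the
    bound \<open>C\<close> permits.\<close>
  let ?t = "(2 * C + 1) / \<mu>"
  have C: "0 \<le> C" using assms(4)[of 0] by linarith
  have "\<phi> 0 - \<mu> * 0 \<le> \<phi> ?t - \<mu> * ?t"
  proof (rule DERIV_nonneg_imp_nondecreasing[of 0 ?t "\<lambda>t. \<phi> t - \<mu> * t"])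
    fix x
    show "\<exists>y. ((\<lambda>t. \<phi> t - \<mu> * t) has_real_derivative y) (at x) \<and> 0 \<le> y"
      using assms(1)[of x] assms(2)[of x] by (intro exI[of _ "\<phi>' x - \<mu>"]) (auto intro!: derivative_eq_intros)
  qed (use C assms(3) in auto)
  then show False using assms(3) assms(4)[of 0] assms(4)[of ?t] by simp
qed

lemma Ck_id: "Ck_on m UNIV (\<lambda>x. x)"
proof (cases m)
  case (Suc k)
  show ?thesis unfolding Suc by (rule Ck_SucI[OF has_derivative_ident Ck_on_const])
qed simp

lemma integer_matrix_vector:
  fixes A :: "int ^ 'd ^ 'd" and m :: "int ^ 'd"
  shows "map_matrix real_of_int A *v (\<chi> j. of_int (m $ j)) = (\<chi> j. of_int ((A *v m) $ j))"
  by (simp add: vec_eq_iff matrix_vector_mult_def)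

text \<open>Here \<open>V\<close> is the lifted vector field, \<open>F x = A x + g x\<close> the lifted diffeomorphism and
  \<open>H = id + h\<close>. The counterterm \<open>w\<close> makes \<open>H\<inverse> F H - A\<close> drift linearly along the lines
  \<open>y + t v\<close>, which is impossible for a bounded function unless \<open>w = 0\<close>.\<close>

locale conjugated_field =
  fixes A :: "int ^ 'd::finite ^ 'd" and lam :: real and v :: "real ^ 'd"
    and h g V :: "real ^ 'd \<Rightarrow> real ^ 'd" and h' g' :: "real ^ 'd \<Rightarrow> real ^ 'd \<Rightarrow> real ^ 'd"
    and b B :: real and w :: "real ^ 'd" and N :: "real ^ 'd \<Rightarrow> real ^ 'd" and N' :: "real ^ 'd \<Rightarrow> real ^ 'd \<Rightarrow> real ^ 'd"
    and R F H
  defines "R \<equiv> map_matrix real_of_int A" and "F \<equiv> \<lambda>x. R *v x + g x" and "H \<equiv> \<lambda>x. x + h x"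
  assumes irr: "irreducible_aut A" and v: "eigenvector (map_matrix real_of_int A) v lam"
    and B: "0 < B" "\<And>u. u \<bullet> v = 0 \<Longrightarrow> B * norm u \<le> norm (lam *\<^sub>R u - R *v u)"
    and Ckh: "\<And>m. Ck_on m UNIV h" and h': "\<And>x. (h has_derivative h' x) (at x)" and ph: "periodic h"
    and small: "\<And>x u. norm (h' x u) \<le> 1 / 8 * norm u"
    and Ckg: "\<And>m. Ck_on m UNIV g" and g': "\<And>x. (g has_derivative g' x) (at x)" and pg: "periodic g"
    and smallg: "\<And>x u. norm (g' x u) \<le> B / 4 * norm u"
    and b: "\<bar>b - 1\<bar> \<le> 1 / 8" and wv: "w \<bullet> v = 0"
    and VH: "\<And>x. V (H x) = b *\<^sub>R (v + h' x v) + w"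
    and inv: "\<And>x. R *v V x + g' x (V x) = lam *\<^sub>R V (F x)"
    and NH: "\<And>x. N (H x) = x" and HN: "\<And>y. H (N y) = y" and CkN: "\<And>m. Ck_on m UNIV N"
    and N': "\<And>y. (N has_derivative N' y) (at y)" and N'1: "\<And>y u. N' y u + h' (N y) (N' y u) = u"
    and N'2: "\<And>y u. N' y (u + h' (N y) u) = u"
begin

definition "G y = N (F (H y))"

lemma HG: "H (G y) = F (H y)"
  by (simp add: G_def HN)

lemma Rv: "R *v v = lam *\<^sub>R v"
  using v by (simp add: eigenvector_def R_def scalar_mult_eq_scaleR)

definition "G' y u = N' (F (H y)) (R *v (u + h' y u) + g' (H y) (u + h' y u))"

lemma G': "(G has_derivative G' y) (at y)"
proof -
  have dH: "(H has_derivative (\<lambda>u. u + h' y u)) (at y)"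
    unfolding H_def by (intro has_derivative_add has_derivative_ident h')
  have dF: "(F has_derivative (\<lambda>u. R *v u + g' x u)) (at x)" for x
    unfolding F_def by (intro has_derivative_add g' bounded_linear_imp_has_derivative matrix_vector_mul_bounded_linear)
  show ?thesis unfolding G_def[abs_def] G'_def[abs_def]
    by (rule has_derivative_compose[OF has_derivative_compose[OF dH dF] N'])
qed

lemma linear_N': "linear (N' y)"
  using has_derivative_bounded_linear[OF N'] bounded_linear.linear by blast

lemma linear_g': "linear (g' y)"
  using has_derivative_bounded_linear[OF g'] bounded_linear.linear by blast

text \<open>It is \<open>b\<close> times the deviation of the derivative of \<open>G\<close> along
  \<open>v\<close> from \<open>lam *\<^sub>R v\<close>. Up to small terms from \<open>g'\<close> and
  \<open>h'\<close> it is the constant vector \<open>lam *\<^sub>R w - R *v w\<close>.\<close>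

definition "drift y = N' (F (H y)) (lam *\<^sub>R w - R *v w - g' (H y) w)"

lemma b_pos: "7 / 8 \<le> b" "b \<le> 9 / 8"
  using b by linarith+

text \<open>The invariance of \<open>V\<close> under \<open>F\<close> is used at \<open>H y\<close>,
  and \<open>V\<close> is expressed by \<open>VH\<close> both there and at
  \<open>F (H y) = H (G y)\<close>. The terms with \<open>w\<close> are the only ones that do not
  combine to \<open>lam *\<^sub>R v\<close>.\<close>

lemma G'_v: "G' y v = lam *\<^sub>R v + (1 / b) *\<^sub>R drift y"
proof -
  let ?z = "F (H y)"
  define u where "u = v + h' y v"
  have Nz: "N ?z = G y" by (simp add: G_def)
  have lin: "N' ?z (c *\<^sub>R a + e) = c *\<^sub>R N' ?z a + N' ?z e" for c a e
    by (simp only: linear_add[OF linear_N'] linear_scale[OF linear_N'])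
  have "b *\<^sub>R (R *v u + g' (H y) u) = R *v (b *\<^sub>R u) + g' (H y) (b *\<^sub>R u)"
    by (simp only: scaleR_add_right linear_scale[OF linear_g'] matrix_vector_mult_scaleR)
  also have "b *\<^sub>R u = V (H y) - w" by (simp add: VH u_def)
  also have "R *v (V (H y) - w) + g' (H y) (V (H y) - w) = lam *\<^sub>R V ?z - (R *v w + g' (H y) w)"
    unfolding matrix_vector_mult_diff_distrib linear_diff[OF linear_g'] inv[symmetric] by simp
  also have "V ?z = b *\<^sub>R (v + h' (N ?z) v) + w" using VH[of "G y"] unfolding HG Nz .
  also have "lam *\<^sub>R \<dots> - (R *v w + g' (H y) w)
      = (b * lam) *\<^sub>R (v + h' (N ?z) v) + (lam *\<^sub>R w - R *v w - g' (H y) w)"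
    by (simp add: scaleR_add_right mult.commute)
  finally have "N' ?z (b *\<^sub>R (R *v u + g' (H y) u)) = (b * lam) *\<^sub>R v + drift y"
    by (simp only: lin N'2 drift_def)
  then have "b *\<^sub>R G' y v = (b * lam) *\<^sub>R v + drift y"
    by (simp only: G'_def linear_scale[OF linear_N'] u_def)
  then have "(1 / b) *\<^sub>R (b *\<^sub>R G' y v) = (1 / b) *\<^sub>R ((b * lam) *\<^sub>R v + drift y)" by simp
  then show ?thesis using b_pos by (simp add: scaleR_add_right)
qed

lemma int_shift:
  fixes m :: "int ^ 'd"
  shows "H (x + (\<chi> j. of_int (m $ j))) = H x + (\<chi> j. of_int (m $ j))"
    "F (x + (\<chi> j. of_int (m $ j))) = F x + (\<chi> j. of_int ((A *v m) $ j))"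
    "N (x + (\<chi> j. of_int (m $ j))) = N x + (\<chi> j. of_int (m $ j))"
    "G (x + (\<chi> j. of_int (m $ j))) = G x + (\<chi> j. of_int ((A *v m) $ j))"
proof -
  show H: "H (x + (\<chi> j. of_int (m $ j))) = H x + (\<chi> j. of_int (m $ j))" for x m
    by (simp add: H_def periodicD[OF ph])
  show F: "F (x + (\<chi> j. of_int (m $ j))) = F x + (\<chi> j. of_int ((A *v m) $ j))" for x m
    unfolding F_def R_def matrix_vector_right_distrib integer_matrix_vector periodicD[OF pg] by (simp add: algebra_simps)
  show N: "N (x + (\<chi> j. of_int (m $ j))) = N x + (\<chi> j. of_int (m $ j))" for x m
    using NH[of "N x + (\<chi> j. of_int (m $ j))"] unfolding H HN .
  show "G (x + (\<chi> j. of_int (m $ j))) = G x + (\<chi> j. of_int ((A *v m) $ j))"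
    unfolding G_def H F N ..
qed

lemma bounded_G: obtains C where "\<And>y. norm (G y - R *v y) \<le> C"
proof -
  obtain Ch where Ch: "\<And>x. norm (h x) \<le> Ch" using periodic_bounded[OF ph Ck_continuous[OF Ckh]] by blast
  obtain Cg where Cg: "\<And>x. norm (g x) \<le> Cg" using periodic_bounded[OF pg Ck_continuous[OF Ckg]] by blast
  have bl: "bounded_linear ((*v) R)" by (rule matrix_vector_mul_bounded_linear)
  show thesis
  proof
    fix y
    have "G y - R *v y = R *v h y + g (H y) - h (G y)"
      using HG[of y] unfolding F_def by (simp add: H_def matrix_vector_right_distrib algebra_simps)
    also have "norm \<dots> \<le> norm (R *v h y) + norm (g (H y)) + norm (h (G y))"
      by (meson norm_triangle_ineq norm_triangle_ineq4 add_mono_thms_linordered_semiring(3) order_trans)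
    also have "norm (R *v h y) \<le> onorm ((*v) R) * Ch"
      using onorm[OF bl, of "h y"] Ch[of y] onorm_pos_le[OF bl] by (meson mult_left_mono order_trans)
    finally show "norm (G y - R *v y) \<le> onorm ((*v) R) * Ch + Cg + Ch"
      using Ch[of "G y"] Cg[of "H y"] by linarith
  qed
qed

text \<open>For nonzero \<open>w\<close> the lower bound on \<open>lam - R\<close> transversally to
  \<open>v\<close> makes \<open>E\<close> nonzero, and \<open>drift\<close> stays within half the
  length of \<open>E\<close> from \<open>E\<close>. The component of \<open>G - R\<close> along
  \<open>E\<close> then grows at a definite rate along the line \<open>t *\<^sub>R v\<close>,
  against \<open>bounded_G\<close>.\<close>

lemma w_zero: "w = 0"
proof (rule ccontr)
  assume w0: "w \<noteq> 0"
  define E where "E = lam *\<^sub>R w - R *v w"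
  have Bw: "B * norm w \<le> norm E" unfolding E_def by (rule B(2)[OF wv])
  have E0: "0 < norm E" using Bw w0 B(1) by (smt (verit) mult_pos_pos zero_less_norm_iff)
  have lower: "norm E ^ 2 / 4 \<le> (1 / b) * (drift y \<bullet> E)" for y
  proof -
    let ?\<xi> = "drift y" and ?z = "F (H y)"
    have eq: "?\<xi> + h' (N ?z) ?\<xi> = E - g' (H y) w" unfolding drift_def N'1 E_def ..
    \<comment> \<open>The reason for the constant \<open>B / 4\<close> in \<open>smallg\<close>: the
      error has to be small relative to \<open>E\<close>, which may itself be tiny. Together with
      the 1/8 in \<open>small\<close> this keeps the total error below half of
      \<open>norm E\<close>.\<close>
    have gw: "norm (g' (H y) w) \<le> norm E / 4" using smallg[of "H y" w] Bw by (simp add: field_simps)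
    have hx: "norm (h' (N ?z) ?\<xi>) \<le> 1 / 8 * norm ?\<xi>" by (rule small)
    have E: "E = ?\<xi> + h' (N ?z) ?\<xi> + g' (H y) w" using eq by (simp add: eq_diff_eq)
    then have "E - ?\<xi> = h' (N ?z) ?\<xi> + g' (H y) w" by (simp only: add.assoc add_diff_cancel_left')
    then have d: "norm (?\<xi> - E) \<le> norm (h' (N ?z) ?\<xi>) + norm (g' (H y) w)"
      by (metis norm_minus_commute norm_triangle_ineq)
    have "norm ?\<xi> \<le> norm (?\<xi> - E) + norm E" using norm_triangle_ineq[of "?\<xi> - E" E] by simp
    then have dE: "norm (?\<xi> - E) \<le> norm E / 2" using d gw hx E0 by linarith
    have "\<bar>(?\<xi> - E) \<bullet> E\<bar> \<le> norm (?\<xi> - E) * norm E" by (rule Cauchy_Schwarz_ineq2)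
    also have "\<dots> \<le> norm E / 2 * norm E" using dE by (intro mult_right_mono) auto
    finally have "\<bar>?\<xi> \<bullet> E - norm E ^ 2\<bar> \<le> norm E ^ 2 / 2"
      by (simp add: inner_diff_left power2_norm_eq_inner[symmetric] power2_eq_square[of "norm E", symmetric])
    then have "norm E ^ 2 / 2 \<le> ?\<xi> \<bullet> E" by linarith
    moreover have "b * (norm E ^ 2 / 4) \<le> norm E ^ 2 / 2"
      using mult_right_mono[of b 2 "norm E ^ 2 / 4"] b_pos by simp
    ultimately have "b * (norm E ^ 2 / 4) \<le> ?\<xi> \<bullet> E" by linarith
    then show ?thesis using b_pos by (simp add: pos_le_divide_eq mult.commute)
  qed
  obtain C where C: "\<And>y. norm (G y - R *v y) \<le> C" by (rule bounded_G) blast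
  let ?\<phi> = "\<lambda>t. (G (t *\<^sub>R v) - R *v (t *\<^sub>R v)) \<bullet> E"
  show False
  proof (rule unbounded_if_derivative_ge[of ?\<phi> "\<lambda>t. (1 / b) * (drift (t *\<^sub>R v) \<bullet> E)" "norm E ^ 2 / 4" "C * norm E"])
    fix t
    have 1: "((\<lambda>t. t *\<^sub>R v) has_derivative (\<lambda>t. t *\<^sub>R v)) (at t)" by (auto intro!: derivative_eq_intros)
    have lin: "linear (G' (t *\<^sub>R v))" using has_derivative_bounded_linear[OF G'] bounded_linear.linear by blast
    have "((\<lambda>t. G (t *\<^sub>R v)) has_derivative (\<lambda>s. G' (t *\<^sub>R v) (s *\<^sub>R v))) (at t)"
      by (rule has_derivative_compose[OF 1 G'])
    moreover have "((\<lambda>t. R *v (t *\<^sub>R v)) has_derivative (\<lambda>s. R *v (s *\<^sub>R v))) (at t)"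
      by (rule has_derivative_compose[OF 1 bounded_linear_imp_has_derivative[OF matrix_vector_mul_bounded_linear]])
    ultimately have "(?\<phi> has_derivative (\<lambda>s. (G' (t *\<^sub>R v) (s *\<^sub>R v) - R *v (s *\<^sub>R v)) \<bullet> E)) (at t)"
      by (intro has_derivative_inner_left has_derivative_diff)
    moreover have "(\<lambda>s. (G' (t *\<^sub>R v) (s *\<^sub>R v) - R *v (s *\<^sub>R v)) \<bullet> E) = (*) ((1 / b) * (drift (t *\<^sub>R v) \<bullet> E))"
      by (rule ext) (simp add: linear_scale[OF lin] G'_v matrix_vector_mult_scaleR Rv inner_diff_left inner_add_left algebra_simps)
    ultimately show "(?\<phi> has_real_derivative (1 / b) * (drift (t *\<^sub>R v) \<bullet> E)) (at t)"
      unfolding has_field_derivative_def by simp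
    show "norm E ^ 2 / 4 \<le> (1 / b) * (drift (t *\<^sub>R v) \<bullet> E)" by (rule lower)
    show "\<bar>?\<phi> t\<bar> \<le> C * norm E"
      using Cauchy_Schwarz_ineq2[of "G (t *\<^sub>R v) - R *v (t *\<^sub>R v)" E] mult_right_mono[OF C[of "t *\<^sub>R v"], of "norm E"] by simp
  qed (use E0 in simp)
qed

lemma G'_v_eigen: "G' y v = lam *\<^sub>R v"
  unfolding G'_v drift_def by (simp add: w_zero linear_0[OF linear_N'] linear_0[OF linear_g'])

lemma Ck_G: "Ck_on m UNIV (\<lambda>y. G y - R *v y)"
proof -
  have H: "Ck_on m UNIV H" unfolding H_def by (intro Ck_add Ckh Ck_id)
  have "Ck_on m UNIV F" unfolding F_def
    by (intro Ck_add Ckg Ck_bounded_linear[OF matrix_vector_mul_bounded_linear] Ck_id)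
  from Ck_compose[OF Ck_compose[OF H this] CkN] have "Ck_on m UNIV G" unfolding G_def[abs_def] .
  moreover have "Ck_on m UNIV (\<lambda>y. - (R *v y))"
    by (intro Ck_bounded_linear[OF bounded_linear_minus[OF matrix_vector_mul_bounded_linear]] Ck_id)
  ultimately have "Ck_on m UNIV (\<lambda>y. G y + - (R *v y))" by (rule Ck_add)
  then show ?thesis by simp
qed

lemma G_affine: obtains k0 where "\<And>y. G y = R *v y + k0"
proof -
  let ?k = "\<lambda>y. G y - R *v y" and ?k' = "\<lambda>y u. G' y u - R *v u"
  have k': "(?k has_derivative ?k' y) (at y)" for y
    by (intro has_derivative_diff G' bounded_linear_imp_has_derivative matrix_vector_mul_bounded_linear)
  have pk: "periodic ?k"
    unfolding periodic_def int_shift matrix_vector_right_distrib R_def integer_matrix_vector by simp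
  have const: "of_real (?k y $ i) = cmean (\<lambda>y. of_real (?k y $ i) :: complex)" for y i
  proof (rule constant_if_directional_derivative_zero)
    let ?L = "\<lambda>x :: real ^ 'd. of_real (x $ i) :: complex"
    have L: "bounded_linear ?L"
      by (rule bounded_linear_compose[OF bounded_linear_of_real bounded_linear_vec_nth])
    show "periodic (\<lambda>y. ?L (?k y))" unfolding periodic_def periodicD[OF pk] by simp
    show "((\<lambda>y. ?L (?k y)) has_derivative (\<lambda>u. ?L (?k' y u))) (at y)" for y
      by (rule bounded_linear.has_derivative[OF L k'])
    show "continuous_on UNIV (\<lambda>y. ?L (?k' y u))" for u
      by (intro continuous_of_real_component Ck_continuous[OF Ck_has_derivative[OF Ck_G k']])
    show "?L (?k' y v) = 0" for y by (simp add: G'_v_eigen Rv)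
    obtain \<gamma> where g: "0 < \<gamma>" "\<And>k. k \<noteq> 0 \<Longrightarrow> \<gamma> \<le> \<bar>\<Sum>j\<in>UNIV. of_int (k $ j) * v $ j\<bar> * knorm k ^ CARD('d)"
      using eigenvector_diophantine[OF irr v] by blast
    fix k :: "int ^ 'd" assume "k \<noteq> 0"
    then have "(\<Sum>j\<in>UNIV. real_of_int (k $ j) * v $ j) \<noteq> 0" using g(1) g(2)[of k] by auto
    moreover have "kdot k (cvec v) = of_real (\<Sum>j\<in>UNIV. real_of_int (k $ j) * v $ j)"
      by (simp add: kdot_def cvec_def)
    ultimately show "kdot k (cvec v) \<noteq> 0" by (metis of_real_eq_0_iff)
  qed
  have "?k y $ i = ?k 0 $ i" for y i
    using const[of y i] const[of 0 i] by (metis of_real_eq_iff)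
  then have "?k y = ?k 0" for y by (simp only: vec_eq_iff) simp
  then have "G y = R *v y + ?k 0" for y by (metis add.commute diff_add_cancel)
  then show thesis by (rule that)
qed

end

section \<open>Rigidity\<close>

text \<open>The value is taken at an arbitrary representative; for lifts that commute with integer
  translations it does not depend on the choice.\<close>

definition torus_map :: "(real ^ 'd \<Rightarrow> real ^ 'd) \<Rightarrow> 'd::finite torus \<Rightarrow> 'd torus" where
  "torus_map \<Phi> X = to_torus (\<Phi> (rep_torus X))"

lemma to_torus_rep [simp]: "to_torus (rep_torus X) = X"
  by (rule Quotient_abs_rep[OF Quotient_torus])

lemma torus_map_to_torus:
  assumes "\<And>x m. \<Phi> (x + (\<chi> j. of_int (m $ j))) = \<Phi> x + (\<chi> j. of_int (m $ j))"
  shows "torus_map \<Phi> (to_torus x) = to_torus (\<Phi> x)"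
proof -
  obtain m where "rep_torus (to_torus x) = x + (\<chi> j. of_int (m $ j))"
    using to_torus_rep[of "to_torus x"] by (rule to_torus_eqE)
  then show ?thesis by (simp add: torus_map_def assms to_torus_add_int)
qed

lemma diffeo_torus_map:
  assumes eq1: "\<And>x m. \<Phi> (x + (\<chi> j. of_int (m $ j))) = \<Phi> x + (\<chi> j. of_int (m $ j))"
    and eq2: "\<And>x m. \<Psi> (x + (\<chi> j. of_int (m $ j))) = \<Psi> x + (\<chi> j. of_int (m $ j))"
    and inv: "\<And>x. \<Phi> (\<Psi> x) = x" "\<And>x. \<Psi> (\<Phi> x) = x"
    and Ck: "\<And>m. Ck_on m UNIV \<Phi>" "\<And>m. Ck_on m UNIV \<Psi>"
  shows "diffeo (torus_map \<Phi>)"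
proof -
  have lift1: "torus_map \<Phi> (to_torus x) = to_torus (\<Phi> x)" and lift2: "torus_map \<Psi> (to_torus x) = to_torus (\<Psi> x)" for x
    using torus_map_to_torus eq1 eq2 by blast+
  have 1: "torus_map \<Phi> (torus_map \<Psi> X) = X" "torus_map \<Psi> (torus_map \<Phi> X) = X" for X
    by (induct X rule: torus.abs_induct, simp add: lift1 lift2 inv)+
  then have c: "torus_map \<Phi> \<circ> torus_map \<Psi> = id" "torus_map \<Psi> \<circ> torus_map \<Phi> = id" by (auto simp: fun_eq_iff)
  then have "inv (torus_map \<Phi>) = torus_map \<Psi>" by (rule inv_unique_comp)
  moreover have "smooth_map (torus_map \<Phi>)" "smooth_map (torus_map \<Psi>)"
    unfolding smooth_map_def smooth_on_def using lift1 lift2 Ck by blast+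
  ultimately show ?thesis using c by (auto simp: diffeo_def intro: o_bij)
qed

text \<open>The kernel of the map on the right is spanned by \<open>v\<close>, so the map is
  injective on the orthogonal hyperplane and, in finite dimension, bounded below there. The number
  \<open>B\<close> dictates how small the derivative of the perturbation of \<open>A\<close> must
  be.\<close>

lemma transversal_lower_bound:
  fixes A :: "int ^ 'd ^ 'd" and v :: "real ^ 'd"
  assumes "irreducible_aut A" "eigenvector (map_matrix of_int A) v lam"
  obtains B where "0 < B" "\<And>u. u \<bullet> v = 0 \<Longrightarrow> B * norm u \<le> norm (lam *\<^sub>R u - map_matrix of_int A *v u)"
proof -
  let ?f = "\<lambda>u :: real ^ 'd. lam *\<^sub>R u - map_matrix real_of_int A *v u"
  have "\<exists>B>0. \<forall>u\<in>{u. v \<bullet> u = 0}. norm (?f u) \<ge> B * norm u"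
  proof (rule injective_imp_isometric)
    show "closed {u. v \<bullet> u = 0}" by (rule closed_hyperplane)
    show "subspace {u. v \<bullet> u = 0}" by (rule subspace_hyperplane)
    show "bounded_linear ?f"
      by (intro bounded_linear_sub bounded_linear_scaleR_right matrix_vector_mul_bounded_linear)
    show "\<forall>u\<in>{u. v \<bullet> u = 0}. ?f u = 0 \<longrightarrow> u = 0"
    proof (intro ballI impI)
      fix u assume u: "u \<in> {u. v \<bullet> u = 0}" "?f u = 0"
      have "map_matrix of_int A *v u = lam *s u" using u(2) by (simp add: scalar_mult_eq_scaleR)
      then obtain c where c: "u = c *\<^sub>R v" by (rule eigenspace_one_dimensional[OF assms])
      then have "c * (v \<bullet> v) = 0" using u(1) by simp
      then show "u = 0" using c by auto
    qed
  qed
  then show thesis using that by (auto simp: inner_commute)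
qed

lemma smooth_fun_periodic:
  "periodic (f \<circ> to_torus)"
  by (simp add: periodic_def to_torus_add_int)

lemma norm_derivative_le_Cr_norm:
  fixes f :: "'d::finite torus \<Rightarrow> real ^ 'd"
  assumes f: "smooth_fun f" "1 \<le> r" and g': "\<And>x. (f \<circ> to_torus has_derivative g' x) (at x)"
  shows "norm (g' x u) \<le> real CARD('d) * Cr_norm r f * norm u"
proof -
  have lin: "linear (g' x)" using has_derivative_bounded_linear[OF g'] bounded_linear.linear by blast
  have e: "norm (g' x (axis i 1)) \<le> Cr_norm r f" for i
    using norm_iter_partial_le_Cr_norm[OF f(1), of "[i]" r x] f(2) frechet_derivative_at[OF g', of x] by simp
  have u: "u = (\<Sum>i\<in>UNIV. u $ i *\<^sub>R axis i 1)"
    by (simp add: vec_eq_iff axis_def if_distrib cong: if_cong)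
  have "g' x u = g' x (\<Sum>i\<in>UNIV. u $ i *\<^sub>R axis i 1)" by (rule arg_cong[where f = "g' x", OF u])
  also have "\<dots> = (\<Sum>i\<in>UNIV. u $ i *\<^sub>R g' x (axis i 1))"
    by (simp only: linear_sum[OF lin] linear_scale[OF lin])
  also have "norm \<dots> \<le> (\<Sum>i\<in>(UNIV :: 'd set). norm u * Cr_norm r f)"
    by (rule sum_norm_le) (use e component_le_norm_cart[of u] in \<open>auto intro!: mult_mono\<close>)
  finally show ?thesis by (simp add: mult_ac)
qed

lemma small_fourier_coefficients:
  assumes "0 < \<eta>"
  obtains \<delta> where "0 < \<delta>" "\<And>(P :: 'd::finite torus \<Rightarrow> real ^ 'd) j. smooth_fun P \<Longrightarrow> m + 2 * CARD('d) \<le> r \<Longrightarrow> Cr_norm r P < \<delta> \<Longrightarrow>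
    (\<Sum>\<^sub>\<infinity>k. norm (fcoeff (\<lambda>x. of_real (P (to_torus x) $ j)) k) * (1 + knorm k) ^ m) \<le> \<eta>"
proof -
  let ?Z = "\<Sum>\<^sub>\<infinity>k::int ^ 'd. 1 / (1 + knorm k) ^ (2 * CARD('d))"
  let ?K = "(2 * real CARD('d)) ^ (m + 2 * CARD('d))"
  have Z: "0 \<le> ?Z" by (intro infsum_nonneg) (auto intro!: divide_nonneg_nonneg zero_le_power add_nonneg_nonneg)
  then have KZ: "0 \<le> ?K * ?Z" by (intro mult_nonneg_nonneg) auto
  show thesis
  proof
    show "0 < \<eta> / (?K * ?Z + 1)" using assms KZ by (intro divide_pos_pos) auto
    fix P :: "'d torus \<Rightarrow> real ^ 'd" and j
    assume P: "smooth_fun P" "m + 2 * CARD('d) \<le> r" "Cr_norm r P < \<eta> / (?K * ?Z + 1)"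
    have Ck: "Ck_on k UNIV (P \<circ> to_torus)" for k using P(1) by (simp add: smooth_fun_def smooth_on_def)
    have B: "norm (iter_partial is (P \<circ> to_torus) x) \<le> Cr_norm r P" if "length is \<le> r" for "is" x
      by (rule norm_iter_partial_le_Cr_norm[OF P(1) that])
    have "(\<Sum>\<^sub>\<infinity>k. norm (fcoeff (\<lambda>x. of_real ((P \<circ> to_torus) x $ j)) k) * (1 + knorm k) ^ m) \<le> ?K * Cr_norm r P * ?Z"
      by (rule conjunct2[OF fcoeff_decay[OF Ck smooth_fun_periodic]]) (use B[of "[]"] in \<open>auto intro!: B simp: P(2) simp del: comp_apply\<close>)
    also have "\<dots> = (?K * ?Z) * Cr_norm r P" by (simp only: mult_ac)
    also have "\<dots> \<le> (?K * ?Z) * (\<eta> / (?K * ?Z + 1))" using P(3) KZ by (intro mult_left_mono) auto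
    also have "\<dots> \<le> \<eta>" using KZ assms by (simp add: field_simps)
    finally show "(\<Sum>\<^sub>\<infinity>k. norm (fcoeff (\<lambda>x. of_real (P (to_torus x) $ j)) k) * (1 + knorm k) ^ m) \<le> \<eta>" by simp
  qed
qed

lemma action_mult:
  assumes "\<beta> \<in> hom (ZR_group lam) Diff_group"
  shows "\<beta> (n + m, lam powi (- m) * s + t) = \<beta> (n, s) \<circ> \<beta> (m, t)"
  using hom_mult[OF assms, of "(n, s)" "(m, t)"] by (simp add: ZR_group_def Diff_group_def)

lemma action_one:
  assumes "\<beta> \<in> hom (ZR_group lam) Diff_group"
  shows "\<beta> (0, 0) = id"
proof -
  have "bij (\<beta> (0, 0))" using hom_in_carrier[OF assms, of "(0, 0)"] by (simp add: ZR_group_def Diff_group_def diffeo_def)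
  moreover have "\<beta> (0, 0) x = \<beta> (0, 0) (\<beta> (0, 0) x)" for x
    using fun_cong[OF action_mult[OF assms, of 0 0 0 0], of x] by simp
  ultimately show ?thesis by (metis bij_is_inj eq_id_iff injD)
qed

text \<open>The group relation \<open>(1, 0) (0, s) = (0, lam * s) (1, 0)\<close> says that
  \<open>A' \<circ> \<beta> (0, s) = \<beta> (0, lam * s) \<circ> A'\<close>. Both sides are curves
  in \<open>s\<close>, and their velocities at \<open>s = 0\<close> are compared.\<close>

lemma lifted_invariance:
  fixes A :: "int ^ 'd ^ 'd" and v :: "real ^ 'd"
  assumes lam: "lam \<noteq> 0" and act: "smooth_action A lam A' v' \<beta>"
    and f: "\<And>x. A' x = toral_map A x + to_torus (f x)" and g': "(f \<circ> to_torus has_derivative g') (at x)"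
  shows "map_matrix of_int A *v v' (to_torus x) + g' (v' (to_torus x))
    = lam *\<^sub>R v' (to_torus (map_matrix of_int A *v x + f (to_torus x)))"
proof -
  let ?F = "\<lambda>x. map_matrix of_int A *v x + f (to_torus x)" and ?V = "v' (to_torus x)"
  have hom: "\<beta> \<in> hom (ZR_group lam) Diff_group" and A': "\<beta> (1, 0) = A'"
    and vel: "\<And>X t. has_velocity (\<lambda>s. \<beta> (0, s) X) (v' (\<beta> (0, t) X)) t"
    using act by (auto simp: smooth_action_def)
  note one = action_one[OF hom]
  have F: "A' (to_torus y) = to_torus (?F y)" for y
    by (simp add: f toral_map.abs_eq plus_torus.abs_eq)
  have dF: "(?F has_derivative (\<lambda>u. map_matrix of_int A *v u + g' u)) (at x)"
    using g' by (intro has_derivative_add bounded_linear_imp_has_derivative matrix_vector_mul_bounded_linear) (simp add: o_def)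
  have "has_velocity (\<lambda>s. \<beta> (0, s) (to_torus x)) ?V 0" using vel[of "to_torus x" 0] by (simp add: one)
  then have 1: "has_velocity (\<lambda>s. A' (\<beta> (0, s) (to_torus x))) (map_matrix of_int A *v ?V + g' ?V) 0"
    by (rule has_velocity_map[OF _ _ dF F]) (simp add: one)
  have "A' (\<beta> (0, s) (to_torus x)) = \<beta> (0, lam * s) (A' (to_torus x))" for s
    using fun_cong[OF action_mult[OF hom, of 1 0 0 s], of "to_torus x"]
      fun_cong[OF action_mult[OF hom, of 0 1 "lam * s" 0], of "to_torus x"] lam
    by (simp add: A' power_int_minus flip: mult.assoc)
  moreover have "has_velocity (\<lambda>s. \<beta> (0, lam * s) (A' (to_torus x))) (lam *\<^sub>R v' (A' (to_torus x))) 0"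
    using has_velocity_scale[of "\<lambda>s. \<beta> (0, s) (A' (to_torus x))" _ lam] vel[of "A' (to_torus x)" 0] by (simp add: one)
  ultimately have "has_velocity (\<lambda>s. A' (\<beta> (0, s) (to_torus x))) (lam *\<^sub>R v' (to_torus (?F x))) 0"
    by (simp add: F)
  from has_velocity_unique[OF 1 this] show ?thesis .
qed

text \<open>Positive powers follow from the generator by iteration, negative ones by injectivity of
  \<open>toral_map A\<close>, and \<open>(n, t) = (n, 0) (0, t)\<close> covers the whole
  group.\<close>

lemma conjugacy_from_lift:
  fixes A :: "int ^ 'd::finite ^ 'd" and v :: "real ^ 'd"
  assumes "invertible A" and act: "smooth_action A lam A' v' \<beta>"
    and semi: "\<And>X. \<Theta> (A' X) = toral_map A (\<Theta> X)"
    and flow: "\<And>t X. \<Theta> (\<beta> (0, t) X) = \<Theta> X + to_torus (t *\<^sub>R u)" and "bij \<Theta>"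
  shows "\<Theta> \<circ> \<beta> g \<circ> inv \<Theta> = affine_action A u g"
proof -
  let ?P = "int_funpow (toral_map A)"
  have hom: "\<beta> \<in> hom (ZR_group lam) Diff_group" and A': "\<beta> (1, 0) = A'"
    using act by (auto simp: smooth_action_def)
  obtain B where "A ** B = mat 1" "B ** A = mat 1" using assms(1) by (auto simp: invertible_def)
  then have bij: "bij (toral_map A)" by (rule toral_map_bij)
  have step: "\<beta> (1 + n, 0) = A' \<circ> \<beta> (n, 0)" "?P (1 + n) = toral_map A \<circ> ?P n" for n
    using action_mult[OF hom, of 1 n 0 0] int_funpow_add[OF bij, of 1 n] by (simp_all add: A' int_funpow_def)
  have P: "\<Theta> (\<beta> (n, 0) X) = ?P n (\<Theta> X)" for n X
  proof (induction n rule: int_induct[where k = 0])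
    case base
    show ?case by (simp add: action_one[OF hom] int_funpow_def)
  next
    case (step1 i)
    then show ?case using step[of i] by (simp add: semi add.commute)
  next
    case (step2 i)
    have "toral_map A (\<Theta> (\<beta> (i - 1, 0) X)) = \<Theta> (\<beta> (1 + (i - 1), 0) X)"
      unfolding step(1) by (simp add: semi)
    also have "\<dots> = toral_map A (?P (i - 1) (\<Theta> X))"
      using step2 step(2)[of "i - 1"] by simp
    finally show ?case by (rule injD[OF bij_is_inj[OF bij]])
  qed
  obtain n t where g: "g = (n, t)" by (cases g)
  have "\<beta> g = \<beta> (n, 0) \<circ> \<beta> (0, t)" using action_mult[OF hom, of n 0 0 t] by (simp add: g)
  then have "\<Theta> (\<beta> g X) = affine_action A u g (\<Theta> X)" for X
    by (simp add: P flow g affine_action_def)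
  then show ?thesis using assms(5) by (simp add: fun_eq_iff bij_is_surj surj_f_inv_f)
qed

lemma affine_rigidity:
  fixes A :: "int ^ 'd::finite ^ 'd" and v :: "real ^ 'd"
  assumes inv: "invertible A" and irr: "irreducible_aut A" and erg: "ergodic_aut A"
    and v: "eigenvector (map_matrix of_int A) v lam" and r: "42 * (CARD('d) + 1) \<le> r"
  shows "\<exists>\<delta>>0. \<forall>\<beta> A' v'. smooth_action A lam A' v' \<beta> \<and> dist_less r \<delta> A v A' v' \<longrightarrow>
    (\<exists>w c. w = c *\<^sub>R v \<and> (\<exists>H. diffeo H \<and> (\<forall>g. H \<circ> \<beta> g \<circ> inv_into UNIV H = affine_action A w g)))"
proof -
  obtain \<gamma> where g: "0 < \<gamma>" "\<And>k. k \<noteq> 0 \<Longrightarrow> \<gamma> \<le> \<bar>\<Sum>j\<in>UNIV. of_int (k $ j) * v $ j\<bar> * knorm k ^ CARD('d)"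
    using eigenvector_diophantine[OF irr v] by blast
  interpret diophantine v \<gamma> "CARD('d)"
  proof
    fix k :: "int ^ 'd" assume k: "k \<noteq> 0"
    have "kdot k (cvec v) = of_real (\<Sum>j\<in>UNIV. real_of_int (k $ j) * v $ j)" by (simp add: kdot_def cvec_def)
    then have "norm (kdot k (cvec v)) = \<bar>\<Sum>j\<in>UNIV. real_of_int (k $ j) * v $ j\<bar>" by (simp only: norm_of_real)
    then show "\<gamma> \<le> norm (kdot k (cvec v)) * knorm k ^ CARD('d)" using g(2)[OF k] by simp
  qed (rule g(1))
  obtain B where B: "0 < B" "\<And>u. u \<bullet> v = 0 \<Longrightarrow> B * norm u \<le> norm (lam *\<^sub>R u - map_matrix of_int A *v u)"
    using transversal_lower_bound[OF irr v] by blast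
  \<comment> \<open>The value 1/8 makes \<open>id + h\<close> invertible, keeps \<open>b\<close>
    away from zero and leaves enough room in \<open>w_zero\<close>.\<close>
  have "(0::real) < 1 / 8" by simp
  then obtain \<eta> where \<eta>: "0 < \<eta>"
    "\<And>a. (\<And>i k. a i (- k) = cnj (a i k)) \<Longrightarrow> (\<And>i m. (\<lambda>k. norm (a i k) * (1 + knorm k) ^ m) summable_on UNIV) \<Longrightarrow>
      (\<And>i. (\<Sum>\<^sub>\<infinity>k. norm (a i k) * (1 + knorm k) ^ (2 * Q + 1)) \<le> \<eta>) \<Longrightarrow>
      \<exists>h h' b w. (\<forall>m. Ck_on m UNIV h) \<and> (\<forall>x. (h has_derivative h' x) (at x)) \<and>
        (\<forall>x m. h (x + (\<chi> j. of_int (m $ j))) = h x) \<and> (\<forall>x u. norm (h' x u) \<le> 1 / 8 * norm u) \<and>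
        \<bar>b - 1\<bar> \<le> 1 / 8 \<and> w \<bullet> v = 0 \<and>
        (\<forall>x i. b * (v $ i + h' x v $ i) + w $ i = v $ i + Re (\<Sum>\<^sub>\<infinity>k. a i k * em k (cvec (x + h x))))"
    by (rule kam) blast
  obtain \<delta>1 where \<delta>1: "0 < \<delta>1" "\<And>(P :: 'd torus \<Rightarrow> real ^ 'd) j. smooth_fun P \<Longrightarrow> 2 * Q + 1 + 2 * CARD('d) \<le> r \<Longrightarrow> Cr_norm r P < \<delta>1 \<Longrightarrow>
    (\<Sum>\<^sub>\<infinity>k. norm (fcoeff (\<lambda>x. of_real (P (to_torus x) $ j)) k) * (1 + knorm k) ^ (2 * Q + 1)) \<le> \<eta>"
    using small_fourier_coefficients[OF \<eta>(1)] by blast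
  \<comment> \<open>The first bound makes the Fourier data small enough for the iteration; the
    second bounds the derivative of \<open>f\<close> by \<open>B / 4\<close>.\<close>
  define \<delta> where "\<delta> = min \<delta>1 (B / (4 * real CARD('d)))"
  have d0: "0 < real CARD('d)" by simp
  have "0 < \<delta>" using \<delta>1(1) B(1) d0 by (simp add: \<delta>_def)
  moreover have "\<exists>w c. w = c *\<^sub>R v \<and> (\<exists>H. diffeo H \<and> (\<forall>g. H \<circ> \<beta> g \<circ> inv_into UNIV H = affine_action A w g))"
    if act: "smooth_action A lam A' v' \<beta>" and dist: "dist_less r \<delta> A v A' v'" for \<beta> A' v'
  proof -
    obtain f where f: "smooth_fun f" "\<And>x. A' x = toral_map A x + to_torus (f x)" "Cr_norm r f < \<delta>"
      and Pd: "Cr_norm r (\<lambda>x. v' x - v) < \<delta>"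
      using dist by (auto simp: dist_less_def)
    let ?P = "\<lambda>x. v' x - v" and ?V = "\<lambda>x. v' (to_torus x)" and ?g = "f \<circ> to_torus"
    have CkV: "Ck_on m UNIV (v' \<circ> to_torus)" for m using act by (simp add: smooth_action_def smooth_fun_def smooth_on_def)
    have CkP: "Ck_on m UNIV (?P \<circ> to_torus)" for m
      using Ck_add[OF CkV Ck_on_const[of m UNIV "- v"]] by (simp add: o_def)
    have P: "smooth_fun ?P" using CkP by (simp add: smooth_fun_def smooth_on_def)
    have Ckg: "Ck_on m UNIV ?g" for m using f(1) by (simp add: smooth_fun_def smooth_on_def)
    let ?g' = "\<lambda>x. frechet_derivative ?g (at x)"
    have g': "(?g has_derivative ?g' x) (at x)" for x
      using Ckg[of "Suc 0"] by (simp add: frechet_derivative_works)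
    define a where "a i = fcoeff (\<lambda>x. of_real ((?P \<circ> to_torus) x $ i))" for i
    have "\<exists>h h' b w. (\<forall>m. Ck_on m UNIV h) \<and> (\<forall>x. (h has_derivative h' x) (at x)) \<and>
        (\<forall>x m. h (x + (\<chi> j. of_int (m $ j))) = h x) \<and> (\<forall>x u. norm (h' x u) \<le> 1 / 8 * norm u) \<and>
        \<bar>b - 1\<bar> \<le> 1 / 8 \<and> w \<bullet> v = 0 \<and>
        (\<forall>x i. b * (v $ i + h' x v $ i) + w $ i = v $ i + Re (\<Sum>\<^sub>\<infinity>k. a i k * em k (cvec (x + h x))))"
    proof (rule \<eta>(2))
      show "a i (- k) = cnj (a i k)" for i k unfolding a_def by (rule fcoeff_cnj[OF Ck_continuous[OF CkP]])
      show "(\<lambda>k. norm (a i k) * (1 + knorm k) ^ m) summable_on UNIV" for i m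
        unfolding a_def by (rule fcoeff_summable[OF CkP smooth_fun_periodic])
      have "2 * Q + 1 + 2 * CARD('d) \<le> r" using r unfolding Q_def by simp
      moreover have "Cr_norm r ?P < \<delta>1" using Pd by (simp add: \<delta>_def)
      ultimately show "(\<Sum>\<^sub>\<infinity>k. norm (a i k) * (1 + knorm k) ^ (2 * Q + 1)) \<le> \<eta>" for i
        unfolding a_def comp_apply by (intro \<delta>1(2) P)
    qed
    then obtain h h' b w where Ckh: "\<And>m. Ck_on m UNIV h" and h': "\<And>x. (h has_derivative h' x) (at x)"
      and ph: "\<And>x m. h (x + (\<chi> j. of_int (m $ j))) = h x" and small: "\<And>x u. norm (h' x u) \<le> 1 / 8 * norm u"
      and b: "\<bar>b - 1\<bar> \<le> 1 / 8" and wv: "w \<bullet> v = 0"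
      and eq: "\<And>x i. b * (v $ i + h' x v $ i) + w $ i = v $ i + Re (\<Sum>\<^sub>\<infinity>k. a i k * em k (cvec (x + h x)))"
      by blast
    have VH: "?V (x + h x) = b *\<^sub>R (v + h' x v) + w" for x
      unfolding vec_eq_iff
    proof
      fix i
      have "(?P \<circ> to_torus) (x + h x) $ i = Re (\<Sum>\<^sub>\<infinity>k. a i k * em k (cvec (x + h x)))"
        unfolding a_def by (rule fourier_expansion[OF CkP smooth_fun_periodic])
      then show "?V (x + h x) $ i = (b *\<^sub>R (v + h' x v) + w) $ i" using eq[where x = x and i = i] by simp
    qed
    have "norm (h' x u) \<le> norm u / 2" for x u using small[of x u] by (rule order_trans) simp
    from near_identity_inverse[OF Ckh h' this] obtain N N' where
      NH: "\<And>x. N (x + h x) = x" and HN: "\<And>y. N y + h (N y) = y" and CkN: "\<And>m. Ck_on m UNIV N"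
      and N': "\<And>y. (N has_derivative N' y) (at y)" "\<And>y u. N' y u + h' (N y) (N' y u) = u" "\<And>y u. N' y (u + h' (N y) u) = u"
      by blast
    have smallg: "norm (?g' x u) \<le> B / 4 * norm u" for x u
    proof -
      have "1 \<le> r" using r by simp
      have "real CARD('d) * Cr_norm r f \<le> real CARD('d) * \<delta>" using f(3) by (intro mult_left_mono) auto
      also have "\<dots> \<le> real CARD('d) * (B / (4 * real CARD('d)))" by (intro mult_left_mono) (auto simp: \<delta>_def)
      finally have "real CARD('d) * Cr_norm r f \<le> B / 4" by simp
      then have "real CARD('d) * Cr_norm r f * norm u \<le> B / 4 * norm u" by (intro mult_right_mono) auto
      then show ?thesis using norm_derivative_le_Cr_norm[OF f(1) \<open>1 \<le> r\<close> g', of x u] by linarith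
    qed
    let ?R = "map_matrix real_of_int A"
    have lam: "lam \<noteq> 0" by (rule eigenvalue_nonzero[OF inv v])
    have "conjugated_field A lam v h ?g ?V h' ?g' b B w N N'"
    proof
      show "?R *v ?V x + ?g' x (?V x) = lam *\<^sub>R ?V (?R *v x + ?g x)" for x
        using lifted_invariance[OF lam act f(2) g'] by simp
      show "periodic h" using ph by (simp add: periodic_def)
    qed (use irr v B Ckh h' small Ckg g' smooth_fun_periodic smallg b wv VH NH HN CkN N' in auto)
    then interpret C: conjugated_field A lam v h ?g ?V h' ?g' b B w N N' ?R "\<lambda>x. ?R *v x + ?g x" "\<lambda>x. x + h x"
      by simp_all
    obtain k0 where k0: "\<And>y. C.G y = ?R *v y + k0" by (rule C.G_affine) blast
    have "\<exists>q. (mat 1 - ?R) *v q = k0"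
    proof -
      have "q = 0" if "(mat 1 - ?R) *v q = 0" for q
        using ergodic_no_fixed_vector[OF erg, of q] that by (simp add: matrix_vector_mult_diff_rdistrib)
      then have "invertible (mat 1 - ?R)" unfolding invertible_left_inverse matrix_left_invertible_ker by blast
      then obtain D where "(mat 1 - ?R) ** D = mat 1" by (auto simp: invertible_def)
      then have "(mat 1 - ?R) *v (D *v k0) = k0" by (simp add: matrix_vector_mul_assoc)
      then show ?thesis by blast
    qed
    then obtain q where "k0 = (mat 1 - ?R) *v q" by blast
    \<comment> \<open>Thus \<open>q\<close> is a fixed point of the affine map \<open>G\<close>;
      moving the origin to \<open>q\<close> makes \<open>G\<close> linear.\<close>
    then have q: "?R *v q + k0 = q" by (simp add: matrix_vector_mult_diff_rdistrib)
    define H2 where "H2 y = (y + q) + h (y + q)" for y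
    define N2 where "N2 y = N y - q" for y
    have HN2: "H2 (N2 y) = y" for y by (simp add: H2_def N2_def HN)
    have NH2: "N2 (H2 y) = y" for y by (simp add: H2_def N2_def NH)
    have N2_shift: "N2 (x + (\<chi> j. of_int (m $ j))) = N2 x + (\<chi> j. of_int (m $ j))" for x m
      using C.int_shift(3)[of x m] by (simp add: N2_def)
    have H2_shift: "H2 (x + (\<chi> j. of_int (m $ j))) = H2 x + (\<chi> j. of_int (m $ j))" for x m
      using NH2[of "H2 x + (\<chi> j. of_int (m $ j))"] HN2 N2_shift NH2 by metis
    have CkN2: "Ck_on m UNIV N2" for m
      using Ck_add[OF CkN Ck_on_const[of m UNIV "- q"]] by (simp add: N2_def[abs_def])
    have CkH2: "Ck_on m UNIV H2" for m
      unfolding H2_def[abs_def] by (intro Ck_add Ck_id Ck_on_const Ck_compose[OF _ Ckh])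
    let ?F = "\<lambda>x. ?R *v x + f (to_torus x)"
    have conj: "?F (H2 y) = H2 (?R *v y)" for y
    proof -
      have "?F (H2 y) = C.G (y + q) + h (C.G (y + q))" using C.HG[of "y + q"] by (simp add: H2_def)
      also have "C.G (y + q) = ?R *v y + q" unfolding k0 matrix_vector_right_distrib using q by (simp add: add.assoc)
      finally show ?thesis by (simp add: H2_def)
    qed
    \<comment> \<open>The conjugacy has to carry the perturbed action to the affine one, hence it is
      induced by the inverse \<open>N2\<close> of the map that the iteration provides.\<close>
    let ?\<Theta> = "torus_map N2"
    have lift: "?\<Theta> (to_torus x) = to_torus (N2 x)" for x by (rule torus_map_to_torus[OF N2_shift])
    have diffeo: "diffeo ?\<Theta>" by (rule diffeo_torus_map[OF N2_shift H2_shift NH2 HN2 CkN2 CkH2])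
    have "?\<Theta> (A' X) = toral_map A (?\<Theta> X)" for X
    proof (induct X rule: torus.abs_induct)
      fix x
      have "N2 (?F x) = ?R *v N2 x" using conj[of "N2 x"] NH2 by (simp add: HN2)
      then show "?\<Theta> (A' (to_torus x)) = toral_map A (?\<Theta> (to_torus x))"
        by (simp add: f(2) toral_map.abs_eq plus_torus.abs_eq lift)
    qed
    moreover have "?\<Theta> (\<beta> (0, t) X) = ?\<Theta> X + to_torus (t *\<^sub>R (b *\<^sub>R v))" for t X
    proof -
      have hom: "\<beta> \<in> hom (ZR_group lam) Diff_group"
        and vel: "has_velocity (\<lambda>s. \<beta> (0, s) X) (v' (\<beta> (0, t) X)) t" for t
        using act by (auto simp: smooth_action_def)
      \<comment> \<open>In the new coordinates the flow moves with constant velocity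
        \<open>b *\<^sub>R v\<close>, so its difference from the straight line has velocity zero and
        is constant. This identifies the flow directly, without a uniqueness theorem for
        differential equations.\<close>
      have "has_velocity (\<lambda>s. ?\<Theta> (\<beta> (0, s) X) - to_torus (s *\<^sub>R (b *\<^sub>R v))) 0 t" for t
      proof -
        define x where "x = rep_torus (\<beta> (0, t) X)"
        have x: "\<beta> (0, t) X = to_torus x" by (simp add: x_def)
        have d: "(N2 has_derivative N' x) (at x)"
          using has_derivative_diff[OF N'(1) has_derivative_const[of q]] by (simp add: N2_def[abs_def])
        have "?V x = b *\<^sub>R (v + h' (N x) v)" using VH[of "N x"] by (simp add: HN C.w_zero)
        then have "N' x (?V x) = b *\<^sub>R v" by (simp only: linear_scale[OF C.linear_N'] N'(3))
        then have "has_velocity (\<lambda>s. ?\<Theta> (\<beta> (0, s) X)) (b *\<^sub>R v) t"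
          using has_velocity_map[OF vel x d lift] by (simp add: x)
        from has_velocity_diff_line[OF this, of "b *\<^sub>R v"] show ?thesis by simp
      qed
      from has_velocity_zero_imp_constant[OF this, of t]
      show ?thesis by (simp add: action_one[OF hom] diff_eq_eq flip: zero_torus.abs_eq)
    qed
    ultimately have "?\<Theta> \<circ> \<beta> g \<circ> inv_into UNIV ?\<Theta> = affine_action A (b *\<^sub>R v) g" for g
      using diffeo by (intro conjugacy_from_lift[OF inv act]) (auto simp: diffeo_def)
    then show ?thesis using diffeo by blast
  qed
  ultimately show ?thesis by blast
qed

theorem theorem1:
  shows "\<exists>r::nat.
    (\<forall>(A :: int ^ 'd ^ 'd) (lam::real) (v :: real ^ 'd).
       invertible A \<and> irreducible_aut A \<and> ergodic_aut A \<and>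
       eigenvector (map_matrix of_int A) v lam \<longrightarrow>
       (\<exists>\<delta>>0. \<forall>\<beta> A' v'.
          smooth_action A lam A' v' \<beta> \<and> dist_less r \<delta> A v A' v' \<longrightarrow>
          (\<exists>w c. w = c *\<^sub>R v \<and>
             (\<exists>H. diffeo H \<and> (\<forall>g. H \<circ> \<beta> g \<circ> inv_into UNIV H = affine_action A w g))))) \<and>
    r = 42 * (CARD('d) + 1)"
proof (rule exI[of _ "42 * (CARD('d) + 1)"], intro conjI allI impI refl)
  fix A :: "int ^ 'd ^ 'd" and lam :: real and v :: "real ^ 'd"
  assume "invertible A \<and> irreducible_aut A \<and> ergodic_aut A \<and> eigenvector (map_matrix of_int A) v lam"
  then show "\<exists>\<delta>>0. \<forall>\<beta> A' v'. smooth_action A lam A' v' \<beta> \<and> dist_less (42 * (CARD('d) + 1)) \<delta> A v A' v' \<longrightarrow>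
      (\<exists>w c. w = c *\<^sub>R v \<and> (\<exists>H. diffeo H \<and> (\<forall>g. H \<circ> \<beta> g \<circ> inv_into UNIV H = affine_action A w g)))"
    using affine_rigidity[of A v lam] by simp
qed

end
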